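(* Let $\beta>0$ and $\mathbb{E}(u,v)=\int_{\mathcal{G}_0}\langle\mathbb{D}u(g),\mathbb{D}v(g)\rangle_{L^2([0,1])}\,d\mathbb{Q}_0^\beta(g)$ for $u,v\in\mathfrak{Z}^1(\mathcal{G}_0)$. Then: (i) $(\mathbb{E},\mathfrak{Z}^1(\mathcal{G}_0))$ is closable in $L^2(\mathcal{G}_0,\mathbb{Q}_0^\beta)$; its closure $(\mathbb{E},\mathrm{Dom}(\mathbb{E}))$ is a regular, recurrent Dirichlet form. Moreover $\mathrm{Dom}(\mathbb{E})=\mathrm{Dom}(\overline{\mathbb{D}})$ and $\mathbb{E}(u,v)=\int_{\mathcal{G}_0\times[0,1]}\overline{\mathbb{D}}u\cdot\overline{\mathbb{D}}v\,d(\mathbb{Q}_0^\beta\otimes\mathrm{Leb})$ for all $u,v\in\mathrm{Dom}(\overline{\mathbb{D}})$, where $(\overline{\mathbb{D}},\mathrm{Dom}(\overline{\mathbb{D}}))$ is the closure of $(\mathbb{D},\mathfrak{Z}^1(\mathcal{G}_0))$. (ii) The set $\mathfrak{Z}^\infty_0(\mathcal{G}_0)$ is a core for $(\mathbb{E},\mathrm{Dom}(\mathbb{E}))$. (iii) The generator $(\mathbb{L},\mathrm{Dom}(\mathbb{L}))$ of $(\mathbb{E},\mathrm{Dom}(\mathbb{E}))$ is the Friedrichs extension of the operator $\mathbb{L}$ given on $u(g)=U(\int\vec\alpha(g_s)ds)\in\mathfrak{Z}^\infty_0(\mathcal{G}_0)$ by $$\mathbb{L}u(g)=\sum_{i,j=1}^m\partial_i\partial_jU\Big(\int\vec\alpha(g_s)ds\Big)\int_0^1\alpha_i'(g_s)\alpha_j'(g_s)ds+\sum_{i=1}^m\partial_iU\Big(\int\vec\alpha(g_s)ds\Big)\,V^\beta_{\alpha_i',0}(g).$$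 (iv) The Dirichlet form has square field operator $\Gamma(u,v):=\langle\overline{\mathbb{D}}u,\overline{\mathbb{D}}v\rangle_{L^2(\mathrm{Leb})}\in L^1(\mathcal{G}_0,\mathbb{Q}_0^\beta)$ on $\mathrm{Dom}(\mathbb{E})\cap L^\infty(\mathcal{G}_0,\mathbb{Q}_0^\beta)$: for all $u,v,w$ in this set, $$2\int w\,\Gamma(u,v)\,d\mathbb{Q}_0^\beta=\mathbb{E}(u,vw)+\mathbb{E}(uw,v)-\mathbb{E}(uv,w).$$
   Context: $\mathcal{G}_0$ is the set of right continuous nondecreasing maps $g:[0,1[\,\to[0,1]$ extended by $g(1):=1$, with the $L^2([0,1])$ distance (compact). $\mathbb{Q}_0^\beta$ is the probability measure on $\mathcal{G}_0$ such that for every $N$ and $0=t_0<\dots<t_{N+1}=1$ the law of $(g(t_1),\dots,g(t_N))$ is $\frac{\Gamma(\beta)}{\prod_{i=0}^{N}\Gamma(\beta(t_{i+1}-t_i))}\prod_{i=0}^{N}(x_{i+1}-x_i)^{\beta(t_{i+1}-t_i)-1}dx$ on $\{0<x_1<\dots<x_N<1\}$, $x_0:=0,x_{N+1}:=1$. $\mathfrak{Z}^k(\mathcal{G}_0)$: functions $u(g)=U(\int_0^1\vec\alpha(g_s)ds)$ with $U\in\mathcal{C}^k(\mathbb{R}^m)$, $\vec\alpha=(\alpha_1,\dots,\alpha_m)\in\mathcal{C}^k([0,1],\mathbb{R}^m)$; $\mathfrak{Z}^\infty_0(\mathcal{G}_0)$: those with $k=\infty$ and $\alpha_i'(0)=\alpha_i'(1)=0$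 for all $i$. For $u\in\mathfrak{Z}^1(\mathcal{G}_0)$, $\mathbb{D}u(g)=\sum_i\partial_iU(\int\vec\alpha(g_s)ds)\,\alpha_i'(g(\cdot))\in L^2([0,1])$; $\mathbb{D}$ is closable from $L^2(\mathcal{G}_0,\mathbb{Q}_0^\beta)$ into $L^2(\mathcal{G}_0\times[0,1],\mathbb{Q}_0^\beta\otimes\mathrm{Leb})$. For $\varphi\in\mathcal{C}^\infty([0,1])$ with $\varphi(0)=\varphi(1)=0$ and $g\in\mathcal{G}_0$ with jump set $J_g\subset\,]0,1[$: $$V^\beta_{\varphi,0}(g):=\sum_{a\in J_g}\Big[\frac{\varphi'(g(a+))+\varphi'(g(a-))}{2}-\frac{\varphi(g(a+))-\varphi(g(a-))}{g(a+)-g(a-)}\Big]+\beta\int_0^1\varphi'(g(x))dx-\frac{\varphi'(0)+\varphi'(1)}{2}.$$ *)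

theory Defs
  imports "HOL-Analysis.Analysis" "HOL-Probability.Probability"
begin

text \<open>Elements of G_0 are right continuous nondecreasing maps on [0,1[ with values in [0,1],
  extended by g 1 = 1.  To make the representation canonical we also fix g x = 0 for x < 0
  and g x = 1 for x > 1 (these values play no role).\<close>

definition G0 :: "(real \<Rightarrow> real) set" where
  "G0 = {g. mono_on {0..<1} g
            \<and> (\<forall>x\<in>{0..<1}. continuous (at_right x) g \<and> 0 \<le> g x \<and> g x \<le> 1)
            \<and> g 1 = 1 \<and> (\<forall>x. x < 0 \<longrightarrow> g x = 0) \<and> (\<forall>x. x > 1 \<longrightarrow> g x = 1)}"

definition dG0 :: "(real \<Rightarrow> real) \<Rightarrow> (real \<Rightarrow> real) \<Rightarrow> real" where
  "dG0 g h = sqrt (integral {0..1} (\<lambda>s. (g s - h s)^2))"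

definition G0_opens :: "(real \<Rightarrow> real) set set" where
  "G0_opens = {A. A \<subseteq> G0 \<and> (\<forall>g\<in>A. \<exists>d>0. \<forall>h\<in>G0. dG0 g h < d \<longrightarrow> h \<in> A)}"

definition cont_G0 :: "((real \<Rightarrow> real) \<Rightarrow> real) \<Rightarrow> bool" where
  "cont_G0 f \<longleftrightarrow> (\<forall>g\<in>G0. \<forall>e>0. \<exists>d>0. \<forall>h\<in>G0. dG0 g h < d \<longrightarrow> \<bar>f h - f g\<bar> < e)"

definition Q0_density :: "real \<Rightarrow> nat \<Rightarrow> (nat \<Rightarrow> real) \<Rightarrow> (nat \<Rightarrow> real) \<Rightarrow> real" where
  "Q0_density \<beta> N t x =
     (let xx = (\<lambda>i. if i = 0 then 0 else if i = Suc N then 1 else x i) in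
      if (\<forall>i\<le>N. xx i < xx (Suc i))
      then Gamma \<beta> / (\<Prod>i\<le>N. Gamma (\<beta> * (t (Suc i) - t i)))
           * (\<Prod>i\<le>N. (xx (Suc i) - xx i) powr (\<beta> * (t (Suc i) - t i) - 1))
      else 0)"

definition is_Q0 :: "real \<Rightarrow> (real \<Rightarrow> real) measure \<Rightarrow> bool" where
  "is_Q0 \<beta> Q \<longleftrightarrow>
     space Q = G0 \<and> sets Q = sigma_sets G0 G0_opens \<and>
     (\<forall>N t. t 0 = 0 \<and> t (Suc N) = 1 \<and> (\<forall>i\<le>N. t i < t (Suc i)) \<longrightarrow>
        distr Q (PiM {1..N} (\<lambda>_. lborel)) (\<lambda>g. restrict (\<lambda>i. g (t i)) {1..N})
        = density (PiM {1..N} (\<lambda>_. lborel)) (\<lambda>x. ennreal (Q0_density \<beta> N t x)))"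

definition Rm :: "nat \<Rightarrow> (nat \<Rightarrow> real) set" where
  "Rm m = {x. \<forall>i\<ge>m. x i = 0}"

definition cont_Rm :: "nat \<Rightarrow> ((nat \<Rightarrow> real) \<Rightarrow> real) \<Rightarrow> bool" where
  "cont_Rm m V \<longleftrightarrow> (\<forall>x\<in>Rm m. \<forall>e>0. \<exists>d>0. \<forall>y\<in>Rm m.
       (\<forall>i<m. \<bar>y i - x i\<bar> < d) \<longrightarrow> \<bar>V y - V x\<bar> < e)"

definition pd :: "nat \<Rightarrow> ((nat \<Rightarrow> real) \<Rightarrow> real) \<Rightarrow> (nat \<Rightarrow> real) \<Rightarrow> real" where
  "pd i V x = deriv (\<lambda>h. V (x(i := h))) (x i)"

primrec CkRm :: "nat \<Rightarrow> nat \<Rightarrow> ((nat \<Rightarrow> real) \<Rightarrow> real) \<Rightarrow> bool" where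
  "CkRm m 0 V = cont_Rm m V"
| "CkRm m (Suc k) V = (cont_Rm m V \<and>
      (\<forall>i<m. \<forall>x\<in>Rm m. (\<lambda>h. V (x(i := h))) differentiable (at (x i))) \<and>
      (\<forall>i<m. CkRm m k (pd i V)))"

definition deriv01 :: "(real \<Rightarrow> real) \<Rightarrow> real \<Rightarrow> real" where
  "deriv01 a x = (SOME d. (a has_real_derivative d) (at x within {0..1}))"

primrec Ck01 :: "nat \<Rightarrow> (real \<Rightarrow> real) \<Rightarrow> bool" where
  "Ck01 0 a = continuous_on {0..1} a"
| "Ck01 (Suc k) a = ((\<forall>x\<in>{0..1}. a differentiable (at x within {0..1})) \<and> Ck01 k (deriv01 a))"

definition zvec :: "nat \<Rightarrow> (nat \<Rightarrow> real \<Rightarrow> real) \<Rightarrow> (real \<Rightarrow> real) \<Rightarrow> nat \<Rightarrow> real" where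
  "zvec m \<alpha> g = (\<lambda>i. if i < m then integral {0..1} (\<lambda>s. \<alpha> i (g s)) else 0)"

definition zfun :: "nat \<Rightarrow> ((nat \<Rightarrow> real) \<Rightarrow> real) \<Rightarrow> (nat \<Rightarrow> real \<Rightarrow> real) \<Rightarrow> (real \<Rightarrow> real) \<Rightarrow> real" where
  "zfun m U \<alpha> = (\<lambda>g. U (zvec m \<alpha> g))"

definition rep_ok :: "nat \<Rightarrow> nat \<Rightarrow> ((nat \<Rightarrow> real) \<Rightarrow> real) \<Rightarrow> (nat \<Rightarrow> real \<Rightarrow> real) \<Rightarrow> bool" where
  "rep_ok k m U \<alpha> \<longleftrightarrow> CkRm m k U \<and> (\<forall>i<m. Ck01 k (\<alpha> i))"

definition rep_inf0 :: "nat \<Rightarrow> ((nat \<Rightarrow> real) \<Rightarrow> real) \<Rightarrow> (nat \<Rightarrow> real \<Rightarrow> real) \<Rightarrow> bool" where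
  "rep_inf0 m U \<alpha> \<longleftrightarrow> (\<forall>k. rep_ok k m U \<alpha>) \<and>
      (\<forall>i<m. deriv01 (\<alpha> i) 0 = 0 \<and> deriv01 (\<alpha> i) 1 = 0)"

definition Zset :: "nat \<Rightarrow> ((real \<Rightarrow> real) \<Rightarrow> real) set" where
  "Zset k = {zfun m U \<alpha> | m U \<alpha>. rep_ok k m U \<alpha>}"

definition Zinf0 :: "((real \<Rightarrow> real) \<Rightarrow> real) set" where
  "Zinf0 = {zfun m U \<alpha> | m U \<alpha>. rep_inf0 m U \<alpha>}"

definition Dz :: "((real \<Rightarrow> real) \<Rightarrow> real) \<Rightarrow> (real \<Rightarrow> real) \<Rightarrow> real \<Rightarrow> real" where
  "Dz u g s = (case (SOME r. case r of (m, U, \<alpha>) \<Rightarrow> rep_ok 1 m U \<alpha> \<and> u = zfun m U \<alpha>) of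
      (m, U, \<alpha>) \<Rightarrow> (\<Sum>i<m. pd i U (zvec m \<alpha> g) * deriv01 (\<alpha> i) (g s)))"

definition gleft :: "(real \<Rightarrow> real) \<Rightarrow> real \<Rightarrow> real" where
  "gleft g a = Lim (at_left a) g"

definition gright :: "(real \<Rightarrow> real) \<Rightarrow> real \<Rightarrow> real" where
  "gright g a = Lim (at_right a) g"

definition jumps :: "(real \<Rightarrow> real) \<Rightarrow> real set" where
  "jumps g = {a \<in> {0<..<1}. gleft g a \<noteq> gright g a}"

definition Vbeta :: "real \<Rightarrow> (real \<Rightarrow> real) \<Rightarrow> (real \<Rightarrow> real) \<Rightarrow> real" where
  "Vbeta \<beta> \<phi> g =
     infsum (\<lambda>a. (deriv01 \<phi> (gright g a) + deriv01 \<phi> (gleft g a)) / 2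
                 - (\<phi> (gright g a) - \<phi> (gleft g a)) / (gright g a - gleft g a)) (jumps g)
     + \<beta> * integral {0..1} (\<lambda>x. deriv01 \<phi> (g x))
     - (deriv01 \<phi> 0 + deriv01 \<phi> 1) / 2"

definition L0 :: "real \<Rightarrow> ((real \<Rightarrow> real) \<Rightarrow> real) \<Rightarrow> (real \<Rightarrow> real) \<Rightarrow> real" where
  "L0 \<beta> u g = (case (SOME r. case r of (m, U, \<alpha>) \<Rightarrow> rep_inf0 m U \<alpha> \<and> u = zfun m U \<alpha>) of
      (m, U, \<alpha>) \<Rightarrow>
        (\<Sum>i<m. \<Sum>j<m. pd i (pd j U) (zvec m \<alpha> g)
              * integral {0..1} (\<lambda>s. deriv01 (\<alpha> i) (g s) * deriv01 (\<alpha> j) (g s)))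
      + (\<Sum>i<m. pd i U (zvec m \<alpha> g) * Vbeta \<beta> (deriv01 (\<alpha> i)) g))"

definition L2 :: "'a measure \<Rightarrow> ('a \<Rightarrow> real) \<Rightarrow> bool" where
  "L2 M f \<longleftrightarrow> f \<in> borel_measurable M \<and> integrable M (\<lambda>x. (f x)^2)"

definition L2conv :: "'a measure \<Rightarrow> (nat \<Rightarrow> 'a \<Rightarrow> real) \<Rightarrow> ('a \<Rightarrow> real) \<Rightarrow> bool" where
  "L2conv M us f \<longleftrightarrow> (\<forall>n. L2 M (us n)) \<and> L2 M f \<and>
      ((\<lambda>n. \<integral>x. (us n x - f x)^2 \<partial>M) \<longlonglongrightarrow> 0)"

definition Linf :: "'a measure \<Rightarrow> ('a \<Rightarrow> real) \<Rightarrow> bool" where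
  "Linf M f \<longleftrightarrow> f \<in> borel_measurable M \<and> (\<exists>C. AE x in M. \<bar>f x\<bar> \<le> C)"

type_synonym 'a form = "('a \<Rightarrow> real) \<Rightarrow> ('a \<Rightarrow> real) \<Rightarrow> real"

definition ecauchy :: "'a form \<Rightarrow> (nat \<Rightarrow> 'a \<Rightarrow> real) \<Rightarrow> bool" where
  "ecauchy e us \<longleftrightarrow> (\<forall>\<epsilon>>0. \<exists>N. \<forall>n\<ge>N. \<forall>k\<ge>N.
      e (\<lambda>x. us n x - us k x) (\<lambda>x. us n x - us k x) < \<epsilon>)"

definition approx_seq :: "'a measure \<Rightarrow> ('a \<Rightarrow> real) set \<Rightarrow> 'a form \<Rightarrow> (nat \<Rightarrow> 'a \<Rightarrow> real) \<Rightarrow> ('a \<Rightarrow> real) \<Rightarrow> bool" where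
  "approx_seq M A e us u \<longleftrightarrow> (\<forall>n. us n \<in> A) \<and> L2conv M us u \<and> ecauchy e us"

definition closable :: "'a measure \<Rightarrow> ('a \<Rightarrow> real) set \<Rightarrow> 'a form \<Rightarrow> bool" where
  "closable M A e \<longleftrightarrow> (\<forall>us. approx_seq M A e us (\<lambda>_. 0) \<longrightarrow>
      (\<lambda>n. e (us n) (us n)) \<longlonglongrightarrow> 0)"

definition cl_dom :: "'a measure \<Rightarrow> ('a \<Rightarrow> real) set \<Rightarrow> 'a form \<Rightarrow> ('a \<Rightarrow> real) set" where
  "cl_dom M A e = {u. \<exists>us. approx_seq M A e us u}"

definition cl_form :: "'a measure \<Rightarrow> ('a \<Rightarrow> real) set \<Rightarrow> 'a form \<Rightarrow> 'a form" where
  "cl_form M A e u v = lim (\<lambda>n. e ((SOME us. approx_seq M A e us u) n) ((SOME vs. approx_seq M A e vs v) n))"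

definition e1 :: "'a measure \<Rightarrow> 'a form \<Rightarrow> 'a form" where
  "e1 M e u v = e u v + (\<integral>x. u x * v x \<partial>M)"

definition dirichlet_form :: "'a measure \<Rightarrow> ('a \<Rightarrow> real) set \<Rightarrow> 'a form \<Rightarrow> bool" where
  "dirichlet_form M F e \<longleftrightarrow>
     (\<forall>u\<in>F. L2 M u) \<and>
     (\<forall>u\<in>F. \<forall>v\<in>F. (\<lambda>x. u x + v x) \<in> F) \<and> (\<forall>c. \<forall>u\<in>F. (\<lambda>x. c * u x) \<in> F) \<and>
     (\<forall>u\<in>F. \<forall>v\<in>F. e u v = e v u) \<and>
     (\<forall>u\<in>F. \<forall>v\<in>F. \<forall>w\<in>F. e (\<lambda>x. u x + v x) w = e u w + e v w) \<and>
     (\<forall>c. \<forall>u\<in>F. \<forall>w\<in>F. e (\<lambda>x. c * u x) w = c * e u w) \<and>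
     (\<forall>u\<in>F. e u u \<ge> 0) \<and>
     (\<forall>f. L2 M f \<longrightarrow> (\<exists>us. (\<forall>n. us n \<in> F) \<and> L2conv M us f)) \<and>
     \<comment> \<open>closed: complete with respect to the e_1 norm\<close>
     (\<forall>us. (\<forall>n. us n \<in> F) \<and> (\<forall>\<epsilon>>0. \<exists>N. \<forall>n\<ge>N. \<forall>k\<ge>N.
             e1 M e (\<lambda>x. us n x - us k x) (\<lambda>x. us n x - us k x) < \<epsilon>) \<longrightarrow>
        (\<exists>u\<in>F. (\<lambda>n. e1 M e (\<lambda>x. us n x - u x) (\<lambda>x. us n x - u x)) \<longlonglongrightarrow> 0)) \<and>
     \<comment> \<open>Markovian: unit contraction operates\<close>
     (\<forall>u\<in>F. (\<lambda>x. min 1 (max 0 (u x))) \<in> F \<and>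
        e (\<lambda>x. min 1 (max 0 (u x))) (\<lambda>x. min 1 (max 0 (u x))) \<le> e u u)"

text \<open>Regularity on the compact space G_0 (so C_c(G_0) = C(G_0)).\<close>
definition regular_G0 :: "(real \<Rightarrow> real) measure \<Rightarrow> ((real \<Rightarrow> real) \<Rightarrow> real) set \<Rightarrow> (real \<Rightarrow> real) form \<Rightarrow> bool" where
  "regular_G0 M F e \<longleftrightarrow>
     (\<forall>f. cont_G0 f \<longrightarrow> (\<forall>\<epsilon>>0. \<exists>h\<in>F. cont_G0 h \<and> (\<forall>g\<in>G0. \<bar>f g - h g\<bar> < \<epsilon>))) \<and>
     (\<forall>u\<in>F. \<forall>\<epsilon>>0. \<exists>h\<in>F. cont_G0 h \<and> e1 M e (\<lambda>x. u x - h x) (\<lambda>x. u x - h x) < \<epsilon>)"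

definition recurrent :: "'a measure \<Rightarrow> ('a \<Rightarrow> real) set \<Rightarrow> 'a form \<Rightarrow> bool" where
  "recurrent M F e \<longleftrightarrow> (\<exists>us. (\<forall>n. us n \<in> F) \<and> (AE x in M. (\<lambda>n. us n x) \<longlonglongrightarrow> 1) \<and>
      (\<lambda>n. e (us n) (us n)) \<longlonglongrightarrow> 0)"

text \<open>Core (in the sense of Fukushima) of a regular Dirichlet form on G_0.\<close>
definition core_G0 :: "(real \<Rightarrow> real) measure \<Rightarrow> ((real \<Rightarrow> real) \<Rightarrow> real) set \<Rightarrow> (real \<Rightarrow> real) form \<Rightarrow> ((real \<Rightarrow> real) \<Rightarrow> real) set \<Rightarrow> bool" where
  "core_G0 M F e C \<longleftrightarrow> C \<subseteq> F \<and> (\<forall>h\<in>C. cont_G0 h) \<and>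
     (\<forall>u\<in>F. \<forall>\<epsilon>>0. \<exists>h\<in>C. e1 M e (\<lambda>x. u x - h x) (\<lambda>x. u x - h x) < \<epsilon>) \<and>
     (\<forall>f. cont_G0 f \<longrightarrow> (\<forall>\<epsilon>>0. \<exists>h\<in>C. \<forall>g\<in>G0. \<bar>f g - h g\<bar> < \<epsilon>))"

text \<open>Generator of a form, as a relation: u in Dom(L) and L u = f.\<close>
definition gen_rel :: "'a measure \<Rightarrow> ('a \<Rightarrow> real) set \<Rightarrow> 'a form \<Rightarrow> ('a \<Rightarrow> real) \<Rightarrow> ('a \<Rightarrow> real) \<Rightarrow> bool" where
  "gen_rel M F e u f \<longleftrightarrow> u \<in> F \<and> L2 M f \<and> (\<forall>v\<in>F. e u v = - (\<integral>x. f x * v x \<partial>M))"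

definition op_form :: "'a measure \<Rightarrow> (('a \<Rightarrow> real) \<Rightarrow> 'a \<Rightarrow> real) \<Rightarrow> 'a form" where
  "op_form M L u v = - (\<integral>x. L u x * v x \<partial>M)"

definition friedrichs_admissible :: "'a measure \<Rightarrow> ('a \<Rightarrow> real) set \<Rightarrow> (('a \<Rightarrow> real) \<Rightarrow> 'a \<Rightarrow> real) \<Rightarrow> bool" where
  "friedrichs_admissible M C L \<longleftrightarrow>
     (\<forall>u\<in>C. L2 M u \<and> L2 M (L u)) \<and>
     (\<forall>u\<in>C. \<forall>v\<in>C. (\<lambda>x. u x + v x) \<in> C) \<and> (\<forall>c. \<forall>u\<in>C. (\<lambda>x. c * u x) \<in> C) \<and>
     (\<forall>f. L2 M f \<longrightarrow> (\<exists>us. (\<forall>n. us n \<in> C) \<and> L2conv M us f)) \<and>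
     (\<forall>u\<in>C. \<forall>v\<in>C. (\<integral>x. L u x * v x \<partial>M) = (\<integral>x. u x * L v x \<partial>M)) \<and>
     (\<forall>u\<in>C. (\<integral>x. L u x * u x \<partial>M) \<le> 0) \<and>
     closable M C (op_form M L)"

definition friedrichs_rel :: "'a measure \<Rightarrow> ('a \<Rightarrow> real) set \<Rightarrow> (('a \<Rightarrow> real) \<Rightarrow> 'a \<Rightarrow> real) \<Rightarrow> ('a \<Rightarrow> real) \<Rightarrow> ('a \<Rightarrow> real) \<Rightarrow> bool" where
  "friedrichs_rel M C L = gen_rel M (cl_dom M C (op_form M L)) (cl_form M C (op_form M L))"

definition Leb01 :: "real measure" where
  "Leb01 = restrict_space lborel {0..1}"

definition M2 :: "(real \<Rightarrow> real) measure \<Rightarrow> ((real \<Rightarrow> real) \<times> real) measure" where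
  "M2 Q = Q \<Otimes>\<^sub>M Leb01"

definition Eform :: "(real \<Rightarrow> real) measure \<Rightarrow> (real \<Rightarrow> real) form" where
  "Eform Q u v = (\<integral>g. (LINT s:{0..1}|lborel. Dz u g s * Dz v g s) \<partial>Q)"

definition Dbar_rel :: "(real \<Rightarrow> real) measure \<Rightarrow> ((real \<Rightarrow> real) \<Rightarrow> real) \<Rightarrow> ((real \<Rightarrow> real) \<times> real \<Rightarrow> real) \<Rightarrow> bool" where
  "Dbar_rel Q u w \<longleftrightarrow> (\<exists>us. (\<forall>n. us n \<in> Zset 1) \<and> L2conv Q us u \<and>
      L2conv (M2 Q) (\<lambda>n z. Dz (us n) (fst z) (snd z)) w)"

definition D_closable :: "(real \<Rightarrow> real) measure \<Rightarrow> bool" where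
  "D_closable Q \<longleftrightarrow> (\<forall>w. Dbar_rel Q (\<lambda>_. 0) w \<longrightarrow> (AE z in M2 Q. w z = 0))"

definition Dom_Dbar :: "(real \<Rightarrow> real) measure \<Rightarrow> ((real \<Rightarrow> real) \<Rightarrow> real) set" where
  "Dom_Dbar Q = {u. \<exists>w. Dbar_rel Q u w}"

definition Dbar :: "(real \<Rightarrow> real) measure \<Rightarrow> ((real \<Rightarrow> real) \<Rightarrow> real) \<Rightarrow> (real \<Rightarrow> real) \<times> real \<Rightarrow> real" where
  "Dbar Q u = (SOME w. Dbar_rel Q u w)"

definition EDom :: "(real \<Rightarrow> real) measure \<Rightarrow> ((real \<Rightarrow> real) \<Rightarrow> real) set" where
  "EDom Q = cl_dom Q (Zset 1) (Eform Q)"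

definition Ebar :: "(real \<Rightarrow> real) measure \<Rightarrow> (real \<Rightarrow> real) form" where
  "Ebar Q = cl_form Q (Zset 1) (Eform Q)"

definition Gamma_sq :: "(real \<Rightarrow> real) measure \<Rightarrow> ((real \<Rightarrow> real) \<Rightarrow> real) \<Rightarrow> ((real \<Rightarrow> real) \<Rightarrow> real) \<Rightarrow> (real \<Rightarrow> real) \<Rightarrow> real" where
  "Gamma_sq Q u v g = (LINT s:{0..1}|lborel. Dbar Q u (g, s) * Dbar Q v (g, s))"

end

(* Pushing forward by x -> x + eps phi(x) leaves the finite dimensional distributions of Q_0^beta
   quasi-invariant with an explicit Jacobian. Differentiating at eps = 0 along the partition k/n and letting
   n -> infinity gives an integration by parts formula whose drift is V^beta_phi: summation by parts turns the
   Jacobian into trapezoidal rule errors of phi' over the increments of g, which are quadratic in these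
   increments and therefore converge to the sum over the jumps. Consequently the gradient D satisfies <D u, D v> = - <u, L v> for u in
   Z^1 and v in Z^infinity_0. As the gradients of the latter are dense in those of the former (polynomial
   approximation of U and of the derivatives alpha_i', cut off at 0 and 1), this yields at once that D u does not
   depend on the representation of u, that D is closable, the core property, and the identification of the
   generator. The Markov property and the square field operator come from the chain and product rules, which
   pass to the closure. *)
theory Submission
  imports Defs
begin

section \<open>Square integrable functions\<close>

text \<open>The delicate limit is the one over partitions, since the drift sees infinitely many
  jumps of g at once. It is taken in the range of g: the trapezoid error of an increment is spread
  evenly over the interval of values between \<open>g(k/(N+1))\<close> and
  \<open>g((k+1)/(N+1))\<close>. These intervals are disjoint in \<open>[0,1]\<close>, so the
  resulting step functions of a level r are bounded uniformly in N and g, and at a fixed r only the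
  cell crossing the level r counts. Dominated convergence in r then yields the jump sum, and the
  same bound dominates the limit under the expectation. The boundary needs care twice. Directions
  must vanish at 0 and 1, so flat derivatives approximate \<alpha>' only boundedly and pointwise on
  the open interval; this suffices because g(s) lies in \<open>]0,1[\<close> for almost every (g,s).
  And the partition formula also contains increments at 0 and 1; there g has almost surely no jump,
  because g(t) has mean t. Since \<open>Dz\<close> chooses a representation, its algebraic rules
  hold only almost everywhere, and the abstract theory of closures is written for gradients of this
  kind.\<close>

lemma L2D: "L2 M f ==> f \<in> borel_measurable M" "L2 M f ==> integrable M (%x. (f x)^2)"
 by (auto simp: L2_def)

lemma L2_mult_integrable:
 assumes "L2 M f" "L2 M g" shows "integrable M (%x. f x * g x)"
proof (rule Bochner_Integration.integrable_bound[of _ "%x. (f x)^2 + (g x)^2"])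
 show "AE x in M. norm (f x * g x) <= norm ((f x)^2 + (g x)^2)"
 proof (rule AE_I2)
  fix x
  have "0 <= (\<bar>f x\<bar> - \<bar>g x\<bar>)^2" by simp
  hence "2 * (\<bar>f x\<bar> * \<bar>g x\<bar>) <= (f x)^2 + (g x)^2" by (simp add: power2_diff)
  moreover have "0 <= \<bar>f x\<bar> * \<bar>g x\<bar>" by simp
  ultimately show "norm (f x * g x) <= norm ((f x)^2 + (g x)^2)"
   unfolding real_norm_def abs_mult by linarith
 qed
qed (use assms in \<open>auto simp: L2_def\<close>)

lemma L2_add:
 assumes "L2 M f" "L2 M g" shows "L2 M (%x. f x + g x)"
 using assms L2_mult_integrable[OF assms]
 by (auto simp: L2_def power2_sum mult.assoc)

lemma L2_cmult: "L2 M f ==> L2 M (%x. c * f x)"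
 by (auto simp: L2_def power_mult_distrib)

lemma L2_diff: "L2 M f ==> L2 M g ==> L2 M (%x. f x - g x)"
 using L2_add[of M f "%x. (-1) * g x"] L2_cmult[of M g "-1"] by simp

lemma L2_cong_AE:
 assumes "L2 M f" "g \<in> borel_measurable M" "AE x in M. f x = g x" shows "L2 M g"
proof -
 have "AE x in M. (f x)^2 = (g x)^2" using assms(3) by auto
 thus ?thesis using assms integrable_cong_AE[of "%x. (f x)^2" M "%x. (g x)^2"]
  by (auto simp: L2_def)
qed

lemma (in finite_measure) L2_bounded:
 assumes [measurable]: "f \<in> borel_measurable M" and "AE x in M. \<bar>f x\<bar> <= C" shows "L2 M f"
 unfolding L2_def
proof
 have b: "AE x in M. norm ((f x)^2) <= C^2"
  using assms(2) by eventually_elim (use abs_le_square_iff in fastforce)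
 show "integrable M (%x. (f x)^2)"
  by (rule integrable_const_bound[OF b]) measurable
qed fact

lemma L2_mult_bounded:
 assumes "L2 M w" and [measurable]: "f \<in> borel_measurable M" and b: "AE x in M. \<bar>f x\<bar> <= K"
 shows "L2 M (%x. f x * w x)" and "(\<integral>x. (f x * w x)^2 \<partial>M) <= K^2 * (\<integral>x. (w x)^2 \<partial>M)"
proof -
 have [measurable]: "w \<in> borel_measurable M" and i: "integrable M (%x. K^2 * (w x)^2)"
  using assms by (auto simp: L2_def)
 have le: "AE x in M. (f x * w x)^2 <= K^2 * (w x)^2"
  using b
 proof eventually_elim
  fix x assume "\<bar>f x\<bar> <= K"
  hence "(f x)^2 <= K^2" using abs_le_square_iff[of "f x" K] by auto
  thus "(f x * w x)^2 <= K^2 * (w x)^2"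
   by (simp add: power_mult_distrib mult_right_mono)
 qed
 have int: "integrable M (%x. (f x * w x)^2)"
  by (rule Bochner_Integration.integrable_bound[OF i]) (use le in auto)
 thus "L2 M (%x. f x * w x)" by (auto simp: L2_def)
 show "(\<integral>x. (f x * w x)^2 \<partial>M) <= K^2 * (\<integral>x. (w x)^2 \<partial>M)"
  using integral_mono_AE[OF int i le] by simp
qed

lemma integral_square_add_le:
 assumes "L2 M f" "L2 M g"
 shows "(\<integral>x. (f x + g x)^2 \<partial>M) <= 2 * (\<integral>x. (f x)^2 \<partial>M) + 2 * (\<integral>x. (g x)^2 \<partial>M)"
proof -
 have "(\<integral>x. (f x + g x)^2 \<partial>M) <= (\<integral>x. 2 * (f x)^2 + 2 * (g x)^2 \<partial>M)"
 proof (rule integral_mono)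
  fix x have "0 <= (f x - g x)^2" by simp
  thus "(f x + g x)^2 <= 2 * (f x)^2 + 2 * (g x)^2" by (simp add: power2_sum power2_diff)
 qed (use L2_add[OF assms] assms in \<open>auto simp: L2_def\<close>)
 thus ?thesis using assms by (simp add: L2_def)
qed

lemma integral_square_diff_triangle:
 assumes "L2 M f" "L2 M g" "L2 M h"
 shows "(\<integral>x. (f x - h x)^2 \<partial>M) <= 2 * (\<integral>x. (f x - g x)^2 \<partial>M) + 2 * (\<integral>x. (g x - h x)^2 \<partial>M)"
 using integral_square_add_le[OF L2_diff[OF assms(1,2)] L2_diff[OF assms(2,3)]] by simp

lemma quadratic_nonneg_discriminant:
 fixes a b c :: real
 assumes "!!t. 0 <= a * t^2 + 2 * b * t + c" "0 <= a" shows "b^2 <= a * c"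
proof (cases "a = 0")
 case True
 have "b = 0"
 proof (rule ccontr)
  assume "b \<noteq> 0"
  \<comment> \<open>At this t the affine function 2bt + c takes the value -1.\<close>
  thus False using assms(1)[of "- (c + 1) / (2 * b)"] True by simp
 qed
 thus ?thesis using True by simp
next
 case False
 hence a: "a > 0" using assms by simp
 have "0 <= a * (a * (- b / a)^2 + 2 * b * (- b / a) + c)"
  using assms(1)[of "- b / a"] a by simp
 also have "\<dots> = a * c - b^2" using a by (simp add: field_simps power2_eq_square)
 finally show ?thesis by simp
qed

lemma L2_Cauchy_Schwarz:
 assumes "L2 M f" "L2 M g"
 shows "(\<integral>x. f x * g x \<partial>M)^2 <= (\<integral>x. (f x)^2 \<partial>M) * (\<integral>x. (g x)^2 \<partial>M)"
proof (rule quadratic_nonneg_discriminant)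
 fix t :: real
 have "0 <= (\<integral>x. (t * f x + g x)^2 \<partial>M)" by simp
 also have "(%x. (t * f x + g x)^2) = (%x. t^2 * (f x)^2 + (2 * t) * (f x * g x) + (g x)^2)"
  by (auto simp: power2_sum power_mult_distrib)
 also have "(\<integral>x. t^2 * (f x)^2 + (2 * t) * (f x * g x) + (g x)^2 \<partial>M)
  = t^2 * (\<integral>x. (f x)^2 \<partial>M) + (2 * t) * (\<integral>x. f x * g x \<partial>M) + (\<integral>x. (g x)^2 \<partial>M)"
  using assms L2_mult_integrable[OF assms] by (simp add: L2_def)
 finally show "0 <= (\<integral>x. (f x)^2 \<partial>M) * t^2 + 2 * (\<integral>x. f x * g x \<partial>M) * t + (\<integral>x. (g x)^2 \<partial>M)"
  by (simp add: algebra_simps)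
qed simp

section \<open>Convergence in L^2 and completeness\<close>

lemma L2convD: "L2conv M us u ==> L2 M (us n)" "L2conv M us u ==> L2 M u"
 "L2conv M us u ==> (%n. \<integral>x. (us n x - u x)^2 \<partial>M) \<longlonglongrightarrow> 0"
 by (auto simp: L2conv_def)

lemma L2conv_const: "L2 M u ==> L2conv M (%_. u) u"
 by (simp add: L2conv_def)

lemma L2conv_cong_AE:
 assumes "L2conv M us u" "!!n. AE x in M. us n x = vs n x" "!!n. vs n \<in> borel_measurable M"
  "AE x in M. u x = v x" "v \<in> borel_measurable M"
 shows "L2conv M vs v"
proof -
 have eq: "(\<integral>x. (us n x - u x)^2 \<partial>M) = (\<integral>x. (vs n x - v x)^2 \<partial>M)" for n
 proof (rule integral_cong_AE)
  show "AE x in M. (us n x - u x)^2 = (vs n x - v x)^2"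
   using assms(2)[of n] assms(4) by eventually_elim simp
 qed (use assms L2D(1)[OF L2convD(1)[OF assms(1)]] L2D(1)[OF L2convD(2)[OF assms(1)]] in auto)
 show ?thesis unfolding L2conv_def
  using L2_cong_AE[OF L2convD(1)[OF assms(1)] assms(3) assms(2)]
   L2_cong_AE[OF L2convD(2)[OF assms(1)] assms(5) assms(4)] L2convD(3)[OF assms(1)] eq by simp
qed

lemma L2conv_add:
 assumes "L2conv M us u" "L2conv M vs v"
 shows "L2conv M (%n x. us n x + vs n x) (%x. u x + v x)"
proof -
 note [simp] = L2convD(1)[OF assms(1)] L2convD(2)[OF assms(1)] L2convD(1)[OF assms(2)] L2convD(2)[OF assms(2)]
 have lim: "(%n. 2 * (\<integral>x. (us n x - u x)^2 \<partial>M) + 2 * (\<integral>x. (vs n x - v x)^2 \<partial>M)) \<longlonglongrightarrow> 0"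
  using tendsto_add[OF tendsto_mult_left[OF L2convD(3)[OF assms(1)], of 2]
   tendsto_mult_left[OF L2convD(3)[OF assms(2)], of 2]] by simp
 have "(%n. \<integral>x. ((us n x + vs n x) - (u x + v x))^2 \<partial>M) \<longlonglongrightarrow> 0"
 proof (rule tendsto_sandwich[OF _ _ tendsto_const lim]; rule always_eventually; rule allI)
  fix n
  show "(\<integral>x. ((us n x + vs n x) - (u x + v x))^2 \<partial>M)
   <= 2 * (\<integral>x. (us n x - u x)^2 \<partial>M) + 2 * (\<integral>x. (vs n x - v x)^2 \<partial>M)"
   using integral_square_add_le[of M "%x. us n x - u x" "%x. vs n x - v x"]
   by (simp add: L2_diff add_diff_add)
 qed simp
 thus ?thesis by (simp add: L2conv_def L2_add)
qed

text \<open>Split f_n w_n - g w = f_n (w_n - w) + (f_n - g) w. The first part is controlled by K^2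
  times the distance of w_n to w, the second by dominated convergence with majorant (2K)^2 w^2.
  Applied with f_n = f'(u_n) and w_n = D u_n this passes the chain rule to the limit.\<close>

lemma L2conv_mult_bounded:
 assumes w: "L2conv M ws w" and f[measurable]: "!!n. f n \<in> borel_measurable M" "g \<in> borel_measurable M"
  and b: "!!n. AE x in M. \<bar>f n x\<bar> <= K" and lim: "AE x in M. (%n. f n x) \<longlonglongrightarrow> g x"
 shows "L2conv M (%n x. f n x * ws n x) (%x. g x * w x)"
proof -
 have [measurable]: "w \<in> borel_measurable M" "!!n. ws n \<in> borel_measurable M"
  using w by (auto simp: L2conv_def L2_def)
 have ball: "AE x in M. \<forall>n. \<bar>f n x\<bar> <= K" using b by (simp add: AE_all_countable)
 have bg: "AE x in M. \<bar>g x\<bar> <= K" using ball lim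
 proof eventually_elim
  fix x assume "\<forall>n. \<bar>f n x\<bar> <= K" "(%n. f n x) \<longlonglongrightarrow> g x"
  thus "\<bar>g x\<bar> <= K" using tendsto_upperbound[of "%n. \<bar>f n x\<bar>" "\<bar>g x\<bar>" sequentially K] tendsto_rabs by auto
 qed
 have Lw: "L2 M w" and Lws: "!!n. L2 M (ws n)" using w by (auto simp: L2conv_def)
 have Ld: "L2 M (%x. ws n x - w x)" for n by (intro L2_diff Lw Lws)
 have 1: "(%n. \<integral>x. (f n x * (ws n x - w x))^2 \<partial>M) \<longlonglongrightarrow> 0"
 proof (rule tendsto_sandwich[OF _ _ tendsto_const]; (rule always_eventually, rule allI)?)
  show "(\<integral>x. (f n x * (ws n x - w x))^2 \<partial>M) <= K^2 * (\<integral>x. (ws n x - w x)^2 \<partial>M)" for n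
   by (rule L2_mult_bounded(2)[OF Ld f(1) b])
  show "(%n. K^2 * (\<integral>x. (ws n x - w x)^2 \<partial>M)) \<longlonglongrightarrow> 0"
   using tendsto_mult_left[OF L2convD(3)[OF w], of "K^2"] by simp
 qed simp
 have L1: "L2 M (%x. f n x * (ws n x - w x))" for n by (rule L2_mult_bounded(1)[OF Ld f(1) b])
 have b2: "AE x in M. \<bar>f n x - g x\<bar> <= 2 * K" for n using b[of n] bg by eventually_elim linarith
 have L22: "L2 M (%x. (f n x - g x) * w x)" for n
  by (rule L2_mult_bounded(1)[OF Lw _ b2]) measurable
 have "(%n. \<integral>x. ((f n x - g x) * w x)^2 \<partial>M) \<longlonglongrightarrow> (\<integral>x. 0 \<partial>M)"
 proof (rule integral_dominated_convergence[where w="%x. (2*K)^2 * (w x)^2"])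
  show "integrable M (%x. (2*K)^2 * (w x)^2)" using Lw by (auto simp: L2_def)
  show "AE x in M. (%n. ((f n x - g x) * w x)^2) \<longlonglongrightarrow> 0"
   using lim
  proof eventually_elim
   fix x assume "(%n. f n x) \<longlonglongrightarrow> g x"
   hence "(%n. f n x - g x) \<longlonglongrightarrow> 0" by (simp add: LIM_zero)
   hence "(%n. (f n x - g x) * w x) \<longlonglongrightarrow> 0" by (rule tendsto_mult_left_zero)
   from tendsto_power[OF this, of 2] show "(%n. ((f n x - g x) * w x)^2) \<longlonglongrightarrow> 0" by simp
  qed
  show "AE x in M. norm (((f n x - g x) * w x)^2) <= (2*K)^2 * (w x)^2" for n
   using b2[of n]
  proof eventually_elim
   fix x assume "\<bar>f n x - g x\<bar> <= 2 * K"
   hence "(f n x - g x)^2 <= (2*K)^2" using abs_le_square_iff[of "f n x - g x" "2*K"] by auto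
   thus "norm (((f n x - g x) * w x)^2) <= (2*K)^2 * (w x)^2"
    by (simp add: power_mult_distrib mult_right_mono)
  qed
 qed measurable
 hence 2: "(%n. \<integral>x. ((f n x - g x) * w x)^2 \<partial>M) \<longlonglongrightarrow> 0" by simp
 have "L2conv M (%n x. f n x * (ws n x - w x)) (%_. 0)"
  using 1 L1 by (simp add: L2conv_def) (simp add: L2_def)
 moreover have "L2conv M (%n x. (f n x - g x) * w x) (%_. 0)"
  using 2 L22 by (simp add: L2conv_def) (simp add: L2_def)
 moreover have "L2conv M (%n x. g x * w x) (%x. g x * w x)"
  by (intro L2conv_const L2_mult_bounded(1)[OF Lw _ bg]) measurable
 ultimately have "L2conv M (%n x. f n x * (ws n x - w x) + ((f n x - g x) * w x + g x * w x))
   (%x. 0 + (0 + g x * w x))"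
  by (intro L2conv_add)
 thus ?thesis by (simp add: algebra_simps)
qed

lemma L2conv_cmult: 
 assumes "L2conv M us u" shows "L2conv M (%n x. c * us n x) (%x. c * u x)"
 by (rule L2conv_mult_bounded[OF assms, where f="%_ _. c" and K="\<bar>c\<bar>"]) auto

lemma L2conv_diff: "L2conv M us u ==> L2conv M vs v ==> L2conv M (%n x. us n x - vs n x) (%x. u x - v x)"
 using L2conv_add[of M us u "%n x. (-1) * vs n x" "%x. (-1) * v x"] L2conv_cmult[of M vs v "-1"] by simp

lemma L2conv_subseq:
 assumes "L2conv M us u" "strict_mono r" shows "L2conv M (%n. us (r n)) u"
 using assms LIMSEQ_subseq_LIMSEQ[OF L2convD(3)[OF assms(1)] assms(2)] by (auto simp: L2conv_def o_def)

lemma L2conv_inner0: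
 assumes "L2conv M us (%_. 0)" "!!n. L2 M (vs n)" "!!n. (\<integral>x. (vs n x)^2 \<partial>M) <= C"
 shows "(%n. \<integral>x. us n x * vs n x \<partial>M) \<longlonglongrightarrow> 0"
proof -
 have "(%n. (\<integral>x. us n x * vs n x \<partial>M)^2) \<longlonglongrightarrow> 0"
 proof (rule tendsto_sandwich[OF _ _ tendsto_const]; (rule always_eventually, rule allI)?)
  fix n
  have "(\<integral>x. us n x * vs n x \<partial>M)^2 <= (\<integral>x. (us n x)^2 \<partial>M) * (\<integral>x. (vs n x)^2 \<partial>M)"
   by (rule L2_Cauchy_Schwarz) (use assms in \<open>auto simp: L2conv_def\<close>)
  also have "\<dots> <= (\<integral>x. (us n x)^2 \<partial>M) * C" by (intro mult_left_mono assms) auto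
  finally show "(\<integral>x. us n x * vs n x \<partial>M)^2 <= (\<integral>x. (us n x)^2 \<partial>M) * C" .
 next
  show "(%n. (\<integral>x. (us n x)^2 \<partial>M) * C) \<longlonglongrightarrow> 0"
   using tendsto_mult_right[OF L2convD(3)[OF assms(1)], of C] by simp
 qed simp
 thus ?thesis by simp
qed

lemma L2conv_inner:
 assumes "L2conv M us u" "L2conv M vs v"
 shows "(%n. \<integral>x. us n x * vs n x \<partial>M) \<longlonglongrightarrow> (\<integral>x. u x * v x \<partial>M)"
proof -
 note L = L2convD(1)[OF assms(1)] L2convD(2)[OF assms(1)] L2convD(1)[OF assms(2)] L2convD(2)[OF assms(2)]
 have u0: "L2conv M (%n x. us n x - u x) (%_. 0)"
  using L2conv_diff[OF assms(1) L2conv_const[OF L(2)]] by simp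
 have v0: "L2conv M (%n x. vs n x - v x) (%_. 0)"
  using L2conv_diff[OF assms(2) L2conv_const[OF L(4)]] by simp
 obtain C where C: "!!n. (\<integral>x. (vs n x - v x)^2 \<partial>M) <= C"
  using convergent_imp_Bseq[OF convergentI[OF L2convD(3)[OF assms(2)]]]
  by (auto simp: Bseq_def) 
 have C2: "(\<integral>x. (vs n x)^2 \<partial>M) <= 2 * C + 2 * (\<integral>x. (v x)^2 \<partial>M)" for n
  using integral_square_add_le[OF L2_diff[OF L(3,4)] L(4), of n] C[of n] by simp
 have 1: "(%n. \<integral>x. (us n x - u x) * vs n x \<partial>M) \<longlonglongrightarrow> 0" 
  by (rule L2conv_inner0[OF u0 L(3) C2])
 have 2: "(%n. \<integral>x. (vs n x - v x) * u x \<partial>M) \<longlonglongrightarrow> 0" 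
  by (rule L2conv_inner0[OF v0 L(2) order_refl])
 have "(\<integral>x. us n x * vs n x \<partial>M) = (\<integral>x. (us n x - u x) * vs n x \<partial>M) + (\<integral>x. (vs n x - v x) * u x \<partial>M) + (\<integral>x. u x * v x \<partial>M)" for n
 proof -
  have "(\<integral>x. us n x * vs n x \<partial>M) = (\<integral>x. ((us n x - u x) * vs n x + (vs n x - v x) * u x) + u x * v x \<partial>M)"
   by (rule Bochner_Integration.integral_cong) (auto simp: algebra_simps)
  thus ?thesis using L by (simp add: L2_mult_integrable L2_diff)
 qed
 thus ?thesis using tendsto_add[OF tendsto_add[OF 1 2] tendsto_const[of "\<integral>x. u x * v x \<partial>M"]] by simp
qed

lemma L2_zero_AE:
 assumes "L2 M f" "(\<integral>x. (f x)^2 \<partial>M) = 0" shows "AE x in M. f x = 0"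
 using assms integral_nonneg_eq_0_iff_AE[of M "%x. (f x)^2"] by (auto simp: L2_def)

lemma L2conv_unique:
 assumes "L2conv M us u" "L2conv M us v" shows "AE x in M. u x = v x"
proof -
 have "L2conv M (%n x. us n x - us n x) (%x. u x - v x)" by (rule L2conv_diff[OF assms])
 hence "L2 M (%x. u x - v x)" "(\<integral>x. (u x - v x)^2 \<partial>M) = 0"
  by (auto simp: L2conv_def power2_commute dest: LIMSEQ_unique[OF tendsto_const])
 from L2_zero_AE[OF this] show ?thesis by simp
qed

lemma L2conv_AE_subseq:
 assumes "L2conv M us u"
 obtains r :: "nat => nat" where "strict_mono r" "AE x in M. (%n. us (r n) x) \<longlonglongrightarrow> u x"
proof -
 note L = L2convD(1)[OF assms(1)] L2convD(2)[OF assms(1)]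
 have "\<exists>r::nat=>nat. strict_mono r \<and> (AE x in M. (%n. (us (r n) x - u x)^2) \<longlonglongrightarrow> 0)"
  by (rule tendsto_L1_AE_subseq) (use L2convD(3)[OF assms] L2_diff[OF L] in \<open>auto simp: L2_def\<close>)
 then obtain r :: "nat=>nat" where r: "strict_mono r" "AE x in M. (%n. (us (r n) x - u x)^2) \<longlonglongrightarrow> 0" by auto
 have "AE x in M. (%n. us (r n) x) \<longlonglongrightarrow> u x" using r(2)
 proof eventually_elim
  fix x assume "(%n. (us (r n) x - u x)^2) \<longlonglongrightarrow> 0"
  hence "(%n. us (r n) x - u x) \<longlonglongrightarrow> 0" by simp
  thus "(%n. us (r n) x) \<longlonglongrightarrow> u x" by (simp add: LIM_zero_iff)
 qed
 thus ?thesis using that r by blast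
qed

lemma (in prob_space) L2_integrable:
 assumes "L2 M f" shows "integrable M f" "(\<integral>x. \<bar>f x\<bar> \<partial>M) <= sqrt (\<integral>x. (f x)^2 \<partial>M)"
proof -
 have 1: "L2 M (%_. 1::real)" by (auto simp: L2_def)
 show "integrable M f" using L2_mult_integrable[OF assms 1] by simp
 have a: "L2 M (%x. \<bar>f x\<bar>)" using assms by (auto simp: L2_def)
 have "(\<integral>x. \<bar>f x\<bar> \<partial>M)^2 <= (\<integral>x. (f x)^2 \<partial>M)"
  using L2_Cauchy_Schwarz[OF a 1] prob_space by simp
 thus "(\<integral>x. \<bar>f x\<bar> \<partial>M) <= sqrt (\<integral>x. (f x)^2 \<partial>M)" by (rule real_le_rsqrt)
qed

text \<open>The Riesz-Fischer argument: along a fast subsequence the increments have summable L^1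
  norms, so it converges almost everywhere, and Fatou's lemma shows that the whole sequence
  converges to that limit in L^2.\<close>

theorem (in prob_space) L2_complete:
 assumes L: "!!n. L2 M (us n)"
  and C: "!!e. e > 0 ==> \<exists>N. \<forall>n\<ge>N. \<forall>k\<ge>N. (\<integral>x. (us n x - us k x)^2 \<partial>M) < e"
 shows "\<exists>u. L2conv M us u"
proof -
 have "\<exists>N. \<forall>n\<ge>N. \<forall>k\<ge>N. (\<integral>x. (us n x - us k x)^2 \<partial>M) < (1/4)^j" for j :: nat using C[of "(1/4)^j"] by simp
 then obtain N :: "nat => nat" where N: "!!j n k. n \<ge> N j ==> k \<ge> N j ==> (\<integral>x. (us n x - us k x)^2 \<partial>M) < (1/4)^j"
  by metis
 \<comment> \<open>The summand n makes r strictly increasing, the sum makes r n at least N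
   n.\<close>
 define r where "r n = n + (\<Sum>i\<le>n. N i)" for n
 have rs: "r n < r (Suc n)" for n by (simp add: r_def)
 hence r: "strict_mono r" by (simp add: strict_mono_Suc_iff)
 have rN: "r n \<ge> N n" for n unfolding r_def by (simp add: member_le_sum trans_le_add2)
 have [measurable]: "us n \<in> borel_measurable M" for n using L by (auto simp: L2_def)
 define d where "d n x = us (r (Suc n)) x - us (r n) x" for n x
 have [measurable]: "d n \<in> borel_measurable M" for n unfolding d_def by measurable
 have dL: "L2 M (d n)" for n unfolding d_def by (intro L2_diff L)
 have db: "(\<integral>x. \<bar>d n x\<bar> \<partial>M) <= (1/2)^n" for n
 proof -
  have "(\<integral>x. (d n x)^2 \<partial>M) < (1/4)^n" unfolding d_def
   by (rule N) (use rN[of n] rs[of n] in auto)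
  hence "sqrt (\<integral>x. (d n x)^2 \<partial>M) <= sqrt ((1/4)^n)" by simp
  also have "\<dots> = (1/2)^n" by (simp add: real_sqrt_power real_sqrt_divide)
  finally show ?thesis using L2_integrable(2)[OF dL[of n]] by simp
 qed
 have "AE x in M. summable (%n. \<bar>d n x\<bar>)"
 proof -
  have "(\<integral>\<^sup>+x. (\<Sum>n. ennreal \<bar>d n x\<bar>) \<partial>M) = (\<Sum>n. \<integral>\<^sup>+x. ennreal \<bar>d n x\<bar> \<partial>M)"
   by (rule nn_integral_suminf) measurable
  also have "\<dots> = (\<Sum>n. ennreal (\<integral>x. \<bar>d n x\<bar> \<partial>M))"
   by (intro suminf_cong nn_integral_eq_integral integrable_abs L2_integrable(1) dL) auto
  also have "\<dots> <= (\<Sum>n. ennreal ((1/2)^n))"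
   by (intro suminf_le ennreal_leI db) auto
  also have "\<dots> = ennreal (\<Sum>n. (1/2)^n)"
   by (intro suminf_ennreal2) (auto intro: summable_geometric)
  also have "\<dots> < \<infinity>" by simp
  finally have "AE x in M. (\<Sum>n. ennreal \<bar>d n x\<bar>) \<noteq> \<infinity>"
   by (intro nn_integral_PInf_AE) auto
  thus ?thesis by eventually_elim (auto intro: summable_suminf_not_top)
 qed
 hence conv: "AE x in M. convergent (%n. us (r n) x)"
 proof eventually_elim
  fix x assume "summable (%n. \<bar>d n x\<bar>)"
  hence "summable (%n. d n x)" by (rule summable_rabs_cancel)
  hence "convergent (%n. \<Sum>i<n. d i x)" by (simp add: summable_iff_convergent)
  moreover have "(\<Sum>i<n. d i x) = us (r n) x - us (r 0) x" for n
   unfolding d_def by (rule sum_lessThan_telescope)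
  ultimately have "convergent (%n. (us (r n) x - us (r 0) x) + us (r 0) x)"
   by (intro convergent_add convergent_const) simp
  thus "convergent (%n. us (r n) x)" by simp
 qed
 define u where "u x = lim (%n. us (r n) x)" for x
 have [measurable]: "u \<in> borel_measurable M" unfolding u_def by (rule borel_measurable_lim_metric) measurable
 have lim: "AE x in M. (%n. us (r n) x) \<longlonglongrightarrow> u x"
  using conv by eventually_elim (simp add: u_def convergent_LIMSEQ_iff)
 \<comment> \<open>Stated in \<open>ennreal\<close>, so that Fatou's lemma applies before u is known
   to be square integrable; the case e = 1 then supplies that.\<close>
 have key: "\<exists>N0. \<forall>n\<ge>N0. (\<integral>\<^sup>+x. ennreal ((us n x - u x)^2) \<partial>M) <= ennreal e" if e: "e > 0" for e
 proof -
  obtain N0 where N0: "!!n k. n\<ge>N0 ==> k\<ge>N0 ==> (\<integral>x. (us n x - us k x)^2 \<partial>M) < e" using C[OF e] by blast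
  show ?thesis
  proof (intro exI allI impI)
   fix n assume n: "n \<ge> N0"
   have "(\<integral>\<^sup>+x. ennreal ((us n x - u x)^2) \<partial>M) = (\<integral>\<^sup>+x. liminf (%k. ennreal ((us n x - us (r k) x)^2)) \<partial>M)"
   proof (rule nn_integral_cong_AE, use lim in eventually_elim)
    fix x assume "(%k. us (r k) x) \<longlonglongrightarrow> u x"
    hence "(%k. ennreal ((us n x - us (r k) x)^2)) \<longlonglongrightarrow> ennreal ((us n x - u x)^2)"
     by (intro tendsto_intros) auto
    thus "ennreal ((us n x - u x)^2) = liminf (%k. ennreal ((us n x - us (r k) x)^2))"
     using lim_imp_Liminf[OF sequentially_bot] by metis
   qed
   also have "\<dots> <= liminf (%k. \<integral>\<^sup>+x. ennreal ((us n x - us (r k) x)^2) \<partial>M)"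
    by (rule nn_integral_liminf) measurable
   also have "\<dots> <= ennreal e"
   proof (rule Liminf_le)
    show "\<forall>\<^sub>F k in sequentially. (\<integral>\<^sup>+x. ennreal ((us n x - us (r k) x)^2) \<partial>M) <= ennreal e"
    proof (rule eventually_sequentiallyI[of N0])
     fix k assume "k \<ge> N0"
     hence k: "r k \<ge> N0" using seq_suble[OF r, of k] by linarith
     have "(\<integral>\<^sup>+x. ennreal ((us n x - us (r k) x)^2) \<partial>M) = ennreal (\<integral>x. (us n x - us (r k) x)^2 \<partial>M)"
      by (rule nn_integral_eq_integral) (use L2_diff[OF L L, of n "r k"] in \<open>auto simp: L2_def\<close>)
     also have "\<dots> <= ennreal e" using N0[OF n k] by (intro ennreal_leI) simp
     finally show "(\<integral>\<^sup>+x. ennreal ((us n x - us (r k) x)^2) \<partial>M) <= ennreal e" .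
    qed
   qed simp
   finally show "(\<integral>\<^sup>+x. ennreal ((us n x - u x)^2) \<partial>M) <= ennreal e" .
  qed
 qed
 obtain N1 where N1: "!!n. n\<ge>N1 ==> (\<integral>\<^sup>+x. ennreal ((us n x - u x)^2) \<partial>M) <= ennreal 1" using key[of 1] by auto
 have "integrable M (%x. (us N1 x - u x)^2)"
  using le_less_trans[OF N1[of N1] ennreal_less_top] by (intro integrableI_bounded) auto
 hence "L2 M (%x. us N1 x - u x)" by (auto simp: L2_def)
 from L2_diff[OF L[of N1] this] have uL: "L2 M u" by simp
 have "(%n. \<integral>x. (us n x - u x)^2 \<partial>M) \<longlonglongrightarrow> 0"
 proof (rule LIMSEQ_I)
  fix e :: real assume e: "e > 0"
  then obtain N0 where N0: "!!n. n\<ge>N0 ==> (\<integral>\<^sup>+x. ennreal ((us n x - u x)^2) \<partial>M) <= ennreal (e/2)" using key[of "e/2"] by auto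
  show "\<exists>no. \<forall>n\<ge>no. norm ((\<integral>x. (us n x - u x)^2 \<partial>M) - 0) < e"
  proof (intro exI allI impI)
   fix n assume n: "n \<ge> N0"
   have "ennreal (\<integral>x. (us n x - u x)^2 \<partial>M) = (\<integral>\<^sup>+x. ennreal ((us n x - u x)^2) \<partial>M)"
    by (rule nn_integral_eq_integral[symmetric]) (use L2_diff[OF L uL, of n] in \<open>auto simp: L2_def\<close>)
   hence "(\<integral>x. (us n x - u x)^2 \<partial>M) <= e/2" using N0[OF n] e by (metis ennreal_le_iff half_gt_zero less_imp_le)
   thus "norm ((\<integral>x. (us n x - u x)^2 \<partial>M) - 0) < e" using e by simp
  qed
 qed
 thus ?thesis using L uL by (auto simp: L2conv_def)
qed


section \<open>Closed forms induced by a closable gradient\<close>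

text \<open>The closed graph of D. It is a relation because functions are not identified when they
  agree almost everywhere, so w is determined by u only up to null sets.\<close>

definition graph_cl :: "'a measure => 'b measure => ('a => real) set => (('a => real) => 'b => real) => ('a => real) => ('b => real) => bool" where
 "graph_cl M N A D u w \<longleftrightarrow> (\<exists>us. (\<forall>n. us n \<in> A) \<and> L2conv M us u \<and> L2conv N (%n. D (us n)) w)"

definition grad_form :: "'b measure => (('a => real) => 'b => real) => 'a form" where
 "grad_form N D u v = (\<integral>z. D u z * D v z \<partial>N)"

text \<open>The forms \<open>Eform\<close>, \<open>op_form\<close> and \<open>grad_form\<close>
  agree only on their initial domains. This and the next lemmas carry closability and closures from
  one to another; since \<open>ecauchy\<close> evaluates a form at differences, the domain has to be
  closed under them.\<close>

lemma form_cong_approx_seq: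
 assumes "!!u v. u \<in> C ==> v \<in> C ==> e u v = e' u v" "!!u v. u \<in> C ==> v \<in> C ==> (%x. u x - v x) \<in> C"
 shows "approx_seq M C e us u \<longleftrightarrow> approx_seq M C e' us u"
 unfolding approx_seq_def ecauchy_def using assms by (auto 4 4)

lemma form_cong_closable:
 assumes "!!u v. u \<in> C ==> v \<in> C ==> e u v = e' u v" "!!u v. u \<in> C ==> v \<in> C ==> (%x. u x - v x) \<in> C"
 shows "closable M C e \<longleftrightarrow> closable M C e'"
proof -
 have eq: "(%n. e (us n) (us n)) = (%n. e' (us n) (us n))" if "approx_seq M C e' us (%_. 0)" for us
  using that assms(1) by (auto simp: approx_seq_def)
 moreover have "approx_seq M C e us u = approx_seq M C e' us u" for us u
  by (rule form_cong_approx_seq[OF assms])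
 ultimately show ?thesis unfolding closable_def by simp
qed

lemma form_cong_cl_dom:
 assumes "!!u v. u \<in> C ==> v \<in> C ==> e u v = e' u v" "!!u v. u \<in> C ==> v \<in> C ==> (%x. u x - v x) \<in> C"
 shows "cl_dom M C e = cl_dom M C e'"
proof -
 have "approx_seq M C e us u = approx_seq M C e' us u" for us u
  by (rule form_cong_approx_seq[OF assms])
 thus ?thesis unfolding cl_dom_def by simp
qed

lemma form_cong_cl_form:
 assumes "!!u v. u \<in> C ==> v \<in> C ==> e u v = e' u v" "!!u v. u \<in> C ==> v \<in> C ==> (%x. u x - v x) \<in> C"
  and "u \<in> cl_dom M C e" "v \<in> cl_dom M C e"
 shows "cl_form M C e u v = cl_form M C e' u v"
proof -
 have eq: "approx_seq M C e us w = approx_seq M C e' us w" for us w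
  by (rule form_cong_approx_seq[OF assms(1,2)])
 have "approx_seq M C e (SOME us. approx_seq M C e us w) w" if "w \<in> cl_dom M C e" for w
  using that unfolding cl_dom_def mem_Collect_eq by (rule someI_ex)
 from this[OF assms(3)] this[OF assms(4)]
 have m: "(SOME us. approx_seq M C e us u) n \<in> C" "(SOME us. approx_seq M C e us v) n \<in> C" for n
  unfolding approx_seq_def by blast+
 show ?thesis
  unfolding cl_form_def using m by (simp add: assms(1) eq)
qed

text \<open>Linearity is required only almost everywhere because the intended D picks a
  representation of its argument by choice, and sums need not respect the choices.\<close>

locale L2_gradient =
 fixes M :: "'a measure" and N :: "'b measure" and A :: "('a => real) set"
  and D :: "('a => real) => 'b => real"
 assumes prob_M: "prob_space M" and prob_N: "prob_space N"
  and A_L2: "u \<in> A ==> L2 M u" and D_L2: "u \<in> A ==> L2 N (D u)"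
  and A_add: "u \<in> A ==> v \<in> A ==> (%x. u x + v x) \<in> A"
  and A_cmult: "u \<in> A ==> (%x. c * u x) \<in> A"
  and D_add: "u \<in> A ==> v \<in> A ==> AE z in N. D (%x. u x + v x) z = D u z + D v z"
  and D_cmult: "u \<in> A ==> AE z in N. D (%x. c * u x) z = c * D u z"
  and D_closed: "(!!n. us n \<in> A) ==> L2conv M us (%_. 0) ==> L2conv N (%n. D (us n)) w ==> AE z in N. w z = 0"
begin

abbreviation "G \<equiv> graph_cl M N A D"
abbreviation "E \<equiv> grad_form N D"

lemma A_diff: "u \<in> A ==> v \<in> A ==> (%x. u x - v x) \<in> A"
 using A_add[OF _ A_cmult[of v "-1"]] by simp

lemma D_diff:
 assumes "u \<in> A" "v \<in> A" shows "AE z in N. D (%x. u x - v x) z = D u z - D v z"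
proof -
 have "AE z in N. D (%x. u x - v x) z = D u z + D (%x. - v x) z" "AE z in N. D (%x. - v x) z = - D v z"
  using D_add[OF assms(1) A_cmult[OF assms(2), of "-1"]] D_cmult[OF assms(2), of "-1"] by simp_all
 thus ?thesis by eventually_elim simp
qed

lemma D_measurable: "u \<in> A ==> D u \<in> borel_measurable N"
 using D_L2 by (simp add: L2_def)

lemma E_diff:
 assumes "u \<in> A" "v \<in> A"
 shows "E (%x. u x - v x) (%x. u x - v x) = (\<integral>z. (D u z - D v z)^2 \<partial>N)"
 unfolding grad_form_def
proof (rule integral_cong_AE)
 show "AE z in N. D (%x. u x - v x) z * D (%x. u x - v x) z = (D u z - D v z)^2"
  using D_diff[OF assms] by eventually_elim (simp add: power2_eq_square)
qed (use D_L2[OF assms(1)] D_L2[OF assms(2)] D_L2[OF A_diff[OF assms]] in \<open>auto simp: L2_def\<close>)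

lemma G_L2: "G u w ==> L2 M u" "G u w ==> L2 N w"
 by (auto simp: graph_cl_def L2conv_def)

lemma G_self: "u \<in> A ==> G u (D u)"
 unfolding graph_cl_def by (intro exI[of _ "%_. u"]) (auto intro: L2conv_const A_L2 D_L2)

text \<open>Trading the approximating sequence for a single approximant at each precision turns
  closedness of the graph into a triangle inequality; no diagonal sequence has to be built.\<close>

lemma G_iff:
 "G u w \<longleftrightarrow> L2 M u \<and> L2 N w \<and> (\<forall>e>0. \<exists>h\<in>A. (\<integral>x. (h x - u x)^2 \<partial>M) < e \<and> (\<integral>z. (D h z - w z)^2 \<partial>N) < e)"
 (is "_ \<longleftrightarrow> _ \<and> _ \<and> ?P")
proof
 assume G: "G u w"
 then obtain us where us: "!!n. us n \<in> A" "L2conv M us u" "L2conv N (%n. D (us n)) w"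
  by (auto simp: graph_cl_def)
 have ?P
 proof (intro allI impI)
  fix e :: real assume "e > 0"
  hence "\<forall>\<^sub>F n in sequentially. (\<integral>x. (us n x - u x)^2 \<partial>M) < e" "\<forall>\<^sub>F n in sequentially. (\<integral>z. (D (us n) z - w z)^2 \<partial>N) < e"
   using order_tendstoD(2)[OF L2convD(3)[OF us(2)]] order_tendstoD(2)[OF L2convD(3)[OF us(3)]] by auto
  hence "\<forall>\<^sub>F n in sequentially. (\<integral>x. (us n x - u x)^2 \<partial>M) < e \<and> (\<integral>z. (D (us n) z - w z)^2 \<partial>N) < e"
   by eventually_elim simp
  then obtain n where "(\<integral>x. (us n x - u x)^2 \<partial>M) < e \<and> (\<integral>z. (D (us n) z - w z)^2 \<partial>N) < e"
   using eventually_happens'[OF sequentially_bot] by blast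
  thus "\<exists>h\<in>A. (\<integral>x. (h x - u x)^2 \<partial>M) < e \<and> (\<integral>z. (D h z - w z)^2 \<partial>N) < e" using us(1) by blast
 qed
 thus "L2 M u \<and> L2 N w \<and> ?P" using G_L2[OF G] by simp
next
 assume h: "L2 M u \<and> L2 N w \<and> ?P"
 have "\<exists>v. v \<in> A \<and> (\<integral>x. (v x - u x)^2 \<partial>M) < 1 / real (Suc n) \<and> (\<integral>z. (D v z - w z)^2 \<partial>N) < 1 / real (Suc n)" for n
  using h[THEN conjunct2, THEN conjunct2, rule_format, of "1 / real (Suc n)"] by auto
 then obtain us where us: "!!n. us n \<in> A" "!!n. (\<integral>x. (us n x - u x)^2 \<partial>M) < 1 / real (Suc n)"
   "!!n. (\<integral>z. (D (us n) z - w z)^2 \<partial>N) < 1 / real (Suc n)"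
  using choice[of "%n v. v \<in> A \<and> (\<integral>x. (v x - u x)^2 \<partial>M) < 1 / real (Suc n) \<and> (\<integral>z. (D v z - w z)^2 \<partial>N) < 1 / real (Suc n)"]
  by auto
 have l: "(%n. 1 / real (Suc n)) \<longlonglongrightarrow> 0" using LIMSEQ_Suc[OF lim_1_over_n] by simp
 have "(%n. \<integral>x. (us n x - u x)^2 \<partial>M) \<longlonglongrightarrow> 0" "(%n. \<integral>z. (D (us n) z - w z)^2 \<partial>N) \<longlonglongrightarrow> 0"
  by (rule tendsto_sandwich[OF _ _ tendsto_const l];
    use us(2,3) in \<open>auto intro!: always_eventually less_imp_le\<close>)+
 thus "G u w" unfolding graph_cl_def L2conv_def using us(1) h A_L2 D_L2 by auto
qed

lemma G_closed:
 assumes "!!n. G (us n) (ws n)" "L2conv M us u" "L2conv N ws w" shows "G u w"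
 unfolding G_iff
proof (intro conjI allI impI)
 show L: "L2 M u" "L2 N w" using assms by (auto simp: L2conv_def)
 \<comment> \<open>The triangle inequality for squared norms costs a factor 2 on each of two terms,
   hence the precision e/4.\<close>
 fix e :: real assume e: "e > 0"
 have "\<forall>\<^sub>F n in sequentially. (\<integral>x. (us n x - u x)^2 \<partial>M) < e/4" "\<forall>\<^sub>F n in sequentially. (\<integral>z. (ws n z - w z)^2 \<partial>N) < e/4"
  using order_tendstoD(2)[OF L2convD(3)[OF assms(2)]] order_tendstoD(2)[OF L2convD(3)[OF assms(3)]] e
  by (meson divide_pos_pos zero_less_numeral)+
 hence "\<forall>\<^sub>F n in sequentially. (\<integral>x. (us n x - u x)^2 \<partial>M) < e/4 \<and> (\<integral>z. (ws n z - w z)^2 \<partial>N) < e/4"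
  by eventually_elim simp
 then obtain n where n: "(\<integral>x. (us n x - u x)^2 \<partial>M) < e/4" "(\<integral>z. (ws n z - w z)^2 \<partial>N) < e/4"
  using eventually_happens'[OF sequentially_bot] by blast
 obtain h where h: "h \<in> A" "(\<integral>x. (h x - us n x)^2 \<partial>M) < e/4" "(\<integral>z. (D h z - ws n z)^2 \<partial>N) < e/4"
  using assms(1)[of n] e unfolding G_iff by (meson divide_pos_pos zero_less_numeral)
 have "(\<integral>x. (h x - u x)^2 \<partial>M) < e" "(\<integral>z. (D h z - w z)^2 \<partial>N) < e"
  using integral_square_diff_triangle[OF A_L2[OF h(1)] G_L2(1)[OF assms(1)] L(1), of n]
   integral_square_diff_triangle[OF D_L2[OF h(1)] G_L2(2)[OF assms(1)] L(2), of n] n h by linarith+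
 thus "\<exists>h\<in>A. (\<integral>x. (h x - u x)^2 \<partial>M) < e \<and> (\<integral>z. (D h z - w z)^2 \<partial>N) < e" using h(1) by blast
qed

lemma G_cong_AE:
 assumes "G u w" "w' \<in> borel_measurable N" "AE z in N. w z = w' z" shows "G u w'"
 by (rule G_closed[of "%_. u" "%_. w"])
  (use assms G_L2[OF assms(1)] L2conv_cong_AE[of N "%_. w" w "%_. w" w'] in \<open>auto intro: L2conv_const simp: L2D\<close>)

lemma G_add: assumes "G u w" "G u' w'" shows "G (%x. u x + u' x) (%z. w z + w' z)"
proof -
 obtain us where us: "!!n. us n \<in> A" "L2conv M us u" "L2conv N (%n. D (us n)) w"
  using assms by (auto simp: graph_cl_def)
 obtain vs where vs: "!!n. vs n \<in> A" "L2conv M vs u'" "L2conv N (%n. D (vs n)) w'"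
  using assms by (auto simp: graph_cl_def)
 show ?thesis
 proof (rule G_closed[of "%n x. us n x + vs n x" "%n z. D (us n) z + D (vs n) z"])
  fix n
  have "AE z in N. D (us n) z + D (vs n) z = D (%x. us n x + vs n x) z" using D_add[OF us(1)[of n] vs(1)[of n]] by eventually_elim simp
  thus "G (%x. us n x + vs n x) (%z. D (us n) z + D (vs n) z)"
   by (intro G_cong_AE[OF G_self[OF A_add[OF us(1) vs(1)]]])
     (auto intro!: borel_measurable_add D_measurable us(1) vs(1))
 qed (intro L2conv_add us(2,3) vs(2,3))+
qed

lemma G_cmult: assumes "G u w" shows "G (%x. c * u x) (%z. c * w z)"
proof -
 obtain us where us: "!!n. us n \<in> A" "L2conv M us u" "L2conv N (%n. D (us n)) w"
  using assms by (auto simp: graph_cl_def)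
 show ?thesis
 proof (rule G_closed[of "%n x. c * us n x" "%n z. c * D (us n) z"])
  fix n
  have "AE z in N. c * D (us n) z = D (%x. c * us n x) z" using D_cmult[OF us(1)[of n], of c] by eventually_elim simp
  thus "G (%x. c * us n x) (%z. c * D (us n) z)"
   by (intro G_cong_AE[OF G_self[OF A_cmult[OF us(1)]]])
     (auto intro!: borel_measurable_times D_measurable us(1))
 qed (intro L2conv_cmult us(2,3))+
qed

lemma G_diff: "G u w ==> G v w' ==> G (%x. u x - v x) (%z. w z - w' z)"
 using G_add[of u w "%x. (-1) * v x" "%z. (-1) * w' z"] G_cmult[of v w' "-1"] by simp

lemma G_zero: assumes "G (%_. 0) w" shows "AE z in N. w z = 0"
 using assms D_closed unfolding graph_cl_def by blast

lemma G_unique: assumes "G u w" "G u w'" shows "AE z in N. w z = w' z"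
 using G_zero[of "%z. w z - w' z"] G_diff[OF assms] by simp

lemma approx_seq_limit:
 assumes "approx_seq M A E us u"
 obtains w where "L2conv N (%n. D (us n)) w" "G u w"
proof -
 have us: "!!n. us n \<in> A" "L2conv M us u" "ecauchy E us" using assms by (auto simp: approx_seq_def)
 have "\<exists>w. L2conv N (%n. D (us n)) w"
 proof (rule prob_space.L2_complete[OF prob_N])
  show "\<exists>N'. \<forall>n\<ge>N'. \<forall>k\<ge>N'. (\<integral>z. (D (us n) z - D (us k) z)^2 \<partial>N) < e" if "e > 0" for e :: real
   using us(3) that unfolding ecauchy_def E_diff[OF us(1) us(1)] by blast
 qed (use D_L2 us in auto)
 thus ?thesis using that us by (auto simp: graph_cl_def)
qed

lemma approx_seqI:
 assumes "!!n. us n \<in> A" "L2conv M us u" "L2conv N (%n. D (us n)) w"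
 shows "approx_seq M A E us u"
 unfolding approx_seq_def ecauchy_def E_diff[OF assms(1) assms(1)]
proof (intro conjI allI impI)
 fix e :: real assume e: "e > 0"
 have "\<forall>\<^sub>F n in sequentially. (\<integral>z. (D (us n) z - w z)^2 \<partial>N) < e/4"
  using order_tendstoD(2)[OF L2convD(3)[OF assms(3)]] e
  by (meson divide_pos_pos zero_less_numeral)
 then obtain n0 where n0: "!!n. n \<ge> n0 ==> (\<integral>z. (D (us n) z - w z)^2 \<partial>N) < e/4"
  by (auto simp: eventually_sequentially)
 have "(\<integral>z. (D (us n) z - D (us k) z)^2 \<partial>N) < e" if "n \<ge> n0" "k \<ge> n0" for n k
  using integral_square_diff_triangle[OF D_L2[OF assms(1)] L2convD(2)[OF assms(3)] D_L2[OF assms(1)], of n k]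
   n0[OF that(1)] n0[OF that(2)] by (simp add: power2_commute)
 thus "\<exists>N'. \<forall>n\<ge>N'. \<forall>k\<ge>N'. (\<integral>z. (D (us n) z - D (us k) z)^2 \<partial>N) < e" by blast
qed (use assms in auto)

lemma cl_dom_eq: "cl_dom M A E = {u. \<exists>w. G u w}"
 proof (intro set_eqI iffI)
 fix u assume "u \<in> cl_dom M A E"
 then obtain us where "approx_seq M A E us u" by (auto simp: cl_dom_def)
 thus "u \<in> {u. \<exists>w. G u w}" by (metis approx_seq_limit mem_Collect_eq)
next
 fix u assume "u \<in> {u. \<exists>w. G u w}"
 then obtain us w where "!!n. us n \<in> A" "L2conv M us u" "L2conv N (%n. D (us n)) w"
  by (auto simp: graph_cl_def)
 from approx_seqI[OF this] show "u \<in> cl_dom M A E" by (auto simp: cl_dom_def)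
qed

text \<open>\<open>cl_form\<close> is evaluated along approximating sequences picked by choice.
  Their gradients converge in L^2, inner products are continuous, and closability makes the limits
  unique almost everywhere, so any gradients w and w' may be used.\<close>

lemma cl_form_eq:
 assumes "G u w" "G v w'" shows "cl_form M A E u v = (\<integral>z. w z * w' z \<partial>N)"
proof -
 have s: "\<exists>ws. L2conv N (%n. D ((SOME us. approx_seq M A E us u) n)) ws \<and> G u ws" if "G u w" for u w
 proof -
  have "\<exists>us. approx_seq M A E us u" using that approx_seqI unfolding graph_cl_def by blast
  hence "approx_seq M A E (SOME us. approx_seq M A E us u) u" by (rule someI_ex)
  thus ?thesis by (metis approx_seq_limit)
 qed
 obtain w0 where w0: "L2conv N (%n. D ((SOME us. approx_seq M A E us u) n)) w0" "G u w0" using s[OF assms(1)] by auto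
 obtain v0 where v0: "L2conv N (%n. D ((SOME us. approx_seq M A E us v) n)) v0" "G v v0" using s[OF assms(2)] by auto
 have "cl_form M A E u v = (\<integral>z. w0 z * v0 z \<partial>N)"
  using limI[OF L2conv_inner[OF w0(1) v0(1)]] unfolding cl_form_def by (simp add: grad_form_def)
 also have "\<dots> = (\<integral>z. w z * w' z \<partial>N)"
 proof (rule integral_cong_AE)
  show "AE z in N. w0 z * v0 z = w z * w' z"
   using G_unique[OF w0(2) assms(1)] G_unique[OF v0(2) assms(2)] by eventually_elim simp
 qed (use G_L2(2)[OF w0(2)] G_L2(2)[OF v0(2)] G_L2(2)[OF assms(1)] G_L2(2)[OF assms(2)] in \<open>auto simp: L2_def\<close>)
 finally show ?thesis .
qed

lemma closable_form: "closable M A E"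
 unfolding closable_def
proof (intro allI impI)
 fix us assume a: "approx_seq M A E us (%_. 0)"
 obtain w where w: "L2conv N (%n. D (us n)) w" "G (%_. 0) w" using approx_seq_limit[OF a] .
 have "(%n. E (us n) (us n)) \<longlonglongrightarrow> (\<integral>z. w z * w z \<partial>N)"
  unfolding grad_form_def by (rule L2conv_inner[OF w(1) w(1)])
 moreover have "(\<integral>z. w z * w z \<partial>N) = 0"
  by (rule integral_eq_zero_AE) (use G_zero[OF w(2)] in auto)
 ultimately show "(%n. E (us n) (us n)) \<longlonglongrightarrow> 0" by simp
qed

lemma e1_cl_form:
 assumes "G u w" "G v w'"
 shows "e1 M (cl_form M A E) (%x. u x - v x) (%x. u x - v x) = (\<integral>z. (w z - w' z)^2 \<partial>N) + (\<integral>x. (u x - v x)^2 \<partial>M)"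
 unfolding e1_def cl_form_eq[OF G_diff[OF assms] G_diff[OF assms]] by (simp add: power2_eq_square)

text \<open>By \<open>e1_cl_form\<close> the squared e1-distance is the sum of the squared L^2
  distances of functions and of gradients, so completeness of both L^2 spaces and closedness of the
  graph give the claim.\<close>

lemma complete_cl_form:
 assumes "!!n. us n \<in> cl_dom M A E"
  and C: "\<forall>e>0. \<exists>N'. \<forall>n\<ge>N'. \<forall>k\<ge>N'. e1 M (cl_form M A E) (%x. us n x - us k x) (%x. us n x - us k x) < e"
 shows "\<exists>u\<in>cl_dom M A E. (%n. e1 M (cl_form M A E) (%x. us n x - u x) (%x. us n x - u x)) \<longlonglongrightarrow> 0"
proof -
 obtain ws where ws: "!!n. G (us n) (ws n)" using assms(1) unfolding cl_dom_eq by simp metis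
 have C': "\<exists>N'. \<forall>n\<ge>N'. \<forall>k\<ge>N'. (\<integral>z. (ws n z - ws k z)^2 \<partial>N) + (\<integral>x. (us n x - us k x)^2 \<partial>M) < e" if "e > 0" for e
  using C that unfolding e1_cl_form[OF ws ws] by blast
 have nn: "0 <= (\<integral>z. (ws n z - ws k z)^2 \<partial>N)" "0 <= (\<integral>x. (us n x - us k x)^2 \<partial>M)" for n k by auto
 have "\<exists>w. L2conv N ws w"
 proof (rule prob_space.L2_complete[OF prob_N G_L2(2)[OF ws]])
  fix e :: real assume "e > 0"
  from C'[OF this] show "\<exists>N'. \<forall>n\<ge>N'. \<forall>k\<ge>N'. (\<integral>z. (ws n z - ws k z)^2 \<partial>N) < e"
   using nn by (meson add_le_cancel_left add_le_cancel_right le_add_same_cancel1 le_add_same_cancel2 le_less_trans)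
 qed
 then obtain w where w: "L2conv N ws w" ..
 have "\<exists>u. L2conv M us u"
 proof (rule prob_space.L2_complete[OF prob_M G_L2(1)[OF ws]])
  fix e :: real assume "e > 0"
  from C'[OF this] show "\<exists>N'. \<forall>n\<ge>N'. \<forall>k\<ge>N'. (\<integral>z. (us n z - us k z)^2 \<partial>M) < e"
   using nn by (meson add_le_cancel_left add_le_cancel_right le_add_same_cancel1 le_add_same_cancel2 le_less_trans)
 qed
 then obtain u where u: "L2conv M us u" ..
 have G: "G u w" by (rule G_closed[OF ws u w])
 have "(%n. e1 M (cl_form M A E) (%x. us n x - u x) (%x. us n x - u x)) \<longlonglongrightarrow> 0"
  unfolding e1_cl_form[OF ws G] using tendsto_add[OF L2convD(3)[OF w] L2convD(3)[OF u]] by simp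
 thus ?thesis using G unfolding cl_dom_eq by blast
qed

end

text \<open>If every element of A is a graph-norm limit of elements of C, then its pair (u, D u)
  lies in the closed graph over C, and \<open>C.G_closed\<close> absorbs the further limit.\<close>

lemma graph_cl_core:
 assumes "L2_gradient M N A D" "L2_gradient M N C D" "C \<subseteq> A"
  and dense: "!!u e. u \<in> A ==> e > 0 ==> \<exists>h\<in>C. (\<integral>x. (h x - u x)^2 \<partial>M) < e \<and> (\<integral>z. (D h z - D u z)^2 \<partial>N) < e"
 shows "graph_cl M N C D u w \<longleftrightarrow> graph_cl M N A D u w"
proof
 assume "graph_cl M N C D u w"
 thus "graph_cl M N A D u w" using assms(3) unfolding graph_cl_def by blast
next
 interpret A: L2_gradient M N A D by fact
 interpret C: L2_gradient M N C D by fact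
 assume "graph_cl M N A D u w"
 then obtain us where us: "!!n. us n \<in> A" "L2conv M us u" "L2conv N (%n. D (us n)) w"
  by (auto simp: graph_cl_def)
 show "graph_cl M N C D u w"
 proof (rule C.G_closed[OF _ us(2,3)])
  show "graph_cl M N C D (us n) (D (us n))" for n
   unfolding C.G_iff using A.A_L2 A.D_L2 us(1) dense by blast
 qed
qed

text \<open>Here p stands for the projection (g,s) to g, through which functions on M multiply
  gradients on N. Its image measure being M lets null sets of M be pulled back to N.\<close>

locale L2_derivation = L2_gradient +
 fixes p :: "'b => 'a"
 assumes p_measurable: "p \<in> measurable N M" and p_distr: "distr N M p = M"
  and A_bounded: "u \<in> A ==> \<exists>C. \<forall>x\<in>space M. \<bar>u x\<bar> <= C"
  and A_nonempty: "A \<noteq> {}"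
  and A_chain: "u \<in> A ==> (!!x. (f has_real_derivative f' x) (at x)) ==> continuous_on UNIV f' ==> (%x. f (u x)) \<in> A"
  and D_chain: "u \<in> A ==> (!!x. (f has_real_derivative f' x) (at x)) ==> continuous_on UNIV f' ==>
    AE z in N. D (%x. f (u x)) z = f' (u (p z)) * D u z"
  and A_mult: "u \<in> A ==> v \<in> A ==> (%x. u x * v x) \<in> A"
  and D_mult: "u \<in> A ==> v \<in> A ==> AE z in N. D (%x. u x * v x) z = u (p z) * D v z + v (p z) * D u z"
begin

lemma AE_p: assumes "AE x in M. P x" shows "AE z in N. P (p z)"
proof -
 have "AE x in distr N M p. P x" using assms by (simp only: p_distr)
 thus ?thesis using p_measurable by (rule AE_distrD[rotated])
qed

lemma meas_p: "u \<in> borel_measurable M ==> (%z. u (p z)) \<in> borel_measurable N"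
 using measurable_compose[OF p_measurable] .

text \<open>The bound K makes f Lipschitz, which handles f(u_n) in L^2. For f'(u_n) one passes to an
  almost everywhere convergent subsequence. The sequence itself is returned because
  \<open>G_bounded_seq\<close> needs approximants of the form f(u_n).\<close>

lemma G_chain_seq:
 assumes G: "G u w" and f: "!!x. (f has_real_derivative f' x) (at x)" and f': "continuous_on UNIV f'"
  and K: "!!x. \<bar>f' x\<bar> <= K"
 obtains us where "!!n. us n \<in> A" "AE x in M. (%n. us n x) \<longlonglongrightarrow> u x"
  "L2conv M (%n x. f (us n x)) (%x. f (u x))"
  "L2conv N (%n. D (%x. f (us n x))) (%z. f' (u (p z)) * w z)"
proof -
 interpret M: prob_space M by (rule prob_M)
 obtain us0 where us0: "!!n. us0 n \<in> A" "L2conv M us0 u" "L2conv N (%n. D (us0 n)) w"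
  using G by (auto simp: graph_cl_def)
 obtain r :: "nat => nat" where r: "strict_mono r" "AE x in M. (%n. us0 (r n) x) \<longlonglongrightarrow> u x"
  using L2conv_AE_subseq[OF us0(2)] .
 define us where "us n = us0 (r n)" for n
 have us: "us n \<in> A" "L2conv M us u" "L2conv N (%n. D (us n)) w" "AE x in M. (%n. us n x) \<longlonglongrightarrow> u x" for n
  unfolding us_def using us0(1) r(2) L2conv_subseq[OF us0(2) r(1)] L2conv_subseq[OF us0(3) r(1)] by auto
 have lip: "\<bar>f x - f y\<bar> <= K * \<bar>x - y\<bar>" for x y
  using field_differentiable_bound[of UNIV f f' K x y] f K by simp
 have [measurable]: "f \<in> borel_measurable borel" "f' \<in> borel_measurable borel"
  using f f' by (auto intro!: borel_measurable_continuous_onI DERIV_continuous_on)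
 have um: "u \<in> borel_measurable M" "us n \<in> borel_measurable M" for n
  using L2convD(1)[OF us(2)] L2convD(2)[OF us(2)] by (auto simp: L2_def)
 note [measurable] = um meas_p[OF um(1)] meas_p[OF um(2)]
 have Lf: "L2 M (%x. f (v x))" if v: "L2 M v" for v
 proof -
  have [measurable]: "v \<in> borel_measurable M" using v by (auto simp: L2_def)
  have "L2 M (%x. (f (v x) - f 0) - 0)"
  proof (rule L2_diff)
   have "integrable M (%x. (f (v x) - f 0)^2)"
   proof (rule Bochner_Integration.integrable_bound)
    show "integrable M (%x. K^2 * (v x)^2)" using v by (auto simp: L2_def)
    show "AE x in M. norm ((f (v x) - f 0)^2) <= norm (K^2 * (v x)^2)"
    proof (rule AE_I2)
     fix x have "\<bar>f (v x) - f 0\<bar> <= \<bar>K * v x\<bar>" using lip[of "v x" 0] by (simp add: abs_mult) (smt (verit) K abs_ge_self mult_right_mono abs_ge_zero)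
     thus "norm ((f (v x) - f 0)^2) <= norm (K^2 * (v x)^2)"
      by (simp add: abs_le_square_iff power_mult_distrib)
    qed
   qed measurable
   thus "L2 M (%x. f (v x) - f 0)" by (simp add: L2_def)
  qed (simp add: L2_def)
  hence "L2 M (%x. (f (v x) - f 0) + f 0)" by (intro L2_add) (auto simp: L2_def)
  thus ?thesis by simp
 qed
 have 1: "L2conv M (%n x. f (us n x)) (%x. f (u x))"
  unfolding L2conv_def
 proof (intro conjI allI)
  note LL = L2convD(1)[OF us(2)] L2convD(2)[OF us(2)]
  show "L2 M (%x. f (us n x))" "L2 M (%x. f (u x))" for n using Lf LL by auto
  have le: "(\<integral>x. (f (us n x) - f (u x))^2 \<partial>M) <= K^2 * (\<integral>x. (us n x - u x)^2 \<partial>M)" for n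
  proof -
   have "(\<integral>x. (f (us n x) - f (u x))^2 \<partial>M) <= (\<integral>x. K^2 * (us n x - u x)^2 \<partial>M)"
   proof (rule integral_mono)
    show "integrable M (%x. (f (us n x) - f (u x))^2)" "integrable M (%x. K^2 * (us n x - u x)^2)"
     using L2_diff[OF Lf[OF LL(1)[of n]] Lf[OF LL(2)]] L2_diff[OF LL(1)[of n] LL(2)] by (auto simp: L2_def)
    fix x have "\<bar>f (us n x) - f (u x)\<bar> <= \<bar>K * (us n x - u x)\<bar>" using lip[of "us n x" "u x"]
     by (simp add: abs_mult) (smt (verit) K abs_ge_self mult_right_mono abs_ge_zero)
    thus "(f (us n x) - f (u x))^2 <= K^2 * (us n x - u x)^2"
     by (simp add: abs_le_square_iff flip: power_mult_distrib)
   qed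
   thus ?thesis by simp
  qed
  show "(%n. \<integral>x. (f (us n x) - f (u x))^2 \<partial>M) \<longlonglongrightarrow> 0"
  proof (rule tendsto_sandwich[OF _ _ tendsto_const]; (rule always_eventually, rule allI)?)
   show "(%n. K^2 * (\<integral>x. (us n x - u x)^2 \<partial>M)) \<longlonglongrightarrow> 0"
    using tendsto_mult_left[OF L2convD(3)[OF us(2)], of "K^2"] by simp
  qed (use le in auto)
 qed
 have 2: "L2conv N (%n z. f' (us n (p z)) * D (us n) z) (%z. f' (u (p z)) * w z)"
 proof (rule L2conv_mult_bounded[OF us(3)])
  show "AE z in N. (%n. f' (us n (p z))) \<longlonglongrightarrow> f' (u (p z))"
   using AE_p[OF us(4)]
  proof eventually_elim
   fix z assume "(%n. us n (p z)) \<longlonglongrightarrow> u (p z)"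
   thus "(%n. f' (us n (p z))) \<longlonglongrightarrow> f' (u (p z))"
    using f' by (metis continuous_on_eq_continuous_at isCont_tendsto_compose open_UNIV UNIV_I)
  qed
 qed (use K in auto)
 have "L2conv N (%n. D (%x. f (us n x))) (%z. f' (u (p z)) * w z)"
 proof (rule L2conv_cong_AE[OF 2])
  fix n
  show "AE z in N. f' (us n (p z)) * D (us n) z = D (%x. f (us n x)) z"
   using D_chain[OF us(1)[of n] f f'] by eventually_elim simp
  show "D (%x. f (us n x)) \<in> borel_measurable N" by (rule D_measurable[OF A_chain[OF us(1) f f']])
 qed (use L2convD(2)[OF 2] in \<open>auto simp: L2_def\<close>)
 thus ?thesis using that us 1 by blast
qed

lemma G_chain:
 assumes "G u w" and f: "!!x. (f has_real_derivative f' x) (at x)" and f': "continuous_on UNIV f'"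
  and K: "!!x. \<bar>f' x\<bar> <= K"
 shows "G (%x. f (u x)) (%z. f' (u (p z)) * w z)"
proof -
 obtain us where us: "!!n. us n \<in> A" "AE x in M. (%n. us n x) \<longlonglongrightarrow> u x"
  "L2conv M (%n x. f (us n x)) (%x. f (u x))"
  "L2conv N (%n. D (%x. f (us n x))) (%z. f' (u (p z)) * w z)" 
  by (rule G_chain_seq[OF assms]) (blast intro: that)
 show ?thesis unfolding graph_cl_def using us(3,4) A_chain[OF us(1) f f']
  by (intro exI[of _ "%n x. f (us n x)"]) auto
qed

end


section \<open>Cutoffs and smooth contractions of the line\<close>

lemma ex_antiderivative:
 fixes f :: "real => real"
 assumes "continuous_on UNIV f"
 obtains F where "F c = d" "!!x. (F has_real_derivative f x) (at x)"
proof -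
 have "\<exists>F. \<forall>x :: real. -\<infinity> < ereal x \<longrightarrow> ereal x < \<infinity> \<longrightarrow> (F has_vector_derivative f x) (at x)"
  by (rule einterval_antiderivative) (use assms in \<open>auto simp: continuous_on_eq_continuous_at\<close>)
 then obtain F where F: "!!x. (F has_real_derivative f x) (at x)"
  by (auto simp: has_real_derivative_iff_has_vector_derivative)
 have "((%x. F x - F c + d) has_real_derivative f x) (at x)" for x
  using F[of x] by (auto intro!: derivative_eq_intros)
 thus ?thesis using that[of "%x. F x - F c + d"] by auto
qed

lemma DERIV_eq_on_convex:
 fixes F G :: "real => real"
 assumes "!!x. x \<in> S ==> (F has_real_derivative f x) (at x)" "!!x. x \<in> S ==> (G has_real_derivative g x) (at x)"
  "!!x. x \<in> S ==> f x = g x"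
  and S: "convex S" "a \<in> S" "F a = G a" "x \<in> S"
 shows "F x = G x"
proof -
 have "\<exists>c. \<forall>x\<in>S. F x - G x = c"
 proof (rule has_field_derivative_zero_constant[OF S(1)])
  fix x assume x: "x \<in> S"
  have "((%x. F x - G x) has_real_derivative f x - g x) (at x)"
   using assms(1,2)[OF x] by (rule DERIV_diff)
  thus "((%x. F x - G x) has_real_derivative 0) (at x within S)"
   by (simp add: has_field_derivative_at_within assms(3)[OF x])
 qed
 then obtain c where c: "!!x. x \<in> S ==> F x - G x = c" by blast
 from c[OF S(2)] c[OF S(4)] S(3) show ?thesis by simp
qed

text \<open>The derivative is 1 on [-C,C], falls linearly to 0 at distance C+1 and stays 0. So f is
  constant beyond C+1, and the Lipschitz bound at C+1 gives the last claim.\<close>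

lemma ex_cutoff:
 assumes "0 <= C"
 obtains f f' :: "real => real" where "!!x. (f has_real_derivative f' x) (at x)" "continuous_on UNIV f'"
  "!!x. \<bar>f' x\<bar> <= 1" "!!x. \<bar>x\<bar> <= C ==> f x = x" "!!x. \<bar>x\<bar> <= C ==> f' x = 1" "!!x. \<bar>f x\<bar> <= C + 1"
proof -
 define f' where "f' x = max 0 (min 1 (C + 1 - \<bar>x\<bar>))" for x :: real
 have c: "continuous_on UNIV f'" unfolding f'_def by (intro continuous_intros)
 obtain f where f: "f 0 = 0" "!!x. (f has_real_derivative f' x) (at x)" using ex_antiderivative[OF c] by metis
 have b: "\<bar>f' x\<bar> <= 1" for x by (auto simp: f'_def)
 have lip: "\<bar>f x\<bar> <= \<bar>x\<bar>" for x
  using field_differentiable_bound[of UNIV f f' 1 x 0] f b by simp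
 have id: "f x = x" if "\<bar>x\<bar> <= C" for x
  by (rule DERIV_eq_on_convex[OF f(2) DERIV_ident, of "{-C..C}" 0])
   (use f(1) that assms in \<open>auto simp: f'_def abs_le_iff\<close>)
 have "\<bar>f x\<bar> <= C + 1" for x
 proof -
  consider "\<bar>x\<bar> <= C + 1" | "x \<ge> C + 1" | "x <= - (C + 1)" by linarith
  thus ?thesis
  proof cases
   case 1 thus ?thesis using lip[of x] by simp
  next
   case 2
   have "f x = f (C + 1)"
    by (rule DERIV_eq_on_convex[OF f(2) DERIV_const[of "f (C+1)"], of "{C+1..}" "C+1"])
     (use 2 assms in \<open>auto simp: f'_def\<close>)
   thus ?thesis using lip[of "C + 1"] assms by simp
  next
   case 3
   have "f x = f (- (C + 1))"
    by (rule DERIV_eq_on_convex[OF f(2) DERIV_const[of "f (-(C+1))"], of "{..-(C+1)}" "-(C+1)"])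
     (use 3 assms in \<open>auto simp: f'_def\<close>)
   thus ?thesis using lip[of "- (C + 1)"] assms by simp
  qed
 qed
 thus ?thesis using that[of f f'] f c b id by (auto simp: f'_def)
qed

definition unit_clamp :: "real => real" where "unit_clamp x = min 1 (max 0 x)"

lemma unit_clamp_bounds: "0 <= unit_clamp x" "unit_clamp x <= 1" by (auto simp: unit_clamp_def)

lemma unit_clamp_eq: "x \<in> {0..1} ==> unit_clamp x = x" by (auto simp: unit_clamp_def)

lemma continuous_unit_clamp: "continuous_on A unit_clamp"
 unfolding unit_clamp_def by (intro continuous_intros)

text \<open>The derivatives $1-(2c-1)^{2n}$, $c$ the clamp of $x$, are continuous and converge pointwise to the
 indicator of $]0,1[$.\<close>

lemma ex_smooth_unit_contraction:
 fixes n :: nat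
 obtains f where "!!x. (f has_real_derivative 1 - (2 * unit_clamp x - 1) ^ (2 * n)) (at x)"
  "!!x. f x = unit_clamp x - ((2 * unit_clamp x - 1) ^ (2 * n + 1) + 1) / (2 * (2 * real n + 1))"
proof -
 define q where "q x = x - ((2 * x - 1) ^ (2 * n + 1) + 1) / (2 * (2 * real n + 1))" for x :: real
 define q' where "q' x = 1 - (2 * x - 1) ^ (2 * n)" for x :: real
 have q: "(q has_real_derivative q' x) (at x)" for x
  unfolding q_def q'_def
  by (rule derivative_eq_intros refl | simp)+ (simp add: field_simps)
 have q0: "q 0 = 0" "q' 0 = 0" "q' 1 = 0" by (auto simp: q_def q'_def)
 have "continuous_on UNIV (%x. q' (unit_clamp x))"
  unfolding q'_def by (intro continuous_intros continuous_unit_clamp)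
 then obtain f where f: "f 0 = 0" "!!x. (f has_real_derivative q' (unit_clamp x)) (at x)"
  using ex_antiderivative by metis
 have 1: "f x = q x" if "x \<in> {0..1}" for x
  by (rule DERIV_eq_on_convex[OF f(2) q, of "{0..1}" 0])
   (use f(1) q0 that in \<open>auto simp: unit_clamp_eq\<close>)
 have "f x = q (unit_clamp x)" for x
 proof -
  consider "x \<in> {0..1}" | "x <= 0" | "x \<ge> 1" by force
  thus ?thesis
  proof cases
   case 1 thus ?thesis using \<open>x \<in> {0..1} ==> f x = q x\<close> by (simp add: unit_clamp_eq)
  next
   case 2
   have "f x = f 0"
    by (rule DERIV_eq_on_convex[OF f(2) DERIV_const[of "f 0"], of "{..0}" 0])
     (use 2 q0 in \<open>auto simp: unit_clamp_def\<close>)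
   thus ?thesis using 2 f(1) q0 by (simp add: unit_clamp_def)
  next
   case 3
   have "f x = f 1"
    by (rule DERIV_eq_on_convex[OF f(2) DERIV_const[of "f 1"], of "{1..}" 1])
     (use 3 q0 in \<open>auto simp: unit_clamp_def\<close>)
   thus ?thesis using 3 1[of 1] by (simp add: unit_clamp_def)
  qed
 qed
 thus ?thesis using that[of f] f unfolding q_def q'_def by blast
qed

lemma (in prob_space) L2conv_bounded:
 assumes [measurable]: "!!n. f n \<in> borel_measurable M" "g \<in> borel_measurable M"
  and "!!n. AE x in M. \<bar>f n x\<bar> <= K" "AE x in M. (%n. f n x) \<longlonglongrightarrow> g x"
 shows "L2conv M f g"
proof -
 have "L2conv M (%n. %_. 1::real) (%_. 1)" by (rule L2conv_const) (simp add: L2_def)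
 from L2conv_mult_bounded[OF this assms] show ?thesis by simp
qed

section \<open>Markov property, product rule and square field on the closure\<close>

context L2_derivation
begin

lemma const_in_A: "(%_. c) \<in> A" and D_const: "AE z in N. D (%_. c) z = 0"
proof -
 obtain u where u: "u \<in> A" using A_nonempty by blast
 show "(%_. c) \<in> A" using A_chain[OF u, of "%_. c" "%_. 0"] by simp
 show "AE z in N. D (%_. c) z = 0" using D_chain[OF u, of "%_. c" "%_. 0"] by simp
qed

lemma G_const: "G (%_. c) (%_. 0)"
 using G_cong_AE[OF G_self[OF const_in_A]] D_const by simp

text \<open>The smooth contractions converge uniformly to the clamp, and their derivatives converge
  boundedly to the indicator of the open interval. As these derivatives vanish exactly at 0 and 1,
  the limit is identified at every point, and nothing has to be known about w on the level sets u =
  0 and u = 1.\<close>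

lemma G_unit_contraction:
 assumes G: "G u w"
 shows "G (%x. min 1 (max 0 (u x))) (%z. indicator {0<..<1} (u (p z)) * w z)"
proof -
 interpret M: prob_space M by (rule prob_M)
 interpret N: prob_space N by (rule prob_N)
 have um[measurable]: "u \<in> borel_measurable M" using G_L2[OF G] by (auto simp: L2_def)
 note [measurable] = meas_p[OF um]
 have "\<exists>f. (\<forall>x. (f has_real_derivative 1 - (2 * unit_clamp x - 1) ^ (2 * Suc n)) (at x)) \<and>
  (\<forall>x. f x = unit_clamp x - ((2 * unit_clamp x - 1) ^ (2 * Suc n + 1) + 1) / (2 * (2 * real (Suc n) + 1)))" for n
  using ex_smooth_unit_contraction[of "Suc n"] by metis
 then obtain f where f: "!!n x. (f n has_real_derivative 1 - (2 * unit_clamp x - 1) ^ (2 * Suc n)) (at x)"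
  and fe: "!!n x. f n x = unit_clamp x - ((2 * unit_clamp x - 1) ^ (2 * Suc n + 1) + 1) / (2 * (2 * real (Suc n) + 1))"
  by metis
 define f' where "f' n x = 1 - (2 * unit_clamp x - 1) ^ (2 * Suc n)" for n x
 have f'c: "continuous_on UNIV (f' n)" for n
  unfolding f'_def by (intro continuous_intros continuous_unit_clamp)
 have ab: "\<bar>2 * unit_clamp x - 1\<bar> <= 1" for x using unit_clamp_bounds[of x] by auto
 have pw: "\<bar>(2 * unit_clamp x - 1) ^ k\<bar> <= 1" for x k unfolding power_abs by (rule power_le_one[OF _ ab]) simp
 have f'b: "\<bar>f' n x\<bar> <= 1" for n x
 proof -
  have "0 <= (2 * unit_clamp x - 1) ^ (2 * Suc n)" by (rule zero_le_even_power) simp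
  thus ?thesis unfolding f'_def using pw[of x "2 * Suc n"] by auto
 qed
 have err: "\<bar>f n x - unit_clamp x\<bar> <= 1 / real (Suc n)" for n x
 proof -
  have "\<bar>f n x - unit_clamp x\<bar> = \<bar>(2 * unit_clamp x - 1) ^ (2 * Suc n + 1) + 1\<bar> / (2 * (2 * real (Suc n) + 1))"
   unfolding fe by simp
  also have "\<dots> <= 2 / (2 * (2 * real (Suc n) + 1))"
   by (rule divide_right_mono) (use pw[of x "2 * Suc n + 1"] in auto)
  also have "\<dots> = 1 / (2 * real (Suc n) + 1)" by (simp add: field_simps)
  also have "\<dots> <= 1 / real (Suc n)" by (rule divide_left_mono) auto
  finally show ?thesis .
 qed
 have l: "(%n. 1 / real (Suc n)) \<longlonglongrightarrow> 0" using LIMSEQ_Suc[OF lim_1_over_n] by simp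
 have flim: "(%n. f n x) \<longlonglongrightarrow> unit_clamp x" for x
 proof -
  have "(%n. f n x - unit_clamp x) \<longlonglongrightarrow> 0"
   by (rule Lim_null_comparison[OF _ l]) (use err in auto)
  thus ?thesis by (simp add: LIM_zero_iff)
 qed
 have f'lim: "(%n. f' n x) \<longlonglongrightarrow> indicator {0<..<1} x" for x
 proof (cases "x \<in> {0<..<1}")
  case True
  hence "\<bar>2 * unit_clamp x - 1\<bar> < 1" by (auto simp: unit_clamp_def)
  hence "(2 * unit_clamp x - 1)^2 < 1" by (simp add: abs_square_less_1)
  hence "(%n. ((2 * unit_clamp x - 1)^2) ^ Suc n) \<longlonglongrightarrow> 0"
   by (intro LIMSEQ_Suc LIMSEQ_realpow_zero) auto
  hence "(%n. 1 - ((2 * unit_clamp x - 1)^2) ^ Suc n) \<longlonglongrightarrow> 1 - 0"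
   by (intro tendsto_diff tendsto_const)
  moreover have "f' n x = 1 - ((2 * unit_clamp x - 1)^2) ^ Suc n" for n
   unfolding f'_def power_mult ..
  ultimately show ?thesis using True by simp
 next
  case False
  hence "2 * unit_clamp x - 1 = -1 \<or> 2 * unit_clamp x - 1 = 1" by (auto simp: unit_clamp_def)
  hence "f' n x = 0" for n unfolding f'_def by auto
  thus ?thesis using False by simp
 qed
 have fm[measurable]: "f n \<in> borel_measurable borel" "f' n \<in> borel_measurable borel" for n
  by (auto intro!: borel_measurable_continuous_onI DERIV_continuous_on[OF f] f'c)
 have cm[measurable]: "unit_clamp \<in> borel_measurable borel"
  by (intro borel_measurable_continuous_onI continuous_unit_clamp)
 have "G (%x. unit_clamp (u x)) (%z. indicator {0<..<1} (u (p z)) * w z)"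
 proof (rule G_closed)
  show "G (%x. f n (u x)) (%z. f' n (u (p z)) * w z)" for n
   by (rule G_chain[OF G f[folded f'_def] f'c f'b])
  show "L2conv M (%n x. f n (u x)) (%x. unit_clamp (u x))"
  proof (rule M.L2conv_bounded)
   show "AE x in M. \<bar>f n (u x)\<bar> <= 2" for n
   proof (rule AE_I2)
    fix x
    have "1 / real (Suc n) <= 1" by simp
    thus "\<bar>f n (u x)\<bar> <= 2" using err[of n "u x"] unit_clamp_bounds[of "u x"] by linarith
   qed
  qed (use flim in auto)
  show "L2conv N (%n z. f' n (u (p z)) * w z) (%z. indicator {0<..<1} (u (p z)) * w z)"
   by (rule L2conv_mult_bounded[OF L2conv_const[OF G_L2(2)[OF G]], where K=1])
    (use f'b f'lim in auto)
 qed
 thus ?thesis by (simp add: unit_clamp_def)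
qed

text \<open>Compose an approximating sequence with a cutoff that is the identity up to the bound of
  u. Then f(u) = u and f'(u) = 1 almost everywhere, so the limit pair (u,w) does not change while
  the approximants become uniformly bounded.\<close>

lemma G_bounded_seq:
 assumes G: "G u w" and b: "AE x in M. \<bar>u x\<bar> <= C"
 obtains us K where "!!n. us n \<in> A" "AE x in M. (%n. us n x) \<longlonglongrightarrow> u x" "!!n x. \<bar>us n x\<bar> <= K"
  "L2conv M us u" "L2conv N (%n. D (us n)) w"
proof -
 define C' where "C' = max C 0"
 have C': "0 <= C'" by (simp add: C'_def)
 obtain f f' :: "real => real" where f: "!!x. (f has_real_derivative f' x) (at x)" "continuous_on UNIV f'"
  "!!x. \<bar>f' x\<bar> <= 1" "!!x. \<bar>x\<bar> <= C' ==> f x = x" "!!x. \<bar>x\<bar> <= C' ==> f' x = 1" "!!x. \<bar>f x\<bar> <= C' + 1"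
  using ex_cutoff[OF C'] by metis
 obtain us where us: "!!n. us n \<in> A" "AE x in M. (%n. us n x) \<longlonglongrightarrow> u x"
  "L2conv M (%n x. f (us n x)) (%x. f (u x))"
  "L2conv N (%n. D (%x. f (us n x))) (%z. f' (u (p z)) * w z)" 
  by (rule G_chain_seq[OF G f(1-3)]) (blast intro: that)
 have bu: "AE x in M. \<bar>u x\<bar> <= C'" using b by eventually_elim (simp add: C'_def)
 have fu: "AE x in M. f (u x) = u x" using bu by eventually_elim (rule f(4))
 have fu': "AE z in N. f' (u (p z)) * w z = w z" using AE_p[OF bu] by eventually_elim (simp add: f(5))
 note mm = L2convD(1)[OF us(3)] L2convD(1)[OF us(4)] G_L2[OF G]
 show ?thesis
 proof (rule that[of "%n x. f (us n x)" "C' + 1"])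
  show "(%x. f (us n x)) \<in> A" for n by (rule A_chain[OF us(1) f(1,2)])
  show "AE x in M. (%n. f (us n x)) \<longlonglongrightarrow> u x" using us(2) fu
  proof eventually_elim
   fix x assume a: "(%n. us n x) \<longlonglongrightarrow> u x" "f (u x) = u x"
   have "(%n. f (us n x)) \<longlonglongrightarrow> f (u x)" by (rule isCont_tendsto_compose[OF DERIV_isCont[OF f(1)] a(1)])
   thus "(%n. f (us n x)) \<longlonglongrightarrow> u x" using a(2) by simp
  qed
  show "\<bar>f (us n x)\<bar> <= C' + 1" for n x by (rule f(6))
  show "L2conv M (%n x. f (us n x)) u"
   by (rule L2conv_cong_AE[OF us(3)]) (use fu mm in \<open>auto simp: L2_def\<close>)
  show "L2conv N (%n. D (%x. f (us n x))) w"
   by (rule L2conv_cong_AE[OF us(4)]) (use fu' mm in \<open>auto simp: L2_def\<close>)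
 qed
qed

text \<open>Both factors are approximated by uniformly bounded elements of A, where the product rule
  holds; \<open>L2conv_mult_bounded\<close> then treats the three products.\<close>

lemma G_mult:
 assumes "G u w" "AE x in M. \<bar>u x\<bar> <= C" "G v w'" "AE x in M. \<bar>v x\<bar> <= C'"
 shows "G (%x. u x * v x) (%z. u (p z) * w' z + v (p z) * w z)"
proof -
 obtain us K where us: "!!n. us n \<in> A" "AE x in M. (%n. us n x) \<longlonglongrightarrow> u x" "!!n x. \<bar>us n x\<bar> <= K"
  "L2conv M us u" "L2conv N (%n. D (us n)) w" 
  by (rule G_bounded_seq[OF assms(1,2)]) (blast intro: that)
 obtain vs K' where vs: "!!n. vs n \<in> A" "AE x in M. (%n. vs n x) \<longlonglongrightarrow> v x" "!!n x. \<bar>vs n x\<bar> <= K'"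
  "L2conv M vs v" "L2conv N (%n. D (vs n)) w'" 
  by (rule G_bounded_seq[OF assms(3,4)]) (blast intro: that)
 have m: "us n \<in> borel_measurable M" "vs n \<in> borel_measurable M" "u \<in> borel_measurable M" "v \<in> borel_measurable M" for n
  using L2convD[OF us(4)] L2convD[OF vs(4)] by (auto simp: L2_def)
 note [measurable] = m meas_p[OF m(1)] meas_p[OF m(2)] meas_p[OF m(3)] meas_p[OF m(4)]
 show ?thesis
 proof (rule G_closed)
  show "G (%x. us n x * vs n x) (D (%x. us n x * vs n x))" for n by (rule G_self[OF A_mult[OF us(1) vs(1)]])
  show "L2conv M (%n x. us n x * vs n x) (%x. u x * v x)"
   by (rule L2conv_mult_bounded[OF vs(4)]) (use us in auto)
  have "L2conv N (%n z. us n (p z) * D (vs n) z) (%z. u (p z) * w' z)"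
   by (rule L2conv_mult_bounded[OF vs(5)]) (use us AE_p[OF us(2)] in auto)
  moreover have "L2conv N (%n z. vs n (p z) * D (us n) z) (%z. v (p z) * w z)"
   by (rule L2conv_mult_bounded[OF us(5)]) (use vs AE_p[OF vs(2)] in auto)
  ultimately have L: "L2conv N (%n z. us n (p z) * D (vs n) z + vs n (p z) * D (us n) z) (%z. u (p z) * w' z + v (p z) * w z)"
   by (rule L2conv_add)
  show "L2conv N (%n. D (%x. us n x * vs n x)) (%z. u (p z) * w' z + v (p z) * w z)"
  proof (rule L2conv_cong_AE[OF L])
   show "AE z in N. us n (p z) * D (vs n) z + vs n (p z) * D (us n) z = D (%x. us n x * vs n x) z" for n
    using D_mult[OF us(1)[of n] vs(1)[of n]] by eventually_elim simp
   show "D (%x. us n x * vs n x) \<in> borel_measurable N" for n by (rule D_measurable[OF A_mult[OF us(1) vs(1)]])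
  qed (use L2convD(2)[OF L] in \<open>auto simp: L2_def\<close>)
 qed
qed

theorem dirichlet_form_closure:
 assumes dense: "!!f. L2 M f ==> \<exists>us. (\<forall>n. us n \<in> A) \<and> L2conv M us f"
 shows "dirichlet_form M (cl_dom M A E) (cl_form M A E)"
proof -
 let ?F = "cl_dom M A E" and ?e = "cl_form M A E"
 have ex: "\<exists>w. G u w" if "u \<in> ?F" for u using that unfolding cl_dom_eq by simp
 have memI: "G u w ==> u \<in> ?F" for u w unfolding cl_dom_eq by blast
 have AF: "A \<subseteq> ?F" using memI G_self by blast
 have dns: "\<exists>us. (\<forall>n. us n \<in> ?F) \<and> L2conv M us f" if "L2 M f" for f
  using dense[OF that] AF by blast
 have 1: "L2 M u" if "u \<in> ?F" for u using ex[OF that] G_L2 by blast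
 have 2: "(%x. u x + v x) \<in> ?F" if "u \<in> ?F" "v \<in> ?F" for u v
  using ex[OF that(1)] ex[OF that(2)] G_add memI by blast
 have 3: "(%x. c * u x) \<in> ?F" if "u \<in> ?F" for u c
  using ex[OF that] G_cmult memI by blast
 have 4: "?e u v = ?e v u" if "u \<in> ?F" "v \<in> ?F" for u v
  using ex[OF that(1)] ex[OF that(2)] by (auto simp: cl_form_eq mult.commute)
 have 5: "?e (%x. u x + v x) w = ?e u w + ?e v w" if m: "u \<in> ?F" "v \<in> ?F" "w \<in> ?F" for u v w
 proof -
  obtain a b c where G: "G u a" "G v b" "G w c" using ex[OF m(1)] ex[OF m(2)] ex[OF m(3)] by blast
  show ?thesis unfolding cl_form_eq[OF G_add[OF G(1,2)] G(3)] cl_form_eq[OF G(1,3)] cl_form_eq[OF G(2,3)]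
   using L2_mult_integrable[OF G_L2(2)[OF G(1)] G_L2(2)[OF G(3)]]
    L2_mult_integrable[OF G_L2(2)[OF G(2)] G_L2(2)[OF G(3)]] by (simp add: distrib_right)
 qed
 have 6: "?e (%x. c * u x) w = c * ?e u w" if m: "u \<in> ?F" "w \<in> ?F" for u w c
 proof -
  obtain a b where G: "G u a" "G w b" using ex[OF m(1)] ex[OF m(2)] by blast
  show ?thesis unfolding cl_form_eq[OF G_cmult[OF G(1)] G(2)] cl_form_eq[OF G] by (simp add: mult.assoc)
 qed
 have 7: "?e u u \<ge> 0" if "u \<in> ?F" for u
  using ex[OF that] by (auto simp: cl_form_eq)
 have 8: "(%x. min 1 (max 0 (u x))) \<in> ?F \<and>
   ?e (%x. min 1 (max 0 (u x))) (%x. min 1 (max 0 (u x))) <= ?e u u" if m: "u \<in> ?F" for u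
 proof -
  obtain w where G: "G u w" using ex[OF m] by blast
  note G' = G_unit_contraction[OF G]
  have "(\<integral>z. (indicator {0<..<1} (u (p z)) * w z) * (indicator {0<..<1} (u (p z)) * w z) \<partial>N) <= (\<integral>z. w z * w z \<partial>N)"
   by (rule integral_mono)
    (use G_L2(2)[OF G'] G_L2(2)[OF G] in \<open>auto simp: L2_def power2_eq_square indicator_def\<close>)
  thus ?thesis using memI[OF G'] by (simp add: cl_form_eq[OF G' G'] cl_form_eq[OF G G])
 qed
 show ?thesis unfolding dirichlet_form_def
  by (intro conjI ballI allI impI 2 3 4 5 6 7 dns 8[THEN conjunct1] 8[THEN conjunct2] complete_cl_form) (auto intro: 1)
qed

text \<open>The constant function 1 belongs to the domain and has energy zero.\<close>

lemma recurrent_closure: "recurrent M (cl_dom M A E) (cl_form M A E)"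
 unfolding recurrent_def
proof (intro exI conjI allI)
 show "(%_. 1) \<in> cl_dom M A E" for n :: nat using G_const unfolding cl_dom_eq by blast
qed (auto simp: cl_form_eq[OF G_const G_const])

text \<open>The product rule writes each energy on the right as a sum of two of the three integrals
  of w a b, v a c and u b c. The last two cancel and the first occurs twice.\<close>

theorem square_field:
 assumes G: "G u a" "G v b" "G w c" and L: "Linf M u" "Linf M v" "Linf M w"
 shows "2 * (\<integral>z. w (p z) * (a z * b z) \<partial>N)
  = cl_form M A E u (%x. v x * w x) + cl_form M A E (%x. u x * w x) v - cl_form M A E (%x. u x * v x) w"
proof -
 obtain Cu Cv Cw where C: "AE x in M. \<bar>u x\<bar> <= Cu" "AE x in M. \<bar>v x\<bar> <= Cv" "AE x in M. \<bar>w x\<bar> <= Cw"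
  using L by (auto simp: Linf_def)
 have m: "u \<in> borel_measurable M" "v \<in> borel_measurable M" "w \<in> borel_measurable M"
  using L by (auto simp: Linf_def)
 have i: "integrable N (%z. f (p z) * (g z * h z))"
  if "f \<in> borel_measurable M" "AE x in M. \<bar>f x\<bar> <= K" "L2 N g" "L2 N h" for f g h K
  using L2_mult_integrable[OF L2_mult_bounded(1)[OF that(3) meas_p[OF that(1)] AE_p[OF that(2)]] that(4)]
  by (simp add: mult.assoc)
 note La = G_L2(2)[OF G(1)] and Lb = G_L2(2)[OF G(2)] and Lc = G_L2(2)[OF G(3)]
 have 1: "cl_form M A E u (%x. v x * w x) = (\<integral>z. v (p z) * (a z * c z) \<partial>N) + (\<integral>z. w (p z) * (a z * b z) \<partial>N)"
  unfolding cl_form_eq[OF G(1) G_mult[OF G(2) C(2) G(3) C(3)]]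
  by (subst Bochner_Integration.integral_add[symmetric, OF i[OF m(2) C(2) La Lc] i[OF m(3) C(3) La Lb]])
    (simp add: algebra_simps)
 have 2: "cl_form M A E (%x. u x * w x) v = (\<integral>z. u (p z) * (b z * c z) \<partial>N) + (\<integral>z. w (p z) * (a z * b z) \<partial>N)"
  unfolding cl_form_eq[OF G_mult[OF G(1) C(1) G(3) C(3)] G(2)]
  by (subst Bochner_Integration.integral_add[symmetric, OF i[OF m(1) C(1) Lb Lc] i[OF m(3) C(3) La Lb]])
    (simp add: algebra_simps)
 have 3: "cl_form M A E (%x. u x * v x) w = (\<integral>z. u (p z) * (b z * c z) \<partial>N) + (\<integral>z. v (p z) * (a z * c z) \<partial>N)"
  unfolding cl_form_eq[OF G_mult[OF G(1) C(1) G(2) C(2)] G(3)]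
  by (subst Bochner_Integration.integral_add[symmetric, OF i[OF m(1) C(1) Lb Lc] i[OF m(2) C(2) La Lc]])
    (simp add: algebra_simps)
 show ?thesis unfolding 1 2 3 by simp
qed

end


section \<open>Calculus for functions of class $C^k$ on $\mathbb{R}^m$\<close>

text \<open>For $s=0$ this is the projection onto \<^const>\<open>Rm\<close>; the offset $s$ serves to join two lists of coordinates.\<close>

definition window :: "nat => nat => (nat => real) => nat => real" where
 "window n s x = (%i. if i < n then x (s + i) else 0)"

lemma window_Rm [simp]: "window n s x \<in> Rm n" by (simp add: window_def Rm_def)

lemma window_id: "x \<in> Rm m ==> window m 0 x = x" by (auto simp: window_def Rm_def)

lemma Rm_upd: "x \<in> Rm m ==> i < m ==> x(i := h) \<in> Rm m" by (auto simp: Rm_def)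

text \<open>The metric of the function space is the series of 2^(-n) min(dist, 1) over the
  coordinates; the factor 2 is the sum of the weights.\<close>

lemma dist_Rm_le:
 assumes "x \<in> Rm m" "y \<in> Rm m" "!!i. i < m ==> \<bar>x i - y i\<bar> <= d" "0 <= d"
 shows "dist x y <= 2 * d"
proof -
 have le: "(1/2)^n * min (dist (x (from_nat n)) (y (from_nat n))) 1 <= (1/2)^n * d" for n
 proof -
  have "\<bar>x (from_nat n) - y (from_nat n)\<bar> <= d" using assms by (cases "from_nat n < m") (auto simp: Rm_def)
  thus ?thesis by (intro mult_left_mono) (auto simp: dist_real_def)
 qed
 have s: "summable (%n. (1/2::real)^n * d)" by (intro summable_mult2 summable_geometric) simp
 have "dist x y <= (\<Sum>n. (1/2)^n * d)"
  unfolding dist_fun_def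
  by (intro suminf_le le s summable_comparison_test'[OF s]) (use le in auto)
 also have "\<dots> = 2 * d" 
  using sums_unique[OF sums_mult2[OF geometric_sums[of "1/2::real"], where c=d]] by simp
 finally show ?thesis .
qed

text \<open>Precomposition with the projection onto \<open>Rm m\<close> turns continuity on
  \<open>Rm m\<close> into continuity on the whole function space, so that the general results on
  continuity, compactness and measurability apply.\<close>

lemma cont_Rm_iff: "cont_Rm m V \<longleftrightarrow> continuous_on UNIV (%x. V (window m 0 x))"
proof
 assume V: "cont_Rm m V"
 show "continuous_on UNIV (%x. V (window m 0 x))"
  unfolding continuous_on_eq_continuous_at[OF open_UNIV] continuous_at
 proof (intro ballI tendstoI)
  fix x :: "nat => real" and e :: real assume "e > 0"
  then obtain d where d: "d > 0" "!!y. y \<in> Rm m ==> (\<forall>i<m. \<bar>y i - window m 0 x i\<bar> < d) ==> \<bar>V y - V (window m 0 x)\<bar> < e"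
   using V[unfolded cont_Rm_def, THEN bspec, OF window_Rm[of m 0 x]] by auto
  have "\<forall>\<^sub>F y in at x. \<bar>y i - x i\<bar> < d" for i
  proof -
   have "((%y. y i) \<longlongrightarrow> x i) (at x)"
    using continuous_on_product_coordinates[of i, where ?'b = real, unfolded continuous_on_def] by simp
   from tendstoD[OF this d(1)] show ?thesis by (simp add: dist_real_def)
  qed
  hence "\<forall>\<^sub>F y in at x. \<forall>i\<in>{..<m}. \<bar>y i - x i\<bar> < d" by (intro eventually_ball_finite) auto
  thus "\<forall>\<^sub>F y in at x. dist (V (window m 0 y)) (V (window m 0 x)) < e"
  proof eventually_elim
   fix y assume "\<forall>i\<in>{..<m}. \<bar>y i - x i\<bar> < d"
   thus "dist (V (window m 0 y)) (V (window m 0 x)) < e"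
    using d(2)[OF window_Rm, of 0 y] by (simp add: dist_real_def) (simp add: window_def)
  qed
 qed
next
 assume C: "continuous_on UNIV (%x. V (window m 0 x))"
 show "cont_Rm m V" unfolding cont_Rm_def
 proof (intro ballI allI impI)
  fix x e assume x: "x \<in> Rm m" and e: "(0::real) < e"
  obtain d where d: "d > 0" "!!y. dist y x < d ==> dist (V (window m 0 y)) (V (window m 0 x)) < e"
   using C e unfolding continuous_on_iff by (metis UNIV_I)
  show "\<exists>d>0. \<forall>y\<in>Rm m. (\<forall>i<m. \<bar>y i - x i\<bar> < d) \<longrightarrow> \<bar>V y - V x\<bar> < e"
  \<comment> \<open>By \<open>dist_Rm_le\<close> coordinatewise distance below d/3 means distance at
    most 2d/3, which is less than d.\<close>
  proof (intro exI[of _ "d/3"] conjI ballI impI)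
   fix y assume y: "y \<in> Rm m" "\<forall>i<m. \<bar>y i - x i\<bar> < d/3"
   have "dist y x <= 2 * (d/3)" by (rule dist_Rm_le[OF y(1) x]) (use y d in \<open>auto intro: less_imp_le\<close>)
   with d(1) have "dist y x < d" by simp
   from d(2)[OF this] show "\<bar>V y - V x\<bar> < e" using x y by (simp add: window_id dist_real_def)
  qed (use d in simp)
 qed
qed

lemma continuous_on_window: "continuous_on A (window n s)"
proof (rule continuous_on_coordinatewise_then_product)
 fix i show "continuous_on A (%x. window n s x i)"
  unfolding window_def by (cases "i < n") (auto intro: continuous_on_subset[OF continuous_on_product_coordinates])
qed

lemma cont_Rm_compose_window:
 assumes "cont_Rm n V" "s + n <= m" shows "cont_Rm m (%x. V (window n s x))"
proof -
 have "continuous_on UNIV (%x. V (window n 0 x))" using assms(1) by (simp add: cont_Rm_iff)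
 hence "continuous_on UNIV (%x. V (window n 0 (window n s (window m 0 x))))"
  by (rule continuous_on_compose2) (auto intro: continuous_on_compose2[OF continuous_on_window continuous_on_window])
 thus ?thesis by (simp add: cont_Rm_iff window_id)
qed

definition Rm_box :: "nat => real => (nat => real) set" where
 "Rm_box m R = {x \<in> Rm m. \<forall>i<m. \<bar>x i\<bar> <= R}"

lemma compact_Rm_box: "compact (Rm_box m R)"
proof -
 have "Rm_box m R = PiE UNIV (%i. if i < m then {-R..R} else {0})"
  by (auto simp: Rm_box_def Rm_def PiE_iff abs_le_iff split: if_splits) (meson not_less minus_le_iff)+
 moreover have "compactin (product_topology (%i::nat. euclidean) UNIV) (PiE UNIV (%i. if i < m then {-R..R} else {0::real}))"
  unfolding compactin_PiE by auto
 ultimately show ?thesis by (simp add: euclidean_product_topology)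
qed

lemma cont_Rm_uniform:
 assumes "cont_Rm m V" "e > 0"
 obtains d where "d > 0" "!!x y. x \<in> Rm_box m R ==> y \<in> Rm_box m R ==> (!!i. i < m ==> \<bar>x i - y i\<bar> < d) ==> \<bar>V x - V y\<bar> < e"
proof -
 have "continuous_on (Rm_box m R) (%x. V (window m 0 x))"
  using assms(1) by (auto simp: cont_Rm_iff intro: continuous_on_subset)
 hence "uniformly_continuous_on (Rm_box m R) (%x. V (window m 0 x))"
  by (rule compact_uniformly_continuous[OF _ compact_Rm_box])
 then obtain d where d: "d > 0" "!!x y. x \<in> Rm_box m R ==> y \<in> Rm_box m R ==> dist y x < d ==> dist (V (window m 0 y)) (V (window m 0 x)) < e"
  using assms(2) unfolding uniformly_continuous_on_def by meson
 show ?thesis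
 proof (rule that[of "d/3"])
  fix x y assume xy: "x \<in> Rm_box m R" "y \<in> Rm_box m R" "!!i. i < m ==> \<bar>x i - y i\<bar> < d/3"
  have R: "x \<in> Rm m" "y \<in> Rm m" using xy by (auto simp: Rm_box_def)
  have "dist x y <= 2 * (d/3)" by (rule dist_Rm_le[OF R]) (use xy(3) d in \<open>auto intro: less_imp_le\<close>)
  with d(1) have "dist x y < d" by simp
  from d(2)[OF xy(2,1) this] show "\<bar>V x - V y\<bar> < e" using R by (simp add: window_id dist_real_def)
 qed (use d in simp)
qed

lemma cont_Rm_bounded:
 assumes "cont_Rm m V" obtains C where "!!x. x \<in> Rm_box m R ==> \<bar>V x\<bar> <= C"
proof -
 have "continuous_on (Rm_box m R) (%x. V (window m 0 x))"
  using assms(1) by (auto simp: cont_Rm_iff intro: continuous_on_subset)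
 hence "bounded ((%x. V (window m 0 x)) ` Rm_box m R)" by (intro compact_imp_bounded compact_continuous_image compact_Rm_box)
 then obtain C where "\<forall>x\<in>Rm_box m R. \<bar>V (window m 0 x)\<bar> <= C" by (auto simp: bounded_iff)
 thus ?thesis using that by (auto simp: Rm_box_def window_id)
qed

lemma CkRm_cont: "CkRm m k V ==> cont_Rm m V" by (cases k) auto

lemma pd_cong:
 assumes "!!x. x \<in> Rm m ==> V x = W x" "i < m" "x \<in> Rm m" shows "pd i V x = pd i W x"
 unfolding pd_def using assms by (simp add: Rm_upd)

lemma CkRm_cong:
 assumes "!!x. x \<in> Rm m ==> V x = W x" "CkRm m k V" shows "CkRm m k W"
 using assms
proof (induction k arbitrary: V W)
 case 0 thus ?case by (auto simp: cont_Rm_def)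
next
 case (Suc k)
 have "cont_Rm m W" using Suc.prems by (auto simp: cont_Rm_def)
 moreover have "(%h. W (x(i := h))) differentiable (at (x i))" if "i < m" "x \<in> Rm m" for i x
 proof -
  have "(%h. W (x(i := h))) = (%h. V (x(i := h)))" by (rule ext, rule Suc.prems(1)[OF Rm_upd[OF that(2,1)], symmetric])
  thus ?thesis using Suc.prems(2) that by simp
 qed
 moreover have "CkRm m k (pd i W)" if "i < m" for i
  by (rule Suc.IH[of "pd i V"]) (use Suc.prems that pd_cong[of m V W] in auto)
 ultimately show ?case by simp
qed

text \<open>Inductions on k can thus work with an explicit formula V' for the partial derivatives,
  which \<open>CkRm_cong\<close> identifies with \<open>pd\<close> on \<open>Rm m\<close>.\<close>

lemma CkRm_SucI:
 assumes "cont_Rm m V"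
  and "!!i x. i < m ==> x \<in> Rm m ==> ((%h. V (x(i := h))) has_real_derivative V' i x) (at (x i))"
  and "!!i. i < m ==> CkRm m k (V' i)"
 shows "CkRm m (Suc k) V"
proof -
 have "CkRm m k (pd i V)" if "i < m" for i
  by (rule CkRm_cong[OF _ assms(3)[OF that]]) (simp add: pd_def DERIV_imp_deriv[OF assms(2)[OF that]])
 thus ?thesis using assms(1,2) by (auto simp: real_differentiable_def)
qed

lemma CkRm_SucD: "CkRm m (Suc k) V ==> CkRm m k V"
 by (induction k arbitrary: V) auto

lemma CkRm_pd: "CkRm m (Suc k) V ==> i < m ==> CkRm m k (pd i V)" by simp

lemma CkRm_has_derivative:
 assumes "CkRm m (Suc k) V" "i < m" "x \<in> Rm m"
 shows "((%h. V (x(i := h))) has_real_derivative pd i V (x(i := a))) (at a)"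
proof -
 have "(%h. V ((x(i := a))(i := h))) differentiable (at ((x(i := a)) i))"
  using assms Rm_upd[OF assms(3,2), of a] by (simp only: CkRm.simps)
 thus ?thesis unfolding pd_def by (simp add: DERIV_deriv_iff_real_differentiable)
qed

lemmas CkRm_has_derivative_self = CkRm_has_derivative[where a="x i" and x=x and i=i for x i, simplified fun_upd_triv]

lemma pd_eqI: "((%h. V (x(i := h))) has_real_derivative d) (at (x i)) ==> pd i V x = d"
 unfolding pd_def by (rule DERIV_imp_deriv)

lemma CkRm_const: "CkRm m k (%_. c)"
proof (induction k arbitrary: c)
 case 0 show ?case by (auto simp: cont_Rm_def intro: exI[of _ 1])
next
 case (Suc k) show ?case
  by (rule CkRm_SucI[where V'="%_ _. 0"]) (use Suc in \<open>auto simp: cont_Rm_def intro: exI[of _ 1]\<close>)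
qed

lemma CkRm_coord: assumes "j < m" shows "CkRm m k (%x. x j)"
proof -
 have c: "cont_Rm m (%x. x j)" using assms by (auto simp: cont_Rm_def)
 show ?thesis
 proof (cases k)
  case (Suc k')
  have "CkRm m (Suc k') (%x. x j)"
  proof (rule CkRm_SucI[OF c])
   fix i x show "((%h. (x(i := h)) j) has_real_derivative (if i = j then 1 else 0)) (at (x i))"
    by (auto intro!: derivative_eq_intros)
  qed (rule CkRm_const)
  thus ?thesis using Suc by simp
 qed (use c in simp)
qed

lemma cont_Rm_add: "cont_Rm m V ==> cont_Rm m W ==> cont_Rm m (%x. V x + W x)"
 unfolding cont_Rm_iff by (rule continuous_on_add)

lemma cont_Rm_mult: "cont_Rm m V ==> cont_Rm m W ==> cont_Rm m (%x. V x * W x)"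
 unfolding cont_Rm_iff by (rule continuous_on_mult)

lemma CkRm_add: "CkRm m k V ==> CkRm m k W ==> CkRm m k (%x. V x + W x)"
proof (induction k arbitrary: V W)
 case 0 thus ?case by (auto intro: cont_Rm_add)
next
 case (Suc k)
 show ?case
 proof (rule CkRm_SucI)
  show "cont_Rm m (%x. V x + W x)" using Suc.prems by (intro cont_Rm_add) auto
  show "CkRm m k (%x. pd i V x + pd i W x)" if "i < m" for i using Suc that by auto
 qed (intro DERIV_add CkRm_has_derivative_self[OF Suc.prems(1)] CkRm_has_derivative_self[OF Suc.prems(2)])
qed

lemma CkRm_mult: "CkRm m k V ==> CkRm m k W ==> CkRm m k (%x. V x * W x)"
proof (induction k arbitrary: V W)
 case 0 thus ?case by (auto intro: cont_Rm_mult)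
next
 case (Suc k)
 show ?case
 proof (rule CkRm_SucI)
  show "cont_Rm m (%x. V x * W x)" using Suc.prems by (intro cont_Rm_mult) auto
  show "CkRm m k (%x. pd i V x * W x + pd i W x * V x)" if "i < m" for i
   using that CkRm_SucD[OF Suc.prems(1)] CkRm_SucD[OF Suc.prems(2)] CkRm_pd[OF Suc.prems(1)] CkRm_pd[OF Suc.prems(2)]
   by (intro CkRm_add Suc.IH) auto
  fix i x assume "i < m" "x \<in> Rm m"
  from DERIV_mult[OF CkRm_has_derivative_self[OF Suc.prems(1) this] CkRm_has_derivative_self[OF Suc.prems(2) this]]
  show "((%h. V (x(i := h)) * W (x(i := h))) has_real_derivative pd i V x * W x + pd i W x * V x) (at (x i))"
   by (simp only: fun_upd_triv)
 qed
qed

lemma CkRm_diff: "CkRm m k V ==> CkRm m k W ==> CkRm m k (%x. V x - W x)"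
 using CkRm_add[of m k V "%x. (-1) * W x"] CkRm_mult[OF CkRm_const[of m k "-1"], of W] by simp

lemma CkRm_sum: "(!!j. j \<in> J ==> CkRm m k (V j)) ==> CkRm m k (%x. \<Sum>j\<in>J. V j x)"
 by (induction J rule: infinite_finite_induct) (auto intro: CkRm_const CkRm_add simp del: CkRm.simps)

lemma CkRm_power: "CkRm m k V ==> CkRm m k (%x. V x ^ n)"
 by (induction n) (auto intro: CkRm_const CkRm_mult simp del: CkRm.simps)

lemma window_upd:
 "window n s (x(i := h)) = (if s <= i \<and> i < s + n then (window n s x)(i - s := h) else window n s x)"
 by (auto simp: window_def fun_eq_iff)

lemma pd_window:
 assumes "CkRm n (Suc k) V" "i < m"
 shows "((%h. V (window n s (x(i := h)))) has_real_derivative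
   (if s <= i \<and> i < s + n then pd (i - s) V (window n s x) else 0)) (at (x i))"
proof (cases "s <= i \<and> i < s + n")
 case True
 hence "x i = window n s x (i - s)" by (auto simp: window_def)
 moreover have "i - s < n" using True by auto
 ultimately show ?thesis using CkRm_has_derivative_self[OF assms(1) _ window_Rm, of "i - s" s x] True
  by (simp add: window_upd del: fun_upd_apply)
qed (auto simp: window_upd)

lemma CkRm_window:
 "CkRm n k V ==> s + n <= m ==> CkRm m k (%x. V (window n s x))"
proof (induction k arbitrary: V)
 case 0 thus ?case by (auto intro: cont_Rm_compose_window)
next
 case (Suc k)
 show ?case
 proof (rule CkRm_SucI)
  show "cont_Rm m (%x. V (window n s x))" using Suc.prems by (intro cont_Rm_compose_window) auto
  show "((%h. V (window n s (x(i := h)))) has_real_derivative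
   (if s <= i \<and> i < s + n then pd (i - s) V (window n s x) else 0)) (at (x i))" if "i < m" for i x
   by (rule pd_window[OF Suc.prems(1) that])
  show "CkRm m k (%x. if s <= i \<and> i < s + n then pd (i - s) V (window n s x) else 0)" if "i < m" for i
   by (cases "s <= i \<and> i < s + n") (use Suc in \<open>auto intro: CkRm_const\<close>)
 qed
qed

lemma C1_chain_1d:
 assumes "CkRm m 1 V" "!!x. (f has_real_derivative f' x) (at x)" "continuous_on UNIV f'"
 shows "CkRm m 1 (%x. f (V x))"
  and "i < m ==> x \<in> Rm m ==> pd i (%x. f (V x)) x = f' (V x) * pd i V x"
proof -
 have V: "CkRm m (Suc 0) V" using assms by simp
 have d: "((%h. f (V (x(i := h)))) has_real_derivative f' (V x) * pd i V x) (at (x i))" if "i < m" "x \<in> Rm m" for i x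
  using DERIV_chain2[OF assms(2) CkRm_has_derivative_self[OF V that]] by simp
 show "pd i (%x. f (V x)) x = f' (V x) * pd i V x" if "i < m" "x \<in> Rm m" by (rule pd_eqI[OF d[OF that]])
 have c: "continuous_on UNIV f" by (rule DERIV_continuous_on) (use assms(2) in auto)
 have "CkRm m (Suc 0) (%x. f (V x))"
 proof (rule CkRm_SucI[OF _ d])
  show "cont_Rm m (%x. f (V x))" using continuous_on_compose2[OF c, of UNIV "%x. V (window m 0 x)"] CkRm_cont[OF V]
   by (simp add: cont_Rm_iff)
  fix i assume i: "i < m"
  have "cont_Rm m (%x. f' (V x))" using continuous_on_compose2[OF assms(3), of UNIV "%x. V (window m 0 x)"] CkRm_cont[OF V]
   by (simp add: cont_Rm_iff)
  thus "CkRm m 0 (%x. f' (V x) * pd i V x)" using CkRm_pd[OF V i] by (auto intro: cont_Rm_mult)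
 qed
 thus "CkRm m 1 (%x. f (V x))" by simp
qed

section \<open>Mean value formulas in several variables\<close>

lemma MVT_segment:
 fixes f :: "real => real"
 assumes "!!x. (f has_real_derivative f' x) (at x)"
 shows "\<exists>t\<in>closed_segment a b. f b - f a = f' t * (b - a)"
proof (cases a b rule: linorder_cases)
 case less
 from MVT2[OF less assms] obtain z where "a < z" "z < b" "f b - f a = (b - a) * f' z" by auto
 thus ?thesis by (intro bexI[of _ z]) (auto simp: closed_segment_eq_real_ivl)
next
 case greater
 from MVT2[OF greater assms] obtain z where "b < z" "z < a" "f a - f b = (a - b) * f' z" by auto
 thus ?thesis by (intro bexI[of _ z]) (auto simp: closed_segment_eq_real_ivl algebra_simps)
qed auto

text \<open>Change the coordinates from z to z' one after the other and apply the mean value theorem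
  to each change. The intermediate points differ from coordinate to coordinate, but all lie in the
  box spanned by z and z'; only partial derivatives enter, no total derivative.\<close>

lemma C1_telescope:
 assumes U: "CkRm m (Suc 0) U" and z: "z \<in> Rm m" "z' \<in> Rm m"
 shows "\<exists>\<xi>. (\<forall>i<m. \<xi> i \<in> Rm m \<and> (\<forall>j. \<xi> i j \<in> closed_segment (z j) (z' j))) \<and>
  U z' - U z = (\<Sum>i<m. pd i U (\<xi> i) * (z' i - z i))"
proof -
 define w where "w j = (%i. if i < j then z' i else z i)" for j :: nat
 have w: "w 0 = z" "w m = z'" "w j \<in> Rm m" for j using z by (auto simp: w_def Rm_def)
 have "\<exists>t\<in>closed_segment (z i) (z' i). U (w (Suc i)) - U (w i) = pd i U ((w i)(i := t)) * (z' i - z i)" if "i < m" for i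
 proof -
  have "w (Suc i) = (w i)(i := z' i)" "w i = (w i)(i := z i)" by (auto simp: w_def)
  thus ?thesis using MVT_segment[OF CkRm_has_derivative[OF U that w(3)], of "z i" "z' i" i] by simp
 qed
 then obtain t where t: "!!i. i < m ==> t i \<in> closed_segment (z i) (z' i)"
  "!!i. i < m ==> U (w (Suc i)) - U (w i) = pd i U ((w i)(i := t i)) * (z' i - z i)" by metis
 have "U z' - U z = (\<Sum>i<m. U (w (Suc i)) - U (w i))" using sum_lessThan_telescope[of "%j. U (w j)" m] by (simp add: w)
 also have "\<dots> = (\<Sum>i<m. pd i U ((w i)(i := t i)) * (z' i - z i))" by (intro sum.cong) (auto simp: t)
 finally have eq: "U z' - U z = (\<Sum>i<m. pd i U ((w i)(i := t i)) * (z' i - z i))" .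
 have "(w i)(i := t i) \<in> Rm m \<and> (\<forall>j. ((w i)(i := t i)) j \<in> closed_segment (z j) (z' j))" if "i < m" for i
  using that t(1)[OF that] w(3) by (auto simp: Rm_upd) (auto simp: w_def)
 thus ?thesis using eq by (intro exI[of _ "%i. (w i)(i := t i)"]) simp
qed

lemma C1_Lipschitz:
 assumes U: "CkRm m (Suc 0) U"
 obtains K where "0 <= K" "!!z z'. z \<in> Rm_box m R ==> z' \<in> Rm_box m R ==> \<bar>U z' - U z\<bar> <= K * (\<Sum>i<m. \<bar>z' i - z i\<bar>)"
proof -
 have "\<exists>C. \<forall>x\<in>Rm_box m R. \<bar>pd i U x\<bar> <= C" if "i < m" for i
  by (rule cont_Rm_bounded[OF CkRm_cont[OF CkRm_pd[OF U that]]]) blast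
 then obtain C where C: "!!i x. i < m ==> x \<in> Rm_box m R ==> \<bar>pd i U x\<bar> <= C i" by metis
 define K where "K = (\<Sum>i<m. \<bar>C i\<bar>)"
 have CK: "\<bar>pd i U x\<bar> <= K" if "i < m" "x \<in> Rm_box m R" for i x
 proof -
  have "\<bar>C i\<bar> <= K" unfolding K_def by (rule member_le_sum) (use that in auto)
  thus ?thesis using C[OF that] by simp
 qed
 show ?thesis
 proof (rule that[of K])
  show "0 <= K" unfolding K_def by (simp add: sum_nonneg)
  fix z z' assume zz: "z \<in> Rm_box m R" "z' \<in> Rm_box m R"
  then obtain \<xi> where \<xi>: "!!i. i < m ==> \<xi> i \<in> Rm m" "!!i j. i < m ==> \<xi> i j \<in> closed_segment (z j) (z' j)"
   "U z' - U z = (\<Sum>i<m. pd i U (\<xi> i) * (z' i - z i))"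
   using C1_telescope[OF U, of z z'] unfolding Rm_box_def by blast
  have b: "\<xi> i \<in> Rm_box m R" if "i < m" for i
  proof -
   have "\<bar>\<xi> i j\<bar> <= R" if j: "j < m" for j
   proof -
    have "\<bar>z j\<bar> <= R" "\<bar>z' j\<bar> <= R" using zz j by (auto simp: Rm_box_def)
    thus ?thesis using \<xi>(2)[OF \<open>i < m\<close>, of j] by (auto simp: closed_segment_eq_real_ivl split: if_splits)
   qed
   thus ?thesis using \<xi>(1)[OF that] by (simp add: Rm_box_def)
  qed
  have "\<bar>U z' - U z\<bar> <= (\<Sum>i<m. \<bar>pd i U (\<xi> i)\<bar> * \<bar>z' i - z i\<bar>)"
   unfolding \<xi>(3) using sum_abs[of "%i. pd i U (\<xi> i) * (z' i - z i)" "{..<m}"] by (simp add: abs_mult)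
  also have "\<dots> <= (\<Sum>i<m. K * \<bar>z' i - z i\<bar>)"
   by (intro sum_mono mult_right_mono CK b) auto
  finally show "\<bar>U z' - U z\<bar> <= K * (\<Sum>i<m. \<bar>z' i - z i\<bar>)" by (simp add: sum_distrib_left)
 qed
qed

text \<open>In the formula of \<open>C1_telescope\<close> between c t0 and c t the intermediate
  points are squeezed towards c t0, so continuity of the partial derivatives gives the limit of the
  difference quotient.\<close>

lemma C1_chain_curve:
 assumes U: "CkRm m (Suc 0) U" and c: "!!t. c t \<in> Rm m"
  and d: "!!i. i < m ==> ((%t. c t i) has_real_derivative d i) (at t0)"
 shows "((%t. U (c t)) has_real_derivative (\<Sum>i<m. pd i U (c t0) * d i)) (at t0)"
proof -
 have "\<exists>\<xi>. (\<forall>i<m. \<xi> i \<in> Rm m \<and> (\<forall>j. \<xi> i j \<in> closed_segment (c t0 j) (c t j))) \<and>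
  U (c t) - U (c t0) = (\<Sum>i<m. pd i U (\<xi> i) * (c t i - c t0 i))" for t
  by (rule C1_telescope[OF U c c])
 then obtain \<xi> where \<xi>: "!!t i. i < m ==> \<xi> t i \<in> Rm m" "!!t i j. i < m ==> \<xi> t i j \<in> closed_segment (c t0 j) (c t j)"
  "!!t. U (c t) - U (c t0) = (\<Sum>i<m. pd i U (\<xi> t i) * (c t i - c t0 i))"
  using choice[of "%t \<xi>. (\<forall>i<m. \<xi> i \<in> Rm m \<and> (\<forall>j. \<xi> i j \<in> closed_segment (c t0 j) (c t j))) \<and>
   U (c t) - U (c t0) = (\<Sum>i<m. pd i U (\<xi> i) * (c t i - c t0 i))"] by blast
 have lim: "((%t. pd i U (\<xi> t i)) \<longlongrightarrow> pd i U (c t0)) (at t0)" if i: "i < m" for i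
 proof (rule tendstoI)
  fix e :: real assume "e > 0"
  then obtain \<delta> where \<delta>: "\<delta> > 0" "!!y. y \<in> Rm m ==> (\<forall>j<m. \<bar>y j - c t0 j\<bar> < \<delta>) ==> \<bar>pd i U y - pd i U (c t0)\<bar> < e"
   using CkRm_cont[OF CkRm_pd[OF U i], unfolded cont_Rm_def, THEN bspec, OF c[of t0]] by auto
  have "\<forall>\<^sub>F t in at t0. \<forall>j\<in>{..<m}. \<bar>c t j - c t0 j\<bar> < \<delta>"
  proof (intro eventually_ball_finite ballI)
   fix j assume "j \<in> {..<m}"
   hence "((%t. c t j) \<longlongrightarrow> c t0 j) (at t0)" using DERIV_isCont[OF d] by (simp add: isCont_def)
   from tendstoD[OF this \<delta>(1)] show "\<forall>\<^sub>F t in at t0. \<bar>c t j - c t0 j\<bar> < \<delta>" by (simp add: dist_real_def)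
  qed simp
  thus "\<forall>\<^sub>F t in at t0. dist (pd i U (\<xi> t i)) (pd i U (c t0)) < e"
  proof eventually_elim
   fix t assume a: "\<forall>j\<in>{..<m}. \<bar>c t j - c t0 j\<bar> < \<delta>"
   have "\<bar>\<xi> t i j - c t0 j\<bar> < \<delta>" if "j < m" for j
    using \<xi>(2)[OF i, of t j] a that by (force simp: closed_segment_eq_real_ivl split: if_splits)
   thus "dist (pd i U (\<xi> t i)) (pd i U (c t0)) < e" using \<delta>(2)[OF \<xi>(1)[OF i]] by (simp add: dist_real_def)
  qed
 qed
 have "((%t. \<Sum>i<m. pd i U (\<xi> t i) * ((c t i - c t0 i) / (t - t0))) \<longlongrightarrow> (\<Sum>i<m. pd i U (c t0) * d i)) (at t0)"
  by (intro tendsto_sum tendsto_mult lim) (use d in \<open>auto simp: has_field_derivative_iff\<close>)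
 moreover have "(\<Sum>i<m. pd i U (\<xi> t i) * ((c t i - c t0 i) / (t - t0))) = (U (c t) - U (c t0)) / (t - t0)" for t
  unfolding \<xi>(3) by (simp add: sum_divide_distrib)
 ultimately show ?thesis by (simp add: has_field_derivative_iff)
qed


section \<open>Approximation of $C^1$ functions by polynomials\<close>

lemma Bernstein_has_derivative:
 "(Bernstein (Suc n) k has_real_derivative
   real (Suc n) * ((if k = 0 then 0 else Bernstein n (k - 1) x) - Bernstein n k x)) (at x)"
proof -
 have d: "(Bernstein (Suc n) k has_real_derivative
   of_nat (Suc n choose k) * (of_nat k * x ^ (k - 1) * (1 - x) ^ (Suc n - k)
    - of_nat (Suc n - k) * x ^ k * (1 - x) ^ (Suc n - k - 1))) (at x)"
  unfolding Bernstein_def[abs_def]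
  by (rule derivative_eq_intros refl | simp)+ (simp add: algebra_simps)
 consider "k = 0" | j where "k = Suc j" "j <= n" | "k > Suc n" by (cases k; cases "k <= Suc n") auto
 thus ?thesis
 proof cases
  case 1 thus ?thesis using d by (simp add: Bernstein_def)
 next
  case 2
  have a: "real (Suc n choose k) * real k = real (Suc n) * real (n choose j)"
   using Suc_times_binomial[of j n] 2 by (simp only: of_nat_mult[symmetric] mult.commute)
  have b: "real (Suc n choose k) * real (Suc n - k) = real (Suc n) * real (n choose k)"
  proof (cases "k <= n")
   case True
   have "(Suc n - k) * (Suc n choose k) = Suc n * (n choose k)"
    using binomial_absorb_comp[of "Suc n" k] by simp
   thus ?thesis by (simp only: of_nat_mult[symmetric] mult.commute)
  next
   case False thus ?thesis using 2 by simp
  qed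
  have "of_nat (Suc n choose k) * (of_nat k * x ^ (k - 1) * (1 - x) ^ (Suc n - k)
    - of_nat (Suc n - k) * x ^ k * (1 - x) ^ (Suc n - k - 1))
   = (real (Suc n choose k) * real k) * (x ^ j * (1 - x) ^ (n - j))
    - (real (Suc n choose k) * real (Suc n - k)) * (x ^ k * (1 - x) ^ (n - k))"
   using 2 by (simp add: algebra_simps)
  also have "\<dots> = real (Suc n) * (Bernstein n j x - Bernstein n k x)"
   unfolding a b by (simp add: Bernstein_def algebra_simps)
  finally show ?thesis using d 2 by simp
 next
  case 3
  hence z: "n choose (k - 1) = 0" "n choose k = 0" "Suc n choose k = 0" by (auto intro: binomial_eq_0)
  show ?thesis using d unfolding Bernstein_def z by simp
 qed
qed

text \<open>Summation by parts: the derivative of a Bernstein polynomial of degree n+1 is a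
  Bernstein sum of degree n over scaled differences of its coefficients.\<close>

lemma sum_Bernstein_derivative:
 "(\<Sum>k\<le>Suc n. a k * (real (Suc n) * ((if k = 0 then 0 else Bernstein n (k - 1) x) - Bernstein n k x)))
  = real (Suc n) * (\<Sum>k\<le>n. (a (Suc k) - a k) * Bernstein n k x)"
proof -
 have "(\<Sum>k\<le>Suc n. a k * (if k = 0 then 0 else Bernstein n (k - 1) x)) = (\<Sum>k\<le>n. a (Suc k) * Bernstein n k x)"
  by (subst sum.atMost_Suc_shift) simp
 moreover have "(\<Sum>k\<le>Suc n. a k * Bernstein n k x) = (\<Sum>k\<le>n. a k * Bernstein n k x)"
  by (simp add: Bernstein_def)
 moreover have "(\<Sum>k\<le>Suc n. a k * (real (Suc n) * ((if k = 0 then 0 else Bernstein n (k - 1) x) - Bernstein n k x)))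
  = real (Suc n) * ((\<Sum>k\<le>Suc n. a k * (if k = 0 then 0 else Bernstein n (k - 1) x)) - (\<Sum>k\<le>Suc n. a k * Bernstein n k x))"
  unfolding sum_subtractf[symmetric] sum_distrib_left by (intro sum.cong) (auto simp: algebra_simps)
 ultimately show ?thesis by (simp only: sum_subtractf left_diff_distrib)
qed

text \<open>The left side is the variance y(1-y)/n of a binomial frequency.\<close>

lemma sum_Bernstein_variance:
 assumes "n \<ge> 1" "0 <= y" "y <= 1"
 shows "(\<Sum>k\<le>n. (real k / real n - y)^2 * Bernstein n k y) <= 1 / real n"
proof -
 have eq: "(real k / real n - y)^2 = (1 / real n)^2 * (real k * (real k - 1)) + (1 / real n^2 - 2 * y / real n) * real k + y^2" for k
  using assms by (simp add: field_simps power2_eq_square)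
 hence "(\<Sum>k\<le>n. (real k / real n - y)^2 * Bernstein n k y)
  = (\<Sum>k\<le>n. (1 / real n)^2 * (real k * (real k - 1) * Bernstein n k y)
    + (1 / real n^2 - 2 * y / real n) * (real k * Bernstein n k y) + y^2 * Bernstein n k y)"
  by (intro sum.cong refl) (simp only: eq, simp add: algebra_simps)
 also have "\<dots> = (1 / real n)^2 * (real n * (real n - 1) * y^2) + (1 / real n^2 - 2 * y / real n) * (real n * y) + y^2 * 1"
  unfolding sum.distrib sum_distrib_left[symmetric] by simp
 also have "\<dots> = y * (1 - y) / real n"
  using assms by (simp add: field_simps power2_eq_square)
 also have "\<dots> <= 1 / real n"
 proof (rule divide_right_mono)
  have "y * (1 - y) <= 1 * 1" using assms by (intro mult_mono) auto
  thus "y * (1 - y) <= 1" by simp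
 qed simp
 finally show ?thesis .
qed

text \<open>Chebyshev's argument: away from x the difference is at most 2M, hence at most 2M (\<tau>
  - x)^2 / \<delta>^2. The nodes may deviate from the uniform grid by one mesh width, because for
  derivatives they will be intermediate points of the mean value theorem. Of the constant 32, one
  half pays for this deviation and the other for the variance.\<close>

lemma Bernstein_estimate:
 fixes F :: "real => real"
 assumes n: "n \<ge> 1" and R: "R > 0" and x: "\<bar>x\<bar> <= R"
  and M: "!!t. \<bar>t\<bar> <= R ==> \<bar>F t\<bar> <= M" and unif: "!!t. \<bar>t\<bar> <= R ==> \<bar>t - x\<bar> < \<delta> ==> \<bar>F t - F x\<bar> <= \<eta>"
  and \<delta>: "\<delta> > 0" and \<eta>: "\<eta> \<ge> 0"
  and \<tau>: "!!k. k <= n ==> \<bar>\<tau> k\<bar> <= R" "!!k. k <= n ==> \<bar>\<tau> k - (2 * R * (real k / real n) - R)\<bar> <= 2 * R / real n"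
 shows "\<bar>(\<Sum>k\<le>n. F (\<tau> k) * Bernstein n k ((x + R) / (2 * R))) - F x\<bar> <= \<eta> + 32 * M * R^2 / (\<delta>^2 * real n)"
proof -
 define y where "y = (x + R) / (2 * R)"
 have y: "0 <= y" "y <= 1" using x R by (auto simp: y_def field_simps)
 have xy: "x = 2 * R * y - R" using R by (simp add: y_def field_simps)
 note B0 = Bernstein_nonneg[OF y]
 have M0: "0 <= M" using M[OF x] by linarith
 have dev: "(\<tau> k - x)^2 <= 8 * R^2 / real n^2 + 8 * R^2 * (real k / real n - y)^2" if "k <= n" for k
 proof -
  define c where "c = \<tau> k - (2 * R * (real k / real n) - R)"
  define d where "d = 2 * R * (real k / real n - y)"
  have e: "\<tau> k - x = c + d" by (simp add: c_def d_def xy algebra_simps)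
  have "c^2 <= (2 * R / real n)^2" using \<tau>(2)[OF that] R by (simp add: c_def abs_le_square_iff[symmetric])
  moreover have "0 <= (c - d)^2" by simp
  ultimately show ?thesis unfolding e
   by (simp add: d_def power2_sum power2_diff power_mult_distrib power_divide)
 qed
 have dif: "\<bar>F (\<tau> k) - F x\<bar> <= \<eta> + 2 * M / \<delta>^2 * (\<tau> k - x)^2" if "k <= n" for k
 proof (cases "\<bar>\<tau> k - x\<bar> < \<delta>")
  case True
  have "0 <= 2 * M / \<delta>^2 * (\<tau> k - x)^2" using M0 by simp
  thus ?thesis using unif[OF \<tau>(1)[OF that] True] by linarith
 next
  case False
  hence "\<delta>^2 <= (\<tau> k - x)^2" using \<delta> abs_le_square_iff[of \<delta> "\<tau> k - x"] by simp
  hence "1 <= (\<tau> k - x)^2 / \<delta>^2" using \<delta> by (simp add: field_simps)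
  hence "2 * M * 1 <= 2 * M * ((\<tau> k - x)^2 / \<delta>^2)" using M0 by (intro mult_left_mono) auto
  thus ?thesis using M[OF \<tau>(1)[OF that]] M[OF x] \<eta> by (simp add: abs_le_iff)
 qed
 have "(\<Sum>k\<le>n. F (\<tau> k) * Bernstein n k y) - F x = (\<Sum>k\<le>n. (F (\<tau> k) - F x) * Bernstein n k y)"
  by (simp add: left_diff_distrib sum_subtractf sum_distrib_left[symmetric])
 hence "\<bar>(\<Sum>k\<le>n. F (\<tau> k) * Bernstein n k y) - F x\<bar> <= (\<Sum>k\<le>n. \<bar>F (\<tau> k) - F x\<bar> * Bernstein n k y)"
  using sum_abs[of "%k. (F (\<tau> k) - F x) * Bernstein n k y" "{..n}"] B0 by (simp add: abs_mult)
 also have "\<dots> <= (\<Sum>k\<le>n. (\<eta> + 2 * M / \<delta>^2 * (8 * R^2 / real n^2 + 8 * R^2 * (real k / real n - y)^2)) * Bernstein n k y)"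
 proof (intro sum_mono mult_right_mono B0)
  fix k assume "k \<in> {..n}"
  hence k: "k <= n" by simp
  have "2 * M / \<delta>^2 * (\<tau> k - x)^2 <= 2 * M / \<delta>^2 * (8 * R^2 / real n^2 + 8 * R^2 * (real k / real n - y)^2)"
   using dev[OF k] M0 by (intro mult_left_mono) auto
  thus "\<bar>F (\<tau> k) - F x\<bar> <= \<eta> + 2 * M / \<delta>^2 * (8 * R^2 / real n^2 + 8 * R^2 * (real k / real n - y)^2)"
   using dif[OF k] by linarith
 qed
 also have "\<dots> = (\<Sum>k\<le>n. (\<eta> + 16 * M * R^2 / (\<delta>^2 * real n^2)) * Bernstein n k y
   + 16 * M * R^2 / \<delta>^2 * ((real k / real n - y)^2 * Bernstein n k y))"
  by (intro sum.cong) (auto simp: algebra_simps add_divide_distrib)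
 also have "\<dots> = \<eta> + 16 * M * R^2 / (\<delta>^2 * real n^2) + 16 * M * R^2 / \<delta>^2 * (\<Sum>k\<le>n. (real k / real n - y)^2 * Bernstein n k y)"
  unfolding sum.distrib sum_distrib_left[symmetric] by simp
 also have "\<dots> <= \<eta> + 16 * M * R^2 / (\<delta>^2 * real n) + 16 * M * R^2 / \<delta>^2 * (1 / real n)"
 proof (intro add_mono order_refl)
  have "real n <= real n^2" using n by (simp add: power2_eq_square)
  thus "16 * M * R^2 / (\<delta>^2 * real n^2) <= 16 * M * R^2 / (\<delta>^2 * real n)"
   using M0 n \<delta> by (intro divide_left_mono mult_left_mono) auto
  show "16 * M * R^2 / \<delta>^2 * (\<Sum>k\<le>n. (real k / real n - y)^2 * Bernstein n k y) <= 16 * M * R^2 / \<delta>^2 * (1 / real n)"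
   using M0 by (intro mult_left_mono sum_Bernstein_variance n y) auto
 qed
 also have "\<dots> = \<eta> + 32 * M * R^2 / (\<delta>^2 * real n)" by (simp add: field_simps)
 finally show ?thesis unfolding y_def .
qed

lemma CkRm_restrict_coord:
 assumes U: "CkRm m (Suc 0) U" and j: "j < m"
 shows "CkRm m (Suc 0) (%x. U (x(j := a)))"
  and "!!i x. i < m ==> x \<in> Rm m ==> pd i (%x. U (x(j := a))) x = (if i = j then 0 else pd i U (x(j := a)))"
proof -
 have c: "cont_Rm m (%x. V (x(j := a)))" if V: "cont_Rm m V" for V :: "(nat => real) => real"
  unfolding cont_Rm_def
 proof (intro ballI allI impI)
  fix x e assume x: "x \<in> Rm m" and "(0::real) < e"
  then obtain d where d: "d > 0" "!!y. y \<in> Rm m ==> (\<forall>i<m. \<bar>y i - (x(j := a)) i\<bar> < d) ==> \<bar>V y - V (x(j := a))\<bar> < e"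
   using V[unfolded cont_Rm_def, THEN bspec, OF Rm_upd[OF x j, of a]] by auto
  show "\<exists>d>0. \<forall>y\<in>Rm m. (\<forall>i<m. \<bar>y i - x i\<bar> < d) \<longrightarrow> \<bar>V (y(j := a)) - V (x(j := a))\<bar> < e"
   by (intro exI[of _ d] conjI ballI impI d) (use d(1) in \<open>auto intro: Rm_upd j\<close>)
 qed
 have d: "((%h. U ((x(i := h))(j := a))) has_real_derivative (if i = j then 0 else pd i U (x(j := a)))) (at (x i))"
  if "i < m" "x \<in> Rm m" for i x
 proof (cases "i = j")
  case False
  thus ?thesis using CkRm_has_derivative_self[OF U that(1) Rm_upd[OF that(2) j], of a]
   by (simp add: fun_upd_twist)
 qed simp
 show "CkRm m (Suc 0) (%x. U (x(j := a)))"
 proof (rule CkRm_SucI[OF c d])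
  show "cont_Rm m U" by (rule CkRm_cont[OF U])
  show "CkRm m 0 (%x. if i = j then 0 else pd i U (x(j := a)))" if "i < m" for i
   using c[of "pd i U"] CkRm_pd[OF U that] CkRm_const[of m 0 0] by (cases "i = j") auto
 qed
 show "pd i (%x. U (x(j := a))) x = (if i = j then 0 else pd i U (x(j := a)))" if "i < m" "x \<in> Rm m" for i x
  by (rule pd_eqI[OF d[OF that]])
qed

lemma Rm_box_upd: "x \<in> Rm_box m R ==> i < m ==> \<bar>h\<bar> <= R ==> x(i := h) \<in> Rm_box m R"
 by (auto simp: Rm_box_def Rm_upd)

text \<open>Bernstein approximation in the variable j commutes with the other partial derivatives.
  For the derivative in j, the scaled differences of coefficients are values of
  \<open>pd j U\<close> at intermediate points, so the sum is a Bernstein sum with displaced nodes.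
  One n serves all cases since only finitely many functions, collected in \<open>Fs\<close>, are
  involved.\<close>

lemma Bernstein_coord_approx:
 assumes U: "CkRm m (Suc 0) U" and j: "j < m" and R: "R > 0" and e: "e > 0"
 obtains n where "!!x. x \<in> Rm_box m R ==>
   \<bar>(\<Sum>k\<le>Suc n. U (x(j := 2 * R * (real k / real (Suc n)) - R)) * Bernstein (Suc n) k ((x j + R) / (2 * R))) - U x\<bar> < e"
  "!!x i. x \<in> Rm_box m R ==> i < m ==> i \<noteq> j ==>
   \<bar>(\<Sum>k\<le>Suc n. pd i U (x(j := 2 * R * (real k / real (Suc n)) - R)) * Bernstein (Suc n) k ((x j + R) / (2 * R))) - pd i U x\<bar> < e"
  "!!x. x \<in> Rm_box m R ==>
   \<bar>(\<Sum>k\<le>Suc n. U (x(j := 2 * R * (real k / real (Suc n)) - R)) *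
     (real (Suc n) * ((if k = 0 then 0 else Bernstein n (k - 1) ((x j + R) / (2 * R))) - Bernstein n k ((x j + R) / (2 * R))) / (2 * R)))
    - pd j U x\<bar> < e"
proof -
 define Fs where "Fs = insert U ((%i. pd i U) ` {..<m})"
 have fin: "finite Fs" by (simp add: Fs_def)
 have cF: "cont_Rm m F" if "F \<in> Fs" for F
  using that CkRm_cont[OF U] CkRm_pd[OF U] by (auto simp: Fs_def)
 have "\<forall>F\<in>Fs. \<exists>C. \<forall>x\<in>Rm_box m R. \<bar>F x\<bar> <= C" using cont_Rm_bounded[OF cF] by metis
 then obtain C where C: "!!F x. F \<in> Fs ==> x \<in> Rm_box m R ==> \<bar>F x\<bar> <= C F" by metis
 define M where "M = (\<Sum>F\<in>Fs. \<bar>C F\<bar>)"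
 have M0: "0 <= M" unfolding M_def by (simp add: sum_nonneg)
 have M: "\<bar>F x\<bar> <= M" if "F \<in> Fs" "x \<in> Rm_box m R" for F x
 proof -
  have "\<bar>C F\<bar> <= M" unfolding M_def by (rule member_le_sum) (use that fin in auto)
  thus ?thesis using C[OF that] by simp
 qed
 have "\<forall>F\<in>Fs. \<exists>d>0. \<forall>x y. x \<in> Rm_box m R \<longrightarrow> y \<in> Rm_box m R \<longrightarrow> (\<forall>i<m. \<bar>x i - y i\<bar> < d) \<longrightarrow> \<bar>F x - F y\<bar> < e/2"
  using cont_Rm_uniform[OF cF half_gt_zero[OF e]] by metis
 then obtain d where d: "!!F. F \<in> Fs ==> d F > 0" "!!F x y. F \<in> Fs ==> x \<in> Rm_box m R ==> y \<in> Rm_box m R ==>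
   (\<forall>i<m. \<bar>x i - y i\<bar> < d F) ==> \<bar>F x - F y\<bar> < e/2" by metis
 define \<delta> where "\<delta> = Min (d ` Fs)"
 have \<delta>: "\<delta> > 0" "!!F. F \<in> Fs ==> \<delta> <= d F" using fin d(1) by (auto simp: \<delta>_def Fs_def)
 obtain n0 where n0: "real n0 > 32 * M * R^2 / (\<delta>^2 * (e/2))" using reals_Archimedean2 by blast
 \<comment> \<open>The estimate is used in degree \<open>Suc n\<close> for values and in degree n
   for the derivative, so n itself has to be positive and large.\<close>
 define n where "n = Suc n0"
 have small: "32 * M * R^2 / (\<delta>^2 * real N) < e / 2" if "N \<ge> n" for N
 proof -
  have "real N > 32 * M * R^2 / (\<delta>^2 * (e/2))" using that n0 unfolding n_def by linarith
  moreover have "real N > 0" using that by (simp add: n_def)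
  ultimately show ?thesis using \<delta>(1) e by (simp add: field_simps)
 qed
 have est: "\<bar>(\<Sum>k\<le>N. F (x(j := \<tau> k)) * Bernstein N k ((x j + R) / (2 * R))) - F x\<bar> < e"
  if F: "F \<in> Fs" and x: "x \<in> Rm_box m R" and N: "N \<ge> n"
   and \<tau>: "!!k. k <= N ==> \<bar>\<tau> k\<bar> <= R" "!!k. k <= N ==> \<bar>\<tau> k - (2 * R * (real k / real N) - R)\<bar> <= 2 * R / real N"
  for F x N \<tau>
 proof -
  have "\<bar>(\<Sum>k\<le>N. (%t. F (x(j := t))) (\<tau> k) * Bernstein N k ((x j + R) / (2 * R))) - (%t. F (x(j := t))) (x j)\<bar>
   <= e/2 + 32 * M * R^2 / (\<delta>^2 * real N)"
  proof (rule Bernstein_estimate)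
   show "1 <= N" using N by (simp add: n_def)
   show xj: "\<bar>x j\<bar> <= R" using x j by (auto simp: Rm_box_def)
   show "\<bar>F (x(j := t))\<bar> <= M" if "\<bar>t\<bar> <= R" for t by (rule M[OF F Rm_box_upd[OF x j that]])
   show "\<bar>F (x(j := t)) - F (x(j := x j))\<bar> <= e/2" if "\<bar>t\<bar> <= R" "\<bar>t - x j\<bar> < \<delta>" for t
   proof -
    have "\<delta> <= d F" by (rule \<delta>(2)[OF F])
    hence "\<bar>F (x(j := t)) - F x\<bar> < e/2"
     by (intro d(2)[OF F Rm_box_upd[OF x j that(1)] x]) (use that(2) d(1)[OF F] in auto)
    thus ?thesis by simp
   qed
  qed (use R \<delta> e \<tau> in auto)
  thus ?thesis using small[OF N] by (simp only: fun_upd_triv)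
 qed
 have grid: "\<bar>2 * R * (real k / real (Suc n)) - R\<bar> <= R" if "k <= Suc n" for k
 proof -
  have "2 * R * (real k / real (Suc n)) <= 2 * R * 1" using that R by (intro mult_left_mono) auto
  moreover have "0 <= 2 * R * (real k / real (Suc n))" using R by simp
  ultimately show ?thesis by linarith
 qed
 show ?thesis
 proof (rule that[of n])
  fix x assume x: "x \<in> Rm_box m R"
  show "\<bar>(\<Sum>k\<le>Suc n. U (x(j := 2 * R * (real k / real (Suc n)) - R)) * Bernstein (Suc n) k ((x j + R) / (2 * R))) - U x\<bar> < e"
   by (rule est[OF _ x]) (use grid R in \<open>auto simp: Fs_def simp del: of_nat_Suc\<close>)
  show "\<bar>(\<Sum>k\<le>Suc n. pd i U (x(j := 2 * R * (real k / real (Suc n)) - R)) * Bernstein (Suc n) k ((x j + R) / (2 * R))) - pd i U x\<bar> < e"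
   if "i < m" for i
   by (rule est[OF _ x]) (use grid R that in \<open>auto simp: Fs_def simp del: of_nat_Suc\<close>)
  let ?y = "(x j + R) / (2 * R)" and ?t = "%k::nat. 2 * R * (real k / real (Suc n)) - R"
  have xR: "x \<in> Rm m" using x by (simp add: Rm_box_def)
  have "\<exists>s\<in>closed_segment (?t k) (?t (Suc k)). U (x(j := ?t (Suc k))) - U (x(j := ?t k)) = pd j U (x(j := s)) * (?t (Suc k) - ?t k)" for k
   by (rule MVT_segment[OF CkRm_has_derivative[OF U j xR]])
  then obtain s where s: "!!k. s k \<in> closed_segment (?t k) (?t (Suc k))"
   "!!k. U (x(j := ?t (Suc k))) - U (x(j := ?t k)) = pd j U (x(j := s k)) * (?t (Suc k) - ?t k)" by metis
  have diff: "?t (Suc k) - ?t k = 2 * R / real (Suc n)" for k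
   unfolding of_nat_Suc[of k] add_divide_distrib distrib_left by simp
  have "(\<Sum>k\<le>Suc n. U (x(j := ?t k)) * (real (Suc n) * ((if k = 0 then 0 else Bernstein n (k - 1) ?y) - Bernstein n k ?y) / (2 * R)))
   = (\<Sum>k\<le>Suc n. U (x(j := ?t k)) * (real (Suc n) * ((if k = 0 then 0 else Bernstein n (k - 1) ?y) - Bernstein n k ?y))) / (2 * R)"
   unfolding sum_divide_distrib by simp
  also have "\<dots> = real (Suc n) * (\<Sum>k\<le>n. (pd j U (x(j := s k)) * (2 * R / real (Suc n))) * Bernstein n k ?y) / (2 * R)"
   unfolding sum_Bernstein_derivative s(2) diff ..
  also have "\<dots> = (\<Sum>k\<le>n. pd j U (x(j := s k)) * Bernstein n k ?y)"
   unfolding sum_distrib_left sum_divide_distrib using R by (intro sum.cong) auto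
  finally have eq: "(\<Sum>k\<le>Suc n. U (x(j := ?t k)) * (real (Suc n) * ((if k = 0 then 0 else Bernstein n (k - 1) ?y) - Bernstein n k ?y) / (2 * R)))
   = (\<Sum>k\<le>n. pd j U (x(j := s k)) * Bernstein n k ?y)" .
  have n1: "real n > 0" by (simp add: n_def)
  have seg: "?t k <= s k \<and> s k <= ?t (Suc k)" for k
  proof -
   have "?t k <= ?t (Suc k)" using diff[of k] R by (smt (verit) divide_nonneg_nonneg of_nat_0_le_iff)
   thus ?thesis using s(1)[of k] by (auto simp: closed_segment_eq_real_ivl)
  qed
  \<comment> \<open>For k at most n the number k/n lies between k/(n+1) and (k+1)/(n+1). Hence the
    uniform node of degree n and the intermediate point \<open>s k\<close> share a cell of the grid
    of degree n+1.\<close>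
  have near: "?t k <= 2 * R * (real k / real n) - R \<and> 2 * R * (real k / real n) - R <= ?t (Suc k)" if "k <= n" for k
  proof -
   have "real k / real (Suc n) <= real k / real n" using n1 by (intro divide_left_mono) auto
   moreover have "real k / real n <= real (Suc k) / real (Suc n)" using n1 that by (simp add: field_simps)
   ultimately have "2 * R * (real k / real (Suc n)) <= 2 * R * (real k / real n)"
    "2 * R * (real k / real n) <= 2 * R * (real (Suc k) / real (Suc n))"
    using R by (auto intro!: mult_left_mono simp del: times_divide_eq_right)
   thus ?thesis by linarith
  qed
  show "\<bar>(\<Sum>k\<le>Suc n. U (x(j := ?t k)) * (real (Suc n) * ((if k = 0 then 0 else Bernstein n (k - 1) ?y) - Bernstein n k ?y) / (2 * R)))
    - pd j U x\<bar> < e"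
   unfolding eq
  proof (rule est[OF _ x])
   show "pd j U \<in> Fs" using j by (auto simp: Fs_def)
   show "\<bar>s k\<bar> <= R" if "k <= n" for k
    using seg[of k] grid[of k] grid[of "Suc k"] that by auto
   show "\<bar>s k - (2 * R * (real k / real n) - R)\<bar> <= 2 * R / real n" if "k <= n" for k
   proof -
    have "\<bar>s k - (2 * R * (real k / real n) - R)\<bar> <= 2 * R / real (Suc n)"
     using seg[of k] near[OF that] diff[of k] by linarith
    also have "\<dots> <= 2 * R / real n" using R n1 by (intro divide_left_mono) auto
    finally show ?thesis .
   qed
  qed simp
 qed
qed

lemma CkRm_Bernstein_coord:
 assumes "j < m" shows "CkRm m l (%x. Bernstein n k ((x j + R) / (2 * R)))"
proof -
 have "CkRm m l (%x. (1 / (2 * R)) * (x j + R))"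
  by (intro CkRm_mult CkRm_add CkRm_const CkRm_coord assms)
 hence a: "CkRm m l (%x. (x j + R) / (2 * R))" by simp
 show ?thesis unfolding Bernstein_def
  by (intro CkRm_mult CkRm_diff CkRm_const CkRm_power a)
qed

text \<open>Induction on the number j of leading coordinates on which U depends. Bernstein
  approximation in the last of them leaves coefficient functions of one coordinate fewer, which the
  induction hypothesis approximates in C^1; the products with Bernstein polynomials are then
  summed.\<close>

theorem C1_approx_smooth:
 assumes "CkRm m (Suc 0) U" "R > 0" "e > 0"
 obtains V where "!!k. CkRm m k V" "!!x. x \<in> Rm_box m R ==> \<bar>V x - U x\<bar> < e"
  "!!x i. x \<in> Rm_box m R ==> i < m ==> \<bar>pd i V x - pd i U x\<bar> < e"
proof -
 have "\<exists>V. (\<forall>k. CkRm m k V) \<and> (\<forall>x\<in>Rm_box m R. \<bar>V x - U x\<bar> < e \<and> (\<forall>i<m. \<bar>pd i V x - pd i U x\<bar> < e))"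
  if "j <= m" "CkRm m (Suc 0) U" "!!x. x \<in> Rm m ==> U x = U (window j 0 x)" "e > 0" for j U e
  using that
 proof (induction j arbitrary: U e)
  case 0
  have cU: "CkRm m k U" for k
   by (rule CkRm_cong[OF _ CkRm_const[of m k "U (%_. 0)"]]) (use 0(3) in \<open>simp add: window_def\<close>)
  show ?case using cU 0 by (intro exI[of _ U]) simp
 next
  case (Suc j)
  have j: "j < m" using Suc.prems by simp
  note U = Suc.prems(2)
  obtain n where n: "!!x. x \<in> Rm_box m R ==>
   \<bar>(\<Sum>k\<le>Suc n. U (x(j := 2 * R * (real k / real (Suc n)) - R)) * Bernstein (Suc n) k ((x j + R) / (2 * R))) - U x\<bar> < e/2"
  "!!x i. x \<in> Rm_box m R ==> i < m ==> i \<noteq> j ==>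
   \<bar>(\<Sum>k\<le>Suc n. pd i U (x(j := 2 * R * (real k / real (Suc n)) - R)) * Bernstein (Suc n) k ((x j + R) / (2 * R))) - pd i U x\<bar> < e/2"
  "!!x. x \<in> Rm_box m R ==>
   \<bar>(\<Sum>k\<le>Suc n. U (x(j := 2 * R * (real k / real (Suc n)) - R)) *
     (real (Suc n) * ((if k = 0 then 0 else Bernstein n (k - 1) ((x j + R) / (2 * R))) - Bernstein n k ((x j + R) / (2 * R))) / (2 * R)))
    - pd j U x\<bar> < e/2"
   by (rule Bernstein_coord_approx[OF U j assms(2) half_gt_zero[OF Suc.prems(4)]]) (blast intro: that)
  define t where "t k = 2 * R * (real k / real (Suc n)) - R" for k
  define Uk where "Uk k x = U (x(j := t k))" for k x
  define b where "b k x = Bernstein (Suc n) k ((x j + R) / (2 * R))" for k and x :: "nat => real"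
  define b' where "b' k x = real (Suc n) * ((if k = 0 then 0 else Bernstein n (k - 1) ((x j + R) / (2 * R))) - Bernstein n k ((x j + R) / (2 * R))) / (2 * R)"
   for k and x :: "nat => real"
  note n' = n[folded t_def, folded b_def b'_def Uk_def]
  \<comment> \<open>Differentiating in j multiplies the error of a coefficient by \<open>b'\<close>,
    which is bounded by (n+1) 2/(2R), and there are n+2 coefficients. With this \<epsilon> that
    contribution and the direct error \<epsilon> add up to e/2.\<close>
  define \<epsilon> where "\<epsilon> = e / (2 * (1 + real (Suc (Suc n)) * (real (Suc n) * 2 / (2 * R))))"
  have den: "1 + real (Suc (Suc n)) * (real (Suc n) * 2 / (2 * R)) > 0" using assms(2) by (intro add_pos_nonneg) auto
  have \<epsilon>: "\<epsilon> > 0" unfolding \<epsilon>_def by (intro divide_pos_pos mult_pos_pos den Suc.prems(4)) simp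
  have \<epsilon>e: "\<epsilon> * (1 + real (Suc (Suc n)) * (real (Suc n) * 2 / (2 * R))) = e / 2"
  proof -
   have "e / (2 * D) * D = e / 2" if "D > 0" for D using that by simp
   from this[OF den] show ?thesis unfolding \<epsilon>_def .
  qed
  have \<epsilon>h: "\<epsilon> <= e/2"
  proof -
   have "\<epsilon> * 1 <= \<epsilon> * (1 + real (Suc (Suc n)) * (real (Suc n) * 2 / (2 * R)))"
    using \<epsilon> assms(2) by (intro mult_left_mono) auto
   thus ?thesis unfolding \<epsilon>e by simp
  qed
  have UkC: "CkRm m (Suc 0) (Uk k)" "i < m ==> x \<in> Rm m ==> pd i (Uk k) x = (if i = j then 0 else pd i U (x(j := t k)))" for k i x
   unfolding Uk_def by (rule CkRm_restrict_coord(1)[OF U j], rule CkRm_restrict_coord(2)[OF U j])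
  have "\<exists>V. (\<forall>l. CkRm m l V) \<and> (\<forall>x\<in>Rm_box m R. \<bar>V x - Uk k x\<bar> < \<epsilon> \<and> (\<forall>i<m. \<bar>pd i V x - pd i (Uk k) x\<bar> < \<epsilon>))" for k
  proof (rule Suc.IH[OF _ UkC(1) _ \<epsilon>])
   show "Uk k x = Uk k (window j 0 x)" if "x \<in> Rm m" for x
   proof -
    have "U (x(j := t k)) = U (window (Suc j) 0 (x(j := t k)))"
     by (rule Suc.prems(3)[OF Rm_upd[OF that j]])
    moreover have "window (Suc j) 0 (x(j := t k)) = (window j 0 x)(j := t k)"
     by (auto simp: window_def)
    ultimately show ?thesis unfolding Uk_def by (simp only:)
   qed
  qed (use j in simp)
  then obtain V where V: "!!k l. CkRm m l (V k)" "!!k x. x \<in> Rm_box m R ==> \<bar>V k x - Uk k x\<bar> < \<epsilon>"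
   "!!k x i. x \<in> Rm_box m R ==> i < m ==> \<bar>pd i (V k) x - pd i (Uk k) x\<bar> < \<epsilon>" by metis
  define W where "W x = (\<Sum>k\<le>Suc n. V k x * b k x)" for x
  have WC: "CkRm m l W" for l
   unfolding W_def b_def by (intro CkRm_sum CkRm_mult V CkRm_Bernstein_coord j)
  have bd: "((%h. b k (x(i := h))) has_real_derivative (if i = j then b' k x else 0)) (at (x i))" for k i x
  proof (cases "i = j")
   case True
   have "((%h. (h + R) / (2 * R)) has_real_derivative 1 / (2 * R)) (at (x j))"
    using assms(2) by (auto intro!: derivative_eq_intros)
   from DERIV_chain2[OF Bernstein_has_derivative this] show ?thesis
    using True by (simp add: b_def b'_def)
  qed (simp add: b_def)
  have pdW: "pd i W x = (\<Sum>k\<le>Suc n. pd i (V k) x * b k x + (if i = j then b' k x else 0) * V k x)" if "i < m" "x \<in> Rm m" for i x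
  proof (rule pd_eqI)
   have d: "((%h. V k (x(i := h)) * b k (x(i := h))) has_real_derivative
    pd i (V k) x * b k x + (if i = j then b' k x else 0) * V k x) (at (x i))" for k
    using DERIV_mult[OF CkRm_has_derivative_self[OF V(1) that, of k] bd[of k x i]]
    by (simp only: fun_upd_triv)
   show "((%h. W (x(i := h))) has_real_derivative (\<Sum>k\<le>Suc n. pd i (V k) x * b k x + (if i = j then b' k x else 0) * V k x)) (at (x i))"
    unfolding W_def by (rule DERIV_sum[OF d])
  qed
  have b0: "0 <= b k x" "(\<Sum>k\<le>Suc n. b k x) = 1" "\<bar>b' k x\<bar> <= real (Suc n) * 2 / (2 * R)" if x: "x \<in> Rm_box m R" for k x
  proof -
   have y: "0 <= (x j + R) / (2 * R)" "(x j + R) / (2 * R) <= 1"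
    using x j assms(2) by (auto simp: Rm_box_def abs_le_iff field_simps)
   show "0 <= b k x" unfolding b_def by (rule Bernstein_nonneg[OF y])
   show "(\<Sum>k\<le>Suc n. b k x) = 1" unfolding b_def by (rule sum_Bernstein)
   have le: "Bernstein n k ((x j + R) / (2 * R)) <= 1" for k
   proof (cases "k <= n")
    case True
    have "Bernstein n k ((x j + R) / (2 * R)) <= (\<Sum>k\<le>n. Bernstein n k ((x j + R) / (2 * R)))"
     by (rule member_le_sum) (use True Bernstein_nonneg[OF y] in auto)
    thus ?thesis by simp
   qed (simp add: Bernstein_def binomial_eq_0)
   have "\<bar>(if k = 0 then 0 else Bernstein n (k - 1) ((x j + R) / (2 * R))) - Bernstein n k ((x j + R) / (2 * R))\<bar> <= 2"
    using le[of k] le[of "k - 1"] Bernstein_nonneg[OF y, of n k] Bernstein_nonneg[OF y, of n "k - 1"] by auto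
   thus "\<bar>b' k x\<bar> <= real (Suc n) * 2 / (2 * R)"
    unfolding b'_def abs_divide abs_mult using assms(2) by (intro frac_le mult_mono) auto
  qed
  have wsum: "\<bar>(\<Sum>k\<le>Suc n. f k * b k x) - (\<Sum>k\<le>Suc n. g k * b k x)\<bar> <= \<epsilon>" if "x \<in> Rm_box m R" "!!k. \<bar>f k - g k\<bar> <= \<epsilon>" for f g :: "nat => real" and x
  proof -
   have "\<bar>(\<Sum>k\<le>Suc n. f k * b k x) - (\<Sum>k\<le>Suc n. g k * b k x)\<bar> = \<bar>\<Sum>k\<le>Suc n. (f k - g k) * b k x\<bar>"
    by (simp only: sum_subtractf left_diff_distrib)
   also have "\<dots> <= (\<Sum>k\<le>Suc n. \<epsilon> * b k x)"
    by (rule order_trans[OF sum_abs sum_mono]) (use that b0(1)[OF that(1)] in \<open>auto simp: abs_mult intro: mult_right_mono\<close>)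
   also have "\<dots> = \<epsilon>" using b0(2)[OF that(1)] by (simp only: sum_distrib_left[symmetric] mult_1_right)
   finally show ?thesis .
  qed
  show ?case
  proof (intro exI[of _ W] conjI allI impI ballI WC)
   fix x assume x: "x \<in> Rm_box m R"
   hence xR: "x \<in> Rm m" by (simp add: Rm_box_def)
   have "\<bar>W x - (\<Sum>k\<le>Suc n. Uk k x * b k x)\<bar> <= \<epsilon>"
    unfolding W_def by (rule wsum[OF x]) (use V(2)[OF x] in \<open>auto intro: less_imp_le\<close>)
   thus "\<bar>W x - U x\<bar> < e" using n'(1)[OF x] \<epsilon>h by linarith
   fix i assume i: "i < m"
   show "\<bar>pd i W x - pd i U x\<bar> < e"
   proof (cases "i = j")
    case False
    have pu: "pd i (Uk k) x = pd i U (x(j := t k))" for k using UkC(2)[OF i xR] False by simp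
    have "\<bar>pd i W x - (\<Sum>k\<le>Suc n. pd i U (x(j := t k)) * b k x)\<bar> <= \<epsilon>"
     unfolding pdW[OF i xR] pu[symmetric] using False wsum[OF x, of "%k. pd i (V k) x" "%k. pd i (Uk k) x"] V(3)[OF x i]
     by (auto intro: less_imp_le)
    thus ?thesis using n'(2)[OF x i False] \<epsilon>h by linarith
   next
    case True
    have p0: "pd i (Uk k) x = 0" for k using UkC(2)[OF i xR] True by simp
    have "\<bar>(\<Sum>k\<le>Suc n. pd i (V k) x * b k x) - (\<Sum>k\<le>Suc n. 0 * b k x)\<bar> <= \<epsilon>"
     using V(3)[OF x i] by (intro wsum[OF x]) (auto intro: less_imp_le simp: p0)
    hence 1: "\<bar>\<Sum>k\<le>Suc n. pd i (V k) x * b k x\<bar> <= \<epsilon>" by simp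
    have "\<bar>(\<Sum>k\<le>Suc n. b' k x * V k x) - (\<Sum>k\<le>Suc n. Uk k x * b' k x)\<bar> = \<bar>\<Sum>k\<le>Suc n. (V k x - Uk k x) * b' k x\<bar>"
     unfolding left_diff_distrib sum_subtractf by (simp only: mult.commute)
    also have "\<dots> <= (\<Sum>k\<le>Suc n. \<epsilon> * (real (Suc n) * 2 / (2 * R)))"
     by (rule order_trans[OF sum_abs sum_mono])
      (unfold abs_mult, intro mult_mono less_imp_le[OF V(2)[OF x]] b0(3)[OF x] less_imp_le[OF \<epsilon>] abs_ge_zero)
    also have "\<dots> = \<epsilon> * (real (Suc (Suc n)) * (real (Suc n) * 2 / (2 * R)))" by simp
    finally have 2: "\<bar>(\<Sum>k\<le>Suc n. b' k x * V k x) - (\<Sum>k\<le>Suc n. Uk k x * b' k x)\<bar> <= \<epsilon> * (real (Suc (Suc n)) * (real (Suc n) * 2 / (2 * R)))" .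
    have 3: "pd i W x = (\<Sum>k\<le>Suc n. pd i (V k) x * b k x) + (\<Sum>k\<le>Suc n. b' k x * V k x)"
     unfolding pdW[OF i xR] using True by (simp only: sum.distrib if_True simp_thms)
    have 4: "\<epsilon> + \<epsilon> * (real (Suc (Suc n)) * (real (Suc n) * 2 / (2 * R))) = e/2"
     using \<epsilon>e by (simp only: distrib_left mult_1_right)
    show ?thesis using 1 2 3 4 n'(3)[OF x] unfolding True by linarith
   qed
  qed
 qed
 from this[OF order_refl assms(1) _ assms(3)] have "\<exists>V. (\<forall>k. CkRm m k V) \<and> (\<forall>x\<in>Rm_box m R. \<bar>V x - U x\<bar> < e \<and> (\<forall>i<m. \<bar>pd i V x - pd i U x\<bar> < e))"
  by (simp add: window_id)
 thus ?thesis using that by metis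
qed


section \<open>Functions of class $C^k$ on the unit interval\<close>

lemma has_derivative_within_01_unique:
 assumes "x \<in> {0..1::real}" "(a has_real_derivative d) (at x within {0..1})" "(a has_real_derivative d') (at x within {0..1})"
 shows "d = d'"
 using vector_derivative_unique_within_closed_interval[of 0 1 x a d d'] assms
 by (simp add: has_real_derivative_iff_has_vector_derivative)

lemma deriv01_eqI:
 assumes "x \<in> {0..1}" "(a has_real_derivative d) (at x within {0..1})" shows "deriv01 a x = d"
 unfolding deriv01_def by (rule some_equality) (use assms has_derivative_within_01_unique in blast)+

lemma deriv01_at: "x \<in> {0..1} ==> (a has_real_derivative d) (at x) ==> deriv01 a x = d"
 by (rule deriv01_eqI) (auto intro: has_field_derivative_at_within)

lemma Ck01_has_derivative:
 assumes "Ck01 (Suc k) a" "x \<in> {0..1}" shows "(a has_real_derivative deriv01 a x) (at x within {0..1})"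
proof -
 have "\<exists>d. (a has_real_derivative d) (at x within {0..1})" using assms by (auto simp: real_differentiable_def)
 thus ?thesis unfolding deriv01_def by (rule someI_ex)
qed

lemma Ck01_continuous: "Ck01 k a ==> continuous_on {0..1} a"
proof (cases k)
 case (Suc k')
 assume "Ck01 k a"
 hence "(a has_real_derivative deriv01 a x) (at x within {0..1})" if "x \<in> {0..1}" for x
  using Ck01_has_derivative that unfolding Suc by blast
 thus ?thesis by (rule DERIV_continuous_on)
qed simp

lemma Ck01_cong:
 assumes "!!x. x \<in> {0..1} ==> a x = b x" "Ck01 k a" shows "Ck01 k b"
 using assms
proof (induction k arbitrary: a b)
 case 0 thus ?case by simp (rule continuous_on_eq[of "{0..1}" a b], auto)
next
 case (Suc k)
 have d: "(b has_real_derivative deriv01 a x) (at x within {0..1})" if x: "x \<in> {0..1}" for x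
  by (rule has_field_derivative_transform_within[OF Ck01_has_derivative[OF Suc.prems(2) x], of 1])
   (use Suc.prems(1) x in auto)
 have "Ck01 k (deriv01 b)"
  by (rule Suc.IH[of "deriv01 a"]) (use deriv01_eqI[OF _ d, symmetric] Suc.prems(2) in auto)
 moreover have "b differentiable (at x within {0..1})" if "x \<in> {0..1}" for x
  using d[OF that] real_differentiable_def by blast
 ultimately show ?case by simp
qed

lemma Ck01_SucI:
 assumes "!!x. (a has_real_derivative b x) (at x)" "Ck01 k b" shows "Ck01 (Suc k) a"
proof -
 have "Ck01 k (deriv01 a)" by (rule Ck01_cong[OF _ assms(2)]) (rule deriv01_at[OF _ assms(1), symmetric])
 thus ?thesis using assms(1) by (auto simp: real_differentiable_def intro: has_field_derivative_at_within)
qed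

lemma Ck01_SucD: "Ck01 (Suc k) a ==> Ck01 k a"
proof (induction k arbitrary: a)
 case 0 thus ?case using Ck01_continuous[OF 0] by simp
qed auto

lemma Ck01_mono: assumes "Ck01 k a" "j <= k" shows "Ck01 j a"
 using assms(2,1) by (induction rule: dec_induct) (auto dest: Ck01_SucD simp del: Ck01.simps)

lemma Ck01_polynomial: "real_polynomial_function p ==> Ck01 k p"
proof (induction k arbitrary: p)
 case 0 thus ?case by (simp add: continuous_on_polymonial_function real_polynomial_function_eq)
next
 case (Suc k)
 obtain p' where "real_polynomial_function p'" "!!x. (p has_real_derivative p' x) (at x)"
  using has_real_derivative_polynomial_function[OF Suc.prems] by blast
 thus ?case using Ck01_SucI Suc.IH by blast
qed

text \<open>The primitive of a continuous extension of a' that agrees with a at 0 is an extension of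
  a. Used repeatedly from the highest derivative downwards.\<close>

lemma Ck01_extend_step:
 assumes a: "Ck01 (Suc 0) a" and g: "continuous_on UNIV g" "!!x. x \<in> {0..1} ==> g x = deriv01 a x"
 obtains F where "!!x. (F has_real_derivative g x) (at x)" "!!x. x \<in> {0..1} ==> F x = a x"
proof -
 obtain F where F: "F 0 = a 0" "!!x. (F has_real_derivative g x) (at x)" using ex_antiderivative[OF g(1)] by metis
 have "\<exists>c. \<forall>x\<in>{0..1}. F x - a x = c"
 proof (rule has_field_derivative_zero_constant)
  fix x :: real assume x: "x \<in> {0..1}"
  show "((%x. F x - a x) has_real_derivative 0) (at x within {0..1})"
   using DERIV_diff[OF has_field_derivative_at_within[OF F(2)] Ck01_has_derivative[OF a x]] g(2)[OF x] by simp
 qed simp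
 then obtain c where c: "!!x. x \<in> {0..1} ==> F x - a x = c" by blast
 from c[of 0] F(1) have "c = 0" by simp
 thus ?thesis using that[of F] F(2) c by auto
qed

lemma continuous_unit_clamp_compose:
 "continuous_on {0..1} a ==> continuous_on UNIV (%x. a (unit_clamp x))"
 by (rule continuous_on_compose2[OF _ continuous_unit_clamp]) (auto simp: unit_clamp_bounds)

lemma Ck01_extend1:
 assumes a: "Ck01 (Suc 0) a"
 obtains F where "!!x. (F has_real_derivative deriv01 a (unit_clamp x)) (at x)" "!!x. x \<in> {0..1} ==> F x = a x"
 by (rule Ck01_extend_step[OF a, of "%x. deriv01 a (unit_clamp x)"])
  (use a in \<open>auto intro!: continuous_unit_clamp_compose that simp: unit_clamp_eq\<close>)

text \<open>An extension to the line makes all derivatives two-sided. Its third derivative is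
  composed with the clamp and hence bounded everywhere, as the locale \<open>trapezoid\<close>
  demands.\<close>

lemma Ck01_extend3:
 assumes a: "Ck01 3 a"
 obtains f f1 f2 f3 where "!!x. (f has_real_derivative f1 x) (at x)" "!!x. (f1 has_real_derivative f2 x) (at x)"
  "!!x. (f2 has_real_derivative f3 x) (at x)" "continuous_on UNIV f3"
  "!!x. x \<in> {0..1} ==> f x = a x" "!!x. x \<in> {0..1} ==> f1 x = deriv01 a x" "!!x. f3 x = f3 (unit_clamp x)"
proof -
 have a3: "Ck01 (Suc (Suc (Suc 0))) a" using a by (simp add: numeral_3_eq_3)
 have a2: "Ck01 (Suc (Suc 0)) (deriv01 a)" and a1: "Ck01 (Suc 0) (deriv01 (deriv01 a))" using a3 by auto
 obtain f2 where f2: "!!x. (f2 has_real_derivative deriv01 (deriv01 (deriv01 a)) (unit_clamp x)) (at x)"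
  "!!x. x \<in> {0..1} ==> f2 x = deriv01 (deriv01 a) x" using Ck01_extend1[OF a1] by metis
 obtain f1 where f1: "!!x. (f1 has_real_derivative f2 x) (at x)" "!!x. x \<in> {0..1} ==> f1 x = deriv01 a x"
  using Ck01_extend_step[OF Ck01_SucD[OF a2] _ f2(2)] DERIV_continuous_on[OF f2(1)] by (metis has_field_derivative_at_within)
 obtain f where f: "!!x. (f has_real_derivative f1 x) (at x)" "!!x. x \<in> {0..1} ==> f x = a x"
  using Ck01_extend_step[OF Ck01_mono[OF a3] _ f1(2)] DERIV_continuous_on[OF f1(1)] by (metis has_field_derivative_at_within le_add2 plus_1_eq_Suc Suc_le_mono zero_le)
 show ?thesis
 proof (rule that[OF f(1) f1(1) f2(1) _ f(2) f1(2)])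
  show "continuous_on UNIV (%x. deriv01 (deriv01 (deriv01 a)) (unit_clamp x))"
   using a1 by (intro continuous_unit_clamp_compose) simp
 qed (auto simp: unit_clamp_eq unit_clamp_bounds)
qed

lemma bounded_on_01:
 assumes "continuous_on {0..1} a" obtains C :: real where "0 <= C" "!!x. x \<in> {0..1::real} ==> \<bar>a x\<bar> <= C"
proof -
 have "bounded (a ` {0..1})" by (intro compact_imp_bounded compact_continuous_image assms) simp
 then obtain C where "\<forall>y\<in>a ` {0..1}. norm y <= C" unfolding bounded_iff by blast
 hence C: "!!x. x \<in> {0..1} ==> \<bar>a x\<bar> <= C" by auto
 have "0 <= C" using C[of 0] by simp
 thus ?thesis using that C by blast
qed

text \<open>Multiplying a polynomial approximation of the derivative by $1-(2x-1)^{2k}$ makes the derivative vanish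
 at the endpoints, at the price of only bounded pointwise convergence on $]0,1[$.\<close>

lemma Ck01_approx_flat:
 assumes a: "Ck01 (Suc 0) a"
 obtains \<gamma> :: "nat => real => real" and C where "!!n k. Ck01 k (\<gamma> n)" "!!n. deriv01 (\<gamma> n) 0 = 0" "!!n. deriv01 (\<gamma> n) 1 = 0"
  "!!n x. x \<in> {0..1} ==> \<bar>deriv01 (\<gamma> n) x\<bar> <= C" "!!n x. x \<in> {0..1} ==> \<bar>\<gamma> n x\<bar> <= C"
  "!!x. 0 < x ==> x < 1 ==> (%n. deriv01 (\<gamma> n) x) \<longlonglongrightarrow> deriv01 a x"
  "!!x. x \<in> {0..1} ==> (%n. \<gamma> n x) \<longlonglongrightarrow> a x"
proof -
 have ca: "continuous_on {0..1} (deriv01 a)" using a by simp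
 obtain C where C: "0 <= C" "!!x. x \<in> {0..1::real} ==> \<bar>deriv01 a x\<bar> <= C" using bounded_on_01[OF ca] by metis
 have "\<exists>p. real_polynomial_function p \<and> (\<forall>x\<in>{0..1}. \<bar>deriv01 a x - p x\<bar> < 1 / real (Suc n))" for n
  using Stone_Weierstrass_real_polynomial_function[OF _ ca, of "1 / real (Suc n)"] by (metis compact_Icc divide_pos_pos of_nat_0_less_iff zero_less_Suc zero_less_one)
 then obtain p where p: "!!n. real_polynomial_function (p n)" "!!n x. x \<in> {0..1} ==> \<bar>deriv01 a x - p n x\<bar> < 1 / real (Suc n)" by metis
 define q where "q n x = p n x * (1 - (2 * x - 1) ^ (2 * Suc n))" for n x
 have lin: "real_polynomial_function (%x::real. 2 * x - 1)"
  by (rule real_polynomial_function_diff real_polynomial_function.intros bounded_linear_mult_right)+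
 have qp: "real_polynomial_function (q n)" for n
  unfolding q_def by (intro real_polynomial_function.intros(4) p real_polynomial_function_diff real_polynomial_function.intros(2)
   real_polynomial_function_power lin)
 have qc: "continuous_on UNIV (q n)" for n
  using qp by (simp add: continuous_on_polymonial_function real_polynomial_function_eq)
 have "\<exists>G. G 0 = a 0 \<and> (\<forall>x. (G has_real_derivative q n x) (at x))" for n
  using ex_antiderivative[OF qc] by metis
 then obtain \<gamma> where \<gamma>: "!!n. \<gamma> n 0 = a 0" "!!n x. (\<gamma> n has_real_derivative q n x) (at x)" by metis
 have d: "deriv01 (\<gamma> n) x = q n x" if "x \<in> {0..1}" for n x by (rule deriv01_at[OF that \<gamma>(2)])
 have w: "0 <= (2 * x - 1) ^ (2 * Suc n)" "(2 * x - 1) ^ (2 * Suc n) <= 1" if "x \<in> {0..1}" for x :: real and n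
 proof -
  show "0 <= (2 * x - 1) ^ (2 * Suc n)" by (rule zero_le_even_power) simp
  have "\<bar>2 * x - 1\<bar> <= 1" using that by auto
  hence "\<bar>2 * x - 1\<bar> ^ (2 * Suc n) <= 1" by (intro power_le_one) auto
  thus "(2 * x - 1) ^ (2 * Suc n) <= 1" unfolding power_abs[symmetric] by linarith
 qed
 have pb: "\<bar>p n x\<bar> <= C + 1" if "x \<in> {0..1}" for n x
 proof -
  have "1 / real (Suc n) <= 1" by simp
  thus ?thesis using p(2)[OF that, of n] C(2)[OF that] by linarith
 qed
 have qb: "\<bar>q n x\<bar> <= C + 1" if "x \<in> {0..1}" for n x
 proof -
  have "\<bar>1 - (2 * x - 1) ^ (2 * Suc n)\<bar> <= 1" using w[OF that, of n] by linarith
  hence "\<bar>p n x\<bar> * \<bar>1 - (2 * x - 1) ^ (2 * Suc n)\<bar> <= (C + 1) * 1" using pb[OF that, of n] C by (intro mult_mono) auto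
  thus ?thesis by (simp add: q_def abs_mult del: power_Suc mult_Suc_right)
 qed
 text \<open>The error is dominated through the explicit primitive of $(2x-1)^{2n}$.\<close>
 have err: "\<bar>\<gamma> n x - a x\<bar> <= (C + 2) / real (Suc n)" if x: "x \<in> {0..1}" for n x
 proof -
  let ?j = "2 * Suc n"
  obtain F where F: "!!x. (F has_real_derivative deriv01 a (unit_clamp x)) (at x)" "!!x. x \<in> {0..1} ==> F x = a x"
   using Ck01_extend1[OF a] by metis
  define P where "P x = x / real (Suc n) + (C + 1) * ((2 * x - 1) ^ Suc ?j / (2 * real (Suc ?j)))" for x
  have P': "(P has_real_derivative 1 / real (Suc n) + (C + 1) * (2 * x - 1) ^ ?j) (at x)" for x
   unfolding P_def by (rule derivative_eq_intros refl | simp del: power_Suc of_nat_Suc)+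
  have dev: "\<bar>q n t - deriv01 a t\<bar> <= 1 / real (Suc n) + (C + 1) * (2 * t - 1) ^ ?j" if t: "t \<in> {0..1}" for t
  proof -
   have "q n t - deriv01 a t = (p n t - deriv01 a t) - p n t * (2 * t - 1) ^ ?j" by (simp add: q_def algebra_simps)
   moreover have "\<bar>p n t * (2 * t - 1) ^ ?j\<bar> <= (C + 1) * (2 * t - 1) ^ ?j"
    unfolding abs_mult using pb[OF t, of n] w[OF t, of n] by (simp add: mult_right_mono del: power_Suc mult_Suc_right)
   ultimately show ?thesis using p(2)[OF t, of n] by linarith
  qed
  have mono: "s * (\<gamma> n 0 - F 0) + P 0 <= s * (\<gamma> n x - F x) + P x" if s: "s = 1 \<or> s = -1" for s
  proof (rule DERIV_nonneg_imp_nondecreasing[where f="%t. s * (\<gamma> n t - F t) + P t"])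
   fix t assume "0 <= t" "t <= x"
   hence t: "t \<in> {0..1}" using x by auto
   have "((%t. s * (\<gamma> n t - F t) + P t) has_real_derivative
    s * (q n t - deriv01 a (unit_clamp t)) + (1 / real (Suc n) + (C + 1) * (2 * t - 1) ^ ?j)) (at t)"
    by (intro DERIV_add P' DERIV_cmult DERIV_diff \<gamma>(2) F(1))
   moreover have "0 <= s * (q n t - deriv01 a (unit_clamp t)) + (1 / real (Suc n) + (C + 1) * (2 * t - 1) ^ ?j)"
    using dev[OF t] s by (auto simp: unit_clamp_eq[OF t] abs_le_iff)
   ultimately show "\<exists>y. ((%t. s * (\<gamma> n t - F t) + P t) has_real_derivative y) (at t) \<and> 0 <= y" by blast
  qed (use x in auto)
  have z: "\<gamma> n 0 - F 0 = 0" using \<gamma>(1) F(2)[of 0] by simp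
  have "\<bar>\<gamma> n x - F x\<bar> <= P x - P 0" using mono[of 1] mono[of "-1"] unfolding z by auto
  also have "P x - P 0 = x / real (Suc n) + (C + 1) * (((2 * x - 1) ^ Suc ?j - (2 * 0 - 1) ^ Suc ?j) / (2 * real (Suc ?j)))"
   unfolding P_def by (simp add: right_diff_distrib diff_divide_distrib add_divide_distrib distrib_left del: power_Suc of_nat_Suc)
  also have "\<dots> <= 1 / real (Suc n) + (C + 1) * (2 / (2 * real (Suc ?j)))"
  proof (intro add_mono mult_left_mono divide_right_mono)
   have "\<bar>2 * x - 1\<bar> ^ Suc ?j <= 1" using x by (intro power_le_one) auto
   hence "(2 * x - 1) ^ Suc ?j <= 1" unfolding power_abs[symmetric] by linarith
   moreover have "(2 * 0 - 1 :: real) ^ Suc ?j = -1" by simp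
   ultimately show "(2 * x - 1) ^ Suc ?j - (2 * 0 - 1) ^ Suc ?j <= 2" by linarith
  qed (use x C in auto)
  also have "\<dots> <= 1 / real (Suc n) + (C + 1) * (1 / real (Suc n))"
   using C by (intro add_left_mono mult_left_mono) (auto simp: field_simps)
  also have "\<dots> = (C + 2) / real (Suc n)" by (simp add: field_simps)
  finally show ?thesis using F(2)[OF x] by simp
 qed
 obtain Ca where Ca: "0 <= Ca" "!!x. x \<in> {0..1::real} ==> \<bar>a x\<bar> <= Ca" using bounded_on_01[OF Ck01_continuous[OF a]] by metis
 have l: "(%n. 1 / real (Suc n)) \<longlonglongrightarrow> 0" using LIMSEQ_Suc[OF lim_1_over_n] by simp
 show ?thesis
 proof (rule that[of \<gamma> "(C + 1) + (Ca + C + 2)"])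
  show "Ck01 k (\<gamma> n)" for n k
   by (rule Ck01_SucD[OF Ck01_SucI[OF \<gamma>(2) Ck01_polynomial[OF qp]]])
  show "deriv01 (\<gamma> n) 0 = 0" "deriv01 (\<gamma> n) 1 = 0" for n by (simp_all add: d q_def)
  show "\<bar>deriv01 (\<gamma> n) x\<bar> <= (C + 1) + (Ca + C + 2)" if "x \<in> {0..1}" for n x
   using qb[OF that, of n] Ca C by (simp add: d[OF that])
  show "\<bar>\<gamma> n x\<bar> <= (C + 1) + (Ca + C + 2)" if "x \<in> {0..1}" for n x
  proof -
   have "(C + 2) / real (Suc n) <= C + 2" using C by (simp add: field_simps)
   thus ?thesis using err[OF that, of n] Ca(2)[OF that] C by linarith
  qed
  show "(%n. deriv01 (\<gamma> n) x) \<longlonglongrightarrow> deriv01 a x" if "0 < x" "x < 1" for x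
  proof -
   have x: "x \<in> {0..1}" using that by auto
   have "(%n. p n x - deriv01 a x) \<longlonglongrightarrow> 0"
    by (rule Lim_null_comparison[OF _ l]) (use p(2)[OF x] in \<open>auto simp: abs_minus_commute intro!: always_eventually less_imp_le\<close>)
   hence pl: "(%n. p n x) \<longlonglongrightarrow> deriv01 a x" by (simp add: LIM_zero_iff)
   have "(2 * x - 1)^2 < 1" using that by (simp add: abs_square_less_1)
   hence "(%n. ((2 * x - 1)^2) ^ Suc n) \<longlonglongrightarrow> 0" by (intro LIMSEQ_Suc LIMSEQ_realpow_zero) auto
   hence "(%n. p n x * (1 - ((2 * x - 1)^2) ^ Suc n)) \<longlonglongrightarrow> deriv01 a x * (1 - 0)"
    by (intro tendsto_intros pl)
   thus ?thesis unfolding d[OF x] q_def power_mult by simp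
  qed
  show "(%n. \<gamma> n x) \<longlonglongrightarrow> a x" if x: "x \<in> {0..1}" for x
  proof -
   have "(%n. (C + 2) * (1 / real (Suc n))) \<longlonglongrightarrow> 0" using tendsto_mult_left[OF l, of "C + 2"] by simp
   hence "(%n. \<gamma> n x - a x) \<longlonglongrightarrow> 0" by (rule Lim_null_comparison[rotated]) (use err[OF x] in auto)
   thus ?thesis by (simp add: LIM_zero_iff)
  qed
 qed
qed


section \<open>Cylinder functions and their representations\<close>

text \<open>The gradient computed from a given representation; \<open>Dz\<close> is this expression
  at a representation picked by choice.\<close>

definition Drep :: "nat => ((nat => real) => real) => (nat => real => real) => (real => real) => real => real" where
 "Drep m U \<alpha> g s = (\<Sum>i<m. pd i U (zvec m \<alpha> g) * deriv01 (\<alpha> i) (g s))"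

lemma zvec_Rm [simp]: "zvec m \<alpha> g \<in> Rm m" by (simp add: zvec_def Rm_def)

text \<open>Concatenating the two lists of inner functions lets two cylinder functions share one
  list; the outer functions read their own block through \<open>window\<close>.\<close>

definition rep_append :: "nat => (nat => real => real) => (nat => real => real) => nat => real => real" where
 "rep_append m \<alpha> \<gamma> i = (if i < m then \<alpha> i else \<gamma> (i - m))"

lemma sum_lessThan_add: "(\<Sum>i<m+n. f i) = (\<Sum>i<m. f i) + (\<Sum>i<n. f (m + i))" for f :: "nat => 'a::comm_monoid_add"
 by (induction n) (auto simp: add.assoc)

lemma window_zvec_append:
 "window m 0 (zvec (m + n) (rep_append m \<alpha> \<gamma>) g) = zvec m \<alpha> g"
 "window n m (zvec (m + n) (rep_append m \<alpha> \<gamma>) g) = zvec n \<gamma> g"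
 by (auto simp: window_def zvec_def rep_append_def fun_eq_iff)

lemma rep_append_ok:
 assumes "rep_ok k m U \<alpha>" "rep_ok k n V \<gamma>"
 shows "rep_ok k (m + n) (%x. U (window m 0 x)) (rep_append m \<alpha> \<gamma>)"
  and "rep_ok k (m + n) (%x. V (window n m x)) (rep_append m \<alpha> \<gamma>)"
 using assms by (auto simp: rep_ok_def rep_append_def intro!: CkRm_window)

lemma zfun_append:
 "zfun (m + n) (%x. U (window m 0 x)) (rep_append m \<alpha> \<gamma>) = zfun m U \<alpha>"
 "zfun (m + n) (%x. V (window n m x)) (rep_append m \<alpha> \<gamma>) = zfun n V \<gamma>"
 by (simp_all add: zfun_def window_zvec_append)

lemma Drep_append:
 assumes "rep_ok (Suc k) m U \<alpha>" "rep_ok (Suc k) n V \<gamma>"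
 shows "Drep (m + n) (%x. U (window m 0 x)) (rep_append m \<alpha> \<gamma>) = Drep m U \<alpha>"
  and "Drep (m + n) (%x. V (window n m x)) (rep_append m \<alpha> \<gamma>) = Drep n V \<gamma>"
proof -
 let ?z = "zvec (m + n) (rep_append m \<alpha> \<gamma>)"
 have U: "pd i (%x. U (window m 0 x)) (?z g) = (if i < m then pd i U (zvec m \<alpha> g) else 0)" if "i < m + n" for i g
  using pd_eqI[OF pd_window[where s=0 and n=m and k=k and V=U and x="?z g", OF _ that]] assms
  by (simp add: rep_ok_def window_zvec_append del: CkRm.simps)
 have V: "pd i (%x. V (window n m x)) (?z g) = (if m <= i then pd (i - m) V (zvec n \<gamma> g) else 0)" if "i < m + n" for i g
  using pd_eqI[OF pd_window[where s=m and n=n and k=k and V=V and x="?z g", OF _ that]] assms that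
  by (simp add: rep_ok_def window_zvec_append del: CkRm.simps)
 show "Drep (m + n) (%x. U (window m 0 x)) (rep_append m \<alpha> \<gamma>) = Drep m U \<alpha>"
  unfolding Drep_def fun_eq_iff sum_lessThan_add by (simp add: U rep_append_def)
 show "Drep (m + n) (%x. V (window n m x)) (rep_append m \<alpha> \<gamma>) = Drep n V \<gamma>"
  unfolding Drep_def fun_eq_iff sum_lessThan_add by (simp add: V rep_append_def)
qed

lemma Drep_add:
 assumes "rep_ok (Suc k) m U \<alpha>" "rep_ok (Suc k) m V \<alpha>"
 shows "Drep m (%x. U x + V x) \<alpha> g s = Drep m U \<alpha> g s + Drep m V \<alpha> g s"
proof -
 have "pd i (%x. U x + V x) (zvec m \<alpha> g) = pd i U (zvec m \<alpha> g) + pd i V (zvec m \<alpha> g)" if "i < m" for i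
  by (rule pd_eqI, intro DERIV_add CkRm_has_derivative_self) (use assms that in \<open>auto simp: rep_ok_def simp del: CkRm.simps\<close>)
 thus ?thesis by (simp add: Drep_def distrib_right sum.distrib)
qed

lemma Drep_mult:
 assumes "rep_ok (Suc k) m U \<alpha>" "rep_ok (Suc k) m V \<alpha>"
 shows "Drep m (%x. U x * V x) \<alpha> g s = zfun m U \<alpha> g * Drep m V \<alpha> g s + zfun m V \<alpha> g * Drep m U \<alpha> g s"
proof -
 have "pd i (%x. U x * V x) (zvec m \<alpha> g) = pd i U (zvec m \<alpha> g) * V (zvec m \<alpha> g) + pd i V (zvec m \<alpha> g) * U (zvec m \<alpha> g)" if i: "i < m" for i
 proof (rule pd_eqI)
  have U: "CkRm m (Suc k) U" "CkRm m (Suc k) V" using assms by (auto simp: rep_ok_def)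
  from DERIV_mult[OF CkRm_has_derivative_self[OF U(1) i zvec_Rm[of m \<alpha> g]] CkRm_has_derivative_self[OF U(2) i zvec_Rm[of m \<alpha> g]]]
  show "((%h. U ((zvec m \<alpha> g)(i := h)) * V ((zvec m \<alpha> g)(i := h))) has_real_derivative
    pd i U (zvec m \<alpha> g) * V (zvec m \<alpha> g) + pd i V (zvec m \<alpha> g) * U (zvec m \<alpha> g)) (at (zvec m \<alpha> g i))"
   by (simp only: fun_upd_triv)
 qed
 hence "Drep m (%x. U x * V x) \<alpha> g s = (\<Sum>i<m. U (zvec m \<alpha> g) * (pd i V (zvec m \<alpha> g) * deriv01 (\<alpha> i) (g s)) + V (zvec m \<alpha> g) * (pd i U (zvec m \<alpha> g) * deriv01 (\<alpha> i) (g s)))"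
  unfolding Drep_def by (intro sum.cong) (auto simp: algebra_simps)
 thus ?thesis by (simp add: Drep_def zfun_def sum.distrib sum_distrib_left)
qed

lemma Drep_cmult:
 assumes "rep_ok (Suc k) m U \<alpha>" shows "Drep m (%x. c * U x) \<alpha> g s = c * Drep m U \<alpha> g s"
proof -
 have "pd i (%x. c * U x) (zvec m \<alpha> g) = c * pd i U (zvec m \<alpha> g)" if "i < m" for i
  by (rule pd_eqI, intro DERIV_cmult CkRm_has_derivative_self) (use assms that in \<open>auto simp: rep_ok_def simp del: CkRm.simps\<close>)
 thus ?thesis by (simp add: Drep_def sum_distrib_left mult.assoc)
qed

lemma Drep_chain:
 assumes "rep_ok 1 m U \<alpha>" "!!x. (f has_real_derivative f' x) (at x)" "continuous_on UNIV f'"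
 shows "rep_ok 1 m (%x. f (U x)) \<alpha>" "Drep m (%x. f (U x)) \<alpha> g s = f' (zfun m U \<alpha> g) * Drep m U \<alpha> g s"
proof -
 have U: "CkRm m 1 U" using assms by (simp add: rep_ok_def)
 show "rep_ok 1 m (%x. f (U x)) \<alpha>" using assms(1) C1_chain_1d(1)[OF U assms(2,3)] by (simp add: rep_ok_def)
 show "Drep m (%x. f (U x)) \<alpha> g s = f' (zfun m U \<alpha> g) * Drep m U \<alpha> g s"
  unfolding Drep_def zfun_def sum_distrib_left
  by (intro sum.cong) (auto simp: C1_chain_1d(2)[OF U assms(2,3) _ zvec_Rm])
qed

text \<open>Over a common list of inner functions, sums and products of cylinder functions reduce to
  sums and products of the outer functions.\<close>

lemma zfun_common:
 assumes "rep_ok 1 m U \<alpha>" "rep_ok 1 n V \<gamma>"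
 obtains M U' V' A where "rep_ok 1 M U' A" "rep_ok 1 M V' A" "zfun M U' A = zfun m U \<alpha>" "zfun M V' A = zfun n V \<gamma>"
  "Drep M U' A = Drep m U \<alpha>" "Drep M V' A = Drep n V \<gamma>"
  "rep_inf0 m U \<alpha> ==> rep_inf0 n V \<gamma> ==> rep_inf0 M U' A \<and> rep_inf0 M V' A"
proof (rule that[of "m + n" "%x. U (window m 0 x)" "rep_append m \<alpha> \<gamma>" "%x. V (window n m x)"])
 show "rep_inf0 (m + n) (%x. U (window m 0 x)) (rep_append m \<alpha> \<gamma>) \<and> rep_inf0 (m + n) (%x. V (window n m x)) (rep_append m \<alpha> \<gamma>)"
  if "rep_inf0 m U \<alpha>" "rep_inf0 n V \<gamma>"
  using that rep_append_ok[of _ m U \<alpha> n V \<gamma>] by (auto simp: rep_inf0_def rep_append_def)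
qed (use assms rep_append_ok[of 1 m U \<alpha> n V \<gamma>] Drep_append[of 0 m U \<alpha> n V \<gamma>] in \<open>simp_all add: zfun_append\<close>)

lemma rep_ok_ops:
 assumes "rep_ok k m U \<alpha>" "rep_ok k m V \<alpha>"
 shows "rep_ok k m (%x. U x + V x) \<alpha>" "rep_ok k m (%x. U x * V x) \<alpha>" "rep_ok k m (%x. c * U x) \<alpha>"
 using assms by (auto simp: rep_ok_def intro: CkRm_add CkRm_mult CkRm_const)

lemma rep_inf0_ops:
 assumes "rep_inf0 m U \<alpha>" "rep_inf0 m V \<alpha>"
 shows "rep_inf0 m (%x. U x + V x) \<alpha>" "rep_inf0 m (%x. U x * V x) \<alpha>" "rep_inf0 m (%x. c * U x) \<alpha>"
 using assms by (auto simp: rep_inf0_def intro: rep_ok_ops(1,2) rep_ok_ops(3)[where V=U])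

lemma rep_inf0_ok: "rep_inf0 m U \<alpha> ==> rep_ok k m U \<alpha>" by (simp add: rep_inf0_def)

lemma ZsetE:
 assumes "u \<in> Zset 1" obtains m U \<alpha> where "rep_ok 1 m U \<alpha>" "u = zfun m U \<alpha>"
 using assms by (auto simp: Zset_def)

lemma Zinf0E:
 assumes "u \<in> Zinf0" obtains m U \<alpha> where "rep_inf0 m U \<alpha>" "u = zfun m U \<alpha>"
 using assms by (auto simp: Zinf0_def)

lemma ZsetI: "rep_ok 1 m U \<alpha> ==> zfun m U \<alpha> \<in> Zset 1" by (auto simp: Zset_def)

lemma Zinf0I: "rep_inf0 m U \<alpha> ==> zfun m U \<alpha> \<in> Zinf0" by (auto simp: Zinf0_def)

lemma Zinf0_subset: "Zinf0 \<subseteq> Zset 1"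
 by (auto simp: Zinf0_def Zset_def rep_inf0_def)

lemma Zinf0_ops:
 assumes "u \<in> Zinf0" "v \<in> Zinf0"
 shows "(%g. u g + v g) \<in> Zinf0" "(%g. u g * v g) \<in> Zinf0" "(%g. c * u g) \<in> Zinf0"
proof -
 obtain m U \<alpha> where u: "rep_inf0 m U \<alpha>" "u = zfun m U \<alpha>" using Zinf0E[OF assms(1)] by metis
 obtain n V \<gamma> where v: "rep_inf0 n V \<gamma>" "v = zfun n V \<gamma>" using Zinf0E[OF assms(2)] by metis
 obtain M U' V' A where c: "zfun M U' A = zfun m U \<alpha>" "zfun M V' A = zfun n V \<gamma>" "rep_inf0 M U' A" "rep_inf0 M V' A"
  using zfun_common[OF rep_inf0_ok[OF u(1)] rep_inf0_ok[OF v(1)]] u(1) v(1) by metis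
 note ops = rep_inf0_ops[OF c(3,4), THEN Zinf0I]
 show "(%g. u g + v g) \<in> Zinf0" "(%g. u g * v g) \<in> Zinf0" "(%g. c * u g) \<in> Zinf0"
  using ops(1,2) ops(3)[of c] unfolding u(2) v(2) c(1,2)[symmetric] by (simp_all add: zfun_def)
qed

lemma Zinf0_const: "(%_. c) \<in> Zinf0"
proof -
 have "rep_inf0 0 (%_. c) \<alpha>" for \<alpha> by (auto simp: rep_inf0_def rep_ok_def CkRm_const)
 from Zinf0I[OF this] show ?thesis by (simp add: zfun_def)
qed

lemma Zinf0_integral:
 assumes "!!k. Ck01 k \<gamma>" "deriv01 \<gamma> 0 = 0" "deriv01 \<gamma> 1 = 0"
 shows "(%g. integral {0..1} (%s. \<gamma> (g s))) \<in> Zinf0"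
proof -
 have "rep_inf0 1 (%x. x 0) (%_. \<gamma>)" using assms by (auto simp: rep_inf0_def rep_ok_def CkRm_coord)
 from Zinf0I[OF this] show ?thesis by (simp add: zfun_def zvec_def)
qed

section \<open>The space of distribution functions on the unit interval\<close>

lemma G0D:
 assumes "g \<in> G0"
 shows "x < 0 ==> g x = 0" "1 <= x ==> g x = 1" "0 <= g x" "g x <= 1"
proof -
 show 1: "x < 0 ==> g x = 0" "1 <= x ==> g x = 1" using assms by (auto simp: G0_def le_less)
 show "0 <= g x" "g x <= 1" using assms 1 by (cases "x < 0"; cases "1 <= x"; force simp: G0_def)+
qed

lemma G0_mono: assumes "g \<in> G0" "x <= y" shows "g x <= g y"
proof -
 consider "x < 0" | "1 <= y" | "x \<in> {0..<1}" "y \<in> {0..<1}" using assms(2) by force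
 thus ?thesis
 proof cases
  case 3 thus ?thesis using assms by (auto simp: G0_def mono_on_def)
 qed (use G0D[OF assms(1)] in auto)
qed

lemma G0_right_limit: assumes "g \<in> G0" shows "(g \<longlongrightarrow> g x) (at_right x)"
proof -
 consider "x < 0" | "1 <= x" | "x \<in> {0..<1}" by force
 thus ?thesis
 proof cases
  case 1
  have "\<forall>\<^sub>F y in at_right x. g y = g x"
   using eventually_at_right_real[OF 1] by eventually_elim (use G0D[OF assms] 1 in auto)
  thus ?thesis by (rule tendsto_eventually)
 next
  case 2
  have "\<forall>\<^sub>F y in at_right x. g y = g x"
   using eventually_at_right_less[of x] by eventually_elim (use G0D[OF assms] 2 in auto)
  thus ?thesis by (rule tendsto_eventually)
 next
  case 3 thus ?thesis using assms by (auto simp: G0_def continuous_within)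
 qed
qed

lemma G0_borel: "g \<in> G0 ==> g \<in> borel_measurable borel"
 by (rule borel_measurable_mono) (auto simp: mono_def G0_mono)

lemma space_Leb01: "space Leb01 = {0..1}" by (simp add: Leb01_def space_restrict_space)

lemma prob_space_Leb01: "prob_space Leb01"
 by (rule prob_spaceI) (simp add: Leb01_def emeasure_restrict_space space_restrict_space)

lemma borel_measurable_Leb01: "f \<in> borel_measurable borel ==> f \<in> borel_measurable Leb01"
 unfolding Leb01_def by (rule measurable_restrict_space1) simp

lemma LINT_Leb01: "(LINT s:{0..1}|lborel. f s) = (\<integral>s. f s \<partial>Leb01)" for f :: "real => real"
 unfolding Leb01_def by (simp add: integral_restrict_space set_lebesgue_integral_def)

lemma integrable_Leb01_bounded:
 fixes f :: "real => real"
 assumes "f \<in> borel_measurable Leb01" "!!s. s \<in> {0..1} ==> \<bar>f s\<bar> <= C" shows "integrable Leb01 f"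
proof -
 interpret prob_space Leb01 by (rule prob_space_Leb01)
 show ?thesis by (rule integrable_const_bound[of _ C]) (use assms in \<open>auto simp: space_Leb01\<close>)
qed

lemma integral_01_eq_Leb01:
 fixes f :: "real => real"
 assumes "f \<in> borel_measurable borel" "!!s. s \<in> {0..1} ==> \<bar>f s\<bar> <= C"
 shows "integral {0..1} f = (\<integral>s. f s \<partial>Leb01)"
proof -
 have "integrable Leb01 f" by (rule integrable_Leb01_bounded[OF borel_measurable_Leb01[OF assms(1)] assms(2)])
 hence "set_integrable lborel {0..1} f" by (simp add: Leb01_def integrable_restrict_space set_integrable_def)
 from set_borel_integral_eq_integral(2)[OF this] show ?thesis by (simp add: LINT_Leb01)
qed

section \<open>Continuous functionals and measurability of evaluations\<close>

lemma measurable_compose_G0: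
 fixes a :: "real => real"
 assumes "continuous_on {0..1} a" "g \<in> G0" shows "(%s. a (g s)) \<in> borel_measurable borel"
proof -
 have "(%x. a (unit_clamp x)) \<in> borel_measurable borel"
  by (intro borel_measurable_continuous_onI continuous_unit_clamp_compose assms)
 from measurable_compose[OF G0_borel[OF assms(2)] this] show ?thesis
  using G0D[OF assms(2)] by (simp add: unit_clamp_eq)
qed

lemma integral_compose_G0:
 fixes a :: "real => real"
 assumes "continuous_on {0..1} a" "g \<in> G0"
 shows "integral {0..1} (%s. a (g s)) = (\<integral>s. a (g s) \<partial>Leb01)" "integrable Leb01 (%s. a (g s))"
proof -
 obtain C where C: "!!x. x \<in> {0..1} ==> \<bar>a x\<bar> <= C" using bounded_on_01[OF assms(1)] by metis
 show "integral {0..1} (%s. a (g s)) = (\<integral>s. a (g s) \<partial>Leb01)"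
  by (rule integral_01_eq_Leb01[OF measurable_compose_G0[OF assms], of C]) (use C G0D[OF assms(2)] in auto)
 show "integrable Leb01 (%s. a (g s))"
  by (rule integrable_Leb01_bounded[OF borel_measurable_Leb01[OF measurable_compose_G0[OF assms]], of C]) (use C G0D[OF assms(2)] in auto)
qed

lemma dG0_sq:
 assumes "g \<in> G0" "h \<in> G0"
 shows "(dG0 g h)^2 = (\<integral>s. (g s - h s)^2 \<partial>Leb01)" "integrable Leb01 (%s. (g s - h s)^2)" "0 <= dG0 g h"
proof -
 note [measurable] = G0_borel[OF assms(1)] G0_borel[OF assms(2)]
 have b: "\<bar>(g s - h s)^2\<bar> <= 1" for s
 proof -
  have "\<bar>g s - h s\<bar> <= 1" using G0D(3,4)[OF assms(1), of s] G0D(3,4)[OF assms(2), of s] by linarith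
  thus ?thesis by (simp add: abs_square_le_1)
 qed
 have m: "(%s. (g s - h s)^2) \<in> borel_measurable borel" by measurable
 have eq: "integral {0..1} (%s. (g s - h s)^2) = (\<integral>s. (g s - h s)^2 \<partial>Leb01)" by (rule integral_01_eq_Leb01[OF m b])
 have "0 <= (\<integral>s. (g s - h s)^2 \<partial>Leb01)" by simp
 thus "(dG0 g h)^2 = (\<integral>s. (g s - h s)^2 \<partial>Leb01)" "0 <= dG0 g h" unfolding dG0_def eq by simp_all
 show "integrable Leb01 (%s. (g s - h s)^2)" by (rule integrable_Leb01_bounded[OF borel_measurable_Leb01[OF m] b])
qed

text \<open>Uniform continuity for close points, the bound 2C for distant ones. Integrated along g
  and h the right side becomes e + K times the squared distance \<open>dG0\<close>, which is how the
  L^2 distance controls nonlinear functionals.\<close>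

lemma continuous_quadratic_modulus:
 fixes a :: "real => real"
 assumes "continuous_on {0..1} a" "e > 0"
 obtains K where "0 <= K" "!!x y. x \<in> {0..1} ==> y \<in> {0..1} ==> \<bar>a x - a y\<bar> <= e + K * (x - y)^2"
proof -
 obtain C where C: "0 <= C" "!!x. x \<in> {0..1} ==> \<bar>a x\<bar> <= C" using bounded_on_01[OF assms(1)] by metis
 obtain d where d: "d > 0" "!!x y. x \<in> {0..1} ==> y \<in> {0..1} ==> dist y x < d ==> dist (a y) (a x) < e"
  using compact_uniformly_continuous[OF assms(1)] assms(2) unfolding uniformly_continuous_on_def by (metis compact_Icc)
 show ?thesis
 proof (rule that[of "2 * C / d^2"])
  fix x y :: real assume xy: "x \<in> {0..1}" "y \<in> {0..1}"
  show "\<bar>a x - a y\<bar> <= e + 2 * C / d^2 * (x - y)^2"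
  proof (cases "\<bar>x - y\<bar> < d")
   case True
   have "0 <= 2 * C / d^2 * (x - y)^2" using C by simp
   thus ?thesis using d(2)[OF xy(2,1)] True by (simp add: dist_real_def) 
  next
   case False
   hence "d^2 <= (x - y)^2" using d(1) abs_le_square_iff[of d "x - y"] by simp
   hence "1 <= (x - y)^2 / d^2" using d(1) by simp
   hence "2 * C * 1 <= 2 * C * ((x - y)^2 / d^2)" using C by (intro mult_left_mono) auto
   thus ?thesis using C(2)[OF xy(1)] C(2)[OF xy(2)] assms(2) by (simp add: abs_le_iff)
  qed
 qed (use C in simp)
qed

text \<open>The weight $w$ is needed to recover the evaluations $g(t)$ as limits of continuous functionals.\<close>

lemma cont_G0_weighted:
 fixes a :: "real => real"
 assumes a: "continuous_on {0..1} a" and w: "w \<in> borel_measurable borel" "!!s. \<bar>w s\<bar> <= 1"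
 shows "cont_G0 (%g. \<integral>s. w s * a (g s) \<partial>Leb01)"
 unfolding cont_G0_def
proof (intro ballI allI impI)
 interpret prob_space Leb01 by (rule prob_space_Leb01)
 fix g and e :: real assume g: "g \<in> G0" and e: "e > 0"
 obtain K where K: "0 <= K" "!!x y. x \<in> {0..1} ==> y \<in> {0..1} ==> \<bar>a x - a y\<bar> <= e / 2 + K * (x - y)^2"
  using continuous_quadratic_modulus[OF a half_gt_zero[OF e]] by metis
 obtain C where C: "0 <= C" "!!x. x \<in> {0..1} ==> \<bar>a x\<bar> <= C" using bounded_on_01[OF a] by metis
 \<comment> \<open>Chosen so that K d^2 < e/2; the denominator K + 1 covers K = 0.\<close>
 define d where "d = sqrt (e / (2 * (K + 1)))"
 have d: "d > 0" unfolding d_def using e K by simp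
 show "\<exists>d>0. \<forall>h\<in>G0. dG0 g h < d \<longrightarrow> \<bar>(\<integral>s. w s * a (h s) \<partial>Leb01) - (\<integral>s. w s * a (g s) \<partial>Leb01)\<bar> < e"
 proof (intro exI[of _ d] conjI ballI impI d)
  fix h assume h: "h \<in> G0" and dh: "dG0 g h < d"
  have i: "integrable Leb01 (%s. w s * a (f s))" if f: "f \<in> G0" for f
  proof (rule integrable_Leb01_bounded)
   show "(%s. w s * a (f s)) \<in> borel_measurable Leb01"
    by (rule borel_measurable_Leb01) (use w(1) measurable_compose_G0[OF a f] in measurable)
   show "\<bar>w s * a (f s)\<bar> <= 1 * C" for s unfolding abs_mult
    by (intro mult_mono w(2) C(2)) (use G0D[OF f] in auto)
  qed
  have "0 <= dG0 g h" by (rule dG0_sq(3)[OF g h])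
  hence "(dG0 g h)^2 < d^2" using dh by (intro power_strict_mono) auto
  hence q: "(\<integral>s. (g s - h s)^2 \<partial>Leb01) < e / (2 * (K + 1))" using e K by (simp add: d_def dG0_sq[OF g h])
  have "\<bar>(\<integral>s. w s * a (h s) \<partial>Leb01) - (\<integral>s. w s * a (g s) \<partial>Leb01)\<bar> = \<bar>\<integral>s. w s * a (h s) - w s * a (g s) \<partial>Leb01\<bar>"
   using i[OF h] i[OF g] by simp
  also have "\<dots> <= (\<integral>s. e / 2 + K * (g s - h s)^2 \<partial>Leb01)"
  proof (rule integral_abs_bound[THEN order_trans], rule integral_mono)
   show "integrable Leb01 (%s. \<bar>w s * a (h s) - w s * a (g s)\<bar>)" using i[OF h] i[OF g] by simp
   show "integrable Leb01 (%s. e / 2 + K * (g s - h s)^2)" using dG0_sq(2)[OF g h] by simp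
   fix s
   have "\<bar>w s * a (h s) - w s * a (g s)\<bar> <= 1 * \<bar>a (g s) - a (h s)\<bar>"
    unfolding right_diff_distrib[symmetric] abs_mult using w(2)[of s] by (intro mult_mono) auto
   also have "\<dots> <= e / 2 + K * (g s - h s)^2" using K(2)[of "g s" "h s"] G0D[OF g] G0D[OF h] by simp
   finally show "\<bar>w s * a (h s) - w s * a (g s)\<bar> <= e / 2 + K * (g s - h s)^2" .
  qed
  also have "\<dots> = e / 2 + K * (\<integral>s. (g s - h s)^2 \<partial>Leb01)" using dG0_sq(2)[OF g h] prob_space by simp
  also have "\<dots> <= e / 2 + K * (e / (2 * (K + 1)))" using q K by (intro add_left_mono mult_left_mono) auto
  also have "\<dots> < e / 2 + e / 2"
  proof -
   have "K * (e / (2 * (K + 1))) < (K + 1) * (e / (2 * (K + 1)))" using e K by (intro mult_strict_right_mono) auto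
   also have "\<dots> = e / 2" using K by (simp add: field_simps)
   finally show ?thesis by (rule add_strict_left_mono)
  qed
  finally show "\<bar>(\<integral>s. w s * a (h s) \<partial>Leb01) - (\<integral>s. w s * a (g s) \<partial>Leb01)\<bar> < e" by simp
 qed
qed

lemma cont_G0_integral:
 fixes a :: "real => real"
 assumes a: "continuous_on {0..1} a" shows "cont_G0 (%g. integral {0..1} (%s. a (g s)))"
 using cont_G0_weighted[OF a, of "%_. 1"] by (simp add: cont_G0_def integral_compose_G0[OF a])

lemma cont_G0_zfun_cont:
 assumes U: "cont_Rm m U" and a: "!!i. i < m ==> continuous_on {0..1} (\<alpha> i)"
 shows "cont_G0 (%g. U (zvec m \<alpha> g))"
 unfolding cont_G0_def
proof (intro ballI allI impI)
 fix g e assume g: "g \<in> G0" and e: "(0::real) < e"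
 obtain d where d: "d > 0" "!!y. y \<in> Rm m ==> (\<forall>i<m. \<bar>y i - zvec m \<alpha> g i\<bar> < d) ==> \<bar>U y - U (zvec m \<alpha> g)\<bar> < e"
  using U[unfolded cont_Rm_def, THEN bspec, OF zvec_Rm[of m \<alpha> g]] e by auto
 have "\<exists>\<delta>>0. \<forall>h\<in>G0. dG0 g h < \<delta> \<longrightarrow> \<bar>zvec m \<alpha> h i - zvec m \<alpha> g i\<bar> < d" if "i < m" for i
  using cont_G0_integral[OF a[OF that]] g d(1) that unfolding cont_G0_def zvec_def by auto
 then obtain \<delta> where \<delta>: "!!i. i < m ==> \<delta> i > 0" "!!i h. i < m ==> h \<in> G0 ==> dG0 g h < \<delta> i ==> \<bar>zvec m \<alpha> h i - zvec m \<alpha> g i\<bar> < d"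
  by metis
 define \<delta>' where "\<delta>' = Min (insert 1 (\<delta> ` {..<m}))"
 have "\<delta>' > 0" "!!i. i < m ==> \<delta>' <= \<delta> i" using \<delta>(1) by (auto simp: \<delta>'_def)
 thus "\<exists>d>0. \<forall>h\<in>G0. dG0 g h < d \<longrightarrow> \<bar>U (zvec m \<alpha> h) - U (zvec m \<alpha> g)\<bar> < e"
  by (intro exI[of _ \<delta>'] conjI ballI impI d(2)) (auto intro!: \<delta>(2) elim: less_le_trans)
qed

lemma cont_G0_zfun: "rep_ok k m U \<alpha> ==> cont_G0 (zfun m U \<alpha>)"
 unfolding zfun_def by (rule cont_G0_zfun_cont) (auto simp: rep_ok_def intro: CkRm_cont Ck01_continuous)

lemma cont_G0_seq:
 assumes "cont_G0 f" "g \<in> G0" "!!n. h n \<in> G0" "(%n. dG0 g (h n)) \<longlonglongrightarrow> 0"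
 shows "(%n. f (h n)) \<longlonglongrightarrow> f g"
proof (rule tendstoI)
 fix e :: real assume "e > 0"
 then obtain d where d: "d > 0" "\<forall>h\<in>G0. dG0 g h < d \<longrightarrow> \<bar>f h - f g\<bar> < e" using assms(1,2) unfolding cont_G0_def by blast
 have "\<forall>\<^sub>F n in sequentially. dG0 g (h n) < d" using order_tendstoD(2)[OF assms(4) d(1)] .
 thus "\<forall>\<^sub>F n in sequentially. dist (f (h n)) (f g) < e"
  by eventually_elim (use d(2) assms(3) in \<open>auto simp: dist_real_def\<close>)
qed

lemma cont_G0_measurable:
 assumes "space Q = G0" "sets Q = sigma_sets G0 G0_opens" "cont_G0 f"
 shows "f \<in> borel_measurable Q"
proof (rule borel_measurableI)
 fix S :: "real set" assume S: "open S"
 have "f -` S \<inter> G0 \<in> G0_opens" unfolding G0_opens_def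
 proof (intro CollectI conjI ballI)
  fix g assume g: "g \<in> f -` S \<inter> G0"
  then obtain e where e: "e > 0" "!!y. dist y (f g) < e ==> y \<in> S" using S unfolding open_dist by blast
  obtain d where "d > 0" "\<forall>h\<in>G0. dG0 g h < d \<longrightarrow> \<bar>f h - f g\<bar> < e" using assms(3) g e(1) unfolding cont_G0_def by blast
  thus "\<exists>d>0. \<forall>h\<in>G0. dG0 g h < d \<longrightarrow> h \<in> f -` S \<inter> G0" using e(2) by (auto simp: dist_real_def)
 qed simp
 thus "f -` S \<inter> space Q \<in> sets Q" by (simp add: assms sigma_sets.Basic)
qed

text \<open>An evaluation is not continuous for the L^2 distance, but it is the limit of the
  averages over [t, t + 1/n], which are. Monotonicity puts the average between g(t) and g(t + 1/n),
  and right continuity closes the gap.\<close>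

lemma eval_measurable:
 assumes Q: "space Q = G0" "sets Q = sigma_sets G0 G0_opens"
 shows "(%g. g t) \<in> borel_measurable Q"
proof -
 consider "t < 0" | "1 <= t" | "t \<in> {0..<1}" by force
 thus ?thesis
 proof cases
  case 1 thus ?thesis by (subst measurable_cong[where g="%_. 0"]) (auto simp: Q G0D)
 next
  case 2 thus ?thesis by (subst measurable_cong[where g="%_. 1"]) (auto simp: Q G0D)
 next
  case 3
  interpret prob_space Leb01 by (rule prob_space_Leb01)
  define F where "F n g = real n * (\<integral>s. indicator {t..t + 1 / real n} s * g s \<partial>Leb01)" for n g
  have [measurable]: "F n \<in> borel_measurable Q" for n
   unfolding F_def
   by (intro borel_measurable_times borel_measurable_const cont_G0_measurable[OF Q] cont_G0_weighted[where a="%x. x"]) (auto simp: indicator_def)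
  show ?thesis
  proof (rule borel_measurable_LIMSEQ_real)
   fix g assume "g \<in> space Q"
   hence g: "g \<in> G0" by (simp add: Q)
   obtain n0 where n0: "real n0 > 1 / (1 - t)" using reals_Archimedean2 by blast
   have fl: "filterlim (%n. t + 1 / real n) (at_right t) sequentially"
    unfolding filterlim_at
    using tendsto_add[OF tendsto_const[of t] lim_1_over_n] by (auto simp: eventually_sequentially intro!: exI[of _ 1])
   have up: "(%n. g (t + 1 / real n)) \<longlonglongrightarrow> g t"
    by (rule filterlim_compose[OF G0_right_limit[OF g] fl])
   have bds: "g t <= F n g \<and> F n g <= g (t + 1 / real n)" if n: "n \<ge> Suc n0" for n
   proof -
    have np: "real n > 0" "1 / real n <= 1 - t"
    proof -
     have "0 < 1 / (1 - t)" using 3 by simp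
     thus "real n > 0" using n by simp
     have "real n > 1 / (1 - t)" using n n0 by linarith
     hence "1 < real n * (1 - t)" using 3 by (simp add: field_simps)
     thus "1 / real n <= 1 - t" using \<open>real n > 0\<close> by (simp add: divide_le_eq mult.commute)
    qed
    have m: "measure Leb01 {t..t + 1 / real n} = 1 / real n"
     unfolding Leb01_def using 3 np by (subst measure_restrict_space) auto
    have sets: "{t..t + 1 / real n} \<in> sets Leb01" unfolding Leb01_def sets_restrict_space using 3 np by (auto intro!: image_eqI[of _ _ "{t..t + 1 / real n}"])
    have ic: "integrable Leb01 (%s. indicator {t..t + 1 / real n} s * c)" "(\<integral>s. indicator {t..t + 1 / real n} s * c \<partial>Leb01) = c / real n" for c :: real
     using sets m integrable_real_indicator[OF sets] by (auto simp: less_top[symmetric])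
    have ig: "integrable Leb01 (%s. indicator {t..t + 1 / real n} s * g s)"
     by (rule integrable_Leb01_bounded[where C=1], rule borel_measurable_Leb01)
      (use G0_borel[OF g] G0D[OF g] in \<open>auto simp: indicator_def\<close>)
    have "(\<integral>s. indicator {t..t + 1 / real n} s * g t \<partial>Leb01) <= (\<integral>s. indicator {t..t + 1 / real n} s * g s \<partial>Leb01)"
     by (rule integral_mono[OF ic(1) ig]) (auto simp: indicator_def intro: G0_mono[OF g])
    moreover have "(\<integral>s. indicator {t..t + 1 / real n} s * g s \<partial>Leb01) <= (\<integral>s. indicator {t..t + 1 / real n} s * g (t + 1 / real n) \<partial>Leb01)"
     by (rule integral_mono[OF ig ic(1)]) (auto simp: indicator_def intro: G0_mono[OF g])
    ultimately show ?thesis unfolding ic(2) F_def using np(1) by (simp add: field_simps)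
   qed
   show "(%n. F n g) \<longlonglongrightarrow> g t"
    by (rule tendsto_sandwich[OF _ _ tendsto_const up]) (use bds in \<open>auto simp: eventually_sequentially\<close>)
  qed measurable
 qed
qed

text \<open>Adding 1 to the floor keeps the grid point strictly to the right of x, so right
  continuity suffices.\<close>

lemma G0_grid_limit:
 assumes g: "g \<in> G0"
 shows "(%n. g (real_of_int (\<lfloor>real (Suc n) * x\<rfloor> + 1) / real (Suc n))) \<longlonglongrightarrow> g x"
proof -
 have b: "x < real_of_int (\<lfloor>real (Suc n) * x\<rfloor> + 1) / real (Suc n)"
  "real_of_int (\<lfloor>real (Suc n) * x\<rfloor> + 1) / real (Suc n) <= x + 1 / real (Suc n)" for n
  using floor_correct[of "real (Suc n) * x"] by (auto simp: field_simps simp del: of_nat_Suc)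
 have "(%n. real_of_int (\<lfloor>real (Suc n) * x\<rfloor> + 1) / real (Suc n)) \<longlonglongrightarrow> x"
 proof (rule tendsto_sandwich[OF _ _ tendsto_const])
  show "(%n. x + 1 / real (Suc n)) \<longlonglongrightarrow> x" using tendsto_add[OF tendsto_const[of x] LIMSEQ_Suc[OF lim_1_over_n]] by simp
 qed (use b in \<open>auto intro!: always_eventually less_imp_le simp del: of_nat_Suc\<close>)
 hence "filterlim (%n. real_of_int (\<lfloor>real (Suc n) * x\<rfloor> + 1) / real (Suc n)) (at_right x) sequentially"
  using b(1) by (auto simp: filterlim_at less_imp_neq[symmetric] simp del: of_nat_Suc)
 from filterlim_compose[OF G0_right_limit[OF g] this] show ?thesis .
qed

text \<open>For each n the grid point to the right of s takes countably many values, so joint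
  measurability of (g,s) to g(s) follows from measurability in g alone and the limit of
  \<open>G0_grid_limit\<close>.\<close>

lemma eval_pair_measurable:
 assumes Q: "space Q = G0" "sets Q = sigma_sets G0 G0_opens"
 shows "(%z. fst z (snd z)) \<in> borel_measurable (M2 Q)"
proof (rule borel_measurable_LIMSEQ_real)
 fix z assume "z \<in> space (M2 Q)"
 hence g: "fst z \<in> G0" by (auto simp: M2_def space_pair_measure Q)
 show "(%n. fst z (real_of_int (\<lfloor>real (Suc n) * snd z\<rfloor> + 1) / real (Suc n))) \<longlonglongrightarrow> fst z (snd z)"
  by (rule G0_grid_limit[OF g])
next
 fix n
 have s: "(%z. snd z) \<in> borel_measurable (M2 Q)"
  unfolding M2_def by (rule measurable_compose[OF measurable_snd borel_measurable_Leb01[of "%x. x"]]) simp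
 have e: "(%z. fst z t) \<in> borel_measurable (M2 Q)" for t
  unfolding M2_def by (rule measurable_compose[OF measurable_fst eval_measurable[OF Q]])
 show "(%z. fst z (real_of_int (\<lfloor>real (Suc n) * snd z\<rfloor> + 1) / real (Suc n))) \<in> borel_measurable (M2 Q)"
  by (rule measurable_compose_countable[where g="%z. \<lfloor>real (Suc n) * snd z\<rfloor>" and f="%k z. fst z (real_of_int (k + 1) / real (Suc n))", OF e])
   (use s in measurable)
qed


section \<open>Compactness and uniform density of flat cylinder functions\<close>

lemma G0_Helly:
 assumes g: "!!n::nat. g n \<in> G0"
 obtains r F where "strict_mono r" "F \<in> G0" "(%n. dG0 F (g (r n))) \<longlonglongrightarrow> 0"
proof -
 have "\<exists>s. strict_mono (s::nat => nat) \<and> (\<exists>F. (\<forall>x. continuous (at_right x) F) \<and> mono F \<and> (\<forall>x. \<bar>F x\<bar> <= 1) \<and>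
  (\<forall>x. continuous (at x) F \<longrightarrow> (%n. g (s n) x) \<longlonglongrightarrow> F x))"
 proof (rule Helly_selection)
  show "continuous (at_right x) (g n)" for n x using G0_right_limit[OF g] by (simp add: continuous_within)
  show "mono (g n)" for n by (rule monoI) (rule G0_mono[OF g])
  show "\<bar>g n x\<bar> <= 1" for n x using G0D(3,4)[OF g[of n], of x] by simp
 qed
 then obtain s F where s: "strict_mono (s::nat => nat)" and F: "!!x. continuous (at_right x) F" "mono F"
  "!!x. continuous (at x) F ==> (%n. g (s n) x) \<longlonglongrightarrow> F x" by blast
 have ct: "countable {a. \<not> isCont F a}" using mono_ctble_discont[OF F(2)] .
 \<comment> \<open>Helly's theorem gives convergence only at continuity points of F. These are
   dense, so monotonicity transfers the prescribed values outside [0,1] to every point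
   there.\<close>
 have pick: "\<exists>y. a < y \<and> y < b \<and> isCont F y" if "a < b" for a b
 proof -
  have "uncountable ({a<..<b} - {a. \<not> isCont F a})"
   using uncountable_open_interval[of a b] that ct by (simp add: uncountable_minus_countable)
  hence "{a<..<b} - {a. \<not> isCont F a} \<noteq> {}" by force
  thus ?thesis by auto
 qed
 have c0: "F y = 0" if "isCont F y" "y < 0" for y
  using F(3)[OF that(1)] G0D(1)[OF g that(2)] LIMSEQ_unique[OF tendsto_const] by fastforce
 have c1: "F y = 1" if "isCont F y" "1 <= y" for y
  using F(3)[OF that(1)] G0D(2)[OF g that(2)] LIMSEQ_unique[OF tendsto_const] by fastforce
 have F0: "F x = 0" if x: "x < 0" for x
 proof (rule antisym)
  obtain y where "x < y" "y < 0" "isCont F y" using pick[OF x] by auto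
  thus "F x <= 0" using c0[of y] monoD[OF F(2), of x y] by simp
  obtain y where "x - 1 < y" "y < x" "isCont F y" using pick[of "x - 1" x] by auto
  thus "0 <= F x" using c0[of y] monoD[OF F(2), of y x] x by simp
 qed
 have F1: "F x = 1" if x: "1 < x" for x
 proof (rule antisym)
  obtain y where "x < y" "isCont F y" using pick[of x "x + 1"] by auto
  thus "F x <= 1" using c1[of y] monoD[OF F(2), of x y] x by simp
  obtain y where "1 < y" "y < x" "isCont F y" using pick[OF x] by auto
  thus "1 <= F x" using c1[of y] monoD[OF F(2), of y x] by simp
 qed
 \<comment> \<open>The point 1 may be a discontinuity of F; its value comes from the right, where F
   is 1.\<close>
 have F11: "F 1 = 1"
 proof -
  have "(F \<longlongrightarrow> F 1) (at_right 1)" using F(1)[of 1] by (simp add: continuous_within)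
  moreover have "(F \<longlongrightarrow> 1) (at_right 1)"
   by (rule tendsto_eventually, rule eventually_mono[OF eventually_at_right_less[of 1]]) (rule F1)
  ultimately show ?thesis using tendsto_unique[OF trivial_limit_at_right_real] by blast
 qed
 have FG: "F \<in> G0" unfolding G0_def
 proof (intro CollectI conjI ballI allI impI)
  show "F 1 = 1" by (rule F11)
  show "F x = 0" if "x < 0" for x using F0[OF that] .
  show "F x = 1" if "1 < x" for x using F1[OF that] .
  show "mono_on {0..<1} F" using F(2) by (simp add: mono_on_def monoD)
  fix x :: real assume x: "x \<in> {0..<1}"
  show "continuous (at_right x) F" by (rule F)
  show "0 <= F x" using monoD[OF F(2), of "-1" x] F0[of "-1"] x by simp
  show "F x <= 1" using monoD[OF F(2), of x 2] F1[of 2] x by simp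
 qed
 have "(%n. (dG0 F (g (s n)))^2) \<longlonglongrightarrow> 0"
 proof -
  have [measurable]: "F \<in> borel_measurable Leb01" "g n \<in> borel_measurable Leb01" for n
   using borel_measurable_Leb01 G0_borel FG g by auto
  have "AE x in lborel. x \<notin> {a. \<not> isCont F a}"
   by (intro AE_not_in countable_imp_null_set_lborel ct)
  hence ae: "AE x in Leb01. isCont F x" unfolding Leb01_def by (subst AE_restrict_space_iff) auto
  have "(%n. \<integral>x. (F x - g (s n) x)^2 \<partial>Leb01) \<longlonglongrightarrow> (\<integral>x. 0 \<partial>Leb01)"
  proof (rule integral_dominated_convergence[where w="%_. 1"])
   interpret prob_space Leb01 by (rule prob_space_Leb01)
   show "integrable Leb01 (%_. 1::real)" by simp
   show "AE x in Leb01. (%n. (F x - g (s n) x)^2) \<longlonglongrightarrow> 0" using ae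
   proof eventually_elim
    fix x assume "isCont F x"
    from tendsto_power[OF tendsto_diff[OF tendsto_const[of "F x"] F(3)[OF this]], of 2]
    show "(%n. (F x - g (s n) x)^2) \<longlonglongrightarrow> 0" by simp
   qed
   show "AE x in Leb01. norm ((F x - g (s n) x)^2) <= 1" for n
   proof (rule AE_I2)
    fix x
    have "\<bar>F x - g (s n) x\<bar> <= 1" using G0D(3,4)[OF FG, of x] G0D(3,4)[OF g[of "s n"], of x] by linarith
    thus "norm ((F x - g (s n) x)^2) <= 1" by (simp add: abs_square_le_1)
   qed
  qed measurable
  thus ?thesis by (simp add: dG0_sq(1)[OF FG g])
 qed
 hence "(%n. dG0 F (g (s n))) \<longlonglongrightarrow> 0" by simp
 thus ?thesis using that[OF s FG] by blast
qed

text \<open>If g(t) < c < b = h(t), take a = 1 below c, a = 0 above b and linear in between. By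
  right continuity g stays below c up to some t' > t, so the integral of a(g) is at least t', while
  that of a(h) is at most t.\<close>

lemma G0_eqI:
 assumes g: "g \<in> G0" and h: "h \<in> G0"
  and eq: "!!a. continuous_on {0..1} a ==> (\<integral>s. a (g s) \<partial>Leb01) = (\<integral>s. a (h s :: real) \<partial>Leb01 :: real)"
 shows "g = h"
proof -
 interpret prob_space Leb01 by (rule prob_space_Leb01)
 have not_less: "\<not> g t < h t" if g: "g \<in> G0" and h: "h \<in> G0"
  and eq: "!!a. continuous_on {0..1} a ==> (\<integral>s. a (g s) \<partial>Leb01) = (\<integral>s. a (h s :: real) \<partial>Leb01 :: real)" for g h t
 proof
  assume lt: "g t < h t"
  have t: "0 <= t" "t < 1" using lt G0D[OF g, of t] G0D[OF h, of t] by (linarith | force)+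
  define b where "b = h t"
  define c where "c = (g t + b) / 2"
  have c: "g t < c" "c < b" using lt by (auto simp: c_def b_def)
  define a where "a x = max 0 (min 1 ((b - x) / (b - c)))" for x
  have ac: "continuous_on {0..1} a" unfolding a_def using c by (intro continuous_intros) auto
  have "\<forall>\<^sub>F y in at_right t. g y < c" using order_tendstoD(2)[OF G0_right_limit[OF g] c(1)] .
  moreover have "\<forall>\<^sub>F y in at_right t. y \<in> {t<..<1}" using eventually_at_right_real[OF t(2)] .
  ultimately have "\<forall>\<^sub>F y in at_right t. g y < c \<and> y \<in> {t<..<1}" by eventually_elim simp
  from eventually_happens'[OF _ this] obtain t' where t': "g t' < c" "t < t'" "t' < 1"
   by (auto simp: trivial_limit_at_right_real)
  have ms: "measure Leb01 {0..u} = u" "{0..u} \<in> sets Leb01" if "0 <= u" "u <= 1" for u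
   using that unfolding Leb01_def by (subst measure_restrict_space, auto simp: sets_restrict_space intro!: image_eqI[of _ _ "{0..u}"])
  have ii: "integrable Leb01 (indicator {0..u} :: real => real)" if "0 <= u" "u <= 1" for u
   using integrable_real_indicator[OF ms(2)[OF that]] by (simp add: less_top[symmetric])
  have "t' = (\<integral>s. indicator {0..t'} s \<partial>Leb01)" using ms[of t'] t t' by simp
  also have "\<dots> <= (\<integral>s. a (g s) \<partial>Leb01)"
  proof (rule integral_mono[OF ii integral_compose_G0(2)[OF ac g]])
   fix s
   have "g s <= c" if "s <= t'" using G0_mono[OF g that] t' by simp
   hence "a (g s) = 1" if "s <= t'" using that c by (simp add: a_def)
   thus "indicator {0..t'} s <= a (g s)" by (auto simp: indicator_def a_def)
  qed (use t t' in auto)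
  also have "\<dots> = (\<integral>s. a (h s) \<partial>Leb01)" by (rule eq[OF ac])
  also have "\<dots> <= (\<integral>s. indicator {0..t} s \<partial>Leb01)"
  proof (rule integral_mono[OF integral_compose_G0(2)[OF ac h] ii])
   fix s assume s: "s \<in> space Leb01"
   have "a (h s) = 0" if "t < s"
   proof -
    have "(b - h s) / (b - c) <= 0"
     using G0_mono[OF h, of t s] that c by (intro divide_nonpos_pos) (auto simp: b_def)
    thus ?thesis by (simp add: a_def)
   qed
   thus "a (h s) <= indicator {0..t} s" using s by (auto simp: indicator_def a_def space_Leb01)
  qed (use t in auto)
  also have "\<dots> = t" using ms[of t] t by simp
  finally show False using t'(2) by simp
 qed
 show ?thesis
  by (rule ext) (meson not_less[OF g h eq] not_less[OF h g eq[symmetric]] linorder_neqE)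
qed

text \<open>Stone-Weierstrass speaks of subsets of a topological type, whereas \<open>G0\<close> is
  a set with the distance function \<open>dG0\<close>. So f is transported to a compact set of
  sequences. Flat functions approximate powers only pointwise, but that is enough to separate
  points, and the theorem supplies uniformity.\<close>

theorem Zinf0_uniformly_dense:
 assumes f: "cont_G0 f" and e: "e > 0"
 shows "\<exists>h\<in>Zinf0. \<forall>g\<in>G0. \<bar>f g - h g\<bar> < e"
proof -
 text \<open>Countably many flat functions separate the points of \<^const>\<open>G0\<close>, so that \<^const>\<open>G0\<close> embeds into a
  space of sequences.\<close>
 define good where "good j p \<longleftrightarrow> (\<forall>n k. Ck01 k (fst p n)) \<and> (\<forall>n. deriv01 (fst p n) 0 = 0) \<and> (\<forall>n. deriv01 (fst p n) 1 = 0) \<and>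
  (\<forall>n x. x \<in> {0..1} \<longrightarrow> \<bar>fst p n x\<bar> <= snd p) \<and> (\<forall>x. x \<in> {0..1} \<longrightarrow> (%n::nat. fst p n x) \<longlonglongrightarrow> x ^ j)"
  for j :: nat and p :: "(nat => real => real) \<times> real"
 have "\<exists>p. good j p" for j
 proof -
  have "real_polynomial_function (%x::real. x ^ j)"
   by (intro real_polynomial_function_power real_polynomial_function.intros bounded_linear_ident)
  then obtain \<gamma> :: "nat => real => real" and C where "!!n k. Ck01 k (\<gamma> n)" "!!n. deriv01 (\<gamma> n) 0 = 0" "!!n. deriv01 (\<gamma> n) 1 = 0"
   "!!n x. x \<in> {0..1} ==> \<bar>\<gamma> n x\<bar> <= C" "!!x. x \<in> {0..1} ==> (%n. \<gamma> n x) \<longlonglongrightarrow> x ^ j"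
   by (rule Ck01_approx_flat[OF Ck01_polynomial]) (blast intro: that)
  thus ?thesis by (intro exI[of _ "(\<gamma>, C)"]) (auto simp: good_def)
 qed
 then obtain p where p: "!!j. good j (p j)" by metis
 define \<gamma> where "\<gamma> j = fst (p j)" for j
 define C where "C j = snd (p j)" for j
 have \<gamma>: "!!j n k. Ck01 k (\<gamma> j n)" "!!j n. deriv01 (\<gamma> j n) 0 = 0" "!!j n. deriv01 (\<gamma> j n) 1 = 0"
  "!!j n x. x \<in> {0..1} ==> \<bar>\<gamma> j n x\<bar> <= C j" "!!j x. x \<in> {0..1} ==> (%n::nat. \<gamma> j n x) \<longlonglongrightarrow> x ^ j"
  using p unfolding good_def \<gamma>_def C_def by blast+
 define \<Phi> where "\<Phi> g i = integral {0..1} (%s. \<gamma> (fst (prod_decode i)) (snd (prod_decode i)) (g s))" for g :: "real => real" and i :: nat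
 have \<Phi>_Z: "(%g. \<Phi> g i) \<in> Zinf0" for i unfolding \<Phi>_def by (rule Zinf0_integral) (use \<gamma> in auto)
 have \<Phi>_cont: "cont_G0 (%g. \<Phi> g i)" for i
  unfolding \<Phi>_def by (rule cont_G0_integral[OF Ck01_continuous[OF \<gamma>(1)]])
 have inj: "g = h" if g: "g \<in> G0" and h: "h \<in> G0" and eq: "\<Phi> g = \<Phi> h" for g h
 proof (rule G0_eqI[OF g h])
  interpret prob_space Leb01 by (rule prob_space_Leb01)
  fix a :: "real => real" assume a: "continuous_on {0..1} a"
  \<comment> \<open>Bounded pointwise convergence of the flat functions to x^j recovers the moments
    of g, and the Weierstrass theorem then recovers the integral of a(g) for every continuous
    a.\<close>
  have pw: "(\<integral>s. g s ^ j \<partial>Leb01) = (\<integral>s. h s ^ j \<partial>Leb01)" for j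
  proof -
   have cj: "continuous_on {0..1} (%x::real. x ^ j)" by (intro continuous_intros)
   have lim: "(%n. \<integral>s. \<gamma> j n (f s) \<partial>Leb01) \<longlonglongrightarrow> (\<integral>s. f s ^ j \<partial>Leb01)" if f: "f \<in> G0" for f
   proof (rule integral_dominated_convergence[where w="%_. C j"])
    show "(%s. f s ^ j) \<in> borel_measurable Leb01" "(%s. \<gamma> j n (f s)) \<in> borel_measurable Leb01" for n
     using borel_measurable_Leb01[OF measurable_compose_G0[OF _ f]] Ck01_continuous[OF \<gamma>(1)] cj by blast+
   qed (use \<gamma>(4,5) G0D[OF f] in auto)
   have "(\<integral>s. \<gamma> j n (g s) \<partial>Leb01) = (\<integral>s. \<gamma> j n (h s) \<partial>Leb01)" for n
    using fun_cong[OF eq, of "prod_encode (j, n)"] integral_compose_G0(1)[OF Ck01_continuous[OF \<gamma>(1)]] g h by (simp add: \<Phi>_def)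
   thus ?thesis using LIMSEQ_unique[OF lim[OF g]] lim[OF h] by simp
  qed
  have poly: "(\<integral>s. p (g s) \<partial>Leb01) = (\<integral>s. p (h s) \<partial>Leb01)" if rp: "real_polynomial_function p" for p
  proof -
   obtain c n where p: "p = (%x. \<Sum>i\<le>n. c i * x ^ i)"
    using real_polynomial_function_iff_sum[THEN iffD1, OF rp] by blast
   have i: "integrable Leb01 (%s. f s ^ i)" if "f \<in> G0" for f i
    by (rule integral_compose_G0(2)[OF _ that]) (intro continuous_intros)
   show ?thesis unfolding p using i g h by (simp add: pw)
  qed
  have "\<bar>(\<integral>s. a (g s) \<partial>Leb01) - (\<integral>s. a (h s) \<partial>Leb01)\<bar> <= 0 + 2 * e" if e: "e > 0" for e
  proof -
   obtain p where p: "real_polynomial_function p" "!!x. x \<in> {0..1} ==> \<bar>a x - p x\<bar> < e"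
    using Stone_Weierstrass_real_polynomial_function[OF _ a e] by (metis compact_Icc)
   have b: "\<bar>(\<integral>s. a (f s) \<partial>Leb01) - (\<integral>s. p (f s) \<partial>Leb01)\<bar> <= e" if f: "f \<in> G0" for f
   proof -
    note i = integral_compose_G0(2)[OF a f] integral_compose_G0(2)[OF Ck01_continuous[OF Ck01_polynomial[OF p(1), of 0]] f]
    have "\<bar>(\<integral>s. a (f s) \<partial>Leb01) - (\<integral>s. p (f s) \<partial>Leb01)\<bar> = \<bar>\<integral>s. a (f s) - p (f s) \<partial>Leb01\<bar>" using i by simp
    also have "\<dots> <= (\<integral>s. e \<partial>Leb01)"
     by (rule integral_abs_bound[THEN order_trans], rule integral_mono) (use i p(2) G0D[OF f] in \<open>auto intro: less_imp_le\<close>)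
    finally show ?thesis using prob_space by simp
   qed
   show ?thesis using b[OF g] b[OF h] poly[OF p(1)] by simp
  qed
  hence "\<bar>(\<integral>s. a (g s) \<partial>Leb01) - (\<integral>s. a (h s) \<partial>Leb01)\<bar> <= 0 + e" if "e > 0" for e
   using half_gt_zero[OF that] by fastforce
  from field_le_epsilon[OF this] show "(\<integral>s. a (g s) \<partial>Leb01) = (\<integral>s. a (h s) \<partial>Leb01)" by simp
 qed
 define S where "S = \<Phi> ` G0"
 define F where "F x = f (inv_into G0 \<Phi> x)" for x
 have inv: "inv_into G0 \<Phi> (\<Phi> g) = g" if "g \<in> G0" for g
  by (rule inv_into_f_f[OF inj_onI that]) (rule inj)
 have sub: "\<exists>r g. strict_mono r \<and> g \<in> G0 \<and> (%n. \<Phi> (gs (r n))) \<longlonglongrightarrow> \<Phi> g \<and> (%n. f (gs (r n))) \<longlonglongrightarrow> f g" if gs: "!!n::nat. gs n \<in> G0" for gs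
 proof -
  obtain r g where r: "strict_mono r" "g \<in> G0" "(%n. dG0 g (gs (r n))) \<longlonglongrightarrow> 0" 
   by (rule G0_Helly[of gs, OF gs]) (blast intro: that)
  have "(%n. \<Phi> (gs (r n)) i) \<longlonglongrightarrow> \<Phi> g i" for i by (rule cont_G0_seq[OF \<Phi>_cont r(2) gs r(3)])
  hence "limitin (product_topology (%_. euclidean) UNIV) (%n. \<Phi> (gs (r n))) (\<Phi> g) sequentially"
   unfolding limitin_componentwise by simp
  hence "(%n. \<Phi> (gs (r n))) \<longlonglongrightarrow> \<Phi> g" by (simp add: euclidean_product_topology)
  thus ?thesis using r cont_G0_seq[OF f r(2) gs r(3)] by blast
 qed
 have "seq_compact S" unfolding seq_compact_def
 proof (intro allI impI)
  fix y :: "nat => nat => real" assume "\<forall>n. y n \<in> S"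
  then obtain gs where gs: "!!n. gs n \<in> G0" "!!n. y n = \<Phi> (gs n)"
   using choice[of "%n g. g \<in> G0 \<and> y n = \<Phi> g"] unfolding S_def by blast
  from sub[of gs, OF gs(1)] show "\<exists>l\<in>S. \<exists>r. strict_mono r \<and> (y \<circ> r) \<longlonglongrightarrow> l"
   by (auto simp: S_def o_def gs(2))
 qed
 hence S: "compact S" by (simp add: compact_eq_seq_compact_metric)
 \<comment> \<open>Continuity of the inverse of \<Phi> is replaced by compactness: a sequence
   violating continuity at x has a subsequence whose preimages converge in \<open>G0\<close>, and
   the limit can only be the preimage of x.\<close>
 have Fc: "continuous_on S F" unfolding continuous_on_iff
 proof (rule ccontr)
  assume "\<not> (\<forall>x\<in>S. \<forall>e>0. \<exists>d>0. \<forall>x'\<in>S. dist x' x < d \<longrightarrow> dist (F x') (F x) < e)"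
  then obtain x e where x: "x \<in> S" "e > 0" "!!d. d > 0 ==> \<exists>x'\<in>S. dist x' x < d \<and> \<not> dist (F x') (F x) < e" by blast
  have "\<exists>y. y \<in> S \<and> dist y x < 1 / real (Suc n) \<and> \<not> dist (F y) (F x) < e" for n using x(3)[of "1 / real (Suc n)"] by auto
  then obtain y where y: "!!n. y n \<in> S" "!!n. dist (y n) x < 1 / real (Suc n)" "!!n. \<not> dist (F (y n)) (F x) < e" by metis
  obtain gs where gs: "!!n. gs n \<in> G0" "!!n. y n = \<Phi> (gs n)" 
   using choice[of "%n g. g \<in> G0 \<and> y n = \<Phi> g"] y(1) unfolding S_def by blast
  obtain r g where r: "strict_mono r" "g \<in> G0" "(%n. \<Phi> (gs (r n))) \<longlonglongrightarrow> \<Phi> g" "(%n. f (gs (r n))) \<longlonglongrightarrow> f g" using sub[of gs, OF gs(1)] by blast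
  have "(%n. dist (y n) x) \<longlonglongrightarrow> 0"
   by (rule tendsto_sandwich[OF _ _ tendsto_const LIMSEQ_Suc[OF lim_1_over_n]]) (use y(2) in \<open>auto intro!: always_eventually less_imp_le simp del: of_nat_Suc\<close>)
  hence "y \<longlonglongrightarrow> x" by (rule tendsto_dist_iff[THEN iffD2])
  hence "(%n. \<Phi> (gs (r n))) \<longlonglongrightarrow> x" using LIMSEQ_subseq_LIMSEQ[OF _ r(1)] by (simp add: o_def gs(2)[symmetric])
  hence "x = \<Phi> g" using r(3) LIMSEQ_unique by blast
  hence "F x = f g" using inv[OF r(2)] by (simp add: F_def)
  moreover have "F (y n) = f (gs n)" for n using inv[OF gs(1)] by (simp add: F_def gs(2))
  ultimately have "\<forall>\<^sub>F n in sequentially. dist (F (y (r n))) (F x) < e" using tendstoD[OF r(4) x(2)] by simp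
  thus False using y(3) by simp
 qed
 define R where "R = {F. continuous_on S F \<and> (\<exists>h\<in>Zinf0. \<forall>g\<in>G0. F (\<Phi> g) = h g)}"
 interpret function_ring_on R S
 proof
  show "compact S" by (rule S)
  show "continuous_on S F" if "F \<in> R" for F using that by (simp add: R_def)
  fix F F' assume FF: "F \<in> R" "F' \<in> R"
  then obtain h h' where h: "h \<in> Zinf0" "h' \<in> Zinf0" "\<forall>g\<in>G0. F (\<Phi> g) = h g" "\<forall>g\<in>G0. F' (\<Phi> g) = h' g" by (auto simp: R_def)
  have c: "continuous_on S F" "continuous_on S F'" using FF by (auto simp: R_def)
  show "(%x. F x + F' x) \<in> R" unfolding R_def using Zinf0_ops(1)[OF h(1,2)] h(3,4)
   by (auto intro!: continuous_on_add c bexI[of _ "%g. h g + h' g"])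
  show "(%x. F x * F' x) \<in> R" unfolding R_def using Zinf0_ops(2)[OF h(1,2)] h(3,4)
   by (auto intro!: continuous_on_mult c bexI[of _ "%g. h g * h' g"])
 next
  show "(%_. c) \<in> R" for c unfolding R_def using Zinf0_const[of c] by (auto intro!: bexI[of _ "%_. c"])
 next
  fix x y assume "x \<in> S" "y \<in> S" "x \<noteq> y"
  then obtain i where "x i \<noteq> y i" by auto
  moreover have "(%x. x i) \<in> R"
  proof -
   have "continuous_on S (%x. x i)"
    by (rule continuous_on_subset[OF continuous_on_product_coordinates]) simp
   thus ?thesis unfolding R_def
    by (intro CollectI conjI bexI[OF _ \<Phi>_Z[of i]]) simp_all
  qed
  ultimately show "\<exists>f\<in>R. f x \<noteq> f y" by (intro bexI[of _ "%x. x i"])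
 qed
 obtain H where H: "H \<in> R" "\<forall>x\<in>S. \<bar>F x - H x\<bar> < e" using Stone_Weierstrass_basic[OF Fc e] by blast
 then obtain h where "h \<in> Zinf0" "\<forall>g\<in>G0. H (\<Phi> g) = h g" by (auto simp: R_def)
 thus ?thesis using H(2) inv unfolding S_def F_def by (intro bexI[of _ h]) auto
qed


section \<open>Density of flat cylinder functions in L^2\<close>

lemma rep_ok_cont:
 assumes "rep_ok k m U \<alpha>" shows "cont_Rm m U" "i < m ==> continuous_on {0..1} (\<alpha> i)"
 using assms CkRm_cont Ck01_continuous unfolding rep_ok_def by blast+

lemma zvec_in_box:
 assumes "!!i. i < m ==> continuous_on {0..1} (\<alpha> i)"
 obtains R where "R > 0" "!!g. g \<in> G0 ==> zvec m \<alpha> g \<in> Rm_box m R"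
proof -
 interpret prob_space Leb01 by (rule prob_space_Leb01)
 have "\<exists>C. \<forall>x\<in>{0..1}. \<bar>\<alpha> i x\<bar> <= C" if "i < m" for i using bounded_on_01[OF assms[OF that]] by metis
 then obtain C where C: "!!i x. i < m ==> x \<in> {0..1} ==> \<bar>\<alpha> i x\<bar> <= C i" by metis
 define R where "R = 1 + (\<Sum>i<m. \<bar>C i\<bar>)"
 have R: "\<bar>C i\<bar> <= R" if "i < m" for i
  using member_le_sum[of i "{..<m}" "%i. \<bar>C i\<bar>"] that by (simp add: R_def)
 show ?thesis
 proof (rule that[of R])
  show "R > 0" unfolding R_def by (simp add: add_pos_nonneg sum_nonneg)
  fix g assume g: "g \<in> G0"
  have "\<bar>zvec m \<alpha> g i\<bar> <= R" if i: "i < m" for i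
  proof -
   have "\<bar>\<integral>s. \<alpha> i (g s) \<partial>Leb01\<bar> <= (\<integral>s. C i \<partial>Leb01)"
    by (rule integral_abs_bound[THEN order_trans], rule integral_mono)
     (use integral_compose_G0(2)[OF assms[OF i] g] C[OF i] G0D[OF g] in auto)
   thus ?thesis using R[OF i] i prob_space by (simp add: zvec_def integral_compose_G0(1)[OF assms[OF i] g])
  qed
  thus "zvec m \<alpha> g \<in> Rm_box m R" by (simp add: Rm_box_def)
 qed
qed

lemma zfun_bounded:
 assumes "cont_Rm m U" "!!i. i < m ==> continuous_on {0..1} (\<alpha> i)"
 obtains C where "!!g. g \<in> G0 ==> \<bar>U (zvec m \<alpha> g)\<bar> <= C"
proof -
 obtain R where R: "!!g. g \<in> G0 ==> zvec m \<alpha> g \<in> Rm_box m R" 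
  using zvec_in_box[of m \<alpha>, OF assms(2)] by blast
 obtain C where "!!x. x \<in> Rm_box m R ==> \<bar>U x\<bar> <= C" using cont_Rm_bounded[OF assms(1), of R] by blast
 thus ?thesis using that R by blast
qed

lemma Zset_bounded:
 assumes "u \<in> Zset 1" obtains C where "!!g. g \<in> G0 ==> \<bar>u g\<bar> <= C"
proof -
 obtain m U \<alpha> where u: "rep_ok 1 m U \<alpha>" "u = zfun m U \<alpha>" using ZsetE[OF assms] by metis
 have c: "cont_Rm m U" "!!i. i < m ==> continuous_on {0..1} (\<alpha> i)"
  using rep_ok_cont[OF u(1)] by blast+
 show ?thesis using zfun_bounded[of m U \<alpha>, OF c] that unfolding u(2) zfun_def by blast
qed

lemma Zset_cont: "u \<in> Zset 1 ==> cont_G0 u"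
 using cont_G0_zfun by (auto simp: Zset_def)

lemma L2_Minkowski:
 assumes "L2 M f" "L2 M g"
 shows "sqrt (\<integral>x. (f x + g x)^2 \<partial>M) <= sqrt (\<integral>x. (f x)^2 \<partial>M) + sqrt (\<integral>x. (g x)^2 \<partial>M)"
proof -
 let ?a = "\<integral>x. (f x)^2 \<partial>M" and ?c = "\<integral>x. (g x)^2 \<partial>M" and ?b = "\<integral>x. f x * g x \<partial>M"
 have "(\<integral>x. (f x + g x)^2 \<partial>M) = (\<integral>x. (f x)^2 + 2 * (f x * g x) + (g x)^2 \<partial>M)"
  by (simp add: power2_sum algebra_simps)
 also have "\<dots> = ?a + 2 * ?b + ?c" using assms L2_mult_integrable[OF assms] by (simp add: L2_def)
 finally have e: "(\<integral>x. (f x + g x)^2 \<partial>M) = ?a + 2 * ?b + ?c" .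
 have nn: "0 <= ?a" "0 <= ?c" by auto
 have "?b <= sqrt (?a * ?c)" using L2_Cauchy_Schwarz[OF assms] by (rule real_le_rsqrt)
 hence "?a + 2 * ?b + ?c <= (sqrt ?a + sqrt ?c)^2" using nn by (simp add: power2_sum real_sqrt_mult)
 thus ?thesis unfolding e using nn by (intro real_le_lsqrt) auto
qed

lemma dG0_triangle:
 assumes "g \<in> G0" "h \<in> G0" "k \<in> G0" shows "dG0 g k <= dG0 g h + dG0 h k"
proof -
 have e: "dG0 f f' = sqrt (\<integral>s. (f s - f' s)^2 \<partial>Leb01)" if "f \<in> G0" "f' \<in> G0" for f f'
  using dG0_sq(1,3)[OF that] by (metis real_sqrt_unique)
 have L: "L2 Leb01 (%s. f s - f' s)" if "f \<in> G0" "f' \<in> G0" for f f'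
  using dG0_sq(2)[OF that] borel_measurable_Leb01[OF G0_borel[OF that(1)]] borel_measurable_Leb01[OF G0_borel[OF that(2)]]
  by (simp add: L2_def)
 show ?thesis using L2_Minkowski[OF L[OF assms(1,2)] L[OF assms(2,3)]] by (simp add: e assms)
qed

lemma dG0_commute: "dG0 g h = dG0 h g" by (simp add: dG0_def power2_commute)

lemma dG0_self [simp]: "dG0 g g = 0" by (simp add: dG0_def)

text \<open>The approximants are min(1, n d), with d the distance to the complement of A; d is
  Lipschitz by the triangle inequality. The case A = G0 is separate because the infimum defining d
  would run over the empty set.\<close>

lemma G0_open_approx:
 assumes A: "A \<in> G0_opens"
 obtains f where "!!n::nat. cont_G0 (f n)" "!!n g. g \<in> G0 ==> \<bar>f n g\<bar> <= 1" "!!g. g \<in> G0 ==> (%n. f n g) \<longlonglongrightarrow> indicator A g"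
proof (cases "G0 \<subseteq> A")
 case True
 thus ?thesis by (intro that[of "%_ _. 1"]) (auto simp: cont_G0_def intro: exI[of _ 1] elim!: subsetD[THEN indicator_simps(1)[symmetric]] simp: subsetD)
next
 case False
 define B where "B = G0 - A"
 have B: "B \<noteq> {}" "B \<subseteq> G0" using False by (auto simp: B_def)
 define d where "d g = (INF h\<in>B. dG0 g h)" for g
 have bdd: "bdd_below (dG0 g ` B)" if "g \<in> G0" for g
  by (rule bdd_belowI2[of _ 0]) (use dG0_sq(3)[OF that] B in auto)
 have d0: "0 <= d g" if "g \<in> G0" for g unfolding d_def by (rule cINF_greatest[OF B(1)]) (use dG0_sq(3)[OF that] B in auto)
 have lip: "d g <= dG0 g g' + d g'" if g: "g \<in> G0" "g' \<in> G0" for g g'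
 proof -
  have "d g - dG0 g g' <= dG0 g' h" if "h \<in> B" for h
   using cINF_lower[OF bdd[OF g(1)] that] dG0_triangle[OF g, of h] that B by (auto simp: d_def)
  hence "d g - dG0 g g' <= d g'" unfolding d_def by (intro cINF_greatest[OF B(1)])
  thus ?thesis by simp
 qed
 have lip2: "\<bar>d h - d g\<bar> <= dG0 g h" if "g \<in> G0" "h \<in> G0" for g h
  using lip[OF that] lip[OF that(2,1)] by (simp add: dG0_commute abs_le_iff)
 show ?thesis
 proof (rule that[of "%n g. min 1 (real n * d g)"])
  show "cont_G0 (%g. min 1 (real n * d g))" for n :: nat
   unfolding cont_G0_def
  proof (intro ballI allI impI)
   fix g e assume g: "g \<in> G0" and e: "(0::real) < e"
   show "\<exists>\<delta>>0. \<forall>h\<in>G0. dG0 g h < \<delta> \<longrightarrow> \<bar>min 1 (real n * d h) - min 1 (real n * d g)\<bar> < e"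
   proof (intro exI[of _ "e / real (Suc n)"] conjI ballI impI)
    fix h assume h: "h \<in> G0" "dG0 g h < e / real (Suc n)"
    have "\<bar>min 1 (real n * d h) - min 1 (real n * d g)\<bar> <= \<bar>real n * d h - real n * d g\<bar>" by (auto simp: min_def)
    also have "\<dots> = real n * \<bar>d h - d g\<bar>" by (simp add: right_diff_distrib[symmetric] abs_mult)
    also have "\<dots> <= real (Suc n) * dG0 g h" using lip2[OF g h(1)] by (intro mult_mono) auto
    also have "\<dots> < e" using h(2) by (simp add: field_simps)
    finally show "\<bar>min 1 (real n * d h) - min 1 (real n * d g)\<bar> < e" .
   qed (use e in simp)
  qed
  show "\<bar>min 1 (real n * d g)\<bar> <= 1" if "g \<in> G0" for n g using d0[OF that] by (auto simp: min_def)
  show "(%n. min 1 (real n * d g)) \<longlonglongrightarrow> indicator A g" if g: "g \<in> G0" for g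
  proof (cases "g \<in> A")
   case True
   then obtain \<delta> where \<delta>: "\<delta> > 0" "\<forall>h\<in>G0. dG0 g h < \<delta> \<longrightarrow> h \<in> A" using A by (auto simp: G0_opens_def)
   have dg: "\<delta> <= d g" unfolding d_def by (rule cINF_greatest[OF B(1)]) (use \<delta>(2) in \<open>auto simp: B_def not_less[symmetric]\<close>)
   obtain n0 where n0: "real n0 > 1 / \<delta>" using reals_Archimedean2 by blast
   have "min 1 (real n * d g) = 1" if "n \<ge> n0" for n
   proof -
    have "1 / \<delta> <= real n" using n0 that by linarith
    hence "1 <= real n * \<delta>" using \<delta>(1) by (simp add: field_simps)
    also have "\<dots> <= real n * d g" using dg by (intro mult_left_mono) auto
    finally show ?thesis by simp
   qed
   hence "\<forall>\<^sub>F n in sequentially. min 1 (real n * d g) = 1" by (auto simp: eventually_sequentially)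
   thus ?thesis using True by (simp add: tendsto_eventually)
  next
   case False
   hence "d g <= dG0 g g" unfolding d_def using g by (intro cINF_lower[OF bdd[OF g]]) (simp add: B_def)
   hence "d g = 0" using d0[OF g] by simp
   thus ?thesis using False by simp
  qed
 qed
qed

locale Q0_space = prob_space Q for Q :: "(real => real) measure" +
 assumes space_Q: "space Q = G0" and sets_Q: "sets Q = sigma_sets G0 G0_opens"
begin

lemma cont_measurable: "cont_G0 f ==> f \<in> borel_measurable Q"
 by (rule cont_G0_measurable[OF space_Q sets_Q])

lemma Zset_L2: assumes "u \<in> Zset 1" shows "L2 Q u"
proof -
 obtain C where "!!g. g \<in> G0 ==> \<bar>u g\<bar> <= C" using Zset_bounded[OF assms] by metis
 thus ?thesis by (intro L2_bounded[OF cont_measurable[OF Zset_cont[OF assms]], of C]) (auto simp: space_Q)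
qed

text \<open>The closure of \<open>Zinf0\<close> contains the continuous functions by uniform
  density, then indicators of open sets, of all measurable sets by a Dynkin argument, nonnegative
  functions by monotone approximation, and finally all of L^2.\<close>

theorem Zinf0_dense_L2:
 assumes "L2 Q f" obtains us where "!!n. us n \<in> Zinf0" "L2conv Q us f"
proof -
 \<comment> \<open>With the zero gradient, \<open>Z.G f (%_. 0)\<close> says that f is an L^2 limit
   of elements of \<open>Zinf0\<close>, so the closure rules of the locale can be reused.\<close>
 interpret Z: L2_gradient Q Q Zinf0 "%_ _. 0"
 proof
  show "L2 Q u" if "u \<in> Zinf0" for u using Zset_L2 Zinf0_subset that by blast
  show "(%x. u x + v x) \<in> Zinf0" if "u \<in> Zinf0" "v \<in> Zinf0" for u v by (rule Zinf0_ops(1)[OF that])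
  show "(%x. c * u x) \<in> Zinf0" if "u \<in> Zinf0" for u c by (rule Zinf0_ops(3)[OF that that])
  show "AE z in Q. w z = 0" if "L2conv Q (%n _. 0) w" for w
   using L2conv_unique[OF that L2conv_const[of Q "%_. 0"]] by (simp add: L2_def)
 qed (auto simp: L2_def)
 have L0: "L2conv Q (%_ _. 0) (%_. 0)" by (rule L2conv_const) (simp add: L2_def)
 have cont: "Z.G f (%_. 0)" if f: "cont_G0 f" for f
 proof -
  have "\<exists>h\<in>Zinf0. \<forall>g\<in>G0. \<bar>f g - h g\<bar> < 1 / real (Suc n)" for n by (rule Zinf0_uniformly_dense[OF f]) simp
  then obtain h where h: "!!n. h n \<in> Zinf0" "!!n g. g \<in> G0 ==> \<bar>f g - h n g\<bar> < 1 / real (Suc n)" by metis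
  obtain C where C: "!!g. g \<in> G0 ==> \<bar>h 0 g\<bar> <= C" using Zset_bounded[of "h 0"] h(1) Zinf0_subset by blast
  have fC: "\<bar>f g\<bar> <= C + 1" if "g \<in> G0" for g using C[OF that] h(2)[OF that, of 0] by simp
  have hC: "\<bar>h n g\<bar> <= C + 2" if "g \<in> G0" for g n
  proof -
   have "1 / real (Suc n) <= 1" by simp
   thus ?thesis using fC[OF that] h(2)[OF that, of n] by linarith
  qed
  have hm: "h n \<in> borel_measurable Q" for n using Zset_L2 h(1) Zinf0_subset by (auto simp: L2_def)
  have "L2conv Q h f"
  proof (rule L2conv_bounded[OF hm cont_measurable[OF f]])
   show "AE x in Q. \<bar>h n x\<bar> <= C + 2" for n using hC by (intro AE_I2) (simp add: space_Q)
   show "AE x in Q. (%n. h n x) \<longlonglongrightarrow> f x"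
   proof (rule AE_I2)
    fix g assume "g \<in> space Q"
    hence g: "g \<in> G0" by (simp add: space_Q)
    have "(%n. h n g - f g) \<longlonglongrightarrow> 0"
     by (rule Lim_null_comparison[OF _ LIMSEQ_Suc[OF lim_1_over_n]])
      (use h(2)[OF g] in \<open>auto simp: abs_minus_commute intro!: always_eventually less_imp_le simp del: of_nat_Suc\<close>)
    thus "(%n. h n g) \<longlonglongrightarrow> f g" by (simp add: LIM_zero_iff)
   qed
  qed
  from Z.G_closed[OF Z.G_self[OF h(1)] this L0] show ?thesis .
 qed
 have bclosed: "Z.G f (%_. 0)"
  if "!!n. Z.G (us n) (%_. 0)" "!!n g. g \<in> G0 ==> \<bar>us n g\<bar> <= K" "f \<in> borel_measurable Q" "!!g. g \<in> G0 ==> (%n. us n g) \<longlonglongrightarrow> f g" for us f K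
 proof (rule Z.G_closed[OF that(1) _ L0])
  show "L2conv Q us f"
   by (rule L2conv_bounded[OF _ that(3), of _ K]) (use that Z.G_L2(1)[OF that(1)] in \<open>auto simp: L2_def space_Q\<close>)
 qed
 \<comment> \<open>Open sets are stable under finite intersections, so it suffices to treat
   complements and countable disjoint unions.\<close>
 have ind: "Z.G (indicator A) (%_. 0)" if "A \<in> sets Q" for A
 proof -
  have "Int_stable G0_opens"
  proof (rule Int_stableI)
   fix a b assume ab: "a \<in> G0_opens" "b \<in> G0_opens"
   have "\<exists>d>0. \<forall>h\<in>G0. dG0 g h < d \<longrightarrow> h \<in> a \<inter> b" if g: "g \<in> a \<inter> b" for g
   proof -
    obtain d d' where d: "d > 0" "\<forall>h\<in>G0. dG0 g h < d \<longrightarrow> h \<in> a" and d': "d' > 0" "\<forall>h\<in>G0. dG0 g h < d' \<longrightarrow> h \<in> b"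
     using ab g unfolding G0_opens_def by blast
    thus ?thesis by (intro exI[of _ "min d d'"]) auto
   qed
   thus "a \<inter> b \<in> G0_opens" using ab by (auto simp: G0_opens_def)
  qed
  moreover have "G0_opens \<subseteq> Pow G0" by (auto simp: G0_opens_def)
  moreover have "A \<in> sigma_sets G0 G0_opens" using that by (simp add: sets_Q)
  ultimately show ?thesis
  proof (induction rule: sigma_sets_induct_disjoint)
   case (basic A)
   obtain f where f: "!!n::nat. cont_G0 (f n)" "!!n g. g \<in> G0 ==> \<bar>f n g\<bar> <= 1" "!!g. g \<in> G0 ==> (%n. f n g) \<longlonglongrightarrow> indicator A g"
    by (rule G0_open_approx[OF basic]) (blast intro: that)
   show ?case by (rule bclosed[OF cont[OF f(1)] f(2) _ f(3)]) (use basic sets_Q in \<open>auto intro!: borel_measurable_indicator\<close>)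
  next
   case empty
   have "(%_. 0 :: real) \<in> Zinf0" by (rule Zinf0_const)
   from Z.G_self[OF this] show ?case by (simp add: indicator_def[abs_def])
  next
   case (compl A)
   have "Z.G (%x. 1 - indicator A x) (%z. 0 - 0)"
    by (rule Z.G_diff[OF Z.G_self[OF Zinf0_const] compl.IH])
   hence "Z.G (%x. 1 - indicator A x) (%z. 0)" by simp
   have m: "indicator (G0 - A) \<in> borel_measurable Q"
    using compl(1) by (intro borel_measurable_indicator) (simp add: sets_Q sigma_sets.Compl)
   have e: "indicator (G0 - A) g = (1 - indicator A g :: real)" if "g \<in> G0" for g
    using that by (simp add: indicator_def)
   have z: "Z.G (%x. 1 - indicator A x) (%_. 0)" by fact
   have b: "\<bar>1 - indicator A g\<bar> <= (1::real)" for g by (simp add: indicator_def)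
   have l: "(%n::nat. 1 - indicator A g) \<longlonglongrightarrow> (indicator (G0 - A) g :: real)" if "g \<in> G0" for g
    by (simp add: e[OF that])
   show ?case by (rule bclosed[OF z b m l])
  next
   case (union A)
   have s: "Z.G (%x. \<Sum>i<n. indicator (A i) x) (%_. 0)" for n :: nat
   proof (induction n)
    case 0 thus ?case using Z.G_self[OF Zinf0_const[of 0]] by simp
   next
    case (Suc n) thus ?case using Z.G_add[OF Suc union.IH[of n]] by (simp add: add.commute)
   qed
   have e: "(\<Sum>i<n. indicator (A i) x) = (indicator (\<Union>i<n. A i) x :: real)" for n x
    by (rule indicator_UN_disjoint[symmetric]) (use union(1) in \<open>auto simp: disjoint_family_on_def\<close>)
   have b: "\<bar>\<Sum>i<n. indicator (A i) g\<bar> <= (1::real)" for n g unfolding e by (simp add: indicator_def)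
   have m: "indicator (\<Union>i. A i) \<in> borel_measurable Q"
    using union(2) by (intro borel_measurable_indicator) (auto simp: sets_Q intro: sigma_sets.Union)
   have l: "(%n. \<Sum>i<n. indicator (A i) g) \<longlonglongrightarrow> (indicator (\<Union>i. A i) g :: real)" for g
    unfolding e by (rule LIMSEQ_indicator_UN)
   show ?case by (rule bclosed[OF s b m l])
  qed
 qed
 \<comment> \<open>Square integrability is a premise of the induction predicate because it has to be
   re-established for each approximant; those lie below u, and u^2 is then also the majorant for the
   limit.\<close>
 have nonneg: "L2 Q u \<longrightarrow> Z.G u (%_. 0)" if "u \<in> borel_measurable Q" "!!x. 0 <= u x" for u
  using that
 proof (induction rule: borel_measurable_induct_real)
  case (set A) thus ?case using ind by simp
 next
  case (mult u c)
  show ?case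
  proof (cases "c = 0")
   case True thus ?thesis using Z.G_self[OF Zinf0_const[of 0]] by simp
  next
   case False
   show ?thesis
   proof
    assume "L2 Q (%x. c * u x)"
    from L2_cmult[OF this, of "1 / c"] have "L2 Q u" using False by simp
    thus "Z.G (%x. c * u x) (%_. 0)" using mult.IH Z.G_cmult[of u "%_. 0" c] by simp
   qed
  qed
 next
  case (add u v)
  show ?case
  proof
   assume L: "L2 Q (%x. v x + u x)"
   have "L2 Q w" if w: "w \<in> borel_measurable Q" "!!x. 0 <= w x" "!!x. w x <= v x + u x" for w
    unfolding L2_def
   proof
    show "integrable Q (%x. (w x)^2)"
     by (rule Bochner_Integration.integrable_bound[of _ "%x. (v x + u x)^2"])
      (use L w in \<open>auto simp: L2_def intro!: power_mono\<close>)
   qed (rule w)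
   hence "L2 Q v" "L2 Q u" using add.hyps(1-4) by auto
   thus "Z.G (%x. v x + u x) (%_. 0)" using add.IH Z.G_add[of v "%_. 0" u "%_. 0"] by simp
  qed
 next
  case (seq U)
  show ?case
  proof
   assume L: "L2 Q u"
   have le: "U i x <= u x" if "x \<in> space Q" for i x
    using incseq_le[OF _ seq.hyps(4)[OF that]] seq.hyps(3) by (auto simp: incseq_def le_fun_def)
   have LU: "L2 Q (U i)" for i unfolding L2_def
   proof
    show "integrable Q (%x. (U i x)^2)"
     by (rule Bochner_Integration.integrable_bound[of _ "%x. (u x)^2"])
      (use L seq.hyps(1,2) le in \<open>auto simp: L2_def intro!: power_mono\<close>)
   qed (rule seq.hyps)
   have "(%i. \<integral>x. (U i x - u x)^2 \<partial>Q) \<longlonglongrightarrow> (\<integral>x. 0 \<partial>Q)"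
   proof (rule integral_dominated_convergence[where w="%x. (u x)^2"])
    show "integrable Q (%x. (u x)^2)" using L by (simp add: L2_def)
    show "AE x in Q. (%i. (U i x - u x)^2) \<longlonglongrightarrow> 0"
    proof (rule AE_I2)
     fix x assume "x \<in> space Q"
     from tendsto_power[OF tendsto_diff[OF seq.hyps(4)[OF this] tendsto_const[of "u x"]], of 2]
     show "(%i. (U i x - u x)^2) \<longlonglongrightarrow> 0" by simp
    qed
    show "AE x in Q. norm ((U i x - u x)^2) <= (u x)^2" for i
    proof (rule AE_I2)
     fix x assume x: "x \<in> space Q"
     have "\<bar>U i x - u x\<bar> <= \<bar>u x\<bar>" using le[OF x, of i] seq.hyps(2)[of i x] by auto
     thus "norm ((U i x - u x)^2) <= (u x)^2" by (simp add: abs_le_square_iff)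
    qed
   qed (use L seq.hyps(1) in \<open>auto simp: L2_def\<close>)
   hence "L2conv Q U u" using L LU by (simp add: L2conv_def)
   moreover have "Z.G (U i) (%_. 0)" for i using seq.IH LU by blast
   ultimately show "Z.G u (%_. 0)" using Z.G_closed[OF _ _ L0] by blast
  qed
 qed
 have fm: "f \<in> borel_measurable Q" using assms by (simp add: L2_def)
 have Lp: "L2 Q (%x. max 0 (f x))" "L2 Q (%x. max 0 (- f x))"
  unfolding L2_def using fm assms
  by (auto simp: L2_def intro!: Bochner_Integration.integrable_bound[of Q "%x. (f x)^2"] AE_I2 simp: max_def)
 have "Z.G (%x. max 0 (f x) - max 0 (- f x)) (%z. 0 - 0)"
  by (intro Z.G_diff nonneg[rule_format] Lp) (use fm in auto)
 moreover have "max 0 (f x) - max 0 (- f x) = f x" for x by (simp add: max_def)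
 ultimately have "Z.G f (%_. 0)" by simp
 thus ?thesis using that unfolding graph_cl_def by blast
qed

end


section \<open>Quasi-invariance and integration by parts for finitely many increments\<close>

lemma nn_integral_subst_01:
 fixes h :: "real => ennreal"
 assumes "h \<in> borel_measurable borel" "!!x. (T has_real_derivative T' x) (at x)" "continuous_on UNIV T'"
  and "!!x. x \<in> {0..1} ==> 0 <= T' x" "T 0 = 0" "T 1 = 1"
 shows "(\<integral>\<^sup>+x. h x * indicator {0..1} x \<partial>lborel) = (\<integral>\<^sup>+x. h (T x) * (ennreal (T' x) * indicator {0..1} x) \<partial>lborel)"
 using nn_integral_substitution_aux[of h 0 1 T T'] assms by (simp add: continuous_on_subset mult.assoc)

text \<open>The same one-dimensional substitution is carried out in every coordinate; the factors T'
  are the diagonal of the Jacobian matrix.\<close>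

lemma PiM_subst_01:
 fixes h :: "('i => real) => ennreal"
 assumes "finite I" "h \<in> borel_measurable (PiM I (%_. lborel))"
  and T: "!!x. (T has_real_derivative T' x) (at x)" "continuous_on UNIV T'"
  "!!x. x \<in> {0..1} ==> 0 <= T' x" "T 0 = 0" "T 1 = 1"
 shows "(\<integral>\<^sup>+x. h x * (\<Prod>i\<in>I. indicator {0..1} (x i)) \<partial>PiM I (%_. lborel))
  = (\<integral>\<^sup>+x. h (\<lambda>i\<in>I. T (x i)) * (\<Prod>i\<in>I. ennreal (T' (x i)) * indicator {0..1} (x i)) \<partial>PiM I (%_. lborel))"
 using assms(1,2)
proof (induction I arbitrary: h rule: finite_induct)
 case empty
 show ?case by (rule nn_integral_cong) (auto simp: space_PiM)
next
 case (insert i I)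
 interpret product_sigma_finite "%_::'i. lborel :: real measure" ..
 have [measurable]: "T \<in> borel_measurable borel" "T' \<in> borel_measurable borel"
  using T(2) by (auto intro!: borel_measurable_continuous_onI DERIV_continuous_on[OF T(1)])
 note [measurable] = insert.prems
 have mu: "(%z. h ((fst z)(i := q (snd z)))) \<in> borel_measurable (PiM I (%_. lborel) \<Otimes>\<^sub>M lborel)"
  if [measurable]: "q \<in> borel_measurable borel" for q
 proof -
  have "(%z. (fst z, q (snd z))) \<in> measurable (PiM I (%_. lborel) \<Otimes>\<^sub>M lborel) (PiM I (%_. lborel) \<Otimes>\<^sub>M lborel)"
   by measurable
  from measurable_compose[OF measurable_compose[OF this measurable_add_dim] insert.prems]
  show ?thesis by simp
 qed
 \<comment> \<open>The new coordinate is substituted and integrated out first, so that the induction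
   hypothesis can be applied to the remaining function H.\<close>
 define H where "H x = (\<integral>\<^sup>+y. h (x(i := T y)) * (ennreal (T' y) * indicator {0..1} y) \<partial>lborel)" for x
 have Hm: "H \<in> borel_measurable (PiM I (%_. lborel))"
  unfolding H_def
  by (rule lborel.borel_measurable_nn_integral) (use mu[of T] in \<open>auto simp: case_prod_beta'\<close>)
 have sec: "(%y. h (x(i := y))) \<in> borel_measurable borel" if x: "x \<in> space (PiM I (%_. lborel))" for x
  using measurable_compose[OF measurable_Pair1'[OF x, of lborel] mu[of "%y. y"]] by simp
 have "(\<integral>\<^sup>+x. h x * (\<Prod>i\<in>insert i I. indicator {0..1} (x i)) \<partial>PiM (insert i I) (%_. lborel))
  = (\<integral>\<^sup>+x. \<integral>\<^sup>+y. h (x(i := y)) * (\<Prod>j\<in>insert i I. indicator {0..1} ((x(i := y)) j)) \<partial>lborel \<partial>PiM I (%_. lborel))"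
  by (rule product_nn_integral_insert[OF insert.hyps(1,2)]) measurable
 also have "\<dots> = (\<integral>\<^sup>+x. H x * (\<Prod>j\<in>I. indicator {0..1} (x j)) \<partial>PiM I (%_. lborel))"
 proof (rule nn_integral_cong)
  fix x assume x: "x \<in> space (PiM I (%_. lborel :: real measure))"
  have "(\<Prod>j\<in>insert i I. indicator {0..1} ((x(i := y)) j)) = indicator {0..1} y * (\<Prod>j\<in>I. indicator {0..1} (x j) :: ennreal)" for y
   using insert.hyps by (simp, intro arg_cong2[of _ _ _ _ times] refl prod.cong) auto
  hence "(\<integral>\<^sup>+y. h (x(i := y)) * (\<Prod>j\<in>insert i I. indicator {0..1} ((x(i := y)) j)) \<partial>lborel)
   = (\<integral>\<^sup>+y. (h (x(i := y)) * indicator {0..1} y) * (\<Prod>j\<in>I. indicator {0..1} (x j)) \<partial>lborel)"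
   by (simp only: mult.assoc)
  also have "\<dots> = (\<integral>\<^sup>+y. h (x(i := y)) * indicator {0..1} y \<partial>lborel) * (\<Prod>j\<in>I. indicator {0..1} (x j))"
   by (rule nn_integral_multc) (use sec[OF x] in measurable)
  also have "(\<integral>\<^sup>+y. h (x(i := y)) * indicator {0..1} y \<partial>lborel) = H x"
   unfolding H_def by (rule nn_integral_subst_01[OF sec[OF x] T])
  finally show "(\<integral>\<^sup>+y. h (x(i := y)) * (\<Prod>j\<in>insert i I. indicator {0..1} ((x(i := y)) j)) \<partial>lborel) = H x * (\<Prod>j\<in>I. indicator {0..1} (x j))" .
 qed
 also have "\<dots> = (\<integral>\<^sup>+x. H (\<lambda>j\<in>I. T (x j)) * (\<Prod>j\<in>I. ennreal (T' (x j)) * indicator {0..1} (x j)) \<partial>PiM I (%_. lborel))"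
  by (rule insert.IH[OF Hm])
 also have "\<dots> = (\<integral>\<^sup>+x. \<integral>\<^sup>+y. h (\<lambda>j\<in>insert i I. T ((x(i := y)) j)) * (\<Prod>j\<in>insert i I. ennreal (T' ((x(i := y)) j)) * indicator {0..1} ((x(i := y)) j)) \<partial>lborel \<partial>PiM I (%_. lborel))"
 proof (rule nn_integral_cong)
  fix x assume x: "x \<in> space (PiM I (%_. lborel :: real measure))"
  let ?Tx = "\<lambda>j\<in>I. T (x j)"
  have Tx: "?Tx \<in> space (PiM I (%_. lborel :: real measure))" by (simp add: space_PiM)
  have 1: "(\<lambda>j\<in>insert i I. T ((x(i := y)) j)) = ?Tx(i := T y)" for y
   using insert.hyps by (auto simp: fun_eq_iff restrict_def)
  have 2: "(\<Prod>j\<in>insert i I. ennreal (T' ((x(i := y)) j)) * indicator {0..1} ((x(i := y)) j))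
   = (ennreal (T' y) * indicator {0..1} y) * (\<Prod>j\<in>I. ennreal (T' (x j)) * indicator {0..1} (x j))" for y
   using insert.hyps by (simp, intro arg_cong2[of _ _ _ _ times] refl prod.cong) auto
  have "(%y. h (?Tx(i := T y))) \<in> borel_measurable borel"
   using measurable_compose[OF _ sec[OF Tx], of T borel] by simp
  hence "(\<integral>\<^sup>+y. (h (?Tx(i := T y)) * (ennreal (T' y) * indicator {0..1} y)) * (\<Prod>j\<in>I. ennreal (T' (x j)) * indicator {0..1} (x j)) \<partial>lborel)
   = H ?Tx * (\<Prod>j\<in>I. ennreal (T' (x j)) * indicator {0..1} (x j))"
   unfolding H_def by (intro nn_integral_multc) measurable
  thus "H ?Tx * (\<Prod>j\<in>I. ennreal (T' (x j)) * indicator {0..1} (x j)) = (\<integral>\<^sup>+y. h (\<lambda>j\<in>insert i I. T ((x(i := y)) j)) * (\<Prod>j\<in>insert i I. ennreal (T' ((x(i := y)) j)) * indicator {0..1} ((x(i := y)) j)) \<partial>lborel)"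
   unfolding 1 2 by (simp only: mult.assoc)
 qed
 also have "\<dots> = (\<integral>\<^sup>+x. h (\<lambda>j\<in>insert i I. T (x j)) * (\<Prod>j\<in>insert i I. ennreal (T' (x j)) * indicator {0..1} (x j)) \<partial>PiM (insert i I) (%_. lborel))"
 proof (rule product_nn_integral_insert[OF insert.hyps(1,2), symmetric])
  have "(%x. \<lambda>j\<in>insert i I. T (x j)) \<in> measurable (PiM (insert i I) (%_. lborel)) (PiM (insert i I) (%_. lborel))"
   by (intro measurable_restrict) measurable
  from measurable_compose[OF this insert.prems]
  show "(%x. h (\<lambda>j\<in>insert i I. T (x j)) * (\<Prod>j\<in>insert i I. ennreal (T' (x j)) * indicator {0..1} (x j))) \<in> borel_measurable (PiM (insert i I) (%_. lborel))"
   by measurable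
 qed
 finally show ?case .
qed

section \<open>Dirichlet densities under a change of variables\<close>

abbreviation LebN :: "nat => (nat => real) measure" where "LebN N \<equiv> PiM {1..N} (%_. lborel)"

definition ext01 :: "nat => (nat => real) => nat => real" where
 "ext01 N x = (%i. if i = 0 then 0 else if i = Suc N then 1 else x i)"

definition incr01 :: "nat => (nat => real) => bool" where
 "incr01 N x \<longleftrightarrow> (\<forall>i\<le>N. ext01 N x i < ext01 N x (Suc i))"

lemma Q0_density_alt:
 "Q0_density \<beta> N t x = (if incr01 N x then Gamma \<beta> / (\<Prod>i\<le>N. Gamma (\<beta> * (t (Suc i) - t i)))
   * (\<Prod>i\<le>N. (ext01 N x (Suc i) - ext01 N x i) powr (\<beta> * (t (Suc i) - t i) - 1)) else 0)"
 unfolding Q0_density_def incr01_def ext01_def Let_def by (rule refl)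

lemma ext01_measurable:
 assumes "i <= Suc N" shows "(%x. ext01 N x i) \<in> borel_measurable (LebN N)"
proof (cases "i = 0 \<or> i = Suc N")
 case False
 hence "i \<in> {1..N}" using assms by auto
 from measurable_component_singleton[OF this, of "%_. lborel"] False show ?thesis by (simp add: ext01_def)
qed (auto simp: ext01_def)

lemma incr01_measurable [measurable]: "Measurable.pred (LebN N) (incr01 N)"
proof -
 have "Measurable.pred (LebN N) (%x. \<forall>i\<in>{..N}. ext01 N x i < ext01 N x (Suc i))"
 proof (rule pred_intros_finite(3))
  show "Measurable.pred (LebN N) (%x. ext01 N x i < ext01 N x (Suc i))" if "i \<in> {..N}" for i
   by (intro borel_measurable_pred_less ext01_measurable) (use that in auto)
 qed simp
 moreover have "incr01 N = (%x. \<forall>i\<in>{..N}. ext01 N x i < ext01 N x (Suc i))" by (auto simp: incr01_def fun_eq_iff)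
 ultimately show ?thesis by (simp only:)
qed

lemma Q0_density_measurable: "Q0_density \<beta> N t \<in> borel_measurable (LebN N)"
proof -
 have [measurable]: "(%x. \<Prod>i\<le>N. (ext01 N x (Suc i) - ext01 N x i) powr (\<beta> * (t (Suc i) - t i) - 1)) \<in> borel_measurable (LebN N)"
  by (intro borel_measurable_prod powr_real_measurable borel_measurable_diff ext01_measurable) auto
 show ?thesis unfolding Q0_density_alt[abs_def] by measurable
qed

lemma incr01_mono:
 assumes "incr01 N x" "i <= j" "j <= Suc N" shows "ext01 N x i <= ext01 N x j"
 using assms(2,3)
proof (induction rule: dec_induct)
 case (step k)
 have "ext01 N x k < ext01 N x (Suc k)" using assms(1) step by (simp add: incr01_def)
 thus ?case using step by simp
qed simp

lemma incr01_bounds: assumes "incr01 N x" "i <= Suc N" shows "0 <= ext01 N x i" "ext01 N x i <= 1"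
 using incr01_mono[OF assms(1), of 0 i] incr01_mono[OF assms(1), of i "Suc N"] assms(2) by (auto simp: ext01_def)

text \<open>The product of the T' comes from the substitution; the powers of difference quotients
  are the ratio of the Dirichlet densities at T x and at x when p lists their exponents.\<close>

definition jac01 :: "nat => (nat => real) => (real => real) => (real => real) => (nat => real) => real" where
 "jac01 N p T T' x = (\<Prod>i\<in>{1..N}. T' (x i)) *
   (\<Prod>i\<le>N. ((T (ext01 N x (Suc i)) - T (ext01 N x i)) / (ext01 N x (Suc i) - ext01 N x i)) powr p i)"

lemma jac01_measurable:
 assumes [measurable]: "T \<in> borel_measurable borel" "T' \<in> borel_measurable borel"
 shows "jac01 N p T T' \<in> borel_measurable (LebN N)"
proof -
 have 1: "(%x. T (ext01 N x i)) \<in> borel_measurable (LebN N)" if "i <= Suc N" for i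
  by (rule measurable_compose[OF ext01_measurable[OF that]]) measurable
 have 2: "(%x. T' (x i)) \<in> borel_measurable (LebN N)" if "i \<in> {1..N}" for i
  by (rule measurable_compose[OF measurable_component_singleton[OF that]]) simp
 show ?thesis unfolding jac01_def[abs_def]
  by (intro borel_measurable_times borel_measurable_prod powr_real_measurable borel_measurable_divide
   borel_measurable_diff borel_measurable_const ext01_measurable 1 2) auto
qed

text \<open>T is an increasing bijection of [0,1] fixing the endpoints, so it maps the open simplex
  to itself and multiplies each increment by a difference quotient. The density confines the
  integral to the cube, where the coordinatewise substitution applies.\<close>

lemma Q0_density_quasi_invariant:
 fixes F :: "(nat => real) => ennreal"
 assumes F: "F \<in> borel_measurable (LebN N)" and \<beta>: "\<beta> > 0" and t: "!!i. i <= N ==> t i < t (Suc i)"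
  and T: "!!x. (T has_real_derivative T' x) (at x)" "continuous_on UNIV T'"
  "!!x. x \<in> {0..1} ==> 0 < T' x" "T 0 = 0" "T 1 = 1"
 shows "(\<integral>\<^sup>+x. ennreal (Q0_density \<beta> N t x) * F x \<partial>LebN N)
  = (\<integral>\<^sup>+x. ennreal (Q0_density \<beta> N t x) * (F (\<lambda>i\<in>{1..N}. T (x i)) * ennreal (jac01 N (%i. \<beta> * (t (Suc i) - t i) - 1) T T' x)) \<partial>LebN N)"
proof -
 let ?P = "PiM {1..N} (%_. lborel :: real measure)" and ?d = "Q0_density \<beta> N t"
 let ?p = "%i. \<beta> * (t (Suc i) - t i) - 1"
 have Tmono: "T x < T y" if "0 <= x" "x < y" "y <= 1" for x y
  by (rule DERIV_pos_imp_increasing[OF that(2)]) (use T(1,3) that in \<open>auto intro!: exI[of _ "T' z" for z]\<close>)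
 have c0: "0 <= Gamma \<beta> / (\<Prod>i\<le>N. Gamma (\<beta> * (t (Suc i) - t i)))"
  using \<beta> t by (intro divide_nonneg_nonneg prod_nonneg Gamma_real_nonneg) (auto intro: less_imp_le)
 have ind1: "(\<Prod>i\<in>{1..N}. indicator {0..1} (x i)) = (1::ennreal)" if "incr01 N x" for x
 proof (intro prod.neutral ballI)
  fix i assume "i \<in> {1..N}"
  thus "indicator {0..1} (x i) = (1::ennreal)" using incr01_bounds[OF that, of i] by (simp add: ext01_def)
 qed
 have e: "ext01 N (\<lambda>i\<in>{1..N}. T (x i)) i = T (ext01 N x i)" if "i <= Suc N" for x i
  using that T(4,5) by (auto simp: ext01_def)
 have "(\<integral>\<^sup>+x. ennreal (?d x) * F x \<partial>?P) = (\<integral>\<^sup>+x. (ennreal (?d x) * F x) * (\<Prod>i\<in>{1..N}. indicator {0..1} (x i)) \<partial>?P)"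
 proof (rule nn_integral_cong)
  fix x show "ennreal (?d x) * F x = (ennreal (?d x) * F x) * (\<Prod>i\<in>{1..N}. indicator {0..1} (x i))"
   by (cases "incr01 N x") (simp_all only: ind1 mult_1_right Q0_density_alt if_False ennreal_0 mult_zero_left)
 qed
 also have "\<dots> = (\<integral>\<^sup>+x. (ennreal (?d (\<lambda>i\<in>{1..N}. T (x i))) * F (\<lambda>i\<in>{1..N}. T (x i))) * (\<Prod>i\<in>{1..N}. ennreal (T' (x i)) * indicator {0..1} (x i)) \<partial>?P)"
  by (rule PiM_subst_01[OF _ _ T(1,2) _ T(4,5)]) (use F Q0_density_measurable T(3) in \<open>auto intro: less_imp_le\<close>)
 also have "\<dots> = (\<integral>\<^sup>+x. ennreal (?d x) * (F (\<lambda>i\<in>{1..N}. T (x i)) * ennreal (jac01 N ?p T T' x)) \<partial>?P)"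
 proof (rule nn_integral_cong)
  fix x
  let ?Tx = "\<lambda>i\<in>{1..N}. T (x i)"
  show "(ennreal (?d ?Tx) * F ?Tx) * (\<Prod>i\<in>{1..N}. ennreal (T' (x i)) * indicator {0..1} (x i)) = ennreal (?d x) * (F ?Tx * ennreal (jac01 N ?p T T' x))"
  proof (cases "incr01 N x")
   case True
   note b = incr01_bounds[OF True]
   have xb: "x i \<in> {0..1}" if "i \<in> {1..N}" for i using b[of i] that by (auto simp: ext01_def split: if_splits)
   have lt: "T (ext01 N x i) < T (ext01 N x (Suc i))" if "i <= N" for i
    using that True b[of i] b[of "Suc i"] by (intro Tmono) (auto simp: incr01_def)
   hence inc: "incr01 N ?Tx" unfolding incr01_def by (metis e Suc_le_mono le_SucI)
   have "(\<Prod>i\<le>N. (ext01 N ?Tx (Suc i) - ext01 N ?Tx i) powr ?p i)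
    = (\<Prod>i\<le>N. (ext01 N x (Suc i) - ext01 N x i) powr ?p i * ((T (ext01 N x (Suc i)) - T (ext01 N x i)) / (ext01 N x (Suc i) - ext01 N x i)) powr ?p i)"
   proof (rule prod.cong[OF refl])
    fix i assume "i \<in> {..N}"
    hence i: "i <= N" by simp
    have p: "ext01 N x (Suc i) - ext01 N x i > 0" using True i by (simp add: incr01_def)
    have q: "(T (ext01 N x (Suc i)) - T (ext01 N x i)) / (ext01 N x (Suc i) - ext01 N x i) > 0" using lt[OF i] p by simp
    have "ext01 N ?Tx (Suc i) - ext01 N ?Tx i = (ext01 N x (Suc i) - ext01 N x i) * ((T (ext01 N x (Suc i)) - T (ext01 N x i)) / (ext01 N x (Suc i) - ext01 N x i))"
     using p i by (simp add: e[unfolded One_nat_def])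
    thus "(ext01 N ?Tx (Suc i) - ext01 N ?Tx i) powr ?p i
     = (ext01 N x (Suc i) - ext01 N x i) powr ?p i * ((T (ext01 N x (Suc i)) - T (ext01 N x i)) / (ext01 N x (Suc i) - ext01 N x i)) powr ?p i"
     using p q by (simp only: powr_mult less_imp_le)
   qed
   hence dT: "?d ?Tx * (\<Prod>i\<in>{1..N}. T' (x i)) = ?d x * jac01 N ?p T T' x"
    using True inc by (simp add: Q0_density_alt jac01_def prod.distrib)
   have "(\<Prod>i\<in>{1..N}. ennreal (T' (x i)) * indicator {0..1} (x i)) = (\<Prod>i\<in>{1..N}. ennreal (T' (x i)))"
    by (rule prod.cong) (use xb in auto)
   also have "\<dots> = ennreal (\<Prod>i\<in>{1..N}. T' (x i))"
    by (rule prod_ennreal) (use xb T(3) in \<open>auto intro: less_imp_le\<close>)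
   finally have pr: "(\<Prod>i\<in>{1..N}. ennreal (T' (x i)) * indicator {0..1} (x i)) = ennreal (\<Prod>i\<in>{1..N}. T' (x i))" .
   have nn: "0 <= ?d y" for y
   proof (cases "incr01 N y")
    case True
    show ?thesis unfolding Q0_density_alt if_P[OF True] by (intro mult_nonneg_nonneg c0 prod_nonneg) auto
   qed (simp add: Q0_density_alt)
   have nn2: "0 <= (\<Prod>i\<in>{1..N}. T' (x i))" by (intro prod_nonneg) (use xb T(3) in \<open>auto intro: less_imp_le\<close>)
   have nn3: "0 <= jac01 N ?p T T' x" unfolding jac01_def by (intro mult_nonneg_nonneg nn2 prod_nonneg) auto
   have "(ennreal (?d ?Tx) * F ?Tx) * ennreal (\<Prod>i\<in>{1..N}. T' (x i)) = F ?Tx * (ennreal (?d ?Tx) * ennreal (\<Prod>i\<in>{1..N}. T' (x i)))"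
    by (simp only: mult_ac)
   also have "ennreal (?d ?Tx) * ennreal (\<Prod>i\<in>{1..N}. T' (x i)) = ennreal (?d x) * ennreal (jac01 N ?p T T' x)"
    by (simp only: ennreal_mult[OF nn nn2, symmetric] ennreal_mult[OF nn nn3, symmetric] dT)
   finally show ?thesis unfolding pr by (simp only: mult_ac)
  next
   \<comment> \<open>Off the simplex both sides vanish: inside the cube because monotonicity of T
     keeps a pair of coordinates in the wrong order, outside because one of the indicators is
     0.\<close>
   case False
   show ?thesis
   proof (cases "\<forall>i\<in>{1..N}. x i \<in> {0..1}")
    case True
    have b: "0 <= ext01 N x i" "ext01 N x i <= 1" if "i <= Suc N" for i using True that by (auto simp: ext01_def)
    obtain i where i: "i <= N" "ext01 N x (Suc i) <= ext01 N x i" using False by (auto simp: incr01_def not_less)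
    have "T (ext01 N x (Suc i)) <= T (ext01 N x i)"
     using i b[of i] b[of "Suc i"] Tmono[of "ext01 N x (Suc i)" "ext01 N x i"] by (cases "ext01 N x (Suc i) = ext01 N x i") auto
    hence "\<not> incr01 N ?Tx" using i(1) by (auto simp: incr01_def e[unfolded One_nat_def] not_less)
    thus ?thesis using False by (simp add: Q0_density_alt)
   next
    case F2: False
    then obtain i where i: "i \<in> {1..N}" "x i \<notin> {0..1}" by blast
    have "(\<Prod>i\<in>{1..N}. ennreal (T' (x i)) * indicator {0..1} (x i)) = 0"
     by (rule prod_zero[OF _ bexI[OF _ i(1)]]) (use i(2) in simp_all)
    thus ?thesis using False by (simp add: Q0_density_alt)
   qed
  qed
 qed
 finally show ?thesis .
qed

section \<open>The entropic measure and its marginals\<close>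

locale entropic = 
 fixes \<beta> :: real and Q :: "(real => real) measure"
 assumes \<beta>: "\<beta> > 0" and Q0: "is_Q0 \<beta> Q"
begin

lemma space_sets: "space Q = G0" "sets Q = sigma_sets G0 G0_opens"
 using Q0 by (auto simp: is_Q0_def)

definition part :: "nat => (nat => real) => bool" where
 "part N t \<longleftrightarrow> t 0 = 0 \<and> t (Suc N) = 1 \<and> (\<forall>i\<le>N. t i < t (Suc i))"

abbreviation marg :: "nat => (nat => real) => (real => real) => nat => real" where
 "marg N t g \<equiv> restrict (%i. g (t i)) {1..N}"

lemma marg_measurable: "marg N t \<in> measurable Q (LebN N)"
 by (rule measurable_restrict) (simp add: eval_measurable[OF space_sets])

lemma marg_distr: "part N t ==> distr Q (LebN N) (marg N t) = density (LebN N) (%x. ennreal (Q0_density \<beta> N t x))"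
 using Q0 by (auto simp: is_Q0_def part_def)

lemma nn_integral_marg:
 assumes "part N t" "F \<in> borel_measurable (LebN N)"
 shows "(\<integral>\<^sup>+g. F (marg N t g) \<partial>Q) = (\<integral>\<^sup>+x. ennreal (Q0_density \<beta> N t x) * F x \<partial>LebN N)"
proof -
 have "(\<integral>\<^sup>+g. F (marg N t g) \<partial>Q) = (\<integral>\<^sup>+x. F x \<partial>distr Q (LebN N) (marg N t))"
  by (rule nn_integral_distr[OF marg_measurable, symmetric]) (use assms(2) in simp)
 also have "\<dots> = (\<integral>\<^sup>+x. ennreal (Q0_density \<beta> N t x) * F x \<partial>LebN N)"
  unfolding marg_distr[OF assms(1)]
  by (rule nn_integral_density[OF measurable_compose[OF Q0_density_measurable measurable_ennreal] assms(2)])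
 finally show ?thesis .
qed

lemma prob_space_Q: "prob_space Q"
proof
 \<comment> \<open>The total mass is the marginal condition for N = 0. The function
   \<open>real\<close> serves as the partition 0, 1; \<open>LebN 0\<close> is a unit point mass and
   the density there is \<Gamma>(\<beta>)/\<Gamma>(\<beta>) = 1.\<close>
 have p: "part 0 real" by (simp add: part_def)
 interpret product_sigma_finite "%_::nat. lborel :: real measure" ..
 have "emeasure Q (space Q) = (\<integral>\<^sup>+g. 1 \<partial>Q)" by simp
 also have "\<dots> = (\<integral>\<^sup>+x. ennreal (Q0_density \<beta> 0 real x) * 1 \<partial>PiM {1..0} (%_. lborel))"
  using nn_integral_marg[OF p, of "%_. 1"] by simp
 also have "(%x. ennreal (Q0_density \<beta> 0 real x) * 1) = (%_. 1)"
  using Gamma_real_pos[OF \<beta>] by (auto simp: Q0_density_alt incr01_def ext01_def)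
 also have "(\<integral>\<^sup>+x. 1 \<partial>PiM {1..0} (%_::nat. lborel :: real measure)) = 1"
  by (simp add: space_PiM)
 finally show "emeasure Q (space Q) = 1" .
qed

sublocale Q0_space Q
 using prob_space_Q space_sets by (simp add: Q0_space_def Q0_space_axioms_def)

lemma AE_incr01: assumes "part N t" shows "AE g in Q. incr01 N (marg N t g)"
proof -
 have "AE x in density (LebN N) (%x. ennreal (Q0_density \<beta> N t x)). incr01 N x"
  unfolding AE_density[OF measurable_compose[OF Q0_density_measurable measurable_ennreal]]
  by (simp add: Q0_density_alt)
 hence "AE x in distr Q (LebN N) (marg N t). incr01 N x" by (subst marg_distr[OF assms])
 thus ?thesis by (rule AE_distrD[OF marg_measurable])
qed

lemma quasi_invariance:
 assumes p: "part N t" and F: "F \<in> borel_measurable (LebN N)"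
  and T: "!!x. (T has_real_derivative T' x) (at x)" "continuous_on UNIV T'"
  "!!x. x \<in> {0..1} ==> 0 < T' x" "T 0 = 0" "T 1 = 1"
 shows "(\<integral>\<^sup>+g. F (marg N t g) \<partial>Q) = (\<integral>\<^sup>+g. F (\<lambda>i\<in>{1..N}. T (g (t i))) * ennreal (jac01 N (%i. \<beta> * (t (Suc i) - t i) - 1) T T' (marg N t g)) \<partial>Q)"
proof -
 have [measurable]: "T \<in> borel_measurable borel" "T' \<in> borel_measurable borel"
  using T(2) by (auto intro!: borel_measurable_continuous_onI DERIV_continuous_on[OF T(1)])
 have Fm: "(%x. F (\<lambda>i\<in>{1..N}. T (x i))) \<in> borel_measurable (LebN N)"
  by (rule measurable_compose[OF measurable_restrict F]) measurable
 have r: "(\<lambda>i\<in>{1..N}. T (marg N t g i)) = (\<lambda>i\<in>{1..N}. T (g (t i)))" for g by (auto simp: restrict_def)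
 have tt: "t i < t (Suc i)" if "i <= N" for i using p that by (simp add: part_def)
 have "(%x. F (\<lambda>i\<in>{1..N}. T (x i)) * ennreal (jac01 N (%i. \<beta> * (t (Suc i) - t i) - 1) T T' x)) \<in> borel_measurable (LebN N)"
  by (intro borel_measurable_times_ennreal Fm measurable_compose[OF jac01_measurable measurable_ennreal]) measurable
 note J = nn_integral_marg[OF p this, unfolded r]
 show ?thesis
  by (rule trans[OF nn_integral_marg[OF p F] trans[OF Q0_density_quasi_invariant[of F N \<beta> t, OF F \<beta> tt T] J[symmetric]]])
qed

end


section \<open>The Jacobian near the identity\<close>

lemma powr_one_plus_bound:
 fixes y q :: real
 assumes "\<bar>y\<bar> <= 1/2" shows "\<bar>(1 + y) powr q - 1\<bar> <= 2 * \<bar>q\<bar> * exp \<bar>q\<bar> * \<bar>y\<bar>"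
proof -
 have "\<bar>ln (1 + y) - y\<bar> <= 2 * y^2" by (rule abs_ln_one_plus_x_minus_x_bound[OF assms])
 also have "2 * y^2 = 2 * \<bar>y\<bar> * \<bar>y\<bar>" by (simp add: power2_eq_square)
 also have "\<dots> <= 1 * \<bar>y\<bar>" using assms by (intro mult_right_mono) auto
 finally have l: "\<bar>ln (1 + y)\<bar> <= 2 * \<bar>y\<bar>" by linarith
 define s where "s = q * ln (1 + y)"
 have s: "\<bar>s\<bar> <= 2 * \<bar>q\<bar> * \<bar>y\<bar>" using mult_left_mono[OF l, of "\<bar>q\<bar>"] by (simp add: s_def abs_mult mult_ac)
 have "2 * \<bar>q\<bar> * \<bar>y\<bar> <= 2 * \<bar>q\<bar> * (1/2)" using assms by (intro mult_left_mono) auto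
 hence s1: "\<bar>s\<bar> <= \<bar>q\<bar>" using s by simp
 obtain t where t: "t \<in> closed_segment 0 s" "exp s - exp 0 = exp t * (s - 0)"
  using MVT_segment[of exp exp 0 s] DERIV_exp by blast
 have "\<bar>t\<bar> <= \<bar>s\<bar>" using t(1) by (auto simp: closed_segment_eq_real_ivl split: if_splits)
 hence "exp t <= exp \<bar>q\<bar>" using s1 by simp
 hence "\<bar>exp s - 1\<bar> <= exp \<bar>q\<bar> * \<bar>s\<bar>" using t(2) by (simp add: abs_mult mult_right_mono)
 also have "\<dots> <= exp \<bar>q\<bar> * (2 * \<bar>q\<bar> * \<bar>y\<bar>)" using s by (intro mult_left_mono) auto
 finally have "\<bar>exp s - 1\<bar> <= 2 * \<bar>q\<bar> * exp \<bar>q\<bar> * \<bar>y\<bar>" by (simp add: mult_ac)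
 moreover have "(1 + y) powr q = exp s" using assms by (simp add: powr_def s_def)
 ultimately show ?thesis by simp
qed

lemma abs_mult_minus_one_le:
 fixes x y :: real shows "\<bar>x * y - 1\<bar> <= \<bar>x - 1\<bar> * (1 + \<bar>y - 1\<bar>) + \<bar>y - 1\<bar>"
proof -
 have "x * y - 1 = (x - 1) * y + (y - 1)" by (simp add: algebra_simps)
 hence "\<bar>x * y - 1\<bar> <= \<bar>x - 1\<bar> * \<bar>y\<bar> + \<bar>y - 1\<bar>" by (metis abs_mult abs_triangle_ineq)
 also have "\<dots> <= \<bar>x - 1\<bar> * (1 + \<bar>y - 1\<bar>) + \<bar>y - 1\<bar>" by (intro add_right_mono mult_left_mono) auto
 finally show ?thesis .
qed

text \<open>The constant B depends neither on a nor on \<epsilon>: it bounds the difference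
  quotients of the Jacobian uniformly over the simplex, where a will collect slopes of f bounded by
  M.\<close>

lemma prod_powr_bound:
 fixes q :: "'i => real"
 assumes "finite I" "1 <= M"
 shows "\<exists>B\<ge>0. \<forall>a \<epsilon>. (\<forall>i\<in>I. \<bar>a i\<bar> <= M) \<longrightarrow> 0 <= \<epsilon> \<longrightarrow> \<epsilon> * M <= 1/2 \<longrightarrow> \<bar>(\<Prod>i\<in>I. (1 + \<epsilon> * a i) powr q i) - 1\<bar> <= B * \<epsilon>"
 using assms(1)
proof (induction I rule: finite_induct)
 case empty show ?case by (intro exI[of _ 0]) simp
next
 case (insert j I)
 then obtain B where B: "B \<ge> 0" "!!a \<epsilon>. (\<forall>i\<in>I. \<bar>a i\<bar> <= M) ==> 0 <= \<epsilon> ==> \<epsilon> * M <= 1/2 ==> \<bar>(\<Prod>i\<in>I. (1 + \<epsilon> * a i) powr q i) - 1\<bar> <= B * \<epsilon>"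
  by blast
 define K where "K = 2 * \<bar>q j\<bar> * exp \<bar>q j\<bar> * M"
 have K: "0 <= K" using assms(2) by (simp add: K_def)
 show ?case
 proof (intro exI[of _ "K * (1 + B) + B"] conjI allI impI)
  show "0 <= K * (1 + B) + B" using K B(1) by simp
  fix a \<epsilon> assume a: "\<forall>i\<in>insert j I. \<bar>a i\<bar> <= M" and e: "0 <= \<epsilon>" "\<epsilon> * M <= (1/2 :: real)"
  have y: "\<bar>\<epsilon> * a j\<bar> <= \<epsilon> * M" using a e by (simp add: abs_mult mult_left_mono)
  have "\<epsilon> * 1 <= \<epsilon> * M" using e assms(2) by (intro mult_left_mono) auto
  hence e1: "\<epsilon> <= 1" using e by simp
  have "\<bar>(1 + \<epsilon> * a j) powr q j - 1\<bar> <= 2 * \<bar>q j\<bar> * exp \<bar>q j\<bar> * \<bar>\<epsilon> * a j\<bar>" by (rule powr_one_plus_bound) (use y e in simp)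
  also have "\<dots> <= 2 * \<bar>q j\<bar> * exp \<bar>q j\<bar> * (\<epsilon> * M)" by (intro mult_left_mono y) auto
  finally have 1: "\<bar>(1 + \<epsilon> * a j) powr q j - 1\<bar> <= K * \<epsilon>" by (simp add: K_def mult_ac)
  have 2: "\<bar>(\<Prod>i\<in>I. (1 + \<epsilon> * a i) powr q i) - 1\<bar> <= B * \<epsilon>" using B(2)[of a \<epsilon>] a e by simp
  have "B * \<epsilon> <= B" using e1 B(1) by (simp add: mult_left_le)
  hence "\<bar>(1 + \<epsilon> * a j) powr q j - 1\<bar> * (1 + \<bar>(\<Prod>i\<in>I. (1 + \<epsilon> * a i) powr q i) - 1\<bar>) + \<bar>(\<Prod>i\<in>I. (1 + \<epsilon> * a i) powr q i) - 1\<bar>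
   <= (K * \<epsilon>) * (1 + B) + B * \<epsilon>"
   using 1 2 K e B(1) by (intro add_mono mult_mono) auto
  also have "\<dots> = (K * (1 + B) + B) * \<epsilon>" by (simp add: algebra_simps)
  finally show "\<bar>(\<Prod>i\<in>insert j I. (1 + \<epsilon> * a i) powr q i) - 1\<bar> <= (K * (1 + B) + B) * \<epsilon>"
   using abs_mult_minus_one_le[of "(1 + \<epsilon> * a j) powr q j" "\<Prod>i\<in>I. (1 + \<epsilon> * a i) powr q i"] insert.hyps by simp
 qed
qed

lemma prod_powr_deriv:
 fixes q a :: "'i => real"
 assumes "finite I" shows "((%\<epsilon>. \<Prod>i\<in>I. (1 + \<epsilon> * a i) powr q i) has_real_derivative (\<Sum>i\<in>I. q i * a i)) (at 0)"
 using assms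
proof (induction I rule: finite_induct)
 case (insert j I)
 have "((%\<epsilon>. (1 + \<epsilon> * a j) powr q j) has_real_derivative q j * a j) (at 0)"
  by (rule derivative_eq_intros refl | simp)+
 from DERIV_mult[OF this insert.IH] show ?case using insert.hyps by simp
qed simp

section \<open>Differentiating the quasi-invariance at the identity\<close>

lemma Ck01_extend1_ex:
 assumes "Ck01 (Suc 0) a"
 shows "\<exists>F. (\<forall>x. (F has_real_derivative deriv01 a (unit_clamp x)) (at x)) \<and> (\<forall>x\<in>{0..1}. F x = a x)"
proof (rule Ck01_extend1[OF assms])
 fix F assume "!!x. (F has_real_derivative deriv01 a (unit_clamp x)) (at x)" "!!x. x \<in> {0..1} ==> F x = a x"
 thus ?thesis by (intro exI[of _ F]) simp
qed

text \<open>The sum over right endpoints that replaces \<open>zvec\<close> when only N values of g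
  are known; the last node always contributes the value at 1. The clamp makes it bounded on all of
  \<open>LebN N\<close>.\<close>

definition riemann01 :: "nat => nat => (nat => real => real) => (nat => real) => nat => real" where
 "riemann01 N m \<alpha> x = (%i. if i < m then (\<Sum>k\<in>{1..Suc N}. \<alpha> i (unit_clamp (ext01 N x k))) / real (Suc N) else 0)"

definition slope :: "nat => (real => real) => (nat => real) => nat => real" where
 "slope N f x k = (f (ext01 N x (Suc k)) - f (ext01 N x k)) / (ext01 N x (Suc k) - ext01 N x k)"

lemma riemann01_Rm [simp]: "riemann01 N m \<alpha> x \<in> Rm m" by (simp add: riemann01_def Rm_def)

lemma riemann01_box:
 assumes "!!i. i < m ==> continuous_on {0..1} (\<alpha> i)"
 obtains R where "R > 0" "!!N x. riemann01 N m \<alpha> x \<in> Rm_box m R"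
proof -
 have "\<exists>C. \<forall>x\<in>{0..1}. \<bar>\<alpha> i x\<bar> <= C" if "i < m" for i using bounded_on_01[OF assms[OF that]] by metis
 then obtain C where C: "!!i x. i < m ==> x \<in> {0..1} ==> \<bar>\<alpha> i x\<bar> <= C i" by metis
 define R where "R = 1 + (\<Sum>i<m. \<bar>C i\<bar>)"
 have R: "C i <= R" if "i < m" for i
  using member_le_sum[of i "{..<m}" "%i. \<bar>C i\<bar>"] that by (simp add: R_def)
 show ?thesis
 proof (rule that[of R])
  show "R > 0" unfolding R_def by (simp add: add_pos_nonneg sum_nonneg)
  fix N x
  have "\<bar>riemann01 N m \<alpha> x i\<bar> <= R" if i: "i < m" for i
  proof -
   have "\<bar>\<Sum>k\<in>{1..Suc N}. \<alpha> i (unit_clamp (ext01 N x k))\<bar> <= (\<Sum>k\<in>{1..Suc N}. R)"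
    by (rule order_trans[OF sum_abs sum_mono]) (rule order_trans[OF C[OF i] R[OF i]], simp add: unit_clamp_bounds)
   thus ?thesis using i by (simp add: riemann01_def field_simps)
  qed
  thus "riemann01 N m \<alpha> x \<in> Rm_box m R" by (simp add: Rm_box_def)
 qed
qed

lemma riemann01_measurable:
 assumes V: "cont_Rm m V" and a: "!!i. i < m ==> continuous_on {0..1} (\<alpha> i)"
 shows "(%x. V (riemann01 N m \<alpha> x)) \<in> borel_measurable (LebN N)"
proof -
 have "(%y. V (window m 0 y)) \<in> borel_measurable borel"
  using V by (intro borel_measurable_continuous_onI) (simp add: cont_Rm_iff)
 moreover have "riemann01 N m \<alpha> \<in> measurable (LebN N) borel"
 proof (rule measurable_coordinatewise_then_product)
  fix i
  show "(%x. riemann01 N m \<alpha> x i) \<in> borel_measurable (LebN N)"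
  proof (cases "i < m")
   case True
   have "(%x. \<alpha> i (unit_clamp (ext01 N x k))) \<in> borel_measurable (LebN N)" if "k <= Suc N" for k
    by (rule measurable_compose[OF ext01_measurable[OF that]])
     (intro borel_measurable_continuous_onI continuous_unit_clamp_compose a[OF True])
   thus ?thesis unfolding riemann01_def using True
    by (simp only: if_True) (intro borel_measurable_divide borel_measurable_sum borel_measurable_const, simp)
  qed (simp add: riemann01_def)
 qed
 ultimately have "(%x. V (window m 0 (riemann01 N m \<alpha> x))) \<in> borel_measurable (LebN N)"
  by (rule measurable_compose[rotated])
 thus ?thesis by (simp add: window_id)
qed

context entropic
begin

text \<open>The case F = 1 shows that J has integral 1. Signed F are reduced to F + C, which is
  nonnegative.\<close>

lemma quasi_invariance_real:
 assumes p: "part N t" and F: "F \<in> borel_measurable (LebN N)" and b: "!!x. \<bar>F x\<bar> <= (C::real)"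
  and T: "!!x. (T has_real_derivative T' x) (at x)" "continuous_on UNIV T'"
  "!!x. x \<in> {0..1} ==> 0 < T' x" "T 0 = 0" "T 1 = 1"
  and J_def: "J = (%g. jac01 N (%i. \<beta> * (t (Suc i) - t i) - 1) T T' (marg N t g))" and Jnn: "AE g in Q. 0 <= J g"
 shows "integrable Q (%g. F (\<lambda>i\<in>{1..N}. T (g (t i))) * J g)"
  and "(\<integral>g. F (\<lambda>i\<in>{1..N}. T (g (t i))) * J g \<partial>Q) = (\<integral>g. F (marg N t g) \<partial>Q)"
proof -
 have [measurable]: "T \<in> borel_measurable borel" "T' \<in> borel_measurable borel"
  using T(2) by (auto intro!: borel_measurable_continuous_onI DERIV_continuous_on[OF T(1)])
 have Jm[measurable]: "J \<in> borel_measurable Q" unfolding J_def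
  by (rule measurable_compose[OF marg_measurable jac01_measurable]) auto
 have Tm: "(%g. \<lambda>i\<in>{1..N}. T (g (t i))) \<in> measurable Q (LebN N)"
 proof (rule measurable_restrict)
  fix i
  have "(%g. T (g (t i))) \<in> borel_measurable Q"
   by (rule measurable_compose[OF eval_measurable[OF space_sets]]) measurable
  thus "(%g. T (g (t i))) \<in> measurable Q lborel" by simp
 qed
 have Fm[measurable]: "(%g. F (\<lambda>i\<in>{1..N}. T (g (t i)))) \<in> borel_measurable Q" "(%g. F (marg N t g)) \<in> borel_measurable Q"
  by (rule measurable_compose[OF Tm F], rule measurable_compose[OF marg_measurable F])
 have "(\<integral>\<^sup>+g. ennreal (J g) \<partial>Q) = 1"
  using quasi_invariance[OF p _ T, of "%_. 1"] emeasure_space_1 by (simp add: J_def)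
 hence Ji: "integrable Q J" by (intro integrableI_nonneg) (use Jnn in auto)
 hence J1: "(\<integral>g. J g \<partial>Q) = 1" using \<open>(\<integral>\<^sup>+g. ennreal (J g) \<partial>Q) = 1\<close> nn_integral_eq_integral[OF Ji Jnn] integral_nonneg_AE[OF Jnn]
  by (metis ennreal_1 ennreal_inj zero_le_one)
 show i: "integrable Q (%g. F (\<lambda>i\<in>{1..N}. T (g (t i))) * J g)"
 proof (rule Bochner_Integration.integrable_bound[of _ "%g. C * J g"])
  show "AE g in Q. norm (F (\<lambda>i\<in>{1..N}. T (g (t i))) * J g) <= norm (C * J g)"
   by (rule AE_I2) (use b in \<open>auto simp: abs_mult intro!: mult_right_mono order_trans[OF b abs_ge_self]\<close>)
  show "(%g. F (\<lambda>i\<in>{1..N}. T (g (t i))) * J g) \<in> borel_measurable Q"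
   by (rule borel_measurable_times[OF Fm(1) Jm])
 qed (use Ji in auto)
 have nn: "0 <= F x + C" for x using b[of x] by linarith
 have iF: "integrable Q (%g. F (marg N t g))" by (rule integrable_const_bound[of _ C, OF _ Fm(2)]) (use b in simp)
 have FC: "(%x. ennreal (F x + C)) \<in> borel_measurable (LebN N)" using F by measurable
 have "ennreal (\<integral>g. F (marg N t g) + C \<partial>Q) = (\<integral>\<^sup>+g. ennreal (F (marg N t g) + C) \<partial>Q)"
  by (rule nn_integral_eq_integral[symmetric]) (use iF nn in auto)
 also have "\<dots> = (\<integral>\<^sup>+g. ennreal (F (\<lambda>i\<in>{1..N}. T (g (t i))) + C) * ennreal (J g) \<partial>Q)"
  unfolding J_def by (rule quasi_invariance[OF p FC T])
 also have "\<dots> = (\<integral>\<^sup>+g. ennreal ((F (\<lambda>i\<in>{1..N}. T (g (t i))) + C) * J g) \<partial>Q)"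
  by (rule nn_integral_cong) (simp add: ennreal_mult' nn)
 also have "\<dots> = ennreal (\<integral>g. (F (\<lambda>i\<in>{1..N}. T (g (t i))) + C) * J g \<partial>Q)"
 proof (rule nn_integral_eq_integral)
  show "integrable Q (%g. (F (\<lambda>i\<in>{1..N}. T (g (t i))) + C) * J g)" using i Ji by (simp add: distrib_right)
  show "AE g in Q. 0 <= (F (\<lambda>i\<in>{1..N}. T (g (t i))) + C) * J g"
   using Jnn by eventually_elim (intro mult_nonneg_nonneg nn)
 qed
 finally have "(\<integral>g. F (marg N t g) + C \<partial>Q) = (\<integral>g. (F (\<lambda>i\<in>{1..N}. T (g (t i))) + C) * J g \<partial>Q)"
 proof (rule ennreal_inj[THEN iffD1, rotated -1])
  show "0 <= (\<integral>g. F (marg N t g) + C \<partial>Q)" by (rule integral_nonneg_AE) (use nn in simp)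
  show "0 <= (\<integral>g. (F (\<lambda>i\<in>{1..N}. T (g (t i))) + C) * J g \<partial>Q)"
  proof (rule integral_nonneg_AE)
   show "AE g in Q. 0 <= (F (\<lambda>i\<in>{1..N}. T (g (t i))) + C) * J g"
    using Jnn by eventually_elim (intro mult_nonneg_nonneg nn)
  qed
 qed
 thus "(\<integral>g. F (\<lambda>i\<in>{1..N}. T (g (t i))) * J g \<partial>Q) = (\<integral>g. F (marg N t g) \<partial>Q)"
  using i iF Ji J1 prob_space by (simp add: distrib_right)
qed

definition grid :: "nat => nat => real" where "grid N i = real i / real (Suc N)"

lemma part_grid: "part N (grid N)"
 by (simp add: part_def grid_def divide_strict_right_mono)

text \<open>The derivative at \<epsilon> = 0 of F(T x) times the Jacobian, for T = id + \<epsilon> f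
  and F the discretized cylinder function. The sum of \<open>f1\<close> stems from the factors T',
  the sum of slopes from the powers.\<close>

definition ibp_term :: "nat => nat => ((nat => real) => real) => (nat => real => real) => (real => real) => (real => real) => (real => real) => real" where
 "ibp_term N m U \<alpha> f f1 g = (\<Sum>i<m. pd i U (riemann01 N m \<alpha> (marg N (grid N) g)) *
       ((\<Sum>k\<in>{1..Suc N}. deriv01 (\<alpha> i) (ext01 N (marg N (grid N) g) k) * f (ext01 N (marg N (grid N) g) k)) / real (Suc N)))
   + U (riemann01 N m \<alpha> (marg N (grid N) g)) *
    ((\<Sum>k\<in>{1..N}. f1 (marg N (grid N) g k)) + (\<Sum>k\<le>N. (\<beta> / real (Suc N) - 1) * slope N f (marg N (grid N) g) k))"

text \<open>By quasi-invariance the difference quotients in \<epsilon> of F(T x) J all have integral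
  zero. They are bounded uniformly on the simplex, so dominated convergence along a sequence
  \<epsilon>_j tending to 0 gives the claim.\<close>

lemma IBP_discrete:
 assumes rep: "rep_ok 1 m U \<alpha>"
  and f: "!!x. (f has_real_derivative f1 x) (at x)" "continuous_on UNIV f1" "f 0 = 0" "f 1 = 0"
 shows "integral\<^sup>L Q (ibp_term N m U \<alpha> f f1) = 0" and "ibp_term N m U \<alpha> f f1 \<in> borel_measurable Q"
proof -
 let ?X = "marg N (grid N)"
 have U: "CkRm m (Suc 0) U" and al: "!!i. i < m ==> Ck01 (Suc 0) (\<alpha> i)" using rep by (auto simp: rep_ok_def simp del: CkRm.simps Ck01.simps)
 have alc: "!!i. i < m ==> continuous_on {0..1} (\<alpha> i)" using al Ck01_continuous by blast
 obtain R where R: "R > 0" "!!x. riemann01 N m \<alpha> x \<in> Rm_box m R" 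
  by (rule riemann01_box[of m \<alpha>]) (rule alc, assumption, rule that, assumption, simp)
 obtain C where C: "!!y. y \<in> Rm_box m R ==> \<bar>U y\<bar> <= C" using cont_Rm_bounded[OF CkRm_cont[OF U], of R] by blast
 obtain L where L: "0 <= L" "!!z z'. z \<in> Rm_box m R ==> z' \<in> Rm_box m R ==> \<bar>U z' - U z\<bar> <= L * (\<Sum>i<m. \<bar>z' i - z i\<bar>)"
  using C1_Lipschitz[OF U, of R] by blast
 obtain M0 where M0: "0 <= M0" "!!x. x \<in> {0..1} ==> \<bar>f1 x\<bar> <= M0" using bounded_on_01[OF continuous_on_subset[OF f(2)]] by (metis subset_UNIV)
 define M where "M = M0 + 1"
 have M1: "\<bar>f1 x\<bar> <= M" if "x \<in> {0..1}" for x using M0(2)[OF that] by (simp add: M_def)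
 have M: "1 <= M" "!!x. x \<in> {0..1} ==> \<bar>f1 x\<bar> <= M" using M0(1) by (simp add: M_def) (rule M1)
 have fL: "\<bar>f x - f y\<bar> <= M * \<bar>x - y\<bar>" if "x \<in> {0..1}" "y \<in> {0..1}" for x y
  using field_differentiable_bound[of "{0..1}" f f1 M x y] M(2) that by (auto simp: has_field_derivative_at_within f(1))
 \<comment> \<open>The inner functions are extended to the line so that they can be differentiated
   two-sidedly at \<epsilon> = 0, even at the nodes 0 and 1.\<close>
 have "\<exists>A. (\<forall>x. (A has_real_derivative deriv01 (\<alpha> i) (unit_clamp x)) (at x)) \<and> (\<forall>x\<in>{0..1}. A x = \<alpha> i x)" if l: "i < m" for i
  using Ck01_extend1_ex[OF al[OF l]] .
 then obtain A where A: "!!i x. i < m ==> (A i has_real_derivative deriv01 (\<alpha> i) (unit_clamp x)) (at x)"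
  "!!i x. i < m ==> x \<in> {0..1} ==> A i x = \<alpha> i x" by metis
 have "\<exists>D. \<forall>x\<in>{0..1}. \<bar>deriv01 (\<alpha> i) x\<bar> <= D" if "i < m" for i
 proof -
  have "continuous_on {0..1} (deriv01 (\<alpha> i))" using al[OF that] by simp
  thus ?thesis using bounded_on_01 by metis
 qed
 then obtain D where D: "!!i x. i < m ==> x \<in> {0..1} ==> \<bar>deriv01 (\<alpha> i) x\<bar> <= D i" by metis
 have AL: "\<bar>A i x - A i y\<bar> <= D i * \<bar>x - y\<bar>" if "i < m" for i x y
  using field_differentiable_bound[of UNIV "A i" "%x. deriv01 (\<alpha> i) (unit_clamp x)" "D i" x y] A(1)[OF that] D[OF that] unit_clamp_bounds by simp
 define p where "p = \<beta> / real (Suc N) - 1"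
 have pe: "(%i. \<beta> * (grid N (Suc i) - grid N i) - 1) = (%i. p)" by (auto simp: p_def grid_def diff_divide_distrib[symmetric])
 obtain B1 where B1: "B1 \<ge> 0" "!!a \<epsilon>. (\<forall>i\<in>{1..N}. \<bar>a i\<bar> <= M) ==> 0 <= \<epsilon> ==> \<epsilon> * M <= 1/2 ==> \<bar>(\<Prod>i\<in>{1..N}. (1 + \<epsilon> * a i) powr 1) - 1\<bar> <= B1 * \<epsilon>"
  using prod_powr_bound[of "{1..N}" M "%_. 1"] M(1) by blast
 obtain B2 where B2: "B2 \<ge> 0" "!!a \<epsilon>. (\<forall>i\<in>{..N}. \<bar>a i\<bar> <= M) ==> 0 <= \<epsilon> ==> \<epsilon> * M <= 1/2 ==> \<bar>(\<Prod>i\<in>{..N}. (1 + \<epsilon> * a i) powr p) - 1\<bar> <= B2 * \<epsilon>"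
  using prod_powr_bound[of "{..N}" M "%_. p"] M(1) by blast
 \<comment> \<open>With \<epsilon> M at most 1/2 the derivative of T is positive on [0,1], and the
   bounds of \<open>prod_powr_bound\<close> apply.\<close>
 define \<epsilon> where "\<epsilon> j = 1 / (2 * M * real (Suc j))" for j :: nat
 have \<epsilon>: "0 < \<epsilon> j" "\<epsilon> j * M <= 1/2" for j
 proof -
  have "M > 0" using M(1) by simp
  hence "\<epsilon> j * M = 1 / (2 * real (Suc j))" "0 < \<epsilon> j" by (simp_all add: \<epsilon>_def del: of_nat_Suc)
  thus "0 < \<epsilon> j" "\<epsilon> j * M <= 1/2" by simp_all
 qed
 have \<epsilon>1: "\<epsilon> j <= 1" for j 
 proof -
  have "\<epsilon> j * 1 <= \<epsilon> j * M" by (rule mult_left_mono[OF M(1) less_imp_le[OF \<epsilon>(1)]])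
  thus ?thesis using \<epsilon>(2)[of j] by linarith
 qed
 have \<epsilon>0: "\<epsilon> \<longlonglongrightarrow> 0"
 proof -
  have "(%j. (1 / (2 * M)) * (1 / real (Suc j))) \<longlonglongrightarrow> 0" using tendsto_mult_left[OF LIMSEQ_Suc[OF lim_1_over_n], of "1 / (2 * M)"] by simp
  thus ?thesis unfolding \<epsilon>_def by simp
 qed
 define T where "T j x = x + \<epsilon> j * f x" for j x
 define T' where "T' j x = 1 + \<epsilon> j * f1 x" for j x
 have T: "!!x. (T j has_real_derivative T' j x) (at x)" "continuous_on UNIV (T' j)"
  "!!x. x \<in> {0..1} ==> 0 < T' j x" "T j 0 = 0" "T j 1 = 1" for j
 proof -
  show "(T j has_real_derivative T' j x) (at x)" for x unfolding T_def T'_def by (intro DERIV_add DERIV_ident DERIV_cmult f)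
  show "continuous_on UNIV (T' j)" unfolding T'_def by (intro continuous_intros f)
  show "0 < T' j x" if "x \<in> {0..1}" for x
  proof -
   have "\<bar>\<epsilon> j * f1 x\<bar> <= \<epsilon> j * M" using M(2)[OF that] \<epsilon>(1)[of j] by (simp add: abs_mult)
   thus ?thesis using \<epsilon>(2)[of j] unfolding T'_def by linarith
  qed
 qed (simp_all add: T_def f)
 \<comment> \<open>Since f vanishes at both ends, |f(x)| is at most M x and M (1 - x), so the
   displacement \<epsilon> f(x) never crosses an endpoint.\<close>
 have T01: "T j x \<in> {0..1}" if x: "x \<in> {0..1}" for j x
 proof -
  have "\<bar>f x\<bar> <= M * x" "\<bar>f x\<bar> <= M * (1 - x)" using fL[OF x, of 0] fL[OF x, of 1] f x by auto
  hence "\<epsilon> j * \<bar>f x\<bar> <= \<epsilon> j * M * x" "\<epsilon> j * \<bar>f x\<bar> <= \<epsilon> j * M * (1 - x)" using \<epsilon>(1)[of j] by (simp_all add: mult.assoc)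
  moreover have "\<epsilon> j * M * x <= 1/2 * x" "\<epsilon> j * M * (1 - x) <= 1/2 * (1 - x)"
   by (rule mult_right_mono[OF \<epsilon>(2)], use x in simp)+
  moreover have "\<bar>\<epsilon> j * f x\<bar> = \<epsilon> j * \<bar>f x\<bar>" using \<epsilon>(1)[of j] by (simp add: abs_mult)
  ultimately show ?thesis using x unfolding T_def by auto
 qed
 define F where "F x = U (riemann01 N m \<alpha> x)" for x
 have Fm: "F \<in> borel_measurable (LebN N)" unfolding F_def by (rule riemann01_measurable[of m U \<alpha>, OF CkRm_cont[OF U] alc])
 have Fb: "\<bar>F x\<bar> <= C" for x unfolding F_def by (rule C[OF R(2)])
 have C0: "0 <= C" using Fb[of undefined] by linarith
 define J where "J j g = jac01 N (%i. p) (T j) (T' j) (?X g)" for j g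
 define FT where "FT j g = F (\<lambda>i\<in>{1..N}. T j (g (grid N i)))" for j g
 \<comment> \<open>The exponent 1 lets the factors T' be treated by the same two lemmas as the
   powers of the slopes.\<close>
 define P1 where "P1 x e = (\<Prod>i\<in>{1..N}. (1 + e * f1 (x i)) powr 1)" for x :: "nat => real" and e
 define P2 where "P2 x e = (\<Prod>i\<in>{..N}. (1 + e * slope N f x i) powr p)" for x e
 define DF where "DF x = (\<Sum>i<m. pd i U (riemann01 N m \<alpha> x) * ((\<Sum>k\<in>{1..Suc N}. deriv01 (\<alpha> i) (ext01 N x k) * f (ext01 N x k)) / real (Suc N)))" for x
 define VN where "VN x = (\<Sum>k\<in>{1..N}. f1 (x k)) + (\<Sum>k\<le>N. p * slope N f x k)" for x
 have inc: "AE g in Q. incr01 N (?X g)" by (rule AE_incr01[OF part_grid])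
 have slope_le: "\<bar>slope N f x k\<bar> <= M" if "incr01 N x" "k <= N" for x k
 proof -
  have "ext01 N x k < ext01 N x (Suc k)" using that by (simp add: incr01_def)
  thus ?thesis using fL[of "ext01 N x (Suc k)" "ext01 N x k"] incr01_bounds[OF that(1), of k] incr01_bounds[OF that(1), of "Suc k"] that(2)
   by (simp add: slope_def abs_divide pos_divide_le_eq)
 qed
 have e01: "ext01 N x k \<in> {0..1}" if "incr01 N x" "k <= Suc N" for x k using incr01_bounds[OF that] by simp
 have x01: "x k \<in> {0..1}" if "incr01 N x" "k \<in> {1..N}" for x k using e01[OF that(1), of k] that(2) by (simp add: ext01_def split: if_splits)
 have JP: "J j g = P1 (?X g) (\<epsilon> j) * P2 (?X g) (\<epsilon> j)" if i: "incr01 N (?X g)" for j g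
 proof -
  have 1: "(\<Prod>k\<in>{1..N}. T' j (?X g k)) = P1 (?X g) (\<epsilon> j)" unfolding P1_def
  proof (rule prod.cong[OF refl])
   fix k assume "k \<in> {1..N}"
   hence "T' j (?X g k) > 0" by (intro T(3) x01[OF i])
   thus "T' j (?X g k) = (1 + \<epsilon> j * f1 (?X g k)) powr 1" unfolding T'_def by (simp only: powr_one less_imp_le)
  qed
  have "(T j (ext01 N (?X g) (Suc k)) - T j (ext01 N (?X g) k)) / (ext01 N (?X g) (Suc k) - ext01 N (?X g) k) = 1 + \<epsilon> j * slope N f (?X g) k" if "k <= N" for k
  proof -
   have "ext01 N (?X g) k < ext01 N (?X g) (Suc k)" using i that by (simp only: incr01_def)
   thus ?thesis unfolding T_def slope_def by (simp add: field_simps del: restrict_apply)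
  qed
  thus ?thesis unfolding J_def jac01_def 1 P2_def by (intro arg_cong2[of _ _ _ _ times] refl prod.cong) auto
 qed
 have P1b: "\<bar>P1 x (\<epsilon> j) - 1\<bar> <= B1 * \<epsilon> j" if "incr01 N x" for x j
  unfolding P1_def using x01[OF that] M(2) \<epsilon>[of j] by (intro B1(2)) auto
 have P2b: "\<bar>P2 x (\<epsilon> j) - 1\<bar> <= B2 * \<epsilon> j" if "incr01 N x" for x j
  unfolding P2_def using slope_le[OF that] \<epsilon>[of j] by (intro B2(2)) auto
 define B where "B = B1 * (1 + B2) + B2"
 have B: "0 <= B" using B1(1) B2(1) by (simp add: B_def)
 have Jb: "\<bar>J j g - 1\<bar> <= B * \<epsilon> j" if i: "incr01 N (?X g)" for j g
 proof -
  have "B2 * \<epsilon> j <= B2" using \<epsilon>1[of j] B2(1) by (simp add: mult_left_le)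
  hence "\<bar>P1 (?X g) (\<epsilon> j) - 1\<bar> * (1 + \<bar>P2 (?X g) (\<epsilon> j) - 1\<bar>) + \<bar>P2 (?X g) (\<epsilon> j) - 1\<bar> <= (B1 * \<epsilon> j) * (1 + B2) + B2 * \<epsilon> j"
   using P1b[OF i, of j] P2b[OF i, of j] B1(1) B2(1) \<epsilon>(1)[of j] by (intro add_mono mult_mono) auto
  also have "\<dots> = B * \<epsilon> j" by (simp add: B_def algebra_simps)
  finally show ?thesis unfolding JP[OF i] using abs_mult_minus_one_le[of "P1 (?X g) (\<epsilon> j)" "P2 (?X g) (\<epsilon> j)"] by linarith
 qed
 have eT: "ext01 N (\<lambda>i\<in>{1..N}. T j (g (grid N i))) k = T j (ext01 N (?X g) k)" if "k <= Suc N" for j g k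
  using that T(4,5)[of j] by (auto simp: ext01_def)
 define c where "c x e = (%i. if i < m then (\<Sum>k\<in>{1..Suc N}. A i (ext01 N x k + e * f (ext01 N x k))) / real (Suc N) else 0)" for x e
 have cT: "riemann01 N m \<alpha> (\<lambda>i\<in>{1..N}. T j (g (grid N i))) = c (?X g) (\<epsilon> j)" if i: "incr01 N (?X g)" for j g
 proof (rule ext)
  fix l
  have "\<alpha> l (unit_clamp (ext01 N (\<lambda>i\<in>{1..N}. T j (g (grid N i))) k)) = A l (ext01 N (?X g) k + \<epsilon> j * f (ext01 N (?X g) k))" if "l < m" "k \<in> {1..Suc N}" for k
  proof -
   have k: "k <= Suc N" using that by simp
   have "T j (ext01 N (?X g) k) \<in> {0..1}" by (rule T01[OF e01[OF i k]])
   thus ?thesis unfolding eT[OF k] using A(2)[OF that(1)] by (simp add: unit_clamp_eq T_def[symmetric] del: restrict_apply)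
  qed
  thus "riemann01 N m \<alpha> (\<lambda>i\<in>{1..N}. T j (g (grid N i))) l = c (?X g) (\<epsilon> j) l" unfolding riemann01_def c_def by (auto intro!: sum.cong arg_cong2[of _ _ _ _ "(/)"] simp del: restrict_apply sum.cl_ivl_Suc)
 qed
 have c0: "riemann01 N m \<alpha> x = c x 0" if i: "incr01 N x" for x
 proof (rule ext)
  fix l
  have "(\<Sum>k\<in>{1..Suc N}. \<alpha> l (unit_clamp (ext01 N x k))) = (\<Sum>k\<in>{1..Suc N}. A l (ext01 N x k + 0 * f (ext01 N x k)))" if "l < m"
  proof (rule sum.cong[OF refl])
   fix k assume "k \<in> {1..Suc N}"
   hence "ext01 N x k \<in> {0..1}" by (intro e01[OF i]) simp
   thus "\<alpha> l (unit_clamp (ext01 N x k)) = A l (ext01 N x k + 0 * f (ext01 N x k))"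
    using A(2)[OF that] by (simp add: unit_clamp_eq)
  qed
  thus "riemann01 N m \<alpha> x l = c x 0 l" unfolding riemann01_def c_def by (cases "l < m") (simp_all only: if_True if_False)
 qed
 have dc: "((%e. c x e i) has_real_derivative (\<Sum>k\<in>{1..Suc N}. deriv01 (\<alpha> i) (ext01 N x k) * f (ext01 N x k)) / real (Suc N)) (at 0)"
  if i: "incr01 N x" "i < m" for x i
 proof -
  have "((%e. A i (ext01 N x k + e * f (ext01 N x k))) has_real_derivative deriv01 (\<alpha> i) (ext01 N x k) * f (ext01 N x k)) (at 0)" if k: "k \<in> {1..Suc N}" for k
  proof (rule DERIV_chain2[where f="A i"])
   have "unit_clamp (ext01 N x k) = ext01 N x k" by (rule unit_clamp_eq[OF e01[OF i(1)]]) (use k in auto)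
   thus "(A i has_real_derivative deriv01 (\<alpha> i) (ext01 N x k)) (at (ext01 N x k + 0 * f (ext01 N x k)))" using A(1)[OF i(2), of "ext01 N x k"] by simp
   show "((%e. ext01 N x k + e * f (ext01 N x k)) has_real_derivative f (ext01 N x k)) (at 0)"
    by (rule derivative_eq_intros refl | simp)+
  qed
  hence "((%e. (\<Sum>k\<in>{1..Suc N}. A i (ext01 N x k + e * f (ext01 N x k))) / real (Suc N)) has_real_derivative (\<Sum>k\<in>{1..Suc N}. deriv01 (\<alpha> i) (ext01 N x k) * f (ext01 N x k)) / real (Suc N)) (at 0)"
   by (intro DERIV_cdivide DERIV_sum)
  thus ?thesis using i(2) by (simp add: c_def del: sum.cl_ivl_Suc)
 qed
 have lim: "(%j. (FT j g * J j g - F (?X g)) / \<epsilon> j) \<longlonglongrightarrow> DF (?X g) + F (?X g) * VN (?X g)" if i: "incr01 N (?X g)" for g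
 proof -
  define \<Psi> where "\<Psi> e = U (c (?X g) e) * (P1 (?X g) e * P2 (?X g) e)" for e
  have du: "((%e. U (c (?X g) e)) has_real_derivative DF (?X g)) (at 0)"
   unfolding DF_def c0[OF i]
   by (rule C1_chain_curve[OF U]) (use dc[OF i] in \<open>auto simp: c_def Rm_def simp del: restrict_apply sum.cl_ivl_Suc\<close>)
  have dp: "((%e. P1 (?X g) e * P2 (?X g) e) has_real_derivative VN (?X g)) (at 0)"
   using DERIV_mult[OF prod_powr_deriv[of "{1..N}" "%i. f1 (?X g i)" "%_. 1"] prod_powr_deriv[of "{..N}" "slope N f (?X g)" "%_. p"]]
   unfolding P1_def P2_def VN_def by (simp del: restrict_apply)
  have P0: "P1 (?X g) 0 * P2 (?X g) 0 = 1" by (simp add: P1_def P2_def)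
  have e: "DF (?X g) * (P1 (?X g) 0 * P2 (?X g) 0) + VN (?X g) * U (c (?X g) 0) = DF (?X g) + F (?X g) * VN (?X g)"
   by (simp only: P0 F_def c0[OF i] mult_1_right mult.commute)
  have d: "(\<Psi> has_real_derivative DF (?X g) + F (?X g) * VN (?X g)) (at 0)"
   using DERIV_mult[OF du dp] unfolding e \<Psi>_def .
  have fl: "filterlim \<epsilon> (at 0) sequentially" unfolding filterlim_at using \<epsilon>0 \<epsilon>(1) by (auto simp: less_imp_neq[symmetric] less_imp_neq)
  have "((%e. (\<Psi> e - \<Psi> 0) / (e - 0)) \<longlongrightarrow> DF (?X g) + F (?X g) * VN (?X g)) (at 0)" using d by (simp only: has_field_derivative_iff)
  from filterlim_compose[OF this fl] have "(%j. (\<Psi> (\<epsilon> j) - \<Psi> 0) / (\<epsilon> j - 0)) \<longlonglongrightarrow> DF (?X g) + F (?X g) * VN (?X g)" .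
  moreover have "\<Psi> (\<epsilon> j) = FT j g * J j g" for j unfolding \<Psi>_def FT_def F_def cT[OF i] JP[OF i] ..
  moreover have "\<Psi> 0 = F (?X g)" unfolding \<Psi>_def F_def c0[OF i] by (simp add: P1_def P2_def)
  ultimately show ?thesis by simp
 qed
 define K where "K = L * (\<Sum>i<m. \<bar>D i\<bar> * M) * (1 + B) + C * B"
 have bound: "\<bar>(FT j g * J j g - F (?X g)) / \<epsilon> j\<bar> <= K" if i: "incr01 N (?X g)" for j g
 proof -
  have "\<bar>c (?X g) (\<epsilon> j) l - c (?X g) 0 l\<bar> <= \<bar>D l\<bar> * M * \<epsilon> j" if l: "l < m" for l
  proof -
   have tk: "\<bar>A l (ext01 N (?X g) k + \<epsilon> j * f (ext01 N (?X g) k)) - A l (ext01 N (?X g) k + 0 * f (ext01 N (?X g) k))\<bar> <= \<bar>D l\<bar> * M * \<epsilon> j" if k: "k \<in> {1..Suc N}" for k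
   proof -
    have ek: "ext01 N (?X g) k \<in> {0..1}" by (rule e01[OF i]) (use k in simp)
    have fM: "\<bar>f (ext01 N (?X g) k)\<bar> <= M"
    proof -
     have "M * \<bar>ext01 N (?X g) k - 0\<bar> <= M * 1" using ek M(1) by (intro mult_left_mono) (auto simp del: restrict_apply)
     thus ?thesis using fL[OF ek, of 0] f(3) by (simp del: restrict_apply)
    qed
    have "\<bar>A l (ext01 N (?X g) k + \<epsilon> j * f (ext01 N (?X g) k)) - A l (ext01 N (?X g) k + 0 * f (ext01 N (?X g) k))\<bar> <= D l * \<bar>\<epsilon> j * f (ext01 N (?X g) k)\<bar>"
     using AL[OF l, of "ext01 N (?X g) k + \<epsilon> j * f (ext01 N (?X g) k)" "ext01 N (?X g) k"] by (simp del: restrict_apply)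
    also have "\<dots> <= \<bar>D l\<bar> * (\<epsilon> j * M)"
     unfolding abs_mult using fM \<epsilon>(1)[of j] by (intro mult_mono) (auto simp del: restrict_apply)
    finally show ?thesis by (simp add: mult_ac del: restrict_apply)
   qed
   have "\<bar>c (?X g) (\<epsilon> j) l - c (?X g) 0 l\<bar> = \<bar>\<Sum>k\<in>{1..Suc N}. A l (ext01 N (?X g) k + \<epsilon> j * f (ext01 N (?X g) k)) - A l (ext01 N (?X g) k + 0 * f (ext01 N (?X g) k))\<bar> / real (Suc N)"
    unfolding c_def sum_subtractf using l by (simp add: diff_divide_distrib[symmetric] abs_divide del: restrict_apply sum.cl_ivl_Suc)
   also have "\<dots> <= (\<Sum>k\<in>{1..Suc N}. \<bar>D l\<bar> * M * \<epsilon> j) / real (Suc N)"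
    by (intro divide_right_mono order_trans[OF sum_abs sum_mono] tk) auto
   also have "\<dots> = \<bar>D l\<bar> * M * \<epsilon> j" by simp
   finally show ?thesis .
  qed
  hence "(\<Sum>l<m. \<bar>c (?X g) (\<epsilon> j) l - c (?X g) 0 l\<bar>) <= (\<Sum>l<m. \<bar>D l\<bar> * M * \<epsilon> j)" by (intro sum_mono) auto
  hence s: "L * (\<Sum>l<m. \<bar>c (?X g) (\<epsilon> j) l - c (?X g) 0 l\<bar>) <= L * (\<Sum>l<m. \<bar>D l\<bar> * M) * \<epsilon> j"
   using L(1) by (simp add: sum_distrib_right[symmetric] mult_left_mono mult.assoc)
  have 1: "\<bar>FT j g - F (?X g)\<bar> <= L * (\<Sum>l<m. \<bar>D l\<bar> * M) * \<epsilon> j"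
   using L(2)[OF R(2)[of "?X g"] R(2)[of "\<lambda>i\<in>{1..N}. T j (g (grid N i))"]] s unfolding FT_def F_def cT[OF i] c0[OF i] by linarith
  have "B * \<epsilon> j <= B" using \<epsilon>1[of j] B by (simp add: mult_left_le)
  hence 2: "\<bar>J j g\<bar> <= 1 + B" using Jb[OF i, of j] by linarith
  have "FT j g * J j g - F (?X g) = (FT j g - F (?X g)) * J j g + F (?X g) * (J j g - 1)" by (simp add: algebra_simps)
  hence "\<bar>FT j g * J j g - F (?X g)\<bar> <= \<bar>FT j g - F (?X g)\<bar> * \<bar>J j g\<bar> + \<bar>F (?X g)\<bar> * \<bar>J j g - 1\<bar>" by (metis abs_mult abs_triangle_ineq)
  also have "\<dots> <= (L * (\<Sum>l<m. \<bar>D l\<bar> * M) * \<epsilon> j) * (1 + B) + C * (B * \<epsilon> j)"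
   using 1 2 Jb[OF i, of j] Fb C0 B by (intro add_mono mult_mono) auto
  also have "\<dots> = K * \<epsilon> j" by (simp add: K_def algebra_simps)
  finally show ?thesis using \<epsilon>(1)[of j] by (simp add: abs_divide pos_divide_le_eq)
 qed
 have Jnn: "AE g in Q. 0 <= J j g" for j
  using inc
 proof eventually_elim
  fix g assume i: "incr01 N (?X g)"
  have "0 <= P1 (?X g) (\<epsilon> j)" "0 <= P2 (?X g) (\<epsilon> j)" unfolding P1_def P2_def by (auto intro!: prod_nonneg)
  thus "0 <= J j g" by (simp add: JP[OF i])
 qed
 have Jd: "J j = (%g. jac01 N (%i. \<beta> * (grid N (Suc i) - grid N i) - 1) (T j) (T' j) (?X g))" for j
  unfolding J_def pe by (rule refl)
 note QI = quasi_invariance_real[OF part_grid Fm Fb T Jd Jnn]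
 have Fi: "integrable Q (%g. F (?X g))"
  by (rule integrable_const_bound[of _ C, OF _ measurable_compose[OF marg_measurable Fm]]) (use Fb in simp)
 have zero: "(\<integral>g. (FT j g * J j g - F (?X g)) / \<epsilon> j \<partial>Q) = 0" for j
  using QI[of j] Fi unfolding FT_def by simp
 have hm: "(%g. (FT j g * J j g - F (?X g)) / \<epsilon> j) \<in> borel_measurable Q" for j
  using borel_measurable_integrable[OF QI(1)[of j]] borel_measurable_integrable[OF Fi] unfolding FT_def by measurable
 have DVm: "(%g. DF (?X g) + F (?X g) * VN (?X g)) \<in> borel_measurable Q"
 proof -
  have f01m: "f \<in> borel_measurable borel" "f1 \<in> borel_measurable borel"
   using f(2) by (auto intro!: borel_measurable_continuous_onI DERIV_continuous_on[OF f(1)])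
  have em: "(%x. q (ext01 N x k)) \<in> borel_measurable (LebN N)" if "q \<in> borel_measurable borel" "k <= Suc N" for q :: "real => real" and k
   by (rule measurable_compose[OF ext01_measurable[OF that(2)] that(1)])
  \<comment> \<open>Outside [0,1] the value of \<open>deriv01\<close> is an arbitrary choice, so
    measurability on \<open>LebN N\<close> is shown for the clamped expression, which agrees with
    \<open>DF\<close> at the marginals of every g in \<open>space Q\<close>.\<close>
  define DF' where "DF' x = (\<Sum>i<m. pd i U (riemann01 N m \<alpha> x) * ((\<Sum>k\<in>{1..Suc N}. deriv01 (\<alpha> i) (unit_clamp (ext01 N x k)) * f (ext01 N x k)) / real (Suc N)))" for x
  have d: "(%x. deriv01 (\<alpha> i) (unit_clamp x)) \<in> borel_measurable borel" if "i < m" for i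
   using al[OF that] by (intro borel_measurable_continuous_onI continuous_unit_clamp_compose) auto
  have DFm: "DF' \<in> borel_measurable (LebN N)"
   unfolding DF'_def[abs_def]
  proof (intro borel_measurable_sum borel_measurable_times borel_measurable_divide borel_measurable_const)
   fix i assume i: "i \<in> {..<m}"
   show "(%x. pd i U (riemann01 N m \<alpha> x)) \<in> borel_measurable (LebN N)"
    by (rule riemann01_measurable[of m "pd i U" \<alpha>, OF _ alc]) (use CkRm_pd[OF U] i in auto)
   fix k assume k: "k \<in> {1..Suc N}"
   show "(%x. deriv01 (\<alpha> i) (unit_clamp (ext01 N x k))) \<in> borel_measurable (LebN N)"
    by (rule em[OF d]) (use i k in auto)
   show "(%x. f (ext01 N x k)) \<in> borel_measurable (LebN N)" by (rule em[OF f01m(1)]) (use k in auto)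
  qed
  have VNm: "(%x. (\<Sum>k\<in>{1..N}. f1 (ext01 N x k)) + (\<Sum>k\<le>N. p * slope N f x k)) \<in> borel_measurable (LebN N)"
   unfolding slope_def
   by (intro borel_measurable_add borel_measurable_sum borel_measurable_times borel_measurable_divide borel_measurable_diff borel_measurable_const em f01m ext01_measurable) auto
  have tot: "(%x. DF' x + F x * ((\<Sum>k\<in>{1..N}. f1 (ext01 N x k)) + (\<Sum>k\<le>N. p * slope N f x k))) \<in> borel_measurable (LebN N)"
   by (rule borel_measurable_add[OF DFm borel_measurable_times[OF Fm VNm]])
  have e: "VN x = (\<Sum>k\<in>{1..N}. f1 (ext01 N x k)) + (\<Sum>k\<le>N. p * slope N f x k)" for x
   unfolding VN_def by (intro arg_cong2[of _ _ _ _ "(+)"] refl sum.cong) (auto simp: ext01_def)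
  have eg: "DF (?X g) = DF' (?X g)" if g: "g \<in> space Q" for g
  proof -
   have "ext01 N (?X g) k \<in> {0..1}" if "k <= Suc N" for k
    using G0D(3,4)[of g] g that by (auto simp: ext01_def space_Q)
   thus ?thesis unfolding DF_def DF'_def by (intro sum.cong arg_cong2[of _ _ _ _ times] arg_cong2[of _ _ _ _ "(/)"] refl) (auto simp: unit_clamp_eq simp del: restrict_apply)
  qed
  show ?thesis using measurable_compose[OF marg_measurable tot] by (subst measurable_cong[OF arg_cong2[of _ _ _ _ "(+)", OF eg refl]]) (simp_all add: e del: restrict_apply)
 qed
 have "(%j. \<integral>g. (FT j g * J j g - F (?X g)) / \<epsilon> j \<partial>Q) \<longlonglongrightarrow> (\<integral>g. DF (?X g) + F (?X g) * VN (?X g) \<partial>Q)"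
 proof (rule integral_dominated_convergence[where w="%_. K"])
  show "AE g in Q. (%j. (FT j g * J j g - F (?X g)) / \<epsilon> j) \<longlonglongrightarrow> DF (?X g) + F (?X g) * VN (?X g)"
   using inc by eventually_elim (rule lim)
  show "AE g in Q. norm ((FT j g * J j g - F (?X g)) / \<epsilon> j) <= K" for j
   using inc by eventually_elim (use bound in simp)
 qed (use hm DVm in auto)
 hence l: "(%j::nat. 0) \<longlonglongrightarrow> (\<integral>g. DF (?X g) + F (?X g) * VN (?X g) \<partial>Q)" by (simp only: zero)
 have "(\<integral>g. DF (?X g) + F (?X g) * VN (?X g) \<partial>Q) = 0" by (rule LIMSEQ_unique[OF l tendsto_const])
 thus "integral\<^sup>L Q (ibp_term N m U \<alpha> f f1) = 0" unfolding ibp_term_def[abs_def] DF_def F_def VN_def p_def .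
 show "ibp_term N m U \<alpha> f f1 \<in> borel_measurable Q" using DVm unfolding ibp_term_def[abs_def] DF_def F_def VN_def p_def .
qed

end


section \<open>The jump sum as a limit over partitions\<close>

lemma gright_eq: "g \<in> G0 ==> gright g a = g a"
 unfolding gright_def by (rule tendsto_Lim[OF trivial_limit_at_right_real G0_right_limit])

lemma gleft_tendsto:
 assumes g: "g \<in> G0" shows "(g \<longlongrightarrow> gleft g a) (at_left a)"
proof -
 define L where "L = (SUP s\<in>{..<a}. g s)"
 have bdd: "bdd_above (g ` {..<a})" by (rule bdd_aboveI2[of _ _ 1]) (rule G0D(4)[OF g])
 have "(g \<longlongrightarrow> L) (at_left a)"
 proof (rule increasing_tendsto)
  show "\<forall>\<^sub>F s in at_left a. g s <= L"
   unfolding eventually_at_left_field L_def by (intro exI[of _ "a - 1"]) (auto intro!: cSUP_upper bdd)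
  fix x assume "x < L"
  then obtain s where s: "s < a" "x < g s" unfolding L_def using less_cSUP_iff[OF _ bdd] by auto
  show "\<forall>\<^sub>F s in at_left a. x < g s"
   unfolding eventually_at_left_field using s G0_mono[OF g, of s] by (intro exI[of _ s]) (auto intro: less_le_trans)
 qed
 thus ?thesis unfolding gleft_def using tendsto_Lim[OF trivial_limit_at_left_real] by metis
qed

lemma gleft_bounds:
 assumes g: "g \<in> G0" shows "s < a ==> g s <= gleft g a" "gleft g a <= g a" "gleft g a \<in> {0..1}"
  "(!!s. s < a ==> g s <= r) ==> gleft g a <= r"
proof -
 have ub: "gleft g a <= r" if "!!s. s < a ==> g s <= r" for r
  by (rule tendsto_upperbound[OF gleft_tendsto[OF g] _ trivial_limit_at_left_real])
   (auto simp: eventually_at_left_field intro!: exI[of _ "a - 1"] that)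
 thus "(!!s. s < a ==> g s <= r) ==> gleft g a <= r" .
 show lb: "g s <= gleft g a" if "s < a" for s
  by (rule tendsto_lowerbound[OF gleft_tendsto[OF g] _ trivial_limit_at_left_real])
   (use that in \<open>auto simp: eventually_at_left_field intro!: exI[of _ s] G0_mono[OF g]\<close>)
 show "gleft g a <= g a" by (rule ub) (auto intro: G0_mono[OF g])
 show "gleft g a \<in> {0..1}" using lb[of "a - 1"] G0D(3)[OF g, of "a - 1"] ub[of 1] G0D(4)[OF g] by auto
qed

lemma jumps_iff: "g \<in> G0 ==> a \<in> jumps g \<longleftrightarrow> 0 < a \<and> a < 1 \<and> gleft g a < g a"
 using gleft_bounds(2)[of g a] by (auto simp: jumps_def gright_eq)

lemma countable_jumps:
 assumes g: "g \<in> G0" shows "countable (jumps g)"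
proof (rule countable_subset[OF _ mono_ctble_discont])
 show "mono g" by (rule monoI) (rule G0_mono[OF g])
 show "jumps g \<subseteq> {a. \<not> isCont g a}"
 proof
  fix a assume "a \<in> jumps g"
  hence "gleft g a \<noteq> g a" by (simp add: jumps_iff[OF g])
  moreover have "gleft g a = g a" if "isCont g a"
  proof -
   have "(g \<longlongrightarrow> g a) (at_left a)" using that by (simp add: isCont_def filterlim_at_split)
   thus ?thesis by (rule tendsto_unique[OF trivial_limit_at_left_real gleft_tendsto[OF g]])
  qed
  ultimately show "a \<in> {a. \<not> isCont g a}" by auto
 qed
qed

section \<open>Levels of g and the trapezoid error\<close>

abbreviation mesh :: "nat => nat => real" where "mesh k N \<equiv> real k / real (Suc N)"

text \<open>The quantile function of g, its generalized inverse: by right continuity the infimum is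
  attained for r in ]0,1], which gives the equivalence below.\<close>

definition first_above :: "(real => real) => real => real" where
 "first_above g r = Inf {s. r <= g s}"

lemma first_above_iff:
 assumes g: "g \<in> G0" and r: "0 < r" "r <= 1"
 shows "r <= g s \<longleftrightarrow> first_above g r <= s" and "0 <= first_above g r" "first_above g r <= 1"
proof -
 let ?S = "{s. r <= g s}"
 have ne: "1 \<in> ?S" using G0D(2)[OF g, of 1] r by simp
 have lb: "0 <= s" if "s \<in> ?S" for s using that G0D(1)[OF g, of s] r by (cases "s < 0") auto
 have bdd: "bdd_below ?S" by (rule bdd_belowI[of _ 0]) (rule lb)
 show "0 <= first_above g r" unfolding first_above_def by (rule cInf_greatest) (use ne lb in auto)
 show "first_above g r <= 1" unfolding first_above_def by (rule cInf_lower[OF ne bdd])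
 have "r <= g (first_above g r)"
 proof (rule tendsto_lowerbound[OF G0_right_limit[OF g] _ trivial_limit_at_right_real])
  have "r <= g y" if "first_above g r < y" for y
  proof -
   have "?S \<noteq> {}" using ne by blast
   from cInf_lessD[OF this that[unfolded first_above_def]] obtain s where "s \<in> ?S" "s < y" by blast
   thus ?thesis using G0_mono[OF g, of s y] by auto
  qed
  thus "\<forall>\<^sub>F y in at_right (first_above g r). r <= g y"
   unfolding eventually_at_right_field by (intro exI[of _ "first_above g r + 1"]) auto
 qed
 hence "r <= g s" if "first_above g r <= s" using G0_mono[OF g that] by simp
 moreover have "first_above g r <= s" if "r <= g s" unfolding first_above_def by (rule cInf_lower[OF _ bdd]) (use that in simp)
 ultimately show "r <= g s \<longleftrightarrow> first_above g r <= s" by blast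
qed

lemma sum_Ioc_indicator:
 fixes x :: "nat => real"
 assumes "!!k. x k <= x (Suc k)"
 shows "(\<Sum>k<N. indicator {x k<..x (Suc k)} r) = (indicator {x 0<..x N} r :: real)"
proof (induction N)
 case (Suc N)
 have "x 0 <= x N" by (rule lift_Suc_mono_le[of x]) (use assms in auto)
 thus ?case using Suc assms[of N] by (auto simp: indicator_def)
qed simp

text \<open>\<open>trap\<close> is the trapezoidal rule error of $f'$, and \<open>kap\<close> its density with respect to the gap.\<close>

locale trapezoid =
 fixes f f1 f2 f3 :: "real => real" and M :: real
 assumes f: "!!x. (f has_real_derivative f1 x) (at x)" and f1: "!!x. (f1 has_real_derivative f2 x) (at x)"
  and f2: "!!x. (f2 has_real_derivative f3 x) (at x)" and f3: "!!x. \<bar>f3 x\<bar> <= M"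
begin

definition trap :: "real => real => real" where
 "trap x y = (if x = y then 0 else (f1 y + f1 x) / 2 - (f y - f x) / (y - x))"

definition kap :: "real => real => real" where "kap x y = trap x y / (y - x)"

lemma M_nonneg: "0 <= M" using f3[of 0] by linarith

text \<open>Let E be the error multiplied by the gap h. E and E' vanish at h = 0, and in E'' the
  terms with f'' cancel, leaving h f'''/2. Two applications of the mean value theorem bound E by M
  h^3.\<close>

lemma trap_bound: assumes "x <= y" shows "\<bar>trap x y\<bar> <= M * (y - x)^2"
proof (cases "x = y")
 case False
 define E where "E h = h * ((f1 x + f1 (x + h)) / 2) - (f (x + h) - f x)" for h
 define E1 where "E1 h = (f1 x - f1 (x + h)) / 2 + h * (f2 (x + h) / 2)" for h
 have "((%h. g (x + h)) has_real_derivative g' (x + h)) (at h)" if "!!x. (g has_real_derivative g' x) (at x)" for g g' :: "real => real" and h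
  using DERIV_shift[of g "g' (x + h)" h x] that by (simp add: add.commute)
 note sh = this[OF f] this[OF f1] this[OF f2]
 have E: "(E has_real_derivative E1 h) (at h)" for h
  unfolding E_def E1_def by (rule derivative_eq_intros sh refl | simp)+ (simp add: field_simps)?
 have E1: "(E1 has_real_derivative h * (f3 (x + h) / 2)) (at h)" for h
  unfolding E1_def by (rule derivative_eq_intros sh refl | simp)+
 define h where "h = y - x"
 have h: "h > 0" using False assms by (simp add: h_def)
 obtain t where t: "t \<in> closed_segment 0 h" "E h - E 0 = E1 t * (h - 0)" using MVT_segment[OF E, of 0 h] by blast
 obtain t' where t': "t' \<in> closed_segment 0 t" "E1 t - E1 0 = t' * (f3 (x + t') / 2) * (t - 0)" using MVT_segment[OF E1, of 0 t] by blast
 have ts: "0 <= t" "t <= h" "0 <= t'" "t' <= h" using t(1) t'(1) h by (auto simp: closed_segment_eq_real_ivl split: if_splits)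
 have "\<bar>E1 t\<bar> = t' * \<bar>f3 (x + t')\<bar> / 2 * t"
 proof -
  have "E1 0 = 0" by (simp add: E1_def)
  hence "E1 t = t' * (f3 (x + t') / 2) * t" using t'(2) by simp
  hence "\<bar>E1 t\<bar> = \<bar>t'\<bar> * (\<bar>f3 (x + t')\<bar> / 2) * \<bar>t\<bar>" by (simp only: abs_mult abs_divide abs_numeral)
  thus ?thesis using ts by (simp only: abs_of_nonneg times_divide_eq_right)
 qed
 also have "\<dots> <= h * M / 1 * h" using ts f3[of "x + t'"] M_nonneg by (intro mult_mono frac_le) auto
 finally have "\<bar>E h\<bar> <= M * h^2 * h" using t(2) h by (simp add: E_def abs_mult power2_eq_square mult_right_mono mult_ac)
 moreover have "trap x y = E h / h" using False h by (simp add: trap_def E_def h_def field_simps)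
 ultimately show ?thesis using h by (simp add: abs_divide pos_divide_le_eq h_def[symmetric])
qed (simp add: trap_def)

lemma kap_bound: assumes "x <= y" shows "\<bar>kap x y\<bar> <= M * (y - x)"
proof (cases "x = y")
 case False
 thus ?thesis using trap_bound[OF assms] assms by (simp add: kap_def abs_divide pos_divide_le_eq power2_eq_square mult.assoc)
qed (simp add: kap_def)

lemma kap_mult: "kap x y * (y - x) = trap x y" by (simp add: kap_def trap_def)

lemma kap_tendsto:
 fixes xs ys :: "nat => real"
 assumes "xs \<longlonglongrightarrow> x" "ys \<longlonglongrightarrow> y" "!!n. xs n <= ys n" shows "(%n. kap (xs n) (ys n)) \<longlonglongrightarrow> kap x y"
proof (cases "x = y")
 case True
 have "(%n. M * (ys n - xs n)) \<longlonglongrightarrow> M * (y - x)" by (intro tendsto_intros assms)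
 hence "(%n. kap (xs n) (ys n)) \<longlonglongrightarrow> 0" using True kap_bound[OF assms(3)]
  by (intro Lim_null_comparison[of "%n. kap (xs n) (ys n)" "%n. M * (ys n - xs n)"]) auto
 thus ?thesis using True by (simp add: kap_def)
next
 case False
 have c: "(%n. f (zs n)) \<longlonglongrightarrow> f z" "(%n. f1 (zs n)) \<longlonglongrightarrow> f1 z" if "zs \<longlonglongrightarrow> z" for zs :: "nat => real" and z
  using that isCont_tendsto_compose[OF DERIV_isCont[OF f]] isCont_tendsto_compose[OF DERIV_isCont[OF f1]] by auto
 have lt: "x < y" using False LIMSEQ_le[OF assms(1,2)] assms(3) by force
 have "(%n. ys n - xs n) \<longlonglongrightarrow> y - x" by (intro tendsto_intros assms)
 hence "\<forall>\<^sub>F n in sequentially. 0 < ys n - xs n" using lt by (intro order_tendstoD(1)) auto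
 hence ev: "\<forall>\<^sub>F n in sequentially. kap (xs n) (ys n) = ((f1 (ys n) + f1 (xs n)) / 2 - (f (ys n) - f (xs n)) / (ys n - xs n)) / (ys n - xs n)"
  by eventually_elim (auto simp: kap_def trap_def)
 have "(%n. ((f1 (ys n) + f1 (xs n)) / 2 - (f (ys n) - f (xs n)) / (ys n - xs n)) / (ys n - xs n)) \<longlonglongrightarrow> ((f1 y + f1 x) / 2 - (f y - f x) / (y - x)) / (y - x)"
  by (intro tendsto_intros c assms) (use lt in auto)
 thus ?thesis using False by (subst tendsto_cong[OF ev]) (simp add: kap_def trap_def)
qed

text \<open>The last cell, which ends at 1, is left out: a jump at 1 would contribute to it but is
  not in \<open>jumps g\<close>. That cell is treated apart, using that the left limit at 1 is
  almost surely 1.\<close>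

definition trap_sum :: "(real => real) => nat => real" where
 "trap_sum g N = (\<Sum>k<N. trap (g (mesh k N)) (g (mesh (Suc k) N)))"

text \<open>The jump sum spread over the levels r: on the interval of values skipped by the jump at
  a, this is the trapezoid error divided by the height of the jump; where g passes r continuously
  \<open>kap\<close> is 0. The guards on \<open>first_above\<close> discard jumps at 0 and
  1.\<close>

definition jump_density :: "(real => real) => real => real" where
 "jump_density g r = (if 0 < r \<and> r <= 1 \<and> 0 < first_above g r \<and> first_above g r < 1
   then kap (gleft g (first_above g r)) (g (first_above g r)) else 0)"

text \<open>A level r lies in the value interval of a cell exactly when the cell contains a =
  \<open>first_above g r\<close>. The left end of this cell tends to a from strictly below and the
  right end from at or above a, so the two values of g tend to g(a-) and g(a).\<close>

lemma jump_density_limit: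
 assumes g: "g \<in> G0"
 shows "(%N. \<Sum>k<N. kap (g (mesh k N)) (g (mesh (Suc k) N)) *
   indicator {g (mesh k N)<..g (mesh (Suc k) N)} r) \<longlonglongrightarrow> jump_density g r"
proof (cases "0 < r \<and> r <= 1")
 case False
 have "r \<notin> {g s<..g t}" for s t using False G0D(3)[OF g, of s] G0D(4)[OF g, of t] by auto
 hence z: "indicator {g s<..g t} r = (0::real)" for s t by simp
 have "jump_density g r = 0" unfolding jump_density_def using False by (intro if_not_P) blast
 thus ?thesis by (simp only: z mult_zero_right sum.neutral_const tendsto_const)
next
 case True
 define a where "a = first_above g r"
 have ge: "r <= g s \<longleftrightarrow> a <= s" for s unfolding a_def using first_above_iff(1)[OF g] True by simp
 have a01: "0 <= a" "a <= 1" unfolding a_def using first_above_iff(2,3)[OF g] True by auto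
 have mem: "r \<in> {g s<..g t} \<longleftrightarrow> s < a \<and> a <= t" for s t using ge[of s] ge[of t] by auto
 show ?thesis
 proof (cases "0 < a \<and> a < 1")
  \<comment> \<open>For a = 0 no mesh point lies strictly to the left of a, and for a = 1 the cells
    with k < N end too early.\<close>
  case F: False
  have F0: "r \<notin> {g (mesh k N)<..g (mesh (Suc k) N)}" if "k < N" for k N
  proof -
   have "mesh (Suc k) N < 1" using that by simp
   moreover have "0 <= mesh k N" by simp
   ultimately show ?thesis unfolding mem using F a01 by linarith
  qed
  have "(\<Sum>k<N. kap (g (mesh k N)) (g (mesh (Suc k) N)) *
   indicator {g (mesh k N)<..g (mesh (Suc k) N)} r) = 0" for N
  proof (intro sum.neutral ballI)
   fix k assume "k \<in> {..<N}"
   hence "r \<notin> {g (mesh k N)<..g (mesh (Suc k) N)}" using F0[of k N] by blast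
   thus "kap (g (mesh k N)) (g (mesh (Suc k) N)) *
    indicator {g (mesh k N)<..g (mesh (Suc k) N)} r = 0" by (simp only: indicator_simps(2) mult_zero_right not_False_eq_True)
  qed
  moreover have "jump_density g r = 0" unfolding jump_density_def a_def[symmetric] using F by (intro if_not_P) blast
  ultimately show ?thesis by (simp only: tendsto_const)
 next
  case T: True
  \<comment> \<open>The index of the cell ]i/(N+1), (i+1)/(N+1)] that contains a; the ceiling
    matches cells that are closed on the right.\<close>
  define i where "i N = nat (\<lceil>real (Suc N) * a\<rceil> - 1)" for N
  have pos: "0 < \<lceil>real (Suc N) * a\<rceil>" for N using T by simp
  have ri: "real (i N) = real_of_int \<lceil>real (Suc N) * a\<rceil> - 1" for N using pos[of N] by (simp add: i_def)
  have i1: "real (i N) / real (Suc N) < a" "a <= real (Suc (i N)) / real (Suc N)" for N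
  proof -
   have c: "real (i N) < real (Suc N) * a" "real (Suc N) * a <= real (i N) + 1"
    using ceiling_correct[of "real (Suc N) * a"] unfolding ri by linarith+
   show "real (i N) / real (Suc N) < a" using c(1) by (simp add: divide_less_eq mult.commute del: of_nat_Suc)
   show "a <= real (Suc (i N)) / real (Suc N)" using c(2) by (simp add: le_divide_eq mult.commute del: of_nat_Suc)
  qed
  have uniq: "k = i N" if "mesh k N < a" "a <= mesh (Suc k) N" for k N
  proof -
   have "real k < real (Suc N) * a" "real (Suc N) * a <= real k + 1" 
    using that by (simp_all add: divide_less_eq le_divide_eq mult.commute del: of_nat_Suc)
   hence "\<lceil>real (Suc N) * a\<rceil> = int k + 1" by (intro ceiling_unique) auto
   thus ?thesis by (simp add: i_def)
  qed
  have l1: "(%N. real (i N) / real (Suc N)) \<longlonglongrightarrow> a"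
  proof (rule tendsto_sandwich[OF _ _ _ tendsto_const])
   show "(%N. a - 1 / real (Suc N)) \<longlonglongrightarrow> a" using tendsto_diff[OF tendsto_const[of a] LIMSEQ_Suc[OF lim_1_over_n]] by simp
   show "\<forall>\<^sub>F N in sequentially. a - 1 / real (Suc N) <= real (i N) / real (Suc N)" "\<forall>\<^sub>F N in sequentially. real (i N) / real (Suc N) <= a"
   proof (intro always_eventually allI)
    fix N
    show "a - 1 / real (Suc N) <= real (i N) / real (Suc N)" using i1(2)[of N] unfolding of_nat_Suc[of "i N"] add_divide_distrib by linarith
   qed (intro always_eventually allI less_imp_le i1(1))
  qed
  have gl: "(%N. g (mesh (i N) N)) \<longlonglongrightarrow> gleft g a"
   by (rule filterlim_compose[OF gleft_tendsto[OF g]]) (use l1 i1(1) in \<open>auto simp: filterlim_at less_imp_neq simp del: of_nat_Suc\<close>)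
  have l2: "(%N. real (Suc (i N)) / real (Suc N)) \<longlonglongrightarrow> a"
  proof -
   have "(%N. real (i N) / real (Suc N) + 1 / real (Suc N)) \<longlonglongrightarrow> a + 0" by (intro tendsto_add l1 LIMSEQ_Suc[OF lim_1_over_n])
   thus ?thesis by (simp add: add_divide_distrib add.commute)
  qed
  have gr: "(%N. g (mesh (Suc (i N)) N)) \<longlonglongrightarrow> g a"
  proof -
   have "continuous (at a within {a..}) g" using G0_right_limit[OF g, of a] by (simp add: continuous_within at_within_Ici_at_right)
   thus ?thesis by (rule continuous_within_tendsto_compose'[OF _ _ l2]) (use i1(2) in auto)
  qed
  have kl: "(%N. kap (g (mesh (i N) N)) (g (mesh (Suc (i N)) N))) \<longlonglongrightarrow> kap (gleft g a) (g a)"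
   by (rule kap_tendsto[OF gl gr]) (auto intro!: G0_mono[OF g] divide_right_mono)
  obtain N0 where N0: "real N0 > 1 / (1 - a)" using reals_Archimedean2 by blast
  have iN: "i N < N" if "N \<ge> N0" for N
  proof -
   have "real N > 1 / (1 - a)" using N0 that by linarith
   hence "1 < real N * (1 - a)" using T by (simp add: field_simps)
   hence "real (Suc N) * a < real N" using T by (simp add: algebra_simps)
   hence "\<lceil>real (Suc N) * a\<rceil> <= int N" by (simp add: ceiling_le_iff)
   thus ?thesis using pos[of N] unfolding i_def by linarith
  qed
  have "\<forall>\<^sub>F N in sequentially. kap (g (mesh (i N) N)) (g (mesh (Suc (i N)) N)) =
   (\<Sum>k<N. kap (g (mesh k N)) (g (mesh (Suc k) N)) *
   indicator {g (mesh k N)<..g (mesh (Suc k) N)} r)"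
  proof (rule eventually_sequentiallyI[of N0])
   fix N assume N: "N \<ge> N0"
   have "(\<Sum>k<N. kap (g (mesh k N)) (g (mesh (Suc k) N)) *
    indicator {g (mesh k N)<..g (mesh (Suc k) N)} r)
    = (\<Sum>k\<in>{i N}. kap (g (mesh k N)) (g (mesh (Suc k) N)) *
    indicator {g (mesh k N)<..g (mesh (Suc k) N)} r)"
   proof (rule sum.mono_neutral_right)
    show "\<forall>k\<in>{..<N} - {i N}. kap (g (mesh k N)) (g (mesh (Suc k) N)) *
     indicator {g (mesh k N)<..g (mesh (Suc k) N)} r = 0"
    proof
     fix k assume "k \<in> {..<N} - {i N}"
     hence "r \<notin> {g (mesh k N)<..g (mesh (Suc k) N)}" unfolding mem using uniq[of k N] by blast
     thus "kap (g (mesh k N)) (g (mesh (Suc k) N)) *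
      indicator {g (mesh k N)<..g (mesh (Suc k) N)} r = 0" by (simp only: indicator_simps(2) mult_zero_right not_False_eq_True)
    qed
   qed (use iN[OF N] in auto)
   moreover have "r \<in> {g (mesh (i N) N)<..g (mesh (Suc (i N)) N)}" unfolding mem using i1 by blast
   ultimately show "kap (g (mesh (i N) N)) (g (mesh (Suc (i N)) N)) =
    (\<Sum>k<N. kap (g (mesh k N)) (g (mesh (Suc k) N)) *
    indicator {g (mesh k N)<..g (mesh (Suc k) N)} r)"
    by (simp only: sum.insert_if finite.emptyI sum.empty indicator_simps mult_1_right add_0_right if_False empty_iff)
  qed
  from tendsto_cong[THEN iffD1, OF this kl] show ?thesis using T True by (simp add: jump_density_def a_def)
 qed
qed

lemma integral_Ioc: "(x::real) <= y ==> integrable lborel (%r. c * indicator {x<..y} r)" "x <= y ==> (\<integral>r. c * indicator {x<..y} r \<partial>lborel) = c * (y - x :: real)"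
 by simp_all

lemma jump_density_borel: assumes g: "g \<in> G0" shows "jump_density g \<in> borel_measurable lborel"
 by (rule borel_measurable_LIMSEQ_real[OF jump_density_limit[OF g]]) measurable

text \<open>Each trapezoid error is the integral of its \<open>kap\<close> over the value interval
  of the cell. These intervals are disjoint in [0,1] and \<open>kap\<close> is at most M in absolute
  value, so M on [0,1] is a majorant for all N. The second claim is the same bound, uniform in
  g.\<close>

lemma trap_sum_tendsto_integral:
 assumes g: "g \<in> G0"
 shows "trap_sum g \<longlonglongrightarrow> (\<integral>r. jump_density g r \<partial>lborel)" and "\<bar>trap_sum g N\<bar> <= M"
proof -
 define x where "x N k = g (mesh k N)" for N k
 have mono: "x N k <= x N (Suc k)" for N k unfolding x_def by (intro G0_mono[OF g] divide_right_mono) auto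
 have x01: "0 <= x N k" "x N k <= 1" for N k unfolding x_def by (rule G0D(3)[OF g], rule G0D(4)[OF g])
 have kb: "\<bar>kap (x N k) (x N (Suc k))\<bar> <= M" for N k
 proof -
  have "M * (x N (Suc k) - x N k) <= M * 1" using x01(1)[of N k] x01(2)[of N "Suc k"] M_nonneg by (intro mult_left_mono) auto
  thus ?thesis using kap_bound[OF mono[of N k]] by linarith
 qed
 have b: "\<bar>\<Sum>k<N. kap (x N k) (x N (Suc k)) * indicator {x N k<..x N (Suc k)} r\<bar> <= M * indicator {0..1} r" for N r
 proof -
  have "\<bar>\<Sum>k<N. kap (x N k) (x N (Suc k)) * indicator {x N k<..x N (Suc k)} r\<bar> <= (\<Sum>k<N. M * indicator {x N k<..x N (Suc k)} r)"
   by (rule order_trans[OF sum_abs sum_mono]) (auto simp: abs_mult intro!: mult_right_mono kb)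
  also have "\<dots> = M * indicator {x N 0<..x N N} r" unfolding sum_distrib_left[symmetric] sum_Ioc_indicator[of "x N", OF mono] ..
  also have "\<dots> <= M * indicator {0..1} r" using M_nonneg x01[of N 0] x01[of N N] by (intro mult_left_mono) (auto simp: indicator_def)
  finally show ?thesis .
 qed
 have int: "(\<integral>r. (\<Sum>k<N. kap (x N k) (x N (Suc k)) * indicator {x N k<..x N (Suc k)} r) \<partial>lborel) = trap_sum g N" for N
  unfolding trap_sum_def x_def[symmetric] by (subst Bochner_Integration.integral_sum) (auto simp: integral_Ioc mono kap_mult)
 have ib: "integrable lborel (%r::real. M * indicator {0..1} r :: real)" by (intro integrable_mult_right integrable_real_indicator; simp)
 have "(%N. \<integral>r. (\<Sum>k<N. kap (x N k) (x N (Suc k)) * indicator {x N k<..x N (Suc k)} r) \<partial>lborel) \<longlonglongrightarrow> (\<integral>r. jump_density g r \<partial>lborel)"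
 proof (rule integral_dominated_convergence[OF _ _ ib])
  show "AE r in lborel. (%N. \<Sum>k<N. kap (x N k) (x N (Suc k)) * indicator {x N k<..x N (Suc k)} r) \<longlonglongrightarrow> jump_density g r"
   unfolding x_def by (intro AE_I2 jump_density_limit[OF g])
  show "(%r. \<Sum>k<N. kap (x N k) (x N (Suc k)) * indicator {x N k<..x N (Suc k)} r) \<in> borel_measurable lborel" for N
   by measurable
 qed (use b jump_density_borel[OF g] in auto)
 thus "trap_sum g \<longlonglongrightarrow> (\<integral>r. jump_density g r \<partial>lborel)" by (simp only: int)
 have "\<bar>trap_sum g N\<bar> <= (\<integral>r. M * indicator {0..1} (r::real) \<partial>lborel)" unfolding int[symmetric]
  by (rule order_trans[OF integral_abs_bound], rule Bochner_Integration.integral_mono)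
   (intro integrable_abs Bochner_Integration.integrable_sum integral_Ioc mono ib b)+
 also have "\<dots> = M" by (subst Bochner_Integration.integral_mult_right_zero) simp
 finally show "\<bar>trap_sum g N\<bar> <= M" .
qed

lemma jump_intervals_unique:
 assumes g: "g \<in> G0" and r: "r \<in> {gleft g a<..g a}"
 shows "0 < r" "r <= 1" "first_above g r = a"
proof -
 show r01: "0 < r" "r <= 1" using r gleft_bounds(3)[OF g, of a] G0D(4)[OF g, of a] by auto
 note ge = first_above_iff(1)[OF g r01]
 have "first_above g r <= a" using ge[of a] r by simp
 moreover have "\<not> first_above g r < a"
  using ge[of "first_above g r"] gleft_bounds(1)[OF g, of "first_above g r" a] r by auto
 ultimately show "first_above g r = a" by simp
qed

lemma sum_jump_indicator:
 assumes g: "g \<in> G0" "finite A" "A \<subseteq> jumps g"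
 shows "(\<Sum>a\<in>A. h a * indicator {gleft g a<..g a} r) = (if \<exists>a\<in>A. r \<in> {gleft g a<..g a} then h (first_above g r) else (0::real))"
proof (cases "\<exists>a\<in>A. r \<in> {gleft g a<..g a}")
 case True
 then obtain a where a: "a \<in> A" "r \<in> {gleft g a<..g a}" by blast
 have "(\<Sum>b\<in>A. h b * indicator {gleft g b<..g b} r) = (\<Sum>b\<in>A. if b = a then h a else 0)"
 proof (rule sum.cong[OF refl])
  fix b
  show "h b * indicator {gleft g b<..g b} r = (if b = a then h a else 0)"
   using jump_intervals_unique(3)[OF g(1) a(2)] jump_intervals_unique(3)[OF g(1), of r b] a(2)
  proof (cases "r \<in> {gleft g b<..g b}")
   case True
   hence "b = a" using jump_intervals_unique(3)[OF g(1) a(2)] jump_intervals_unique(3)[OF g(1), of r b] by simp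
   thus ?thesis using True by simp
  next
   case False
   hence "b \<noteq> a" using a(2) by blast
   thus ?thesis using False by simp
  qed
 qed
 thus ?thesis using True a jump_intervals_unique(3)[OF g(1) a(2)] g(2) by auto
qed (auto intro!: sum.neutral)

text \<open>The heights of the jumps add up to at most 1, so the sum converges absolutely and may be
  taken along an exhausting sequence of finite sets. Its partial sums are integrals of step
  functions of r, to which dominated convergence applies again.\<close>

theorem jump_sum:
 assumes g: "g \<in> G0"
 shows "infsum (%a. trap (gleft g a) (g a)) (jumps g) = (\<integral>r. jump_density g r \<partial>lborel)"
proof -
 let ?J = "jumps g" and ?I = "%a. {gleft g a<..g a}"
 have le: "gleft g a <= g a" for a by (rule gleft_bounds(2)[OF g])
 have gapsum: "(\<Sum>a\<in>A. g a - gleft g a) <= 1" if "finite A" "A \<subseteq> ?J" for A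
 proof -
  have "(\<Sum>a\<in>A. g a - gleft g a) = (\<integral>r. (\<Sum>a\<in>A. 1 * indicator (?I a) r) \<partial>lborel)"
   by (subst Bochner_Integration.integral_sum) (simp_all only: integral_Ioc[OF le, of 1], simp)
  also have "\<dots> <= (\<integral>r. indicator {0..1} (r::real) \<partial>lborel)"
  proof (rule Bochner_Integration.integral_mono)
   show "integrable lborel (%r. \<Sum>a\<in>A. 1 * indicator (?I a) r :: real)" by (intro Bochner_Integration.integrable_sum integral_Ioc le)
   fix r
   have "r \<in> {0..1}" if ex: "\<exists>a\<in>A. r \<in> ?I a" 
   proof -
    obtain a where "r \<in> ?I a" using ex by blast
    from jump_intervals_unique(1,2)[OF g this] show ?thesis by simp
   qed
   thus "(\<Sum>a\<in>A. 1 * indicator (?I a) r) <= (indicator {0..1} r :: real)"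
    unfolding sum_jump_indicator[OF g that, of "%_. 1"] by (simp only: indicator_def split: if_splits) auto
  qed (intro integrable_real_indicator; simp)
  finally show ?thesis by simp
 qed
 have gs: "(%a. g a - gleft g a) summable_on ?J"
  by (rule nonneg_bdd_above_summable_on) (use le gapsum in \<open>auto intro!: bdd_aboveI[of _ 1]\<close>)
 have "(%a. norm (trap (gleft g a) (g a))) summable_on ?J"
 proof (rule Infinite_Sum.abs_summable_on_comparison_test')
  show "(%a. M * (g a - gleft g a)) summable_on ?J" by (rule summable_on_cmult_right[OF gs])
  fix a
  have "\<bar>kap (gleft g a) (g a)\<bar> * (g a - gleft g a) <= M * 1 * (g a - gleft g a)"
   using kap_bound[OF le[of a]] le[of a] M_nonneg gleft_bounds(3)[OF g, of a] G0D(4)[OF g, of a]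
   by (intro mult_right_mono order_trans[OF kap_bound[OF le[of a]]] mult_left_mono) auto
  thus "norm (trap (gleft g a) (g a)) <= M * (g a - gleft g a)"
   using le[of a] unfolding kap_mult[symmetric] by (simp add: abs_mult)
 qed
 hence "(%a. trap (gleft g a) (g a)) summable_on ?J" by (rule abs_summable_summable)
 hence hs: "(sum (%a. trap (gleft g a) (g a)) \<longlongrightarrow> infsum (%a. trap (gleft g a) (g a)) ?J) (finite_subsets_at_top ?J)"
  using has_sum_infsum has_sum_def by blast
 \<comment> \<open>An enumeration of the jumps turns the limit over the net of finite subsets into a
   limit of a sequence, as dominated convergence requires.\<close>
 define A where "A n = {a \<in> ?J. to_nat_on ?J a < n}" for n
 have inj: "inj_on (to_nat_on ?J) ?J" by (rule inj_on_to_nat_on[OF countable_jumps[OF g]])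
 have finA: "finite (A n)" "A n \<subseteq> ?J" for n
 proof -
  have "finite (to_nat_on ?J ` A n)" by (rule finite_subset[of _ "{..<n}"]) (auto simp: A_def)
  thus "finite (A n)" by (rule finite_imageD) (rule inj_on_subset[OF inj], auto simp: A_def)
 qed (auto simp: A_def)
 have "filterlim A (finite_subsets_at_top ?J) sequentially"
  unfolding filterlim_finite_subsets_at_top
 proof (intro allI impI)
  fix X assume X: "finite X \<and> X \<subseteq> ?J"
  define n0 where "n0 = Suc (\<Sum>a\<in>X. to_nat_on ?J a)"
  have "X \<subseteq> A n" if "n \<ge> n0" for n
  proof
   fix a assume a: "a \<in> X"
   have "to_nat_on ?J a <= (\<Sum>a\<in>X. to_nat_on ?J a)" by (rule member_le_sum) (use a X in auto)
   thus "a \<in> A n" using that a X by (auto simp: A_def n0_def)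
  qed
  thus "\<forall>\<^sub>F n in sequentially. finite (A n) \<and> X \<subseteq> A n \<and> A n \<subseteq> ?J"
   using finA by (auto simp: eventually_sequentially)
 qed
 from filterlim_compose[OF hs this]
 have l1: "(%n. \<Sum>a\<in>A n. trap (gleft g a) (g a)) \<longlonglongrightarrow> infsum (%a. trap (gleft g a) (g a)) ?J" .
 have int: "(\<integral>r. (\<Sum>a\<in>A n. kap (gleft g a) (g a) * indicator (?I a) r) \<partial>lborel) = (\<Sum>a\<in>A n. trap (gleft g a) (g a))" for n
  by (subst Bochner_Integration.integral_sum) (auto simp: integral_Ioc le kap_mult)
 \<comment> \<open>At r = g(a-) the first passage may already be a although r is outside the
   half-open jump interval. There are only countably many such levels.\<close>
 have "AE r in lborel. r \<notin> gleft g ` ?J"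
  by (intro AE_not_in countable_imp_null_set_lborel countable_image countable_jumps[OF g])
 hence ae: "AE r in lborel. (%n. \<Sum>a\<in>A n. kap (gleft g a) (g a) * indicator (?I a) r) \<longlonglongrightarrow> jump_density g r"
 proof eventually_elim
  fix r assume r: "r \<notin> gleft g ` ?J"
  let ?a = "first_above g r"
  have s: "(\<Sum>a\<in>A n. kap (gleft g a) (g a) * indicator (?I a) r) = (if \<exists>a\<in>A n. r \<in> ?I a then kap (gleft g ?a) (g ?a) else 0)" for n
   by (rule sum_jump_indicator[OF g finA])
  show "(%n. \<Sum>a\<in>A n. kap (gleft g a) (g a) * indicator (?I a) r) \<longlonglongrightarrow> jump_density g r"
  proof (cases "\<exists>a\<in>?J. r \<in> ?I a")
   case True
   then obtain a where a: "a \<in> ?J" "r \<in> ?I a" by blast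
   note u = jump_intervals_unique[OF g a(2)]
   have "\<forall>\<^sub>F n in sequentially. (\<Sum>a\<in>A n. kap (gleft g a) (g a) * indicator (?I a) r) = jump_density g r"
   proof (rule eventually_sequentiallyI[of "Suc (to_nat_on ?J a)"])
    fix n assume "n \<ge> Suc (to_nat_on ?J a)"
    hence "a \<in> A n" using a(1) by (auto simp: A_def)
    thus "(\<Sum>a\<in>A n. kap (gleft g a) (g a) * indicator (?I a) r) = jump_density g r"
     unfolding s using a u jumps_iff[OF g, of a] by (auto simp: jump_density_def)
   qed
   thus ?thesis by (rule tendsto_eventually)
  next
   case False
   have "jump_density g r = 0"
   proof (rule ccontr)
    assume n0: "jump_density g r \<noteq> 0"
    hence c: "0 < r" "r <= 1" "0 < ?a" "?a < 1" "kap (gleft g ?a) (g ?a) \<noteq> 0" by (auto simp: jump_density_def split: if_splits)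
    hence "gleft g ?a \<noteq> g ?a" by (auto simp: kap_def)
    hence J: "?a \<in> ?J" using c le[of ?a] by (simp add: jumps_iff[OF g])
    note ge = first_above_iff(1)[OF g c(1,2)]
    have "gleft g ?a <= r" 
    proof (rule gleft_bounds(4)[OF g])
     fix s assume "s < ?a"
     hence "\<not> r <= g s" using ge[of s] by simp
     thus "g s <= r" by simp
    qed
    hence "gleft g ?a < r" using r J by (metis imageI less_eq_real_def)
    moreover have "r <= g ?a" using ge[of ?a] by simp
    ultimately show False using False J by auto
   qed
   moreover have "(\<Sum>a\<in>A n. kap (gleft g a) (g a) * indicator (?I a) r) = 0" for n unfolding s using False finA(2) by auto
   ultimately show ?thesis by simp
  qed
 qed
 have "(%n. \<integral>r. (\<Sum>a\<in>A n. kap (gleft g a) (g a) * indicator (?I a) r) \<partial>lborel) \<longlonglongrightarrow> (\<integral>r. jump_density g r \<partial>lborel)"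
 proof (rule integral_dominated_convergence[where w="%r::real. M * indicator {0..1} r"])
  show "AE r in lborel. norm (\<Sum>a\<in>A n. kap (gleft g a) (g a) * indicator (?I a) r) <= M * indicator {0..1} r" for n
  proof (rule AE_I2)
   fix r
   have "\<bar>kap (gleft g a) (g a)\<bar> <= M" for a
   proof -
    have "M * (g a - gleft g a) <= M * 1" using M_nonneg gleft_bounds(3)[OF g, of a] G0D(4)[OF g, of a] by (intro mult_left_mono) auto
    thus ?thesis using kap_bound[OF le[of a]] by linarith
   qed
   moreover have "r \<in> {0..1}" if ex: "\<exists>a\<in>A n. r \<in> ?I a"
   proof -
    obtain a where "r \<in> ?I a" using ex by blast
    from jump_intervals_unique(1,2)[OF g this] show ?thesis by simp
   qed
   ultimately show "norm (\<Sum>a\<in>A n. kap (gleft g a) (g a) * indicator (?I a) r) <= M * indicator {0..1} r"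
    unfolding sum_jump_indicator[OF g finA] using M_nonneg by (cases "\<exists>a\<in>A n. r \<in> ?I a") (simp_all only: if_True if_False real_norm_def indicator_simps mult_1_right, simp)
  qed
 qed (use ae jump_density_borel[OF g] in auto)
 hence "(%n. \<Sum>a\<in>A n. trap (gleft g a) (g a)) \<longlonglongrightarrow> (\<integral>r. jump_density g r \<partial>lborel)" by (simp only: int)
 thus ?thesis using LIMSEQ_unique[OF l1] by simp
qed

end


section \<open>Integration by parts under the entropic measure\<close>

text \<open>At each s only the cell containing s contributes, and its right endpoint is the grid
  point of \<open>G0_grid_limit\<close>; this turns Riemann sums into integrals of step
  functions.\<close>

lemma sum_cell_indicator:
 fixes q :: "real => real"
 shows "(\<Sum>k<Suc N. q (mesh (Suc k) N) * indicator {mesh k N..<mesh (Suc k) N} s)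
  = q (real_of_int (\<lfloor>real (Suc N) * s\<rfloor> + 1) / real (Suc N)) * indicator {0..<1} s"
proof -
 have mem: "s \<in> {mesh k N..<mesh (Suc k) N} \<longleftrightarrow> \<lfloor>real (Suc N) * s\<rfloor> = int k" for k
  unfolding floor_eq_iff by (simp add: le_divide_eq divide_le_eq less_divide_eq mult.commute add.commute)
 have i: "indicator {mesh k N..<mesh (Suc k) N} s = (if \<lfloor>real (Suc N) * s\<rfloor> = int k then 1 else 0 :: real)" for k
  unfolding indicator_def mem by simp
 show ?thesis
 proof (cases "s \<in> {0..<1}")
  case True
  define j where "j = nat \<lfloor>real (Suc N) * s\<rfloor>"
  have "0 <= real (Suc N) * s" "real (Suc N) * s < real (Suc N) * 1" using True by (intro mult_nonneg_nonneg mult_strict_left_mono; simp)+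
  hence 0: "0 <= \<lfloor>real (Suc N) * s\<rfloor>" "\<lfloor>real (Suc N) * s\<rfloor> < int (Suc N)" by (simp, simp only: floor_less_iff of_int_of_nat_eq mult_1_right)
  hence j: "\<lfloor>real (Suc N) * s\<rfloor> = int j" "j < Suc N" unfolding j_def by (simp, linarith)
  have "(\<Sum>k<Suc N. q (mesh (Suc k) N) * (if int j = int k then 1 else 0)) = (\<Sum>k<Suc N. if k = j then q (real (Suc j) / real (Suc N)) else 0)"
   by (rule sum.cong[OF refl]) (simp only: of_nat_eq_iff if_distrib mult_1_right mult_zero_right split: if_splits, simp)
  also have "\<dots> = q (real (Suc j) / real (Suc N))" using j(2) by (subst sum.delta) (simp_all del: of_nat_Suc)
  finally show ?thesis unfolding i j(1) using True by (simp add: add.commute)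
 next
  case False
  have "\<lfloor>real (Suc N) * s\<rfloor> \<noteq> int k" if k: "k < Suc N" for k
  proof
   assume "\<lfloor>real (Suc N) * s\<rfloor> = int k"
   hence m: "s \<in> {mesh k N..<mesh (Suc k) N}" unfolding mem .
   have "0 <= mesh k N" "mesh (Suc k) N <= 1" using k by simp_all
   hence "s \<in> {0..<1}" using m by (simp only: atLeastLessThan_iff) linarith
   thus False using False by simp
  qed
  hence "(\<Sum>k<Suc N. q (mesh (Suc k) N) * indicator {mesh k N..<mesh (Suc k) N} s) = 0"
   unfolding i by (intro sum.neutral ballI) (simp only: lessThan_iff if_False mult_zero_right)
  thus ?thesis using False by simp
 qed
qed

lemma integral_Ico:
 fixes x y :: real
 assumes "x <= y" shows "integrable lborel (%r. c * indicator {x..<y} r :: real)" "(\<integral>r. c * indicator {x..<y} r \<partial>lborel) = c * (y - x)"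
 using assms by simp_all

lemma Riemann_sum_tendsto:
 assumes g: "g \<in> G0" and q: "continuous_on {0..1} q"
 shows "(%N. (\<Sum>k\<in>{1..Suc N}. q (g (mesh k N))) / real (Suc N)) \<longlonglongrightarrow> (\<integral>s. q (g s) \<partial>Leb01)"
proof -
 obtain C where C: "0 <= C" "!!x. x \<in> {0..1} ==> \<bar>q x\<bar> <= C" by (rule bounded_on_01[OF q]) (blast intro: that)
 have g01: "g x \<in> {0..1}" for x using G0D(3,4)[OF g] by simp
 have qm: "(%s. q (g s)) \<in> borel_measurable borel" by (rule measurable_compose_G0[OF q g])
 define h where "h N s = (\<Sum>k<Suc N. q (g (mesh (Suc k) N)) * indicator {mesh k N..<mesh (Suc k) N} s)" for N and s :: real
 have h: "h N s = q (g (real_of_int (\<lfloor>real (Suc N) * s\<rfloor> + 1) / real (Suc N))) * indicator {0..<1} s" for N s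
  unfolding h_def by (rule sum_cell_indicator[of "%x. q (g x)"])
 have le: "mesh k N <= mesh (Suc k) N" for k N by (rule divide_right_mono) simp_all
 have "(\<integral>s. h N s \<partial>lborel) = (\<Sum>k<Suc N. \<integral>s. q (g (mesh (Suc k) N)) * indicator {mesh k N..<mesh (Suc k) N} s \<partial>lborel)" for N
  unfolding h_def by (intro Bochner_Integration.integral_sum integral_Ico le)
 also have "\<dots>N = (\<Sum>k<Suc N. q (g (mesh (Suc k) N)) * (1 / real (Suc N)))" for N
  by (rule sum.cong[OF refl], subst integral_Ico(2)[OF le]) (simp add: diff_divide_distrib[symmetric])
 also have "\<dots>N = (\<Sum>k\<in>{1..Suc N}. q (g (mesh k N))) / real (Suc N)" for N
  unfolding sum_distrib_right[symmetric] by (simp only: One_nat_def sum.atLeast1_atMost_eq times_divide_eq_right mult_1_right)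
 finally have int: "(\<integral>s. h N s \<partial>lborel) = (\<Sum>k\<in>{1..Suc N}. q (g (mesh k N))) / real (Suc N)" for N .
 have "(%N. \<integral>s. h N s \<partial>lborel) \<longlonglongrightarrow> (\<integral>s. q (g s) * indicator {0..<1} s \<partial>lborel)"
 proof (rule integral_dominated_convergence[where w="%s. C * indicator {0..<1::real} s"])
  show "(%s. q (g s) * indicator {0..<1} s) \<in> borel_measurable lborel" using qm by simp
  show "h N \<in> borel_measurable lborel" for N unfolding h_def[abs_def] by measurable
  show "integrable lborel (%s. C * indicator {0..<1::real} s)" by (intro integrable_mult_right integrable_real_indicator) simp_all
  show "AE s in lborel. (%N. h N s) \<longlonglongrightarrow> q (g s) * indicator {0..<1} s"
  proof (rule AE_I2)
   fix s
   have "(%N. q (g (real_of_int (\<lfloor>real (Suc N) * s\<rfloor> + 1) / real (Suc N)))) \<longlonglongrightarrow> q (g s)"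
    by (rule continuous_on_tendsto_compose[OF q G0_grid_limit[OF g]]) (use g01 in auto)
   thus "(%N. h N s) \<longlonglongrightarrow> q (g s) * indicator {0..<1} s" unfolding h by (intro tendsto_mult tendsto_const)
  qed
  show "AE s in lborel. norm (h N s) <= C * indicator {0..<1::real} s" for N
   unfolding h by (rule AE_I2) (simp only: real_norm_def abs_mult abs_indicator, intro mult_right_mono C(2) g01, simp)
 qed
 moreover have "(\<integral>s. q (g s) * indicator {0..<1} s \<partial>lborel) = (\<integral>s. q (g s) \<partial>Leb01)"
 proof -
  have "(\<integral>s. q (g s) * indicator {0..<1} s \<partial>lborel) = (\<integral>s. indicator {0..1} s *\<^sub>R q (g s) \<partial>lborel)"
  proof (rule integral_cong_AE)
   show "AE s in lborel. q (g s) * indicator {0..<1} s = indicator {0..1} s *\<^sub>R q (g s)"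
    using AE_lborel_singleton[of 1] by eventually_elim (auto simp: indicator_def)
  qed (use qm in simp_all)
  thus ?thesis unfolding LINT_Leb01[symmetric] set_lebesgue_integral_def .
 qed
 ultimately show ?thesis by (simp only: int)
qed

lemma cont_Rm_seq:
 assumes V: "cont_Rm m V" and y: "y \<in> Rm m" "!!n. x n \<in> Rm m" "!!i. i < m ==> (%n. x n i) \<longlonglongrightarrow> y i"
 shows "(%n. V (x n)) \<longlonglongrightarrow> V y"
proof (rule tendstoI)
 fix e :: real assume e: "e > 0"
 obtain d where d: "d > 0" "!!z. z \<in> Rm m ==> (\<forall>i<m. \<bar>z i - y i\<bar> < d) ==> \<bar>V z - V y\<bar> < e"
  using V[unfolded cont_Rm_def, rule_format, OF y(1) e] by auto
 have "\<forall>\<^sub>F n in sequentially. \<forall>i\<in>{..<m}. \<bar>x n i - y i\<bar> < d"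
  by (intro eventually_ball_finite ballI finite_lessThan) (use tendstoD[OF y(3) d(1)] in \<open>simp add: dist_real_def\<close>)
 thus "\<forall>\<^sub>F n in sequentially. dist (V (x n)) (V y) < e"
  by eventually_elim (use d(2) y(2) in \<open>simp add: dist_real_def\<close>)
qed

text \<open>The Jacobian term at level \<open>N\<close>, expressed through trapezoid errors by summation by parts.\<close>

lemma (in trapezoid) jacobian_sum_eq:
 assumes "!!k. k <= N ==> e k < e (Suc k)"
 shows "(\<Sum>k\<in>{1..N}. f1 (e k)) + (\<Sum>k\<le>N. (b - 1) * ((f (e (Suc k)) - f (e k)) / (e (Suc k) - e k)))
  = (\<Sum>k\<le>N. trap (e k) (e (Suc k))) * (1 - b) - (f1 (e 0) + f1 (e (Suc N))) / 2
   + b * ((\<Sum>k\<in>{1..Suc N}. f1 (e k)) + (f1 (e 0) - f1 (e (Suc N))) / 2)"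
proof -
 have s: "(f (e (Suc k)) - f (e k)) / (e (Suc k) - e k) = (f1 (e (Suc k)) + f1 (e k)) / 2 - trap (e k) (e (Suc k))" if "k <= N" for k
  using assms[OF that] by (simp add: trap_def)
 have "(\<Sum>k\<le>N. (f (e (Suc k)) - f (e k)) / (e (Suc k) - e k)) = (\<Sum>k\<le>N. (f1 (e (Suc k)) + f1 (e k)) / 2) - (\<Sum>k\<le>N. trap (e k) (e (Suc k)))"
  unfolding sum_subtractf[symmetric] by (rule sum.cong[OF refl]) (simp only: atMost_iff s)
 moreover have "(\<Sum>k\<le>n. (f1 (e (Suc k)) + f1 (e k)) / 2) = (\<Sum>k\<in>{1..n}. f1 (e k)) + (f1 (e 0) + f1 (e (Suc n))) / 2" for n
  by (induction n) (simp_all add: field_simps)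
 ultimately have q: "(\<Sum>k\<le>N. (f (e (Suc k)) - f (e k)) / (e (Suc k) - e k))
   = (\<Sum>k\<in>{1..N}. f1 (e k)) + (f1 (e 0) + f1 (e (Suc N))) / 2 - (\<Sum>k\<le>N. trap (e k) (e (Suc k)))" by simp
 have P: "(\<Sum>k\<in>{1..Suc N}. f1 (e k)) = (\<Sum>k\<in>{1..N}. f1 (e k)) + f1 (e (Suc N))" by simp
 show ?thesis unfolding sum_distrib_left[symmetric] q P by (simp add: field_simps)
qed

text \<open>The drift in the form in which the partition limit produces it, with the jump sum as an
  integral over levels; boundedness and measurability are proved for this form.\<close>

definition (in trapezoid) Vlim :: "real => (real => real) => real" where
 "Vlim \<beta> g = (\<integral>r. jump_density g r \<partial>lborel) + \<beta> * (\<integral>s. f1 (g s) \<partial>Leb01) - (f1 0 + f1 1) / 2"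

lemma (in trapezoid) Vlim_eq:
 assumes g: "g \<in> G0" and \<phi>: "!!x. x \<in> {0..1} ==> f x = \<phi> x" "!!x. x \<in> {0..1} ==> f1 x = deriv01 \<phi> x"
 shows "Vbeta \<beta> \<phi> g = Vlim \<beta> g"
proof -
 have g01: "g x \<in> {0..1}" for x using G0D(3,4)[OF g] by simp
 have "infsum (%a. (deriv01 \<phi> (gright g a) + deriv01 \<phi> (gleft g a)) / 2
   - (\<phi> (gright g a) - \<phi> (gleft g a)) / (gright g a - gleft g a)) (jumps g) = infsum (%a. trap (gleft g a) (g a)) (jumps g)"
  using \<phi> g01 gleft_bounds(3)[OF g] by (intro infsum_cong) (simp add: jumps_iff[OF g] gright_eq[OF g] trap_def)
 moreover have "continuous_on {0..1} f1" by (rule DERIV_continuous_on[OF DERIV_subset[OF f1]]) simp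
 hence "integral {0..1} (%x. f1 (g x)) = (\<integral>s. f1 (g s) \<partial>Leb01)" by (rule integral_compose_G0[OF _ g])
 hence "integral {0..1} (%x. deriv01 \<phi> (g x)) = (\<integral>s. f1 (g s) \<partial>Leb01)" using \<phi>(2)[OF g01] by simp
 ultimately show ?thesis unfolding Vbeta_def Vlim_def jump_sum[OF g] using \<phi>(2)[of 0] \<phi>(2)[of 1] by simp
qed

lemma (in trapezoid) f1_continuous: "continuous_on A f1"
 by (rule DERIV_continuous_on[OF DERIV_subset[OF f1]]) simp

lemma (in trapezoid) trap_sum_alt:
 "(\<Sum>k\<le>N. trap (g (mesh k N)) (g (mesh (Suc k) N))) = trap_sum g N + trap (g (mesh N N)) (g 1)"
 unfolding trap_sum_def by (simp only: lessThan_Suc_atMost[symmetric] sum.lessThan_Suc divide_self of_nat_eq_0_iff nat.simps if_False, simp)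

lemma abs_combine_le:
 fixes x y p q a b c d :: real
 assumes "\<bar>x\<bar> <= a" "\<bar>p\<bar> <= c" "\<bar>q\<bar> <= d" "\<bar>y\<bar> <= b" shows "\<bar>x - y + (p + q)\<bar> <= a + b + (c + d)"
 using assms by linarith

lemma abs_mean_le: fixes p q c :: real assumes "\<bar>p\<bar> <= c" "\<bar>q\<bar> <= c" shows "\<bar>(p + q) / 2\<bar> <= c"
proof -
 have "\<bar>p + q\<bar> <= c * 2" using assms by linarith
 thus ?thesis by simp
qed

lemma (in trapezoid) Vlim_bound:
 assumes g: "g \<in> G0" and B: "!!x. x \<in> {0..1} ==> \<bar>f1 x\<bar> <= B" and b: "0 <= \<beta>"
 shows "\<bar>Vlim \<beta> g\<bar> <= M + \<beta> * B + B"
proof -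
 have "\<bar>\<integral>r. jump_density g r \<partial>lborel\<bar> <= M"
  by (rule LIMSEQ_le_const2[OF tendsto_rabs[OF trap_sum_tendsto_integral(1)[OF g]]]) (use trap_sum_tendsto_integral(2)[OF g] in blast)
 moreover have "\<bar>\<integral>s. f1 (g s) \<partial>Leb01\<bar> <= B"
 proof -
  interpret L: prob_space Leb01 by (rule prob_space_Leb01)
  have m: "(%s. f1 (g s)) \<in> borel_measurable Leb01" by (rule borel_measurable_Leb01[OF measurable_compose_G0[OF f1_continuous g]])
  have b: "\<bar>f1 (g s)\<bar> <= B" for s using B[of "g s"] G0D(3,4)[OF g, of s] by simp
  have "\<bar>\<integral>s. f1 (g s) \<partial>Leb01\<bar> <= (\<integral>s. \<bar>f1 (g s)\<bar> \<partial>Leb01)" by (rule integral_abs_bound)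
  also have "\<dots> <= B" by (rule L.integral_le_const) (use L.integrable_const_bound[OF _ m, of B] b in auto)
  finally show ?thesis .
 qed
 hence "\<bar>\<beta> * (\<integral>s. f1 (g s) \<partial>Leb01)\<bar> <= \<beta> * B" using b by (simp add: abs_mult mult_left_mono)
 moreover have "\<bar>f1 0\<bar> <= B" "\<bar>f1 1\<bar> <= B" using B[of 0] B[of 1] by auto
 moreover have "\<bar>x + y - (p + q) / 2\<bar> <= a + b + c" if "\<bar>x\<bar> <= a" "\<bar>y\<bar> <= b" "\<bar>p\<bar> <= c" "\<bar>q\<bar> <= c" for x y p q a b c :: real
 proof -
  have "\<bar>(p + q) / 2\<bar> <= c" by (rule abs_mean_le[OF that(3,4)])
  thus ?thesis using that(1,2) abs_triangle_ineq4[of "x + y" "(p + q) / 2"] abs_triangle_ineq[of x y] by linarith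
 qed
 ultimately show ?thesis unfolding Vlim_def by blast
qed

section \<open>Behaviour at the endpoints and passage to the limit\<close>

context entropic
begin

text \<open>g(t) has the Beta distribution with parameters \<beta> t and \<beta> (1 - t), whose mean
  is t. This first moment is used to exclude jumps at the endpoints.\<close>

lemma expectation_eval:
 assumes t: "0 < t" "t < 1" shows "(\<integral>\<^sup>+g. ennreal (g t) \<partial>Q) = ennreal t"
proof -
 define T where "T i = (if i = 0 then 0 else if i = 1 then t else 1)" for i :: nat
 define a b where "a = \<beta> * t" and "b = \<beta> * (1 - t)"
 have ab: "a > 0" "b > 0" "a + b = \<beta>" using t \<beta> by (simp_all add: a_def b_def algebra_simps)
 have p: "part 1 T" using t by (auto simp: part_def T_def le_Suc_eq)
 interpret product_sigma_finite "%_::nat. lborel :: real measure" ..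
 define c where "c = Gamma \<beta> / (Gamma a * Gamma b)"
 have c: "c > 0" unfolding c_def using ab \<beta> by (intro divide_pos_pos mult_pos_pos Gamma_real_pos)
 have dens: "Q0_density \<beta> 1 T x = (if 0 < x 1 \<and> x 1 < 1 then c * (x 1 powr (a - 1) * (1 - x 1) powr (b - 1)) else 0)" for x
 proof -
  have 01: "{..1::nat} = {0, 1}" by auto
  have "incr01 1 x \<longleftrightarrow> 0 < x 1 \<and> x 1 < 1" by (auto simp: incr01_def ext01_def le_Suc_eq)
  thus ?thesis unfolding Q0_density_alt 01 by (simp add: ext01_def T_def a_def b_def c_def)
 qed
 define h where "h y = c * (y powr (a + 1 - 1) * (1 - y) powr (b - 1)) * indicator {0<..<1} y" for y :: real
 have "(\<integral>\<^sup>+g. ennreal (g t) \<partial>Q) = (\<integral>\<^sup>+g. ennreal (marg 1 T g 1) \<partial>Q)" by (simp add: T_def)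
 also have "\<dots> = (\<integral>\<^sup>+x. ennreal (Q0_density \<beta> 1 T x) * ennreal (x 1) \<partial>PiM {1..1} (%_. lborel))"
 proof (rule nn_integral_marg[OF p])
  have "(%x. x 1) \<in> measurable (PiM {1..1} (%_::nat. lborel)) (lborel :: real measure)" by (rule measurable_component_singleton) simp
  hence "(%x. x 1) \<in> borel_measurable (PiM {1..1} (%_::nat. lborel :: real measure))" by simp
  thus "(%x. ennreal (x 1)) \<in> borel_measurable (PiM {1..1} (%_::nat. lborel :: real measure))" by (rule measurable_compose) simp
 qed
 also have "\<dots> = (\<integral>\<^sup>+x. ennreal (h (x 1)) \<partial>PiM {1} (%_::nat. lborel))"
 proof -
  have s: "{1..1} = {1::nat}" by simp
  have "ennreal (Q0_density \<beta> 1 T x) * ennreal (x 1) = ennreal (h (x 1))" for x :: "nat => real"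
  proof (cases "0 < x 1 \<and> x 1 < 1")
   case True
   have "x 1 powr (a - 1) * x 1 = x 1 powr (a + 1 - 1)" using True powr_add[of "x 1" "a - 1" 1] by simp
   hence "c * (x 1 powr (a - 1) * (1 - x 1) powr (b - 1)) * x 1 = h (x 1)" using True unfolding h_def by (simp add: mult_ac)
   thus ?thesis unfolding dens using True c by (simp add: ennreal_mult'[symmetric])
  next
   case False
   have "Q0_density \<beta> 1 T x = 0" unfolding dens using False by (rule if_not_P)
   moreover have "h (x 1) = 0" using False unfolding h_def by (auto simp: indicator_def)
   ultimately show ?thesis by (simp only: ennreal_0 mult_zero_left)
  qed
  thus ?thesis unfolding s by (simp only:)
 qed
 also have "\<dots> = (\<integral>\<^sup>+y. ennreal (h y) \<partial>lborel)"
  by (rule product_nn_integral_singleton) (simp add: h_def[abs_def])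
 also have "\<dots> = ennreal (c * Beta (a + 1) b)"
 proof (rule nn_integral_has_integral_lborel)
  show "h \<in> borel_measurable borel" by (simp add: h_def[abs_def])
  show "0 <= h y" for y using c by (simp add: h_def)
  have "((%y. c * (y powr (a + 1 - 1) * (1 - y) powr (b - 1))) has_integral c * Beta (a + 1) b) {0..1}"
   by (intro has_integral_mult_right has_integral_Beta_real) (use ab in auto)
  hence "((%y. c * (y powr (a + 1 - 1) * (1 - y) powr (b - 1))) has_integral c * Beta (a + 1) b) {0<..<1}"
   using has_integral_Icc_iff_Ioo by blast
  hence "((%y. if y \<in> {0<..<1} then c * (y powr (a + 1 - 1) * (1 - y) powr (b - 1)) else 0) has_integral c * Beta (a + 1) b) UNIV"
   by (simp only: has_integral_restrict_UNIV)
  moreover have "h = (%y. if y \<in> {0<..<1} then c * (y powr (a + 1 - 1) * (1 - y) powr (b - 1)) else 0)" by (auto simp: h_def fun_eq_iff)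
  ultimately show "(h has_integral c * Beta (a + 1) b) UNIV" by simp
 qed
 also have "c * Beta (a + 1) b = t"
 proof -
  have ne: "Gamma a > 0" "Gamma b > 0" using ab by (intro Gamma_real_pos; simp)+
  have "\<beta> * Beta (a + 1) b = a * Beta a b" using Beta_plus1_left[of a b] ab by (simp add: nonpos_Ints_def)
  hence "c * (\<beta> * Beta (a + 1) b) = a * (c * Beta a b)" by (simp only: mult.left_commute)
  moreover have "c * Beta a b = 1" unfolding c_def Beta_def ab(3) using ne Gamma_real_pos[OF \<beta>] by (simp add: field_simps)
  ultimately have "\<beta> * (c * Beta (a + 1) b) = \<beta> * t" by (simp only: mult.left_commute[of \<beta>] mult_1_right a_def)
  thus ?thesis using \<beta> by simp
 qed
 finally show ?thesis .
qed

lemma AE_zero_of_nn_integral_le: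
 assumes m: "f \<in> borel_measurable Q" and le: "!!n. (\<integral>\<^sup>+g. ennreal (f g) \<partial>Q) <= ennreal (1 / real (Suc (Suc n)))"
  and nn: "!!g. g \<in> G0 ==> 0 <= f g"
 shows "AE g in Q. f g = 0"
proof -
 have "(%n. ennreal (1 / real (Suc (Suc n)))) \<longlonglongrightarrow> ennreal 0" by (intro tendsto_ennrealI LIMSEQ_Suc[OF LIMSEQ_Suc[OF lim_1_over_n]])
 hence "(\<integral>\<^sup>+g. ennreal (f g) \<partial>Q) <= 0" using LIMSEQ_le_const[of _ "ennreal 0"] le by simp
 hence "AE g in Q. ennreal (f g) = 0" using nn_integral_0_iff_AE[of "%g. ennreal (f g)" Q] m by simp
 thus ?thesis using AE_space by eventually_elim (use nn space_Q in \<open>auto simp: ennreal_eq_0_iff intro: antisym\<close>)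
qed

text \<open>g(0) is nonnegative and at most g(1/(n+2)), whose mean tends to 0; the shift by 2 keeps
  the time strictly inside ]0,1[.\<close>

lemma AE_start: "AE g in Q. g 0 = 0"
proof (rule AE_zero_of_nn_integral_le)
 fix n
 have "(\<integral>\<^sup>+g. ennreal (g 0) \<partial>Q) <= (\<integral>\<^sup>+g. ennreal (g (1 / real (Suc (Suc n)))) \<partial>Q)"
  by (rule nn_integral_mono, rule ennreal_leI, rule G0_mono) (simp_all add: space_Q)
 also have "\<dots> = ennreal (1 / real (Suc (Suc n)))" by (rule expectation_eval) simp_all
 finally show "(\<integral>\<^sup>+g. ennreal (g 0) \<partial>Q) <= ennreal (1 / real (Suc (Suc n)))" .
qed (use G0D(3) eval_measurable[OF space_sets] in auto)

lemma grid_end_tendsto: "(%n. 1 - 1 / real (Suc (Suc n))) \<longlonglongrightarrow> 1" 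
 using tendsto_diff[OF tendsto_const[of 1] LIMSEQ_Suc[OF LIMSEQ_Suc[OF lim_1_over_n]]] by simp

lemma AE_end: "AE g in Q. gleft g 1 = 1"
proof -
 have "AE g in Q. 1 - gleft g 1 = 0"
 proof (rule AE_zero_of_nn_integral_le)
  have "(%n. g (1 - 1 / real (Suc (Suc n)))) \<longlonglongrightarrow> gleft g 1" if "g \<in> G0" for g
   by (rule filterlim_compose[OF gleft_tendsto[OF that]]) (use grid_end_tendsto in \<open>auto simp: filterlim_at\<close>)
  hence "(%g. gleft g 1) \<in> borel_measurable Q"
   by (rule borel_measurable_LIMSEQ_real[rotated, OF eval_measurable[OF space_sets]]) (simp only: space_Q)
  thus "(%g. 1 - gleft g 1) \<in> borel_measurable Q" by simp
  fix n
  let ?s = "1 - 1 / real (Suc (Suc n))"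
  have s: "0 < ?s" "?s < 1" by (simp_all add: field_simps)
  have "(\<integral>\<^sup>+g. ennreal (1 - gleft g 1) \<partial>Q) <= (\<integral>\<^sup>+g. ennreal (1 - g ?s) \<partial>Q)"
   by (rule nn_integral_mono) (use gleft_bounds(1)[of _ ?s 1] s(2) in \<open>auto simp: space_Q intro!: ennreal_leI\<close>)
  also have "\<dots> = (\<integral>\<^sup>+g. 1 - ennreal (g ?s) \<partial>Q)"
   by (rule nn_integral_cong) (use G0D(3) in \<open>auto simp: space_Q ennreal_minus[symmetric]\<close>)
  also have "\<dots> = (\<integral>\<^sup>+g. 1 \<partial>Q) - (\<integral>\<^sup>+g. ennreal (g ?s) \<partial>Q)"
  proof (rule nn_integral_diff)
   show "(%g. ennreal (g ?s)) \<in> borel_measurable Q" using eval_measurable[OF space_sets] by simp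
   show "AE g in Q. ennreal (g ?s) <= 1" by (rule AE_I2) (use G0D(4) in \<open>auto simp: space_Q\<close>)
  qed (use expectation_eval[OF s] in auto)
  also have "\<dots> = ennreal (1 - ?s)" unfolding expectation_eval[OF s] nn_integral_const emeasure_space_1
   using ennreal_minus[of ?s 1, OF less_imp_le[OF s(1)]] by (simp only: ennreal_1 mult_1)
  finally show "(\<integral>\<^sup>+g. ennreal (1 - gleft g 1) \<partial>Q) <= ennreal (1 / real (Suc (Suc n)))" by simp
 qed (use gleft_bounds(3) in auto)
 thus ?thesis by eventually_elim simp
qed

text \<open>\<open>ext01\<close> prescribes the value 0 at index 0, hence the hypothesis on g(0),
  which holds almost surely by \<open>AE_start\<close>.\<close>

lemma ext01_grid:
 assumes "g \<in> G0" "g 0 = 0" "k <= Suc N"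
 shows "ext01 N (marg N (grid N) g) k = g (mesh k N)"
proof -
 consider "k = 0" | "k = Suc N" | "k \<noteq> 0" "k \<noteq> Suc N" "k \<in> {1..N}" using assms(3) by force
 thus ?thesis by cases (use assms G0D(2)[OF assms(1), of 1] in \<open>simp_all add: ext01_def grid_def del: of_nat_Suc\<close>)
qed

text \<open>The limit of \<open>IBP_discrete\<close> on the uniform partitions. Riemann sums give
  the integrals, summation by parts and the trapezoid limit give the drift, and bounds independent
  of N and g allow dominated convergence. Three derivatives of \<phi> are asked for because
  \<open>trap_bound\<close> rests on a bounded third derivative.\<close>

theorem IBP:
 assumes rep: "rep_ok 1 m U \<alpha>" and \<phi>: "Ck01 3 \<phi>" "\<phi> 0 = 0" "\<phi> 1 = 0"
 shows "(\<integral>g. (\<Sum>i<m. pd i U (zvec m \<alpha> g) * (\<integral>s. deriv01 (\<alpha> i) (g s) * \<phi> (g s) \<partial>Leb01)) + U (zvec m \<alpha> g) * Vbeta \<beta> \<phi> g \<partial>Q) = 0"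
  and "Vbeta \<beta> \<phi> \<in> borel_measurable Q" and "\<exists>C. \<forall>g\<in>G0. \<bar>Vbeta \<beta> \<phi> g\<bar> <= C"
proof -
 obtain f f1 f2 f3 where f: "!!x. (f has_real_derivative f1 x) (at x)" "!!x. (f1 has_real_derivative f2 x) (at x)"
  "!!x. (f2 has_real_derivative f3 x) (at x)" "continuous_on UNIV f3"
  and f\<phi>: "!!x. x \<in> {0..1} ==> f x = \<phi> x" "!!x. x \<in> {0..1} ==> f1 x = deriv01 \<phi> x" and f3: "!!x. f3 x = f3 (unit_clamp x)"
  by (rule Ck01_extend3[OF \<phi>(1)]) (rule that, assumption+)
 obtain M where M: "!!x. x \<in> {0..1} ==> \<bar>f3 x\<bar> <= M" by (rule bounded_on_01[OF continuous_on_subset[OF f(4)]]) (auto intro: that)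
 interpret T: trapezoid f f1 f2 f3 M
 proof
  show "\<bar>f3 x\<bar> <= M" for x using M[of "unit_clamp x"] unit_clamp_bounds[of x] f3[of x] by simp
 qed (fact f)+
 obtain B where B: "0 <= B" "!!x. x \<in> {0..1} ==> \<bar>f1 x\<bar> <= B" by (rule bounded_on_01[OF T.f1_continuous]) (blast intro: that)
 have Veq: "Vbeta \<beta> \<phi> g = T.Vlim \<beta> g" if "g \<in> G0" for g by (rule T.Vlim_eq[OF that f\<phi>])
 have Vb: "\<bar>Vbeta \<beta> \<phi> g\<bar> <= M + \<beta> * B + B" if "g \<in> G0" for g
  unfolding Veq[OF that] by (rule T.Vlim_bound[OF that B(2)]) (use \<beta> in auto)
 thus "\<exists>C. \<forall>g\<in>G0. \<bar>Vbeta \<beta> \<phi> g\<bar> <= C" by blast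
 have tm: "(%g. T.trap_sum g N) \<in> borel_measurable Q" for N
 proof -
  have fm: "f \<in> borel_measurable borel" "f1 \<in> borel_measurable borel"
   by (auto intro!: borel_measurable_continuous_onI T.f1_continuous DERIV_continuous_on[OF f(1)])
  have "(%g. q (g t)) \<in> borel_measurable Q" if "q \<in> borel_measurable borel" for q :: "real => real" and t :: real
   by (rule measurable_compose[OF eval_measurable[OF space_sets] that])
  note gm = this[OF fm(1)] this[OF fm(2)] eval_measurable[OF space_sets]
  show ?thesis unfolding T.trap_sum_def T.trap_def
   by (intro borel_measurable_sum measurable_If borel_measurable_diff borel_measurable_divide borel_measurable_add borel_measurable_const gm borel_measurable_eq)
 qed
 have "T.Vlim \<beta> \<in> borel_measurable Q" unfolding T.Vlim_def[abs_def]
 proof (intro borel_measurable_diff borel_measurable_add borel_measurable_times borel_measurable_const)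
  show "(%g. \<integral>r. T.jump_density g r \<partial>lborel) \<in> borel_measurable Q"
   by (rule borel_measurable_LIMSEQ_real[OF _ tm]) (use T.trap_sum_tendsto_integral(1) space_Q in auto)
  show "(%g. \<integral>s. f1 (g s) \<partial>Leb01) \<in> borel_measurable Q"
   using cont_measurable[OF cont_G0_integral[OF T.f1_continuous]]
   by (rule measurable_cong[THEN iffD1, rotated]) (auto simp: space_Q integral_compose_G0[OF T.f1_continuous])
 qed
 thus Vm: "Vbeta \<beta> \<phi> \<in> borel_measurable Q" by (rule measurable_cong[THEN iffD2, rotated]) (simp add: space_Q Veq)
 have U: "CkRm m (Suc 0) U" and al: "!!i. i < m ==> Ck01 (Suc 0) (\<alpha> i)" using rep by (auto simp: rep_ok_def simp del: CkRm.simps Ck01.simps)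
 have alc: "!!i. i < m ==> continuous_on {0..1} (\<alpha> i)" using al Ck01_continuous by blast
 have dac: "!!i. i < m ==> continuous_on {0..1} (deriv01 (\<alpha> i))" using al by simp
 have phc: "continuous_on {0..1} \<phi>" using \<phi>(1) by (rule Ck01_continuous)
 have f01: "f 0 = 0" "f 1 = 0" using f\<phi>(1)[of 0] f\<phi>(1)[of 1] \<phi> by auto
 have dc: "!!i. i < m ==> continuous_on {0..1} (%x. deriv01 (\<alpha> i) x * f x)"
  using dac f(1) by (intro continuous_on_mult) (auto intro!: DERIV_continuous_on[OF DERIV_subset[OF f(1)]])
 note UV = CkRm_cont[OF U] 
 have pdc: "cont_Rm m (pd i U)" if "i < m" for i using CkRm_pd[OF U that] by simp
 let ?X = "%N. marg N (grid N)"
 define H where "H N = ibp_term N m U \<alpha> f f1" for N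
 note H_def' = H_def[THEN fun_cong, unfolded ibp_term_def]
 have H: "integral\<^sup>L Q (H N) = 0" "H N \<in> borel_measurable Q" for N
  unfolding H_def by (rule IBP_discrete[OF rep f(1) T.f1_continuous f01])+
 define I where "I g = (\<Sum>i<m. pd i U (zvec m \<alpha> g) * (\<integral>s. deriv01 (\<alpha> i) (g s) * f (g s) \<partial>Leb01)) + U (zvec m \<alpha> g) * T.Vlim \<beta> g" for g
 have AEg: "AE g in Q. g \<in> G0 \<and> g 0 = 0 \<and> gleft g 1 = 1 \<and> (\<forall>N. incr01 N (?X N g))"
 proof -
  have "AE g in Q. \<forall>N. incr01 N (?X N g)" unfolding AE_all_countable using AE_incr01[OF part_grid] by blast
  thus ?thesis using AE_start AE_end AE_space by eventually_elim (auto simp: space_Q)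
 qed
 \<comment> \<open>\<open>jacobian_sum_eq\<close> with b = \<beta>/(N+1), the last cell being split
   off. The final term is the correction between the trapezoidal and the right endpoint sum and
   disappears in the limit.\<close>
 have VN: "(\<Sum>k\<in>{1..N}. f1 (?X N g k)) + (\<Sum>k\<le>N. (\<beta> / real (Suc N) - 1) * slope N f (?X N g) k)
   = (T.trap_sum g N + T.trap (g (mesh N N)) 1) * (1 - \<beta> / real (Suc N)) - (f1 0 + f1 1) / 2
    + (\<beta> * ((\<Sum>k\<in>{1..Suc N}. f1 (g (mesh k N))) / real (Suc N)) + \<beta> / real (Suc N) * ((f1 0 - f1 1) / 2))"
  if g: "g \<in> G0" "g 0 = 0" "incr01 N (?X N g)" for g N
 proof -
  let ?e = "ext01 N (?X N g)"
  have e0: "?e 0 = 0" "?e (Suc N) = 1" by (simp_all add: ext01_def)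
  have g1: "g 1 = 1" by (rule G0D(2)[OF g(1)]) simp
  have lt: "?e k < ?e (Suc k)" if "k <= N" for k using g(3) that by (simp add: incr01_def)
  have 1: "(\<Sum>k\<in>{1..N}. f1 (?X N g k)) = (\<Sum>k\<in>{1..N}. f1 (?e k))" by (rule sum.cong) (auto simp: ext01_def)
  have 2: "(\<Sum>k\<le>N. T.trap (?e k) (?e (Suc k))) = T.trap_sum g N + T.trap (g (mesh N N)) 1"
   unfolding T.trap_sum_alt[of g N, unfolded g1, symmetric] by (rule sum.cong[OF refl]) (simp only: atMost_iff ext01_grid[OF g(1,2)] le_SucI Suc_le_mono)
  have 3: "(\<Sum>k\<in>{1..Suc N}. f1 (?e k)) = (\<Sum>k\<in>{1..Suc N}. f1 (g (mesh k N)))"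
   by (rule sum.cong[OF refl]) (simp only: atLeastAtMost_iff ext01_grid[OF g(1,2)])
  show ?thesis using T.jacobian_sum_eq[of N ?e "\<beta> / real (Suc N)", OF lt] unfolding slope_def 1 2 3 e0
   by (simp only: distrib_left times_divide_eq_left times_divide_eq_right)
 qed
 have nN: "(%N. \<beta> / real (Suc N)) \<longlonglongrightarrow> 0" using tendsto_mult[OF tendsto_const[of \<beta>] LIMSEQ_Suc[OF lim_1_over_n]] by simp
 have lim: "(%N. H N g) \<longlonglongrightarrow> I g" if g: "g \<in> G0" "g 0 = 0" "gleft g 1 = 1" "!!N. incr01 N (?X N g)" for g
 proof -
  have g01: "g x \<in> {0..1}" for x using G0D(3,4)[OF g(1)] by simp
  have ru: "riemann01 N m \<alpha> (?X N g) i = (\<Sum>k\<in>{1..Suc N}. \<alpha> i (g (mesh k N))) / real (Suc N)" if "i < m" for N i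
  proof -
   have "(\<Sum>k\<in>{1..Suc N}. \<alpha> i (unit_clamp (ext01 N (?X N g) k))) = (\<Sum>k\<in>{1..Suc N}. \<alpha> i (g (mesh k N)))"
    by (rule sum.cong[OF refl]) (simp only: atLeastAtMost_iff ext01_grid[OF g(1,2)] unit_clamp_eq[OF g01])
   thus ?thesis using that by (simp add: riemann01_def del: sum.cl_ivl_Suc restrict_apply)
  qed
  have rl: "(%N. riemann01 N m \<alpha> (?X N g) i) \<longlonglongrightarrow> zvec m \<alpha> g i" if i: "i < m" for i
   unfolding ru[OF i] using Riemann_sum_tendsto[OF g(1) alc[OF i]] i by (simp only: zvec_def if_True integral_compose_G0[OF alc[OF i] g(1)])
  have dl: "(%N. (\<Sum>k\<in>{1..Suc N}. deriv01 (\<alpha> i) (ext01 N (?X N g) k) * f (ext01 N (?X N g) k)) / real (Suc N)) \<longlonglongrightarrow> (\<integral>s. deriv01 (\<alpha> i) (g s) * f (g s) \<partial>Leb01)" if i: "i < m" for i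
  proof -
   have "(\<Sum>k\<in>{1..Suc N}. deriv01 (\<alpha> i) (ext01 N (?X N g) k) * f (ext01 N (?X N g) k)) = (\<Sum>k\<in>{1..Suc N}. deriv01 (\<alpha> i) (g (mesh k N)) * f (g (mesh k N)))" for N
    by (rule sum.cong[OF refl]) (simp only: atLeastAtMost_iff ext01_grid[OF g(1,2)])
   thus ?thesis using Riemann_sum_tendsto[OF g(1) dc[OF i]] by simp
  qed
  \<comment> \<open>The last cell contributes nothing in the limit, because the left limit of g at 1
    equals g(1) and the error is quadratic in the increment.\<close>
  have last: "(%N. T.trap (g (mesh N N)) 1) \<longlonglongrightarrow> 0"
  proof -
   have e: "real N / real (Suc N) = 1 - 1 / real (Suc N)" for N by (simp add: field_simps)
   have "(%N. real N / real (Suc N)) \<longlonglongrightarrow> 1" unfolding e using tendsto_diff[OF tendsto_const[of 1] LIMSEQ_Suc[OF lim_1_over_n]] by simp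
   hence "filterlim (%N. real N / real (Suc N)) (at_left 1) sequentially" by (auto simp: filterlim_at)
   from filterlim_compose[OF gleft_tendsto[OF g(1)] this] have l: "(%N. g (mesh N N)) \<longlonglongrightarrow> 1" unfolding g(3) .
   have "(%N. M * (1 - g (mesh N N))^2) \<longlonglongrightarrow> M * (1 - 1)^2" by (intro tendsto_intros l)
   thus ?thesis using T.trap_bound G0D(4)[OF g(1)]
    by (intro Lim_null_comparison[of "%N. T.trap (g (mesh N N)) 1" "%N. M * (1 - g (mesh N N))^2"]) auto
  qed
  have "(%N. (T.trap_sum g N + T.trap (g (mesh N N)) 1) * (1 - \<beta> / real (Suc N)) - (f1 0 + f1 1) / 2
    + (\<beta> * ((\<Sum>k\<in>{1..Suc N}. f1 (g (mesh k N))) / real (Suc N)) + \<beta> / real (Suc N) * ((f1 0 - f1 1) / 2)))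
   \<longlonglongrightarrow> ((\<integral>r. T.jump_density g r \<partial>lborel) + 0) * (1 - 0) - (f1 0 + f1 1) / 2 + (\<beta> * (\<integral>s. f1 (g s) \<partial>Leb01) + 0 * ((f1 0 - f1 1) / 2))"
   by (intro tendsto_add tendsto_mult tendsto_diff tendsto_const nN last T.trap_sum_tendsto_integral(1)[OF g(1)] Riemann_sum_tendsto[OF g(1) T.f1_continuous])
  hence VL: "(%N. (\<Sum>k\<in>{1..N}. f1 (?X N g k)) + (\<Sum>k\<le>N. (\<beta> / real (Suc N) - 1) * slope N f (?X N g) k)) \<longlonglongrightarrow> T.Vlim \<beta> g"
   unfolding VN[OF g(1,2,4)] T.Vlim_def by (simp add: algebra_simps del: sum.cl_ivl_Suc of_nat_Suc)
  show ?thesis unfolding H_def' I_def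
   by (intro tendsto_add tendsto_sum tendsto_mult VL dl cont_Rm_seq[OF pdc] cont_Rm_seq[OF UV] rl) auto
 qed
 have "\<exists>K. \<forall>N g. g \<in> G0 \<and> g 0 = 0 \<and> incr01 N (?X N g) \<longrightarrow> \<bar>H N g\<bar> <= K"
 proof -
  obtain R where R: "!!N x. riemann01 N m \<alpha> x \<in> Rm_box m R" 
   by (rule riemann01_box[of m \<alpha>]) (rule alc, assumption, blast intro: that)
  obtain C where C: "!!y. y \<in> Rm_box m R ==> \<bar>U y\<bar> <= C" using cont_Rm_bounded[OF UV, of R] by blast
  have "\<exists>D. \<forall>y\<in>Rm_box m R. \<bar>pd i U y\<bar> <= D" if "i < m" for i 
   by (rule cont_Rm_bounded[OF pdc[OF that], of R]) blast
  then obtain D where D: "!!i y. i < m ==> y \<in> Rm_box m R ==> \<bar>pd i U y\<bar> <= D i" by metis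
  have "\<exists>E. \<forall>x\<in>{0..1}. \<bar>deriv01 (\<alpha> i) x * f x\<bar> <= E" if "i < m" for i using bounded_on_01[OF dc[OF that]] by metis
  then obtain E where E: "!!i x. i < m ==> x \<in> {0..1} ==> \<bar>deriv01 (\<alpha> i) x * f x\<bar> <= E i" by metis
  \<comment> \<open>The bounds of the terms in \<open>VN\<close>: the trapezoid sum and the last
    cell give at most M each, their factor at most 1 + \<beta>, and means of f1 at most B.\<close>
  define W where "W = 2 * M * (1 + \<beta>) + B + (\<beta> * B + \<beta> * B)"
  have b1: "0 <= \<beta> / real (Suc N)" "\<beta> / real (Suc N) <= \<beta>" for N using \<beta> by (simp_all add: field_simps)
  have avg: "\<bar>(\<Sum>k\<in>{1..Suc N}. q k) / real (Suc N)\<bar> <= E" if "!!k. k \<in> {1..Suc N} ==> \<bar>q k\<bar> <= E" for q E N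
  proof -
   have "\<bar>\<Sum>k\<in>{1..Suc N}. q k\<bar> <= (\<Sum>k\<in>{1..Suc N}. E)" by (rule order_trans[OF sum_abs sum_mono[OF that]])
   thus ?thesis by (simp add: abs_divide pos_divide_le_eq mult.commute del: sum.cl_ivl_Suc)
  qed
  have "\<bar>H N g\<bar> <= (\<Sum>i<m. D i * E i) + C * W" if g: "g \<in> G0" "g 0 = 0" "incr01 N (?X N g)" for N g
  proof -
   have g01: "g x \<in> {0..1}" for x using G0D(3,4)[OF g(1)] by simp
   have e01: "ext01 N (?X N g) k \<in> {0..1}" if "k \<in> {1..Suc N}" for k using incr01_bounds[OF g(3), of k] that by simp
   have "\<bar>pd i U (riemann01 N m \<alpha> (?X N g)) * ((\<Sum>k\<in>{1..Suc N}. deriv01 (\<alpha> i) (ext01 N (?X N g) k) * f (ext01 N (?X N g) k)) / real (Suc N))\<bar> <= D i * E i" if i: "i < m" for i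
    unfolding abs_mult by (rule mult_mono[OF D[OF i R] avg[OF E[OF i e01]]]) (use order_trans[OF abs_ge_zero D[OF i R]] in auto)
   hence 1: "\<bar>\<Sum>i<m. pd i U (riemann01 N m \<alpha> (?X N g)) * ((\<Sum>k\<in>{1..Suc N}. deriv01 (\<alpha> i) (ext01 N (?X N g) k) * f (ext01 N (?X N g) k)) / real (Suc N))\<bar> <= (\<Sum>i<m. D i * E i)"
    by (intro order_trans[OF sum_abs sum_mono]) auto
   let ?t = "T.trap_sum g N + T.trap (g (mesh N N)) 1"
   have "\<bar>T.trap (g (mesh N N)) 1\<bar> <= M * (1 - g (mesh N N))^2" using G0D(4)[OF g(1)] by (intro T.trap_bound)
   also have "\<dots> <= M * 1" using T.M_nonneg g01[of "real N / real (Suc N)"] by (intro mult_left_mono) (auto simp: power_le_one)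
   finally have t: "\<bar>?t\<bar> <= 2 * M" using T.trap_sum_tendsto_integral(2)[OF g(1), of N] by linarith
   have "\<bar>1 - \<beta> / real (Suc N)\<bar> <= 1 + \<beta>" using b1[of N] by linarith
   hence "\<bar>?t * (1 - \<beta> / real (Suc N))\<bar> <= 2 * M * (1 + \<beta>)" unfolding abs_mult using t T.M_nonneg by (intro mult_mono) auto
   moreover have "\<bar>(\<Sum>k\<in>{1..Suc N}. f1 (g (mesh k N))) / real (Suc N)\<bar> <= B" by (rule avg) (rule B(2)[OF g01])
   hence "\<bar>\<beta> * ((\<Sum>k\<in>{1..Suc N}. f1 (g (mesh k N))) / real (Suc N))\<bar> <= \<beta> * B" using \<beta> unfolding abs_mult by (intro mult_mono) auto
   moreover have f1b: "\<bar>f1 0\<bar> <= B" "\<bar>f1 1\<bar> <= B" using B(2)[of 0] B(2)[of 1] by auto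
   hence "\<bar>\<beta> / real (Suc N) * ((f1 0 - f1 1) / 2)\<bar> <= \<beta> * B" unfolding abs_mult using b1[of N] B(1) by (intro mult_mono) auto
   moreover have "\<bar>(f1 0 + f1 1) / 2\<bar> <= B" by (rule abs_mean_le[OF f1b])
   ultimately have w: "\<bar>(\<Sum>k\<in>{1..N}. f1 (?X N g k)) + (\<Sum>k\<le>N. (\<beta> / real (Suc N) - 1) * slope N f (?X N g) k)\<bar> <= W"
    unfolding VN[OF g] W_def by (rule abs_combine_le)
   have 2: "\<bar>U (riemann01 N m \<alpha> (?X N g)) * ((\<Sum>k\<in>{1..N}. f1 (?X N g k)) + (\<Sum>k\<le>N. (\<beta> / real (Suc N) - 1) * slope N f (?X N g) k))\<bar> <= C * W"
    unfolding abs_mult by (rule mult_mono[OF C[OF R] w]) (use order_trans[OF abs_ge_zero C[OF R]] in auto)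
   show ?thesis unfolding H_def' by (rule order_trans[OF abs_triangle_ineq add_mono[OF 1 2]])
  qed
  thus ?thesis by blast
 qed
 then obtain K where K: "!!N g. g \<in> G0 ==> g 0 = 0 ==> incr01 N (?X N g) ==> \<bar>H N g\<bar> <= K" by blast
 have Ieq: "(\<Sum>i<m. pd i U (zvec m \<alpha> g) * (\<integral>s. deriv01 (\<alpha> i) (g s) * \<phi> (g s) \<partial>Leb01)) + U (zvec m \<alpha> g) * Vbeta \<beta> \<phi> g = I g" if "g \<in> G0" for g
  unfolding I_def Veq[OF that] using f\<phi>(1) G0D(3,4)[OF that] by simp
 have Im: "I \<in> borel_measurable Q"
 proof -
  have "(%g. \<integral>s. deriv01 (\<alpha> i) (g s) * f (g s) \<partial>Leb01) \<in> borel_measurable Q" if i: "i < m" for i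
   using cont_measurable[OF cont_G0_integral[OF dc[OF i]]]
   by (rule measurable_cong[THEN iffD1, rotated]) (auto simp: space_Q integral_compose_G0[OF dc[OF i]])
  moreover have "(%g. pd i U (zvec m \<alpha> g)) \<in> borel_measurable Q" if "i < m" for i
   by (rule cont_measurable[OF cont_G0_zfun_cont[OF pdc[OF that] alc]])
  moreover have "(%g. U (zvec m \<alpha> g)) \<in> borel_measurable Q" by (rule cont_measurable[OF cont_G0_zfun_cont[OF UV alc]])
  ultimately show ?thesis unfolding I_def[abs_def] using \<open>T.Vlim \<beta> \<in> borel_measurable Q\<close>
   by (intro borel_measurable_add borel_measurable_sum borel_measurable_times) auto
 qed
 have "(%N. integral\<^sup>L Q (H N)) \<longlonglongrightarrow> integral\<^sup>L Q I"
 proof (rule integral_dominated_convergence[where w="%_. K"])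
  show "AE g in Q. (%N. H N g) \<longlonglongrightarrow> I g" using AEg by eventually_elim (use lim in blast)
  show "AE g in Q. norm (H N g) <= K" for N using AEg by eventually_elim (use K in simp)
 qed (use Im H(2) in auto)
 hence "(%N::nat. 0) \<longlonglongrightarrow> integral\<^sup>L Q I" by (simp only: H(1))
 hence "integral\<^sup>L Q I = 0" by (rule LIMSEQ_unique[OF _ tendsto_const])
 thus "(\<integral>g. (\<Sum>i<m. pd i U (zvec m \<alpha> g) * (\<integral>s. deriv01 (\<alpha> i) (g s) * \<phi> (g s) \<partial>Leb01)) + U (zvec m \<alpha> g) * Vbeta \<beta> \<phi> g \<partial>Q) = 0"
  by (subst Bochner_Integration.integral_cong[OF refl, of _ _ I]) (simp_all add: space_Q Ieq)
qed

end


section \<open>Smooth flat cylinder functions are a core\<close>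

text \<open>Unlike square integrability this class is closed under products, so the integrability of
  all expressions built from cylinder functions, their gradients and the drift follows from their
  shape.\<close>

definition bdd_meas :: "'a measure => ('a => real) => bool" where
 "bdd_meas M f \<longleftrightarrow> f \<in> borel_measurable M \<and> (\<exists>C. \<forall>x\<in>space M. \<bar>f x\<bar> <= C)"

lemma bdd_measI: "f \<in> borel_measurable M ==> (!!x. x \<in> space M ==> \<bar>f x\<bar> <= C) ==> bdd_meas M f"
 unfolding bdd_meas_def by blast

lemma bdd_meas_const: "bdd_meas M (%_. c)"
 by (rule bdd_measI[of _ _ "\<bar>c\<bar>"]) auto

lemma bdd_meas_add: assumes "bdd_meas M f" "bdd_meas M g" shows "bdd_meas M (%x. f x + g x)"
proof -
 obtain C C' where C: "!!x. x \<in> space M ==> \<bar>f x\<bar> <= C" "!!x. x \<in> space M ==> \<bar>g x\<bar> <= C'"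
  using assms unfolding bdd_meas_def by blast
 show ?thesis
 proof (rule bdd_measI)
  show "(%x. f x + g x) \<in> borel_measurable M" using assms unfolding bdd_meas_def by (blast intro: borel_measurable_add)
  show "\<bar>f x + g x\<bar> <= C + C'" if "x \<in> space M" for x using C[OF that] by linarith
 qed
qed

lemma bdd_meas_mult: assumes "bdd_meas M f" "bdd_meas M g" shows "bdd_meas M (%x. f x * g x)"
proof -
 obtain C C' where C: "!!x. x \<in> space M ==> \<bar>f x\<bar> <= C" "!!x. x \<in> space M ==> \<bar>g x\<bar> <= C'"
  using assms unfolding bdd_meas_def by blast
 show ?thesis
 proof (rule bdd_measI)
  show "(%x. f x * g x) \<in> borel_measurable M" using assms unfolding bdd_meas_def by (blast intro: borel_measurable_times)
  show "\<bar>f x * g x\<bar> <= C * C'" if "x \<in> space M" for x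
   unfolding abs_mult by (rule mult_mono[OF C[OF that] order_trans[OF abs_ge_zero C(1)[OF that]]]) simp
 qed
qed

lemma bdd_meas_sum: "(!!i. i \<in> I ==> bdd_meas M (f i)) ==> bdd_meas M (%x. \<Sum>i\<in>I. f i x)"
 by (induction I rule: infinite_finite_induct) (auto intro: bdd_meas_const bdd_meas_add)

lemma bdd_meas_cong: "bdd_meas M f ==> (!!x. x \<in> space M ==> f x = g x) ==> bdd_meas M g"
 unfolding bdd_meas_def using measurable_cong[of M f g] by auto

lemma bdd_meas_compose: "bdd_meas M f ==> p \<in> measurable N M ==> bdd_meas N (%x. f (p x))"
 unfolding bdd_meas_def using measurable_space[of p N M] measurable_compose[of p N M f] by blast

lemma (in prob_space) bdd_meas_L2: "bdd_meas M f ==> L2 M f"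
 unfolding bdd_meas_def using L2_bounded[of f] by (auto simp: AE_space intro: AE_I2)

lemma (in prob_space) bdd_meas_integrable: "bdd_meas M f ==> integrable M f"
 using bdd_meas_L2 L2_integrable(1) by blast

text \<open>The expression defining \<^const>\<open>L0\<close>, evaluated on a given representation.\<close>

definition Lrep :: "real => nat => ((nat => real) => real) => (nat => real => real) => (real => real) => real" where
 "Lrep \<beta> m U \<alpha> g = (\<Sum>i<m. \<Sum>j<m. pd i (pd j U) (zvec m \<alpha> g) * integral {0..1} (%s. deriv01 (\<alpha> i) (g s) * deriv01 (\<alpha> j) (g s)))
   + (\<Sum>i<m. pd i U (zvec m \<alpha> g) * Vbeta \<beta> (deriv01 (\<alpha> i)) g)"

lemma Ck01_deriv: "Ck01 (Suc k) a ==> Ck01 k (deriv01 a)" by simp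

lemma rep_okD:
 assumes "rep_ok (Suc k) m U \<alpha>"
 shows "CkRm m (Suc k) U" "i < m ==> Ck01 (Suc k) (\<alpha> i)" "i < m ==> continuous_on {0..1} (deriv01 (\<alpha> i))"
  "i < m ==> cont_Rm m (pd i U)" "cont_Rm m U" "i < m ==> continuous_on {0..1} (\<alpha> i)"
proof -
 show 1: "CkRm m (Suc k) U" "i < m ==> Ck01 (Suc k) (\<alpha> i)" using assms unfolding rep_ok_def by blast+
 show "i < m ==> continuous_on {0..1} (deriv01 (\<alpha> i))" using Ck01_continuous[OF Ck01_deriv[OF 1(2)]] .
 show "i < m ==> cont_Rm m (pd i U)" using CkRm_cont[OF CkRm_pd[OF 1(1)]] .
 show "cont_Rm m U" "i < m ==> continuous_on {0..1} (\<alpha> i)" using rep_ok_cont[OF assms] by blast+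
qed

context Q0_space
begin

lemma prob_space_M2: "prob_space (M2 Q)"
proof -
 interpret L: prob_space Leb01 by (rule prob_space_Leb01)
 interpret P: pair_prob_space Q Leb01 ..
 show ?thesis unfolding M2_def by (rule P.prob_space_axioms)
qed

lemma space_M2: "z \<in> space (M2 Q) ==> fst z \<in> G0" by (auto simp: M2_def space_pair_measure space_Q)

lemma fst_M2: "fst \<in> measurable (M2 Q) Q" unfolding M2_def by simp

lemma distr_fst_M2: "distr (M2 Q) Q fst = Q"
proof -
 interpret L: prob_space Leb01 by (rule prob_space_Leb01)
 show ?thesis
 proof (rule measure_eqI)
  fix A assume "A \<in> sets (distr (M2 Q) Q fst)"
  hence A: "A \<in> sets Q" by simp
  hence e: "fst -` A \<inter> space (M2 Q) = A \<times> space Leb01" using sets.sets_into_space[of A Q] by (auto simp: M2_def space_pair_measure)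
  show "emeasure (distr (M2 Q) Q fst) A = emeasure Q A"
   unfolding emeasure_distr[OF fst_M2 A] e unfolding M2_def
   by (subst L.emeasure_pair_measure_Times) (use A in \<open>auto simp: L.emeasure_space_1\<close>)
 qed simp
qed

lemma integral_M2:
 fixes F :: "_ => real"
 assumes "integrable (M2 Q) F"
 shows "(\<integral>z. F z \<partial>M2 Q) = (\<integral>g. (\<integral>s. F (g, s) \<partial>Leb01) \<partial>Q)" "integrable Q (%g. \<integral>s. F (g, s) \<partial>Leb01)"
proof -
 interpret L: prob_space Leb01 by (rule prob_space_Leb01)
 interpret P: pair_sigma_finite Q Leb01 ..
 show "(\<integral>z. F z \<partial>M2 Q) = (\<integral>g. (\<integral>s. F (g, s) \<partial>Leb01) \<partial>Q)"
  using P.integral_fst'[of F] assms unfolding M2_def by simp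
 show "integrable Q (%g. \<integral>s. F (g, s) \<partial>Leb01)"
  using P.integrable_fst'[of F] assms unfolding M2_def by simp
qed

lemma bdd_meas_fst: "bdd_meas Q f ==> bdd_meas (M2 Q) (%z. f (fst z))"
 by (rule bdd_meas_compose[OF _ fst_M2])

lemma bdd_meas_eval:
 assumes q: "continuous_on {0..1} q" shows "bdd_meas (M2 Q) (%z. q (fst z (snd z)))"
proof (rule bdd_meas_cong)
 obtain C where C: "!!x. x \<in> {0..1} ==> \<bar>q x\<bar> <= C" by (rule bounded_on_01[OF q]) (blast intro: that)
 have "(%x. q (unit_clamp x)) \<in> borel_measurable borel" by (intro borel_measurable_continuous_onI continuous_unit_clamp_compose q)
 from measurable_compose[OF eval_pair_measurable[OF space_Q sets_Q] this]
 show "bdd_meas (M2 Q) (%z. q (unit_clamp (fst z (snd z))))"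
  by (rule bdd_measI[of _ _ C]) (rule C, simp add: unit_clamp_bounds)
 fix z assume "z \<in> space (M2 Q)"
 thus "q (unit_clamp (fst z (snd z))) = q (fst z (snd z))" using G0D(3,4)[OF space_M2] by (simp add: unit_clamp_eq)
qed

lemma bdd_meas_cyl:
 assumes "cont_Rm m V" "!!i. i < m ==> continuous_on {0..1} (\<alpha> i)" shows "bdd_meas Q (%g. V (zvec m \<alpha> g))"
proof (rule zfun_bounded[OF assms])
 fix C assume "!!g. g \<in> G0 ==> \<bar>V (zvec m \<alpha> g)\<bar> <= C"
 thus ?thesis by (intro bdd_measI[where C=C, OF cont_measurable[OF cont_G0_zfun_cont[OF assms]]]) (simp_all add: space_Q)
qed

lemma bdd_meas_integral:
 assumes q: "continuous_on {0..1} q" shows "bdd_meas Q (%g. integral {0..1} (%s. q (g s)))"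
 using bdd_meas_cyl[of 1 "%x. x 0" "%_. q"] CkRm_coord[of 0 1 0] q by (simp add: zvec_def)

lemma bdd_meas_Drep:
 assumes "rep_ok 1 m U \<alpha>" shows "bdd_meas (M2 Q) (%z. Drep m U \<alpha> (fst z) (snd z))"
 unfolding Drep_def
proof (intro bdd_meas_sum bdd_meas_mult)
 note r = rep_okD[OF assms[unfolded One_nat_def]]
 fix i assume "i \<in> {..<m}"
 hence i: "i < m" by simp
 show "bdd_meas (M2 Q) (%z. pd i U (zvec m \<alpha> (fst z)))" by (rule bdd_meas_fst[OF bdd_meas_cyl[OF r(4)[OF i] r(6)]])
 show "bdd_meas (M2 Q) (%z. deriv01 (\<alpha> i) (fst z (snd z)))" by (rule bdd_meas_eval[OF r(3)[OF i]])
qed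

end

context entropic
begin

text \<open>For each fixed s in ]0,1[ the marginal lives on the open simplex; Fubini exchanges the
  quantifiers. This is what makes convergence of flat derivatives on the open interval
  sufficient.\<close>

lemma AE_eval_interior: "AE z in M2 Q. fst z (snd z) \<in> {0<..<1}"
proof -
 interpret L: prob_space Leb01 by (rule prob_space_Leb01)
 interpret P: pair_sigma_finite Q Leb01 ..
 have m: "{z \<in> space (Q \<Otimes>\<^sub>M Leb01). fst z (snd z) \<in> {0<..<1}} \<in> sets (Q \<Otimes>\<^sub>M Leb01)"
  using measurable_sets[OF eval_pair_measurable[OF space_sets], of "{0<..<1}"] unfolding M2_def
  by (simp add: vimage_def Int_def conj_commute)
 have "AE g in Q. g s \<in> {0<..<1}" if s: "0 < s" "s < 1" for s
 proof -
  define T where "T i = (if i = 0 then 0 else if i = 1 then s else 1)" for i :: nat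
  have "part 1 T" using s by (auto simp: part_def T_def le_Suc_eq)
  from AE_incr01[OF this] show ?thesis
   by eventually_elim (auto simp: incr01_def ext01_def T_def le_Suc_eq)
 qed
 moreover have "AE s in Leb01. 0 < s \<and> s < 1"
 proof -
  have "AE s in lborel. s \<in> {0..1} \<longrightarrow> 0 < s \<and> s < (1::real)"
   using AE_lborel_singleton[of 0] AE_lborel_singleton[of 1] by eventually_elim auto
  thus ?thesis unfolding Leb01_def by (rule AE_restrict_space_iff[THEN iffD2, rotated]) simp
 qed
 ultimately have "AE s in Leb01. AE g in Q. g s \<in> {0<..<1}" by (auto elim: eventually_mono)
 hence "AE g in Q. AE s in Leb01. g s \<in> {0<..<1}"
  using P.AE_commute[of "%g s. g s \<in> {0<..<1}"] m by simp
 thus ?thesis unfolding M2_def by (intro P.AE_pair_measure m) simp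
qed

text \<open>Inner functions are replaced by flat ones and the outer function by smooth ones
  converging in C^1 on a box. Values and gradients then converge boundedly almost everywhere, hence
  in L^2.\<close>

lemma rep_approx:
 assumes rep: "rep_ok 1 m U \<alpha>"
 shows "\<exists>V \<gamma>. (\<forall>n. rep_inf0 m (V n) (\<gamma> n)) \<and> L2conv Q (%n. zfun m (V n) (\<gamma> n)) (zfun m U \<alpha>) \<and>
  L2conv (M2 Q) (%n z. Drep m (V n) (\<gamma> n) (fst z) (snd z)) (%z. Drep m U \<alpha> (fst z) (snd z))"
proof -
 note r = rep_okD[OF rep[unfolded One_nat_def]]
 define P where "P i \<gamma> C \<longleftrightarrow> (\<forall>n k. Ck01 k (\<gamma> n)) \<and> (\<forall>n::nat. deriv01 (\<gamma> n) 0 = 0 \<and> deriv01 (\<gamma> n) 1 = 0)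
  \<and> (\<forall>n. \<forall>x\<in>{0..1}. \<bar>deriv01 (\<gamma> n) x\<bar> <= C \<and> \<bar>\<gamma> n x\<bar> <= C)
  \<and> (\<forall>x. 0 < x \<longrightarrow> x < 1 \<longrightarrow> (%n. deriv01 (\<gamma> n) x) \<longlonglongrightarrow> deriv01 (\<alpha> i) x)
  \<and> (\<forall>x\<in>{0..1}. (%n. \<gamma> n x) \<longlonglongrightarrow> \<alpha> i x)" for i \<gamma> C
 have "\<exists>\<gamma> C. P i \<gamma> C" if i: "i < m" for i
 proof (rule Ck01_approx_flat[OF r(2)[OF i]])
  fix \<gamma> C
  assume a: "!!n k. Ck01 k (\<gamma> n)" "!!n. deriv01 (\<gamma> n) 0 = 0" "!!n. deriv01 (\<gamma> n) 1 = 0"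
   "!!n x. x \<in> {0..1} ==> \<bar>deriv01 (\<gamma> n) x\<bar> <= C" "!!n x. x \<in> {0..1} ==> \<bar>\<gamma> n x\<bar> <= C"
   "!!x. 0 < x ==> x < 1 ==> (%n. deriv01 (\<gamma> n) x) \<longlonglongrightarrow> deriv01 (\<alpha> i) x"
   "!!x. x \<in> {0..1} ==> (%n. \<gamma> n x) \<longlonglongrightarrow> \<alpha> i x"
  show ?thesis unfolding P_def by (intro exI[of _ \<gamma>] exI[of _ C] conjI allI ballI impI a)
 qed
 then obtain \<delta> C where "!!i. i < m ==> P i (\<delta> i) (C i)" by metis
 hence \<delta>: "!!i n k. i < m ==> Ck01 k (\<delta> i n)" "!!i n. i < m ==> deriv01 (\<delta> i n) 0 = 0" "!!i n. i < m ==> deriv01 (\<delta> i n) 1 = 0"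
   "!!i n x. i < m ==> x \<in> {0..1} ==> \<bar>deriv01 (\<delta> i n) x\<bar> <= C i" "!!i n x. i < m ==> x \<in> {0..1} ==> \<bar>\<delta> i n x\<bar> <= C i"
   "!!i x. i < m ==> 0 < x ==> x < 1 ==> (%n. deriv01 (\<delta> i n) x) \<longlonglongrightarrow> deriv01 (\<alpha> i) x"
   "!!i x. i < m ==> x \<in> {0..1} ==> (%n. \<delta> i n x) \<longlonglongrightarrow> \<alpha> i x" unfolding P_def by blast+
 define \<gamma> where "\<gamma> n i = \<delta> i n" for n i
 have gc: "continuous_on {0..1} (\<gamma> n i)" if "i < m" for n i using Ck01_continuous[OF \<delta>(1)[OF that]] by (simp add: \<gamma>_def)
 \<comment> \<open>One box for the vectors of all approximating inner functions at once; it must be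
   fixed before the outer functions V n are chosen on it.\<close>
 define R where "R = 1 + (\<Sum>i<m. \<bar>C i\<bar>)"
 have R0: "R > 0" unfolding R_def by (simp add: add_pos_nonneg sum_nonneg)
 have CR: "C i <= R" if "i < m" for i using member_le_sum[of i "{..<m}" "%i. \<bar>C i\<bar>"] that by (simp add: R_def)
 have zl: "(%n. zvec m (\<gamma> n) g i) \<longlonglongrightarrow> zvec m \<alpha> g i" and zb: "\<bar>zvec m (\<gamma> n) g i\<bar> <= R" if g: "g \<in> G0" and i: "i < m" for g i n
 proof -
  interpret L: prob_space Leb01 by (rule prob_space_Leb01)
  have g01: "g x \<in> {0..1}" for x using G0D(3,4)[OF g] by simp
  have z: "zvec m (\<gamma> n) g i = (\<integral>s. \<gamma> n i (g s) \<partial>Leb01)" "zvec m \<alpha> g i = (\<integral>s. \<alpha> i (g s) \<partial>Leb01)" for n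
   using i by (simp_all add: zvec_def integral_compose_G0(1)[OF _ g] gc r(6))
  have mg: "(%s. q (g s)) \<in> borel_measurable Leb01" if "continuous_on {0..1} q" for q :: "real => real"
   by (rule borel_measurable_Leb01[OF measurable_compose_G0[OF that g]])
  show "(%n. zvec m (\<gamma> n) g i) \<longlonglongrightarrow> zvec m \<alpha> g i" unfolding z
   by (rule integral_dominated_convergence[where w="%_. C i"])
    (use \<delta>(5,7)[OF i g01] mg[OF gc[OF i]] mg[OF r(6)[OF i]] in \<open>auto simp: \<gamma>_def\<close>)
  have "\<bar>\<integral>s. \<gamma> n i (g s) \<partial>Leb01\<bar> <= (\<integral>s. \<bar>\<gamma> n i (g s)\<bar> \<partial>Leb01)" by (rule integral_abs_bound)
  also have "\<dots> <= C i" by (rule L.integral_le_const)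
    (use \<delta>(5)[OF i g01] L.integrable_const_bound[where B="C i", OF _ mg[OF gc[OF i]]] in \<open>auto simp: \<gamma>_def\<close>)
  finally show "\<bar>zvec m (\<gamma> n) g i\<bar> <= R" unfolding z using CR[OF i] by linarith
 qed
 have box: "zvec m (\<gamma> n) g \<in> Rm_box m R" if "g \<in> G0" for g n using zb[OF that] by (simp add: Rm_box_def)
 have "\<exists>V. (\<forall>k. CkRm m k V) \<and> (\<forall>x\<in>Rm_box m R. \<bar>V x - U x\<bar> < 1 / real (Suc n)) \<and> (\<forall>x\<in>Rm_box m R. \<forall>i<m. \<bar>pd i V x - pd i U x\<bar> < 1 / real (Suc n))" for n
 proof (rule C1_approx_smooth[OF r(1) R0, of "1 / real (Suc n)"])
  fix V assume "!!k. CkRm m k V" "!!x. x \<in> Rm_box m R ==> \<bar>V x - U x\<bar> < 1 / real (Suc n)"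
   "!!x i. x \<in> Rm_box m R ==> i < m ==> \<bar>pd i V x - pd i U x\<bar> < 1 / real (Suc n)"
  thus ?thesis by (intro exI[of _ V]) blast
 qed simp
 then obtain V where V: "!!n k. CkRm m k (V n)" "!!n x. x \<in> Rm_box m R ==> \<bar>V n x - U x\<bar> < 1 / real (Suc n)"
   "!!n x i. x \<in> Rm_box m R ==> i < m ==> \<bar>pd i (V n) x - pd i U x\<bar> < 1 / real (Suc n)" by metis
 have inf0: "rep_inf0 m (V n) (\<gamma> n)" for n
  using V(1) \<delta>(1,2,3) by (simp add: rep_inf0_def rep_ok_def \<gamma>_def)
 have lim: "(%n. W n (zvec m (\<gamma> n) g)) \<longlonglongrightarrow> W' (zvec m \<alpha> g)"
  if "cont_Rm m W'" "!!n x. x \<in> Rm_box m R ==> \<bar>W n x - W' x\<bar> < 1 / real (Suc n)" "g \<in> G0" for W W' g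
 proof -
  have "(%n. W' (zvec m (\<gamma> n) g)) \<longlonglongrightarrow> W' (zvec m \<alpha> g)" by (rule cont_Rm_seq[OF that(1)]) (use zl[OF that(3)] in auto)
  moreover have "(%n. W n (zvec m (\<gamma> n) g) - W' (zvec m (\<gamma> n) g)) \<longlonglongrightarrow> 0"
   by (rule Lim_null_comparison[OF _ LIMSEQ_Suc[OF lim_1_over_n]]) (use that(2)[OF box[OF that(3)]] in \<open>auto intro!: always_eventually less_imp_le simp del: of_nat_Suc\<close>)
  ultimately show ?thesis using tendsto_add by fastforce
 qed
 have bd: "\<exists>B. \<forall>n. \<forall>g\<in>G0. \<bar>W n (zvec m (\<gamma> n) g)\<bar> <= B"
  if W: "cont_Rm m W'" "!!n x. x \<in> Rm_box m R ==> \<bar>W n x - W' x\<bar> < 1 / real (Suc n)" for W W'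
 proof -
  obtain B where B: "!!x. x \<in> Rm_box m R ==> \<bar>W' x\<bar> <= B" using cont_Rm_bounded[OF W(1), of R] by blast
  have "\<bar>W n (zvec m (\<gamma> n) g)\<bar> <= B + 1" if "g \<in> G0" for n g
  proof -
   have "1 / real (Suc n) <= 1" by simp
   thus ?thesis using W(2)[OF box[OF that], of n n] B[OF box[OF that], of n] by linarith
  qed
  thus ?thesis by blast
 qed
 have ok: "rep_ok 1 m (V n) (\<gamma> n)" for n by (rule rep_inf0_ok[OF inf0])
 have c1: "L2conv Q (%n. zfun m (V n) (\<gamma> n)) (zfun m U \<alpha>)"
 proof -
  obtain B where B: "!!n g. g \<in> G0 ==> \<bar>V n (zvec m (\<gamma> n) g)\<bar> <= B" using bd[OF r(5) V(2)] by blast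
  show ?thesis
  proof (rule L2conv_bounded[of _ _ B])
   show "zfun m (V n) (\<gamma> n) \<in> borel_measurable Q" for n by (rule cont_measurable[OF cont_G0_zfun[OF ok]])
   show "zfun m U \<alpha> \<in> borel_measurable Q" by (rule cont_measurable[OF cont_G0_zfun[OF rep]])
   show "AE x in Q. \<bar>zfun m (V n) (\<gamma> n) x\<bar> <= B" for n by (rule AE_I2) (simp add: space_Q zfun_def B)
   show "AE x in Q. (%n. zfun m (V n) (\<gamma> n) x) \<longlonglongrightarrow> zfun m U \<alpha> x"
    unfolding zfun_def by (rule AE_I2, rule lim[OF r(5) V(2)]) (simp_all add: space_Q)
  qed
 qed
 have c2: "L2conv (M2 Q) (%n z. Drep m (V n) (\<gamma> n) (fst z) (snd z)) (%z. Drep m U \<alpha> (fst z) (snd z))"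
 proof -
  interpret P2: prob_space "M2 Q" by (rule prob_space_M2)
  have "\<exists>B. \<forall>n. \<forall>g\<in>G0. \<bar>pd i (V n) (zvec m (\<gamma> n) g)\<bar> <= B" if "i < m" for i
   by (rule bd[OF r(4)[OF that]]) (rule V(3)[OF _ that])
  then obtain B where B: "!!i n g. i < m ==> g \<in> G0 ==> \<bar>pd i (V n) (zvec m (\<gamma> n) g)\<bar> <= B i" by metis
  show ?thesis
  proof (rule P2.L2conv_bounded[of _ _ "\<Sum>i<m. B i * C i"])
   show "(%z. Drep m (V n) (\<gamma> n) (fst z) (snd z)) \<in> borel_measurable (M2 Q)" for n
    using bdd_meas_Drep[OF ok] unfolding bdd_meas_def by blast
   show "(%z. Drep m U \<alpha> (fst z) (snd z)) \<in> borel_measurable (M2 Q)" using bdd_meas_Drep[OF rep] unfolding bdd_meas_def by blast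
   show "AE z in M2 Q. \<bar>Drep m (V n) (\<gamma> n) (fst z) (snd z)\<bar> <= (\<Sum>i<m. B i * C i)" for n
   proof (rule AE_I2)
    fix z assume "z \<in> space (M2 Q)"
    hence g: "fst z \<in> G0" by (rule space_M2)
    have "\<bar>pd i (V n) (zvec m (\<gamma> n) (fst z)) * deriv01 (\<gamma> n i) (fst z (snd z))\<bar> <= B i * C i" if "i < m" for i
     unfolding abs_mult by (rule mult_mono[OF B[OF that g]])
      (use \<delta>(4)[OF that, of "fst z (snd z)" n] G0D(3,4)[OF g] order_trans[OF abs_ge_zero B[OF that g]] in \<open>auto simp: \<gamma>_def\<close>)
    thus "\<bar>Drep m (V n) (\<gamma> n) (fst z) (snd z)\<bar> <= (\<Sum>i<m. B i * C i)"
     unfolding Drep_def by (intro order_trans[OF sum_abs sum_mono]) auto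
   qed
   show "AE z in M2 Q. (%n. Drep m (V n) (\<gamma> n) (fst z) (snd z)) \<longlonglongrightarrow> Drep m U \<alpha> (fst z) (snd z)"
    using AE_eval_interior AE_space
   proof eventually_elim
    fix z assume z: "fst z (snd z) \<in> {0<..<1}" "z \<in> space (M2 Q)"
    show "(%n. Drep m (V n) (\<gamma> n) (fst z) (snd z)) \<longlonglongrightarrow> Drep m U \<alpha> (fst z) (snd z)"
     unfolding Drep_def
    proof (intro tendsto_sum tendsto_mult)
     fix i assume "i \<in> {..<m}"
     hence i: "i < m" by simp
     show "(%n. pd i (V n) (zvec m (\<gamma> n) (fst z))) \<longlonglongrightarrow> pd i U (zvec m \<alpha> (fst z))"
      by (rule lim[OF r(4)[OF i] V(3)[OF _ i] space_M2[OF z(2)]])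
     show "(%n. deriv01 (\<gamma> n i) (fst z (snd z))) \<longlonglongrightarrow> deriv01 (\<alpha> i) (fst z (snd z))"
      unfolding \<gamma>_def using z(1) by (intro \<delta>(6)[OF i]) auto
    qed
   qed
  qed
 qed
 show ?thesis using inf0 c1 c2 by blast
qed

section \<open>The generator on smooth flat cylinder functions\<close>

lemma bdd_meas_Vbeta: assumes "Ck01 3 \<phi>" "\<phi> 0 = 0" "\<phi> 1 = 0" shows "bdd_meas Q (Vbeta \<beta> \<phi>)"
proof -
 \<comment> \<open>The trivial representation only serves to instantiate \<open>IBP\<close>, whose
   parts on measurability and boundedness do not mention U.\<close>
 have "rep_ok 1 0 (%_. 0) \<alpha>" for \<alpha> by (simp add: rep_ok_def CkRm_const del: CkRm.simps)
 from IBP(2,3)[OF this assms] show ?thesis unfolding bdd_meas_def by (simp add: space_Q)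
qed

lemma IBP_Drep:
 assumes rep: "rep_ok 1 m U \<alpha>" and \<phi>: "Ck01 3 \<phi>" "\<phi> 0 = 0" "\<phi> 1 = 0"
 shows "(\<integral>z. Drep m U \<alpha> (fst z) (snd z) * \<phi> (fst z (snd z)) \<partial>M2 Q) = - (\<integral>g. zfun m U \<alpha> g * Vbeta \<beta> \<phi> g \<partial>Q)"
proof -
 interpret P2: prob_space "M2 Q" by (rule prob_space_M2)
 note r = rep_okD[OF rep[unfolded One_nat_def]]
 have phc: "continuous_on {0..1} \<phi>" by (rule Ck01_continuous[OF \<phi>(1)])
 have i: "integrable (M2 Q) (%z. Drep m U \<alpha> (fst z) (snd z) * \<phi> (fst z (snd z)))"
  by (intro P2.bdd_meas_integrable bdd_meas_mult bdd_meas_Drep rep bdd_meas_eval phc)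
 have e: "(\<integral>s. Drep m U \<alpha> g s * \<phi> (g s) \<partial>Leb01) = (\<Sum>i<m. pd i U (zvec m \<alpha> g) * (\<integral>s. deriv01 (\<alpha> i) (g s) * \<phi> (g s) \<partial>Leb01))" if g: "g \<in> G0" for g
 proof -
  have ii: "integrable Leb01 (%s. deriv01 (\<alpha> i) (g s) * \<phi> (g s))" if "i < m" for i
   by (rule integral_compose_G0(2)[OF _ g, of "%x. deriv01 (\<alpha> i) x * \<phi> x"]) (intro continuous_on_mult r(3)[OF that] phc)
  show ?thesis unfolding Drep_def sum_distrib_right mult.assoc
   by (subst Bochner_Integration.integral_sum) (use ii in auto)
 qed
 have iV: "integrable Q (%g. zfun m U \<alpha> g * Vbeta \<beta> \<phi> g)"
  unfolding zfun_def by (intro bdd_meas_integrable bdd_meas_mult bdd_meas_cyl bdd_meas_Vbeta \<phi> r)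
 have "0 = (\<integral>g. (\<Sum>i<m. pd i U (zvec m \<alpha> g) * (\<integral>s. deriv01 (\<alpha> i) (g s) * \<phi> (g s) \<partial>Leb01)) + zfun m U \<alpha> g * Vbeta \<beta> \<phi> g \<partial>Q)"
  unfolding zfun_def by (rule IBP(1)[OF assms, symmetric])
 also have "\<dots> = (\<integral>g. (\<integral>s. Drep m U \<alpha> g s * \<phi> (g s) \<partial>Leb01) + zfun m U \<alpha> g * Vbeta \<beta> \<phi> g \<partial>Q)"
  by (rule Bochner_Integration.integral_cong[OF refl]) (simp add: space_Q e)
 also have "\<dots> = (\<integral>g. (\<integral>s. Drep m U \<alpha> g s * \<phi> (g s) \<partial>Leb01) \<partial>Q) + (\<integral>g. zfun m U \<alpha> g * Vbeta \<beta> \<phi> g \<partial>Q)"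
  by (rule Bochner_Integration.integral_add[OF _ iV]) (use integral_M2(2)[OF i] in simp)
 finally show ?thesis using integral_M2(1)[OF i] by simp
qed

lemma bdd_meas_Lrep:
 assumes "rep_inf0 m U \<alpha>" shows "bdd_meas Q (Lrep \<beta> m U \<alpha>)"
proof -
 have ok: "rep_ok (Suc k) m U \<alpha>" for k by (rule rep_inf0_ok[OF assms])
 have pp: "cont_Rm m (pd i (pd j U))" if "i < m" "j < m" for i j
  using CkRm_pd[OF CkRm_pd[OF rep_okD(1)[OF ok, of 1, unfolded One_nat_def] that(2)] that(1)] by simp
 have d3: "Ck01 3 (deriv01 (\<alpha> i))" if "i < m" for i using Ck01_deriv[OF rep_okD(2)[OF ok that]] .
 have d0: "deriv01 (\<alpha> i) 0 = 0" "deriv01 (\<alpha> i) 1 = 0" if "i < m" for i using assms that by (auto simp: rep_inf0_def)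
 note r = rep_okD[OF ok[of 0]]
 show ?thesis unfolding Lrep_def[abs_def]
  by (intro bdd_meas_add bdd_meas_sum bdd_meas_mult)
   (auto intro!: bdd_meas_cyl bdd_meas_integral[of "%x. deriv01 (\<alpha> i) x * deriv01 (\<alpha> j) x" for i j] bdd_meas_Vbeta d3 d0 continuous_on_mult r pp)
qed

text \<open>The gradient of v is the sum of the terms \<open>pd j V\<close> times \<gamma>_j'(g).
  For each j apply \<open>IBP_Drep\<close> in the direction \<gamma>_j' to the product of u with
  \<open>pd j V\<close>. The product rule separates the wanted term from one with second derivatives
  of V, and together with the drift these assemble to the generator.\<close>

theorem gradient_IBP:
 assumes rep: "rep_ok 1 m U \<alpha>" and rep': "rep_inf0 n V \<gamma>"
 shows "(\<integral>z. Drep m U \<alpha> (fst z) (snd z) * Drep n V \<gamma> (fst z) (snd z) \<partial>M2 Q) = - (\<integral>g. zfun m U \<alpha> g * Lrep \<beta> n V \<gamma> g \<partial>Q)"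
proof -
 interpret P2: prob_space "M2 Q" by (rule prob_space_M2)
 have ok: "rep_ok (Suc k) n V \<gamma>" for k by (rule rep_inf0_ok[OF rep'])
 note r = rep_okD[OF rep[unfolded One_nat_def]] and r' = rep_okD[OF ok[of 0]]
 have okj: "rep_ok 1 n (pd j V) \<gamma>" if "j < n" for j
  using CkRm_pd[OF rep_okD(1)[OF ok, of 1, unfolded One_nat_def] that] rep_okD(2)[OF ok[of 0]] unfolding rep_ok_def One_nat_def by blast
 have pp: "cont_Rm n (pd i (pd j V))" if "i < n" "j < n" for i j using rep_okD(4)[OF okj[OF that(2), unfolded One_nat_def] that(1)] .
 define \<phi> where "\<phi> j = deriv01 (\<gamma> j)" for j
 have \<phi>: "Ck01 3 (\<phi> j)" "\<phi> j 0 = 0" "\<phi> j 1 = 0" if "j < n" for j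
  using Ck01_deriv[OF rep_okD(2)[OF ok that]] rep' that by (auto simp: \<phi>_def rep_inf0_def)
 have phc: "continuous_on {0..1} (\<phi> j)" if "j < n" for j by (rule Ck01_continuous[OF \<phi>(1)[OF that]])
 let ?u = "zfun m U \<alpha>" and ?Du = "%z. Drep m U \<alpha> (fst z) (snd z)" and ?A = "rep_append m \<alpha> \<gamma>"
 let ?p = "%j g. pd j V (zvec n \<gamma> g)" and ?ph = "%j z. \<phi> j (fst z (snd z))"
 have bu: "bdd_meas Q ?u" unfolding zfun_def by (intro bdd_meas_cyl r)
 have bp: "bdd_meas Q (?p j)" if "j < n" for j by (intro bdd_meas_cyl r' that)
 have bV: "bdd_meas Q (Vbeta \<beta> (\<phi> j))" if "j < n" for j by (intro bdd_meas_Vbeta \<phi> that)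
 \<comment> \<open>The pairing of the gradient of \<open>pd j V\<close> with the direction \<phi> j;
   the sum of these over j is the second order part of \<open>Lrep\<close>.\<close>
 define DD where "DD j g = (\<Sum>i<n. pd i (pd j V) (zvec n \<gamma> g) * integral {0..1} (%s. \<phi> i (g s) * \<phi> j (g s)))" for j g
 have bD: "bdd_meas Q (DD j)" if "j < n" for j
  unfolding DD_def[abs_def] using pp r'(6) phc that
  by (intro bdd_meas_sum bdd_meas_mult bdd_meas_cyl bdd_meas_integral[of "%x. \<phi> i x * \<phi> j x" for i j] continuous_on_mult) auto
 have step: "(\<integral>z. ?Du z * (?p j (fst z) * ?ph j z) \<partial>M2 Q) = - (\<integral>g. ?u g * (DD j g + ?p j g * Vbeta \<beta> (\<phi> j) g) \<partial>Q)" if j: "j < n" for j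
 proof -
  let ?U = "%x. U (window m 0 x)" and ?V = "%x. pd j V (window n m x)"
  have ap: "rep_ok 1 (m + n) ?U ?A" "rep_ok 1 (m + n) ?V ?A" by (rule rep_append_ok[OF rep okj[OF j]])+
  have D: "Drep (m + n) (%x. ?U x * ?V x) ?A g s = ?u g * Drep n (pd j V) \<gamma> g s + ?p j g * Drep m U \<alpha> g s" for g s
   unfolding Drep_mult[OF ap[unfolded One_nat_def]] zfun_append Drep_append[OF rep[unfolded One_nat_def] okj[OF j, unfolded One_nat_def]] by (simp add: zfun_def)
  have Z: "zfun (m + n) (%x. ?U x * ?V x) ?A g = ?u g * ?p j g" for g
   by (simp add: zfun_def window_zvec_append)
  have bb: "bdd_meas (M2 Q) (%z. ?u (fst z) * (Drep n (pd j V) \<gamma> (fst z) (snd z) * ?ph j z))"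
   "bdd_meas (M2 Q) (%z. ?Du z * (?p j (fst z) * ?ph j z))"
   by (intro bdd_meas_mult bdd_meas_fst[OF bu] bdd_meas_fst[OF bp[OF j]] bdd_meas_Drep okj[OF j] rep bdd_meas_eval phc[OF j])+
  have "(\<integral>z. ?u (fst z) * (Drep n (pd j V) \<gamma> (fst z) (snd z) * ?ph j z) \<partial>M2 Q) + (\<integral>z. ?Du z * (?p j (fst z) * ?ph j z) \<partial>M2 Q)
   = (\<integral>z. Drep (m + n) (%x. ?U x * ?V x) ?A (fst z) (snd z) * ?ph j z \<partial>M2 Q)"
   unfolding D by (subst Bochner_Integration.integral_add[symmetric]) (intro P2.bdd_meas_integrable bb, intro P2.bdd_meas_integrable bb, simp add: algebra_simps)
  also have "\<dots> = - (\<integral>g. ?u g * ?p j g * Vbeta \<beta> (\<phi> j) g \<partial>Q)"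
   unfolding IBP_Drep[OF rep_ok_ops(2)[OF ap] \<phi>[OF j]] Z ..
  also have "(\<integral>z. ?u (fst z) * (Drep n (pd j V) \<gamma> (fst z) (snd z) * ?ph j z) \<partial>M2 Q) = (\<integral>g. ?u g * DD j g \<partial>Q)"
   unfolding integral_M2(1)[OF P2.bdd_meas_integrable[OF bb(1)]]
  proof (rule Bochner_Integration.integral_cong[OF refl])
   fix g assume "g \<in> space Q"
   hence g: "g \<in> G0" by (simp add: space_Q)
   have c: "continuous_on {0..1} (%x. \<phi> i x * \<phi> j x)" if "i < n" for i by (intro continuous_on_mult phc that j)
   have "(\<integral>s. Drep n (pd j V) \<gamma> g s * \<phi> j (g s) \<partial>Leb01) = (\<integral>s. (\<Sum>i<n. pd i (pd j V) (zvec n \<gamma> g) * (\<phi> i (g s) * \<phi> j (g s))) \<partial>Leb01)"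
    unfolding Drep_def sum_distrib_right mult.assoc \<phi>_def ..
   also have "\<dots> = (\<Sum>i<n. pd i (pd j V) (zvec n \<gamma> g) * (\<integral>s. \<phi> i (g s) * \<phi> j (g s) \<partial>Leb01))"
    by (subst Bochner_Integration.integral_sum) (use integral_compose_G0(2)[OF c g] in auto)
   also have "\<dots> = DD j g" unfolding DD_def by (rule sum.cong[OF refl]) (use integral_compose_G0(1)[OF c g] in simp)
   finally show "(\<integral>s. ?u (fst (g, s)) * (Drep n (pd j V) \<gamma> (fst (g, s)) (snd (g, s)) * ?ph j (g, s)) \<partial>Leb01) = ?u g * DD j g" by simp
  qed
  finally have "(\<integral>z. ?Du z * (?p j (fst z) * ?ph j z) \<partial>M2 Q) = - ((\<integral>g. ?u g * DD j g \<partial>Q) + (\<integral>g. ?u g * ?p j g * Vbeta \<beta> (\<phi> j) g \<partial>Q))"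
   by linarith
  also have "(\<integral>g. ?u g * DD j g \<partial>Q) + (\<integral>g. ?u g * ?p j g * Vbeta \<beta> (\<phi> j) g \<partial>Q) = (\<integral>g. ?u g * DD j g + ?u g * ?p j g * Vbeta \<beta> (\<phi> j) g \<partial>Q)"
   by (rule Bochner_Integration.integral_add[symmetric]) (intro bdd_meas_integrable bdd_meas_mult bu bD bp bV j)+
  finally show ?thesis by (simp add: algebra_simps)
 qed
 have "(\<integral>z. ?Du z * Drep n V \<gamma> (fst z) (snd z) \<partial>M2 Q) = (\<integral>z. (\<Sum>j<n. ?Du z * (?p j (fst z) * ?ph j z)) \<partial>M2 Q)"
  unfolding Drep_def[of n] \<phi>_def sum_distrib_left ..
 also have "\<dots> = (\<Sum>j<n. \<integral>z. ?Du z * (?p j (fst z) * ?ph j z) \<partial>M2 Q)"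
 proof (rule Bochner_Integration.integral_sum)
  fix j assume "j \<in> {..<n}"
  hence j: "j < n" by simp
  show "integrable (M2 Q) (%z. ?Du z * (?p j (fst z) * ?ph j z))"
   by (intro P2.bdd_meas_integrable bdd_meas_mult bdd_meas_fst[OF bp[OF j]] bdd_meas_Drep rep bdd_meas_eval phc[OF j])
 qed
 also have "\<dots> = (\<Sum>j<n. - (\<integral>g. ?u g * (DD j g + ?p j g * Vbeta \<beta> (\<phi> j) g) \<partial>Q))" by (rule sum.cong[OF refl]) (simp add: step)
 also have "\<dots> = - (\<integral>g. (\<Sum>j<n. ?u g * (DD j g + ?p j g * Vbeta \<beta> (\<phi> j) g)) \<partial>Q)"
  unfolding sum_negf
 proof (subst Bochner_Integration.integral_sum)
  fix j assume "j \<in> {..<n}"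
  hence j: "j < n" by simp
  show "integrable Q (%g. ?u g * (DD j g + ?p j g * Vbeta \<beta> (\<phi> j) g))"
   by (intro bdd_meas_integrable bdd_meas_mult bdd_meas_add bu bD bp bV j)
 qed simp
 also have "(%g. \<Sum>j<n. ?u g * (DD j g + ?p j g * Vbeta \<beta> (\<phi> j) g)) = (%g. ?u g * Lrep \<beta> n V \<gamma> g)"
  unfolding Lrep_def sum_distrib_left[symmetric] sum.distrib DD_def \<phi>_def by (rule ext, subst sum.swap) simp
 finally show ?thesis .
qed

text \<open>Replacing each gradient by a smooth flat one at distance 1/(k+1) shows that w is itself
  a limit of smooth flat gradients. It is orthogonal to all of them, hence to itself.\<close>

lemma Drep_limit_zero:
 assumes w: "L2conv (M2 Q) (%k z. Drep (m k) (U k) (\<alpha> k) (fst z) (snd z)) w" and rep: "!!k. rep_ok 1 (m k) (U k) (\<alpha> k)"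
  and orth: "!!n V \<gamma>. rep_inf0 n V \<gamma> ==> (\<integral>z. w z * Drep n V \<gamma> (fst z) (snd z) \<partial>M2 Q) = 0"
 shows "AE z in M2 Q. w z = 0"
proof -
 interpret P2: prob_space "M2 Q" by (rule prob_space_M2)
 let ?D = "%k z. Drep (m k) (U k) (\<alpha> k) (fst z) (snd z)"
 define P where "P k V \<gamma> \<longleftrightarrow> rep_inf0 (m k) V \<gamma> \<and> (\<integral>z. (Drep (m k) V \<gamma> (fst z) (snd z) - ?D k z)^2 \<partial>M2 Q) < 1 / real (Suc k)" for k V \<gamma>
 have "\<exists>V \<gamma>. P k V \<gamma>" for k
 proof -
  obtain V \<gamma> where V: "!!n. rep_inf0 (m k) (V n) (\<gamma> n)"
   "L2conv (M2 Q) (%n z. Drep (m k) (V n) (\<gamma> n) (fst z) (snd z)) (?D k)" using rep_approx[OF rep[of k]] by blast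
  have "\<forall>\<^sub>F n in sequentially. (\<integral>z. (Drep (m k) (V n) (\<gamma> n) (fst z) (snd z) - ?D k z)^2 \<partial>M2 Q) < 1 / real (Suc k)"
   by (rule order_tendstoD(2)[OF L2convD(3)[OF V(2)]]) simp
  then obtain n where "(\<integral>z. (Drep (m k) (V n) (\<gamma> n) (fst z) (snd z) - ?D k z)^2 \<partial>M2 Q) < 1 / real (Suc k)"
   using eventually_happens'[OF sequentially_bot] by blast
  hence "P k (V n) (\<gamma> n)" unfolding P_def using V(1) by blast
  thus ?thesis by blast
 qed
 then obtain V \<gamma> where "!!k. P k (V k) (\<gamma> k)" by metis
 hence V: "!!k. rep_inf0 (m k) (V k) (\<gamma> k)"
  "!!k. (\<integral>z. (Drep (m k) (V k) (\<gamma> k) (fst z) (snd z) - ?D k z)^2 \<partial>M2 Q) < 1 / real (Suc k)" unfolding P_def by blast+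
 let ?S = "%k z. Drep (m k) (V k) (\<gamma> k) (fst z) (snd z)"
 have L: "L2 (M2 Q) (?S k)" "L2 (M2 Q) (?D k)" for k
  by (intro P2.bdd_meas_L2 bdd_meas_Drep rep_inf0_ok[OF V(1)] rep)+
 have "(%k. \<integral>z. (?S k z - ?D k z)^2 \<partial>M2 Q) \<longlonglongrightarrow> 0"
  by (rule Lim_null_comparison[OF _ LIMSEQ_Suc[OF lim_1_over_n]]) (use V(2) in \<open>auto intro!: always_eventually less_imp_le simp del: of_nat_Suc\<close>)
 hence "L2conv (M2 Q) (%k z. ?S k z - ?D k z) (%_. 0)"
  unfolding L2conv_def using L2_diff[OF L] P2.bdd_meas_L2[OF bdd_meas_const[of _ 0]] by simp
 from L2conv_add[OF this w] have S: "L2conv (M2 Q) ?S w" by simp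
 have "(%k. \<integral>z. w z * ?S k z \<partial>M2 Q) \<longlonglongrightarrow> (\<integral>z. w z * w z \<partial>M2 Q)" by (rule L2conv_inner[OF L2conv_const[OF L2convD(2)[OF w]] S])
 hence "(%k::nat. 0) \<longlonglongrightarrow> (\<integral>z. w z * w z \<partial>M2 Q)" by (simp only: orth[OF V(1)])
 hence "(\<integral>z. w z * w z \<partial>M2 Q) = 0" by (rule LIMSEQ_unique[OF _ tendsto_const])
 thus ?thesis by (intro L2_zero_AE[OF L2convD(2)[OF w]]) (simp add: power2_eq_square)
qed

text \<open>The gradient of a difference of two representations of the same function is orthogonal to the dense range of the smooth gradients.\<close>

lemma Drep_unique:
 assumes r: "rep_ok 1 m U \<alpha>" "rep_ok 1 n V \<gamma>" and eq: "zfun m U \<alpha> = zfun n V \<gamma>"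
 shows "AE z in M2 Q. Drep m U \<alpha> (fst z) (snd z) = Drep n V \<gamma> (fst z) (snd z)"
proof (rule zfun_common[OF r])
 interpret P2: prob_space "M2 Q" by (rule prob_space_M2)
 fix M U' V' A
 assume c: "rep_ok 1 M U' A" "rep_ok 1 M V' A" "zfun M U' A = zfun m U \<alpha>" "zfun M V' A = zfun n V \<gamma>"
  "Drep M U' A = Drep m U \<alpha>" "Drep M V' A = Drep n V \<gamma>"
 let ?W = "%x. U' x + (-1) * V' x"
 have ok': "rep_ok 1 M (%x. (-1) * V' x) A" by (rule rep_ok_ops(3)[OF c(2,2)])
 have ok: "rep_ok 1 M ?W A" by (rule rep_ok_ops(1)[OF c(1) ok'])
 have D: "Drep M ?W A g s = Drep m U \<alpha> g s - Drep n V \<gamma> g s" for g s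
  using Drep_add[OF c(1)[unfolded One_nat_def] ok'[unfolded One_nat_def], of g s] Drep_cmult[OF c(2)[unfolded One_nat_def], of "-1" g s] c(5,6) by simp
 have z: "zfun M ?W A = (%_. 0)" using c(3,4) eq by (simp add: zfun_def fun_eq_iff)
 have "AE z in M2 Q. Drep M ?W A (fst z) (snd z) = 0"
 proof (rule Drep_limit_zero[of "%_. M" "%_. ?W" "%_. A"])
  show "L2conv (M2 Q) (%k z. Drep M ?W A (fst z) (snd z)) (%z. Drep M ?W A (fst z) (snd z))"
   by (intro L2conv_const P2.bdd_meas_L2 bdd_meas_Drep ok)
  show "(\<integral>z. Drep M ?W A (fst z) (snd z) * Drep n V \<gamma> (fst z) (snd z) \<partial>M2 Q) = 0" if "rep_inf0 n V \<gamma>" for n V \<gamma>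
   unfolding gradient_IBP[OF ok that] z by simp
 qed (rule ok)
 thus ?thesis unfolding D by eventually_elim simp
qed

end


section \<open>The Dirichlet form\<close>

lemma e1_cong: "e u u = e' u u ==> e1 M e u u = e1 M e' u u" by (simp add: e1_def)

text \<open>\<open>Ebar\<close> and the abstract closure agree only on the domain; the domain is
  closed under all the operations that occur, so every evaluation stays where they agree.\<close>

lemma dirichlet_form_cong:
 assumes D: "dirichlet_form M F e'" and eq: "!!u v. u \<in> F ==> v \<in> F ==> e u v = e' u v"
 shows "dirichlet_form M F e"
proof -
 have add: "(%x. u x + v x) \<in> F" and cm: "(%x. c * u x) \<in> F" and mk: "(%x. min 1 (max 0 (u x))) \<in> F" if "u \<in> F" "v \<in> F" for u v c
  using D that unfolding dirichlet_form_def by blast+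
 have diff: "(%x. u x - v x) \<in> F" if "u \<in> F" "v \<in> F" for u v
  using add[OF that(1) cm[OF that(2,2), of "-1"]] cm[OF that(2,2), of "-1"] by simp
 have e1: "e1 M e (%x. u x - v x) (%x. u x - v x) = e1 M e' (%x. u x - v x) (%x. u x - v x)" if "u \<in> F" "v \<in> F" for u v
  by (rule e1_cong) (rule eq[OF diff[OF that] diff[OF that]])
 note d = D[unfolded dirichlet_form_def]
 show ?thesis unfolding dirichlet_form_def
 proof (intro conjI ballI allI impI)
  fix u assume u: "u \<in> F"
  show "L2 M u" using d u by blast
  show "0 <= e u u" using d u by (simp only: eq)
  show "e (%x. min 1 (max 0 (u x))) (%x. min 1 (max 0 (u x))) <= e u u"
   unfolding eq[OF mk[OF u u] mk[OF u u]] eq[OF u u] using d u by blast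
  show "(%x. min 1 (max 0 (u x))) \<in> F" by (rule mk[OF u u])
  fix v assume v: "v \<in> F"
  show "(%x. u x + v x) \<in> F" by (rule add[OF u v])
  show "e u v = e v u" unfolding eq[OF u v] eq[OF v u] using d u v by blast
  fix w assume w: "w \<in> F"
  show "e (%x. u x + v x) w = e u w + e v w" unfolding eq[OF add[OF u v] w] eq[OF u w] eq[OF v w] using d u v w by blast
 next
  fix c u w assume u: "u \<in> F" and w: "w \<in> F"
  show "e (%x. c * u x) w = c * e u w" unfolding eq[OF cm[OF u u] w] eq[OF u w] using d u w by blast
 next
  show "(%x. c * u x) \<in> F" if "u \<in> F" for c u by (rule cm[OF that that])
 next
  show "\<exists>us. (\<forall>n. us n \<in> F) \<and> L2conv M us f" if "L2 M f" for f using d that by blast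
 next
  fix us :: "nat => 'a => real"
  assume a: "(\<forall>n. us n \<in> F) \<and> (\<forall>\<epsilon>>0. \<exists>N. \<forall>n\<ge>N. \<forall>k\<ge>N. e1 M e (%x. us n x - us k x) (%x. us n x - us k x) < \<epsilon>)"
  hence us: "!!n. us n \<in> F" by blast
  have "\<forall>\<epsilon>>0. \<exists>N. \<forall>n\<ge>N. \<forall>k\<ge>N. e1 M e' (%x. us n x - us k x) (%x. us n x - us k x) < \<epsilon>"
   using a unfolding e1[OF us us] by blast
  then obtain u where u: "u \<in> F" "(%n. e1 M e' (%x. us n x - u x) (%x. us n x - u x)) \<longlonglongrightarrow> 0"
   using d us by blast
  show "\<exists>u\<in>F. (%n. e1 M e (%x. us n x - u x) (%x. us n x - u x)) \<longlonglongrightarrow> 0"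
   by (rule bexI[OF _ u(1)]) (unfold e1[OF us u(1)], rule u(2))
 qed
qed

section \<open>The gradient of cylinder functions as a derivation\<close>

context entropic
begin

definition Dg :: "((real => real) => real) => (real => real) \<times> real => real" where
 "Dg u z = Dz u (fst z) (snd z)"

lemma Dz_rep:
 assumes "u \<in> Zset 1"
 shows "\<exists>m U \<alpha>. rep_ok 1 m U \<alpha> \<and> u = zfun m U \<alpha> \<and> Dz u = Drep m U \<alpha>"
proof -
 let ?P = "%r. case r of (m, U, \<alpha>) => rep_ok 1 m U \<alpha> \<and> u = zfun m U \<alpha>"
 obtain m U \<alpha> where r: "(SOME r. ?P r) = (m, U, \<alpha>)" by (cases "SOME r. ?P r") auto
 obtain m' U' \<alpha>' where "rep_ok 1 m' U' \<alpha>'" "u = zfun m' U' \<alpha>'" by (rule ZsetE[OF assms])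
 hence "?P (m', U', \<alpha>')" by simp
 hence "?P (SOME r. ?P r)" by (rule someI[of ?P])
 hence "rep_ok 1 m U \<alpha> \<and> u = zfun m U \<alpha>" unfolding r by simp
 moreover have "Dz u = Drep m U \<alpha>" unfolding Dz_def[abs_def] Drep_def[abs_def] r by simp
 ultimately show ?thesis by blast
qed

lemma L0_rep:
 assumes "u \<in> Zinf0"
 shows "\<exists>m U \<alpha>. rep_inf0 m U \<alpha> \<and> u = zfun m U \<alpha> \<and> L0 \<beta> u = Lrep \<beta> m U \<alpha>"
proof -
 let ?P = "%r. case r of (m, U, \<alpha>) => rep_inf0 m U \<alpha> \<and> u = zfun m U \<alpha>"
 obtain m U \<alpha> where r: "(SOME r. ?P r) = (m, U, \<alpha>)" by (cases "SOME r. ?P r") auto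
 obtain m' U' \<alpha>' where "rep_inf0 m' U' \<alpha>'" "u = zfun m' U' \<alpha>'" by (rule Zinf0E[OF assms])
 hence "?P (m', U', \<alpha>')" by simp
 hence "?P (SOME r. ?P r)" by (rule someI[of ?P])
 hence "rep_inf0 m U \<alpha> \<and> u = zfun m U \<alpha>" unfolding r by simp
 moreover have "L0 \<beta> u = Lrep \<beta> m U \<alpha>" unfolding L0_def[abs_def] Lrep_def[abs_def] r by simp
 ultimately show ?thesis by blast
qed

text \<open>By \<open>Drep_unique\<close> the choice inside \<open>Dz\<close> is harmless up to null
  sets; all algebraic rules for the gradient are derived from this by picking a convenient
  representation.\<close>

lemma Dg_AE: "rep_ok 1 m U \<alpha> ==> AE z in M2 Q. Dg (zfun m U \<alpha>) z = Drep m U \<alpha> (fst z) (snd z)"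
proof -
 assume r: "rep_ok 1 m U \<alpha>"
 obtain m' U' \<alpha>' where r': "rep_ok 1 m' U' \<alpha>'" "zfun m U \<alpha> = zfun m' U' \<alpha>'" "Dz (zfun m U \<alpha>) = Drep m' U' \<alpha>'"
  using Dz_rep[OF ZsetI[OF r]] by blast
 show ?thesis unfolding Dg_def r'(3) by (rule Drep_unique[OF r'(1) r r'(2)[symmetric]])
qed

lemma Dg_bdd: assumes "u \<in> Zset 1" shows "bdd_meas (M2 Q) (Dg u)"
proof -
 obtain m U \<alpha> where "rep_ok 1 m U \<alpha>" "Dz u = Drep m U \<alpha>" using Dz_rep[OF assms] by blast
 thus ?thesis using bdd_meas_Drep unfolding Dg_def[abs_def] by simp
qed

lemma Dg_Zinf0_orth:
 assumes "u \<in> Zset 1" "rep_inf0 n V \<gamma>"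
 shows "(\<integral>z. Dg u z * Drep n V \<gamma> (fst z) (snd z) \<partial>M2 Q) = - (\<integral>g. u g * Lrep \<beta> n V \<gamma> g \<partial>Q)"
proof -
 obtain m U \<alpha> where "rep_ok 1 m U \<alpha>" "u = zfun m U \<alpha>" "Dz u = Drep m U \<alpha>" using Dz_rep[OF assms(1)] by blast
 thus ?thesis using gradient_IBP[OF _ assms(2)] unfolding Dg_def by simp
qed

lemma Dg_common:
 assumes "u \<in> Zset 1" "v \<in> Zset 1"
 shows "\<exists>M U V A. rep_ok 1 M U A \<and> rep_ok 1 M V A \<and> u = zfun M U A \<and> v = zfun M V A \<and> Dz u = Drep M U A \<and> Dz v = Drep M V A"
proof -
 obtain m U \<alpha> where u: "rep_ok 1 m U \<alpha>" "u = zfun m U \<alpha>" "Dz u = Drep m U \<alpha>" using Dz_rep[OF assms(1)] by blast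
 obtain n V \<gamma> where v: "rep_ok 1 n V \<gamma>" "v = zfun n V \<gamma>" "Dz v = Drep n V \<gamma>" using Dz_rep[OF assms(2)] by blast
 show ?thesis
 proof (rule zfun_common[OF u(1) v(1)])
  fix M U' V' A
  assume "rep_ok 1 M U' A" "rep_ok 1 M V' A" "zfun M U' A = zfun m U \<alpha>" "zfun M V' A = zfun n V \<gamma>"
   "Drep M U' A = Drep m U \<alpha>" "Drep M V' A = Drep n V \<gamma>"
  thus ?thesis using u v by (intro exI[of _ M] exI[of _ U'] exI[of _ V'] exI[of _ A]) simp
 qed
qed

lemma Zset_add: assumes "u \<in> Zset 1" "v \<in> Zset 1"
 shows "(%g. u g + v g) \<in> Zset 1" "AE z in M2 Q. Dg (%g. u g + v g) z = Dg u z + Dg v z"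
  "(%g. u g * v g) \<in> Zset 1" "AE z in M2 Q. Dg (%g. u g * v g) z = u (fst z) * Dg v z + v (fst z) * Dg u z"
proof -
 obtain M U V A where c: "rep_ok 1 M U A" "rep_ok 1 M V A" "u = zfun M U A" "v = zfun M V A" "Dz u = Drep M U A" "Dz v = Drep M V A"
  using Dg_common[OF assms] by blast
 have z: "zfun M (%x. U x + V x) A = (%g. u g + v g)" "zfun M (%x. U x * V x) A = (%g. u g * v g)"
  by (simp_all add: c(3,4) zfun_def fun_eq_iff)
 note ok = rep_ok_ops(1)[OF c(1,2)] rep_ok_ops(2)[OF c(1,2)]
 show "(%g. u g + v g) \<in> Zset 1" "(%g. u g * v g) \<in> Zset 1" using ZsetI[OF ok(1)] ZsetI[OF ok(2)] unfolding z by auto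
 show "AE z in M2 Q. Dg (%g. u g + v g) z = Dg u z + Dg v z"
  using Dg_AE[OF ok(1)] unfolding z by eventually_elim (simp add: Dg_def c(5,6) Drep_add[OF c(1,2)[unfolded One_nat_def]])
 show "AE z in M2 Q. Dg (%g. u g * v g) z = u (fst z) * Dg v z + v (fst z) * Dg u z"
  using Dg_AE[OF ok(2)] unfolding z by eventually_elim (simp add: Dg_def c(5,6) Drep_mult[OF c(1,2)[unfolded One_nat_def]] c(3,4)[symmetric])
qed

lemma Zset_cmult: assumes "u \<in> Zset 1"
 shows "(%g. c * u g) \<in> Zset 1" "AE z in M2 Q. Dg (%g. c * u g) z = c * Dg u z"
proof -
 obtain m U \<alpha> where u: "rep_ok 1 m U \<alpha>" "u = zfun m U \<alpha>" "Dz u = Drep m U \<alpha>" using Dz_rep[OF assms] by blast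
 have z: "zfun m (%x. c * U x) \<alpha> = (%g. c * u g)" by (simp add: u(2) zfun_def fun_eq_iff)
 note ok = rep_ok_ops(3)[OF u(1,1), of c]
 show "(%g. c * u g) \<in> Zset 1" using ZsetI[OF ok] unfolding z .
 show "AE z in M2 Q. Dg (%g. c * u g) z = c * Dg u z"
  using Dg_AE[OF ok] unfolding z by eventually_elim (simp add: Dg_def u(3) Drep_cmult[OF u(1)[unfolded One_nat_def]])
qed

lemma Zset_chain: assumes "u \<in> Zset 1" and f: "!!x. (f has_real_derivative f' x) (at x)" "continuous_on UNIV f'"
 shows "(%g. f (u g)) \<in> Zset 1" "AE z in M2 Q. Dg (%g. f (u g)) z = f' (u (fst z)) * Dg u z"
proof -
 obtain m U \<alpha> where u: "rep_ok 1 m U \<alpha>" "u = zfun m U \<alpha>" "Dz u = Drep m U \<alpha>" using Dz_rep[OF assms(1)] by blast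
 have z: "zfun m (%x. f (U x)) \<alpha> = (%g. f (u g))" by (simp add: u(2) zfun_def fun_eq_iff)
 note ok = Drep_chain(1)[OF u(1) f]
 show "(%g. f (u g)) \<in> Zset 1" using ZsetI[OF ok] unfolding z .
 show "AE z in M2 Q. Dg (%g. f (u g)) z = f' (u (fst z)) * Dg u z"
  using Dg_AE[OF ok] unfolding z by eventually_elim (simp add: Dg_def u(3) Drep_chain(2)[OF u(1) f] u(2)[symmetric])
qed

text \<open>Pair the gradients with a smooth flat gradient of v. By duality the pairing equals minus
  the inner product of u_n with the bounded function L v, which tends to 0, so
  \<open>Drep_limit_zero\<close> applies to the limit w.\<close>

lemma Dg_closed:
 assumes us: "!!n. us n \<in> Zset 1" and u0: "L2conv Q us (%_. 0)" and w: "L2conv (M2 Q) (%n. Dg (us n)) w"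
 shows "AE z in M2 Q. w z = 0"
proof -
 interpret P2: prob_space "M2 Q" by (rule prob_space_M2)
 define P where "P k r \<longleftrightarrow> (case r of (m, U, \<alpha>) => rep_ok 1 m U \<alpha> \<and> Dz (us k) = Drep m U \<alpha>)" for k r
 have "\<exists>r. P k r" for k using Dz_rep[OF us[of k]] unfolding P_def by auto
 then obtain r where r: "!!k. P k (r k)" by metis
 define m U \<alpha> where "m k = fst (r k)" and "U k = fst (snd (r k))" and "\<alpha> k = snd (snd (r k))" for k
 have ok: "rep_ok 1 (m k) (U k) (\<alpha> k)" "Dz (us k) = Drep (m k) (U k) (\<alpha> k)" for k
  using r[of k] unfolding P_def by (auto simp: m_def U_def \<alpha>_def split: prod.splits)
 show ?thesis
 proof (rule Drep_limit_zero[of m U \<alpha>])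
  show "L2conv (M2 Q) (%k z. Drep (m k) (U k) (\<alpha> k) (fst z) (snd z)) w" using w unfolding Dg_def[abs_def] ok(2) .
  fix n V \<gamma> assume s: "rep_inf0 n V \<gamma>"
  have "(%k. \<integral>z. Dg (us k) z * Drep n V \<gamma> (fst z) (snd z) \<partial>M2 Q) \<longlonglongrightarrow> (\<integral>z. w z * Drep n V \<gamma> (fst z) (snd z) \<partial>M2 Q)"
   by (intro L2conv_inner[OF w] L2conv_const P2.bdd_meas_L2 bdd_meas_Drep rep_inf0_ok[OF s])
  moreover have "(%k. - (\<integral>g. us k g * Lrep \<beta> n V \<gamma> g \<partial>Q)) \<longlonglongrightarrow> - (\<integral>g. 0 * Lrep \<beta> n V \<gamma> g \<partial>Q)"
   by (intro tendsto_minus L2conv_inner[OF u0] L2conv_const bdd_meas_L2 bdd_meas_Lrep s)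
  ultimately show "(\<integral>z. w z * Drep n V \<gamma> (fst z) (snd z) \<partial>M2 Q) = 0"
   unfolding Dg_Zinf0_orth[OF us s] using LIMSEQ_unique by fastforce
 qed (rule ok(1))
qed

sublocale D: L2_derivation Q "M2 Q" "Zset 1" Dg fst
proof (intro L2_derivation.intro L2_gradient.intro L2_derivation_axioms.intro)
 show "prob_space Q" by (rule prob_space_Q)
 show "prob_space (M2 Q)" by (rule prob_space_M2)
 show "fst \<in> measurable (M2 Q) Q" "distr (M2 Q) Q fst = Q" by (rule fst_M2, rule distr_fst_M2)
 show "Zset 1 \<noteq> {}" using Zinf0_const Zinf0_subset by blast
 show "L2 Q u" "L2 (M2 Q) (Dg u)" if "u \<in> Zset 1" for u
  by (rule Zset_L2[OF that], rule prob_space.bdd_meas_L2[OF prob_space_M2 Dg_bdd[OF that]])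
 show "\<exists>C. \<forall>x\<in>space Q. \<bar>u x\<bar> <= C" if "u \<in> Zset 1" for u
  by (rule Zset_bounded[OF that]) (auto simp: space_Q)
 show "AE z in M2 Q. w z = 0" if "!!n. us n \<in> Zset 1" "L2conv Q us (%_. 0)" "L2conv (M2 Q) (%n. Dg (us n)) w" for us w
  by (rule Dg_closed[of us, OF that])
qed (rule Zset_add Zset_cmult Zset_chain; assumption)+

text \<open>The same gradient on the smaller domain, so that the closures taken over
  \<open>Zinf0\<close> and over \<open>Zset 1\<close> can be compared.\<close>

sublocale C: L2_gradient Q "M2 Q" Zinf0 Dg
proof (intro L2_gradient.intro)
 have s: "u \<in> Zset 1" if "u \<in> Zinf0" for u using Zinf0_subset that by blast
 show "prob_space Q" "prob_space (M2 Q)" by (rule prob_space_Q, rule prob_space_M2)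
 fix u v c assume u: "u \<in> Zinf0"
 show "L2 Q u" "L2 (M2 Q) (Dg u)" by (rule D.A_L2[OF s[OF u]], rule D.D_L2[OF s[OF u]])
 show "(%x. c * u x) \<in> Zinf0" by (rule Zinf0_ops(3)[OF u u])
 show "AE z in M2 Q. Dg (%x. c * u x) z = c * Dg u z" by (rule D.D_cmult[OF s[OF u]])
 assume v: "v \<in> Zinf0"
 show "(%x. u x + v x) \<in> Zinf0" by (rule Zinf0_ops(1)[OF u v])
 show "AE z in M2 Q. Dg (%x. u x + v x) z = Dg u z + Dg v z" by (rule D.D_add[OF s[OF u] s[OF v]])
next
 fix us w assume "!!n. us n \<in> Zinf0" "L2conv Q us (%_. 0)" "L2conv (M2 Q) (%n. Dg (us n)) w"
 thus "AE z in M2 Q. w z = 0" using Zinf0_subset by (intro Dg_closed[of us w]) auto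
qed

lemma core_graph: "C.G u w \<longleftrightarrow> D.G u w"
proof (rule graph_cl_core[OF D.L2_gradient_axioms C.L2_gradient_axioms Zinf0_subset])
 fix u and e :: real assume u: "u \<in> Zset 1" and e: "e > 0"
 obtain m U \<alpha> where r: "rep_ok 1 m U \<alpha>" "u = zfun m U \<alpha>" "Dz u = Drep m U \<alpha>" using Dz_rep[OF u] by blast
 obtain V \<gamma> where V: "!!n. rep_inf0 m (V n) (\<gamma> n)" "L2conv Q (%n. zfun m (V n) (\<gamma> n)) u"
  "L2conv (M2 Q) (%n z. Drep m (V n) (\<gamma> n) (fst z) (snd z)) (Dg u)"
  using rep_approx[OF r(1)] unfolding Dg_def[abs_def] r(3) r(2)[symmetric] by blast
 have in0: "zfun m (V n) (\<gamma> n) \<in> Zinf0" for n by (rule Zinf0I[OF V(1)])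
 have ae: "AE z in M2 Q. Drep m (V n) (\<gamma> n) (fst z) (snd z) = Dg (zfun m (V n) (\<gamma> n)) z" for n
  using Dg_AE[OF rep_inf0_ok[OF V(1), of 1 n]] by eventually_elim simp
 have "L2conv (M2 Q) (%n. Dg (zfun m (V n) (\<gamma> n))) (Dg u)"
  by (rule L2conv_cong_AE[OF V(3) ae _ _ D.D_measurable[OF u]]) (use C.D_measurable[OF in0] in auto)
 from order_tendstoD(2)[OF L2convD(3)[OF this] e] order_tendstoD(2)[OF L2convD(3)[OF V(2)] e]
 have "\<forall>\<^sub>F n in sequentially. (\<integral>x. (zfun m (V n) (\<gamma> n) x - u x)^2 \<partial>Q) < e \<and> (\<integral>z. (Dg (zfun m (V n) (\<gamma> n)) z - Dg u z)^2 \<partial>M2 Q) < e"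
  by eventually_elim simp
 then obtain n where "(\<integral>x. (zfun m (V n) (\<gamma> n) x - u x)^2 \<partial>Q) < e \<and> (\<integral>z. (Dg (zfun m (V n) (\<gamma> n)) z - Dg u z)^2 \<partial>M2 Q) < e"
  using eventually_happens'[OF sequentially_bot] by blast
 thus "\<exists>h\<in>Zinf0. (\<integral>x. (h x - u x)^2 \<partial>Q) < e \<and> (\<integral>z. (Dg h z - Dg u z)^2 \<partial>M2 Q) < e" using in0 by blast
qed

lemma Eform_eq: assumes "u \<in> Zset 1" "v \<in> Zset 1" shows "Eform Q u v = D.E u v"
proof -
 have "integrable (M2 Q) (%z. Dg u z * Dg v z)" by (rule L2_mult_integrable[OF D.D_L2[OF assms(1)] D.D_L2[OF assms(2)]])
 from integral_M2(1)[OF this] show ?thesis unfolding Eform_def grad_form_def LINT_Leb01 by (simp add: Dg_def)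
qed

text \<open>The duality of \<open>gradient_IBP\<close> holds for the very representation of u that
  \<open>L0\<close> has chosen, and the gradient computed from it is D u almost everywhere.\<close>

lemma op_form_eq: assumes u: "u \<in> Zinf0" and v: "v \<in> Zinf0" shows "op_form Q (L0 \<beta>) u v = C.E u v"
proof -
 obtain m U \<alpha> where r: "rep_inf0 m U \<alpha>" "u = zfun m U \<alpha>" "L0 \<beta> u = Lrep \<beta> m U \<alpha>" using L0_rep[OF u] by blast
 have vs: "v \<in> Zset 1" using Zinf0_subset v by blast
 have ae: "AE z in M2 Q. Dg u z * Dg v z = Dg v z * Drep m U \<alpha> (fst z) (snd z)"
  using Dg_AE[OF rep_inf0_ok[OF r(1)]] unfolding r(2)[symmetric] by eventually_elim simp
 have "C.E u v = (\<integral>z. Dg v z * Drep m U \<alpha> (fst z) (snd z) \<partial>M2 Q)" unfolding grad_form_def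
 proof (rule integral_cong_AE[OF _ _ ae])
  show "(%z. Dg u z * Dg v z) \<in> borel_measurable (M2 Q)" by (rule borel_measurable_times[OF C.D_measurable[OF u] C.D_measurable[OF v]])
  show "(%z. Dg v z * Drep m U \<alpha> (fst z) (snd z)) \<in> borel_measurable (M2 Q)"
   using bdd_meas_mult[OF Dg_bdd[OF vs] bdd_meas_Drep[OF rep_inf0_ok[OF r(1)]]] unfolding bdd_meas_def by blast
 qed
 also have "\<dots> = - (\<integral>g. v g * Lrep \<beta> m U \<alpha> g \<partial>Q)" by (rule Dg_Zinf0_orth[OF vs r(1)])
 finally show ?thesis unfolding op_form_def r(3) by (simp add: mult.commute)
qed

section \<open>Identification of the closures\<close>

lemma EDom_eq: "EDom Q = {u. \<exists>w. D.G u w}" and op_dom_eq: "cl_dom Q Zinf0 (op_form Q (L0 \<beta>)) = {u. \<exists>w. D.G u w}"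
 and EDom_cl_dom: "EDom Q = cl_dom Q (Zset 1) D.E"
proof -
 show e: "EDom Q = cl_dom Q (Zset 1) D.E" unfolding EDom_def
  by (rule form_cong_cl_dom) (rule Eform_eq D.A_diff; assumption)+
 thus "EDom Q = {u. \<exists>w. D.G u w}" unfolding D.cl_dom_eq .
 have "cl_dom Q Zinf0 (op_form Q (L0 \<beta>)) = cl_dom Q Zinf0 C.E"
  by (rule form_cong_cl_dom) (rule op_form_eq C.A_diff; assumption)+
 thus "cl_dom Q Zinf0 (op_form Q (L0 \<beta>)) = {u. \<exists>w. D.G u w}" unfolding C.cl_dom_eq core_graph .
qed

lemma Ebar_cl_form: assumes "u \<in> EDom Q" "v \<in> EDom Q" shows "Ebar Q u v = cl_form Q (Zset 1) D.E u v"
 unfolding Ebar_def by (rule form_cong_cl_form[OF Eform_eq D.A_diff]) (use assms in \<open>auto simp: EDom_def\<close>)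

lemma Ebar_eq: assumes "D.G u w" "D.G v w'" shows "Ebar Q u v = (\<integral>z. w z * w' z \<partial>M2 Q)"
proof -
 have "u \<in> EDom Q" "v \<in> EDom Q" using assms unfolding EDom_eq by blast+
 thus ?thesis unfolding Ebar_cl_form[OF \<open>u \<in> EDom Q\<close> \<open>v \<in> EDom Q\<close>] by (intro D.cl_form_eq assms)
qed

lemma op_cl_form_eq:
 assumes "u \<in> EDom Q" "v \<in> EDom Q" shows "cl_form Q Zinf0 (op_form Q (L0 \<beta>)) u v = Ebar Q u v"
proof -
 obtain w w' where G: "D.G u w" "D.G v w'" using assms unfolding EDom_eq by blast
 have "u \<in> cl_dom Q Zinf0 (op_form Q (L0 \<beta>))" "v \<in> cl_dom Q Zinf0 (op_form Q (L0 \<beta>))"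
  using assms unfolding EDom_eq op_dom_eq .
 hence "cl_form Q Zinf0 (op_form Q (L0 \<beta>)) u v = cl_form Q Zinf0 C.E u v" by (intro form_cong_cl_form[OF op_form_eq C.A_diff])
 also have "\<dots> = (\<integral>z. w z * w' z \<partial>M2 Q)" by (rule C.cl_form_eq) (use G core_graph in auto)
 finally show ?thesis unfolding Ebar_eq[OF G] .
qed

lemma Zset_EDom: "u \<in> Zset 1 ==> u \<in> EDom Q" unfolding EDom_eq using D.G_self by blast

lemma e1_Ebar:
 assumes "D.G u w" "D.G v w'"
 shows "e1 Q (Ebar Q) (%x. u x - v x) (%x. u x - v x) = (\<integral>z. (w z - w' z)^2 \<partial>M2 Q) + (\<integral>x. (u x - v x)^2 \<partial>Q)"
 unfolding e1_def Ebar_eq[OF D.G_diff[OF assms] D.G_diff[OF assms]] by (simp add: power2_eq_square)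

lemma Zinf0_e1_dense:
 assumes "u \<in> EDom Q" "e > 0" shows "\<exists>h\<in>Zinf0. e1 Q (Ebar Q) (%x. u x - h x) (%x. u x - h x) < e"
proof -
 obtain w where G: "D.G u w" using assms(1) unfolding EDom_eq by blast
 hence "C.G u w" using core_graph by blast
 moreover have "e / 2 > 0" using assms(2) by simp
 ultimately obtain h where h: "h \<in> Zinf0" "(\<integral>x. (h x - u x)^2 \<partial>Q) < e / 2" "(\<integral>z. (Dg h z - w z)^2 \<partial>M2 Q) < e / 2"
  unfolding C.G_iff by blast
 have Gh: "D.G h (Dg h)" using D.G_self h(1) Zinf0_subset by blast
 have "e1 Q (Ebar Q) (%x. u x - h x) (%x. u x - h x) < e"
  unfolding e1_Ebar[OF G Gh] using h(2,3) by (simp add: power2_commute)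
 thus ?thesis using h(1) by blast
qed

lemma Dbar_rel_eq: "Dbar_rel Q u w \<longleftrightarrow> D.G u w"
 unfolding Dbar_rel_def graph_cl_def Dg_def[abs_def] ..

lemma Dbar_G: assumes "u \<in> EDom Q" shows "D.G u (Dbar Q u)"
proof -
 have "\<exists>w. Dbar_rel Q u w" using assms unfolding EDom_eq Dbar_rel_eq by blast
 hence "Dbar_rel Q u (Dbar Q u)" unfolding Dbar_def by (rule someI_ex)
 thus ?thesis unfolding Dbar_rel_eq .
qed

lemma EDom_Dom_Dbar: "EDom Q = Dom_Dbar Q" unfolding EDom_eq Dom_Dbar_def Dbar_rel_eq ..

lemma dirichlet: "dirichlet_form Q (EDom Q) (Ebar Q)"
proof (rule dirichlet_form_cong[OF _ Ebar_cl_form])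
 show "dirichlet_form Q (EDom Q) (cl_form Q (Zset 1) D.E)" unfolding EDom_cl_dom
 proof (rule D.dirichlet_form_closure)
  fix f assume "L2 Q f"
  thus "\<exists>us. (\<forall>n. us n \<in> Zset 1) \<and> L2conv Q us f" by (rule Zinf0_dense_L2) (use Zinf0_subset in blast)
 qed
qed

lemma recurrent_Ebar: "recurrent Q (EDom Q) (Ebar Q)"
proof -
 obtain us where us: "!!n. us n \<in> EDom Q" "AE x in Q. (%n. us n x) \<longlonglongrightarrow> 1"
  "(%n. cl_form Q (Zset 1) D.E (us n) (us n)) \<longlonglongrightarrow> 0"
  using D.recurrent_closure unfolding recurrent_def EDom_cl_dom by blast
 show ?thesis unfolding recurrent_def by (intro exI[of _ us] conjI allI us(1,2)) (unfold Ebar_cl_form[OF us(1) us(1)], rule us(3))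
qed

lemma friedrichs: "friedrichs_admissible Q Zinf0 (L0 \<beta>)"
proof -
 have sym: "(\<integral>x. L0 \<beta> u x * v x \<partial>Q) = - C.E u v" if "u \<in> Zinf0" "v \<in> Zinf0" for u v
  using op_form_eq[OF that] unfolding op_form_def by simp
 have E_comm: "C.E u v = C.E v u" for u v unfolding grad_form_def by (simp add: mult.commute)
 show ?thesis unfolding friedrichs_admissible_def
 proof (intro conjI ballI allI impI)
  fix u assume u: "u \<in> Zinf0"
  show "L2 Q u" by (rule C.A_L2[OF u])
  obtain m U \<alpha> where r: "rep_inf0 m U \<alpha>" "L0 \<beta> u = Lrep \<beta> m U \<alpha>" using L0_rep[OF u] by blast
  show "L2 Q (L0 \<beta> u)" unfolding r(2) by (rule bdd_meas_L2[OF bdd_meas_Lrep[OF r(1)]])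
  show "(\<integral>x. L0 \<beta> u x * u x \<partial>Q) <= 0" unfolding sym[OF u u] grad_form_def by simp
  fix v assume v: "v \<in> Zinf0"
  show "(%x. u x + v x) \<in> Zinf0" by (rule Zinf0_ops(1)[OF u v])
  have "(\<integral>x. u x * L0 \<beta> v x \<partial>Q) = (\<integral>x. L0 \<beta> v x * u x \<partial>Q)" by (simp add: mult.commute)
  thus "(\<integral>x. L0 \<beta> u x * v x \<partial>Q) = (\<integral>x. u x * L0 \<beta> v x \<partial>Q)" unfolding sym[OF u v] sym[OF v u] E_comm[of u v] by simp
 next
  show "(%x. c * u x) \<in> Zinf0" if "u \<in> Zinf0" for c u by (rule Zinf0_ops(3)[OF that that])
  show "\<exists>us. (\<forall>n. us n \<in> Zinf0) \<and> L2conv Q us f" if f: "L2 Q f" for f by (rule Zinf0_dense_L2[OF f]) blast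
  have "closable Q Zinf0 (op_form Q (L0 \<beta>)) \<longleftrightarrow> closable Q Zinf0 C.E"
   by (rule form_cong_closable) (rule op_form_eq C.A_diff; assumption)+
  thus "closable Q Zinf0 (op_form Q (L0 \<beta>))" using C.closable_form by blast
 qed
qed

text \<open>The form of the operator on \<open>Zinf0\<close> and the form on \<open>Zset 1\<close>
  have the same closure, by the core property. The Friedrichs extension is by definition the
  generator of the former.\<close>

lemma generator_eq: "gen_rel Q (EDom Q) (Ebar Q) u f \<longleftrightarrow> friedrichs_rel Q Zinf0 (L0 \<beta>) u f"
 unfolding friedrichs_rel_def gen_rel_def op_dom_eq EDom_eq[symmetric] using op_cl_form_eq by auto

text \<open>The abstract identity is stated on the product space with factor w(g), which does not
  depend on s; Fubini integrates out s and produces \<open>Gamma_sq\<close>.\<close>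

lemma square_field_Gamma:
 assumes uvw: "u \<in> EDom Q" "v \<in> EDom Q" "w \<in> EDom Q" and L: "Linf Q u" "Linf Q v" "Linf Q w"
 shows "integrable Q (Gamma_sq Q u v)"
  and "2 * (\<integral>g. w g * Gamma_sq Q u v g \<partial>Q)
   = Ebar Q u (%g. v g * w g) + Ebar Q (%g. u g * w g) v - Ebar Q (%g. u g * v g) w"
proof -
 note G = Dbar_G[OF uvw(1)] Dbar_G[OF uvw(2)] Dbar_G[OF uvw(3)]
 let ?F = "%z. Dbar Q u z * Dbar Q v z"
 have i: "integrable (M2 Q) ?F" by (rule L2_mult_integrable[OF D.G_L2(2)[OF G(1)] D.G_L2(2)[OF G(2)]])
 have Ga: "Gamma_sq Q u v = (%g. \<integral>s. ?F (g, s) \<partial>Leb01)" unfolding Gamma_sq_def[abs_def] LINT_Leb01 ..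
 show "integrable Q (Gamma_sq Q u v)" unfolding Ga by (rule integral_M2(2)[OF i])
 have "\<exists>C. AE x in Q. \<bar>u x\<bar> <= C" "\<exists>C. AE x in Q. \<bar>v x\<bar> <= C" "\<exists>C. AE x in Q. \<bar>w x\<bar> <= C" and wm: "w \<in> borel_measurable Q"
  using L unfolding Linf_def by blast+
 then obtain Cu Cv Cw where C: "AE x in Q. \<bar>u x\<bar> <= Cu" "AE x in Q. \<bar>v x\<bar> <= Cv" "AE x in Q. \<bar>w x\<bar> <= Cw" by blast
 have mult: "(%g. a g * b g) \<in> EDom Q" if "a \<in> EDom Q" "AE x in Q. \<bar>a x\<bar> <= A" "b \<in> EDom Q" "AE x in Q. \<bar>b x\<bar> <= B" for a b A B
  using D.G_mult[OF Dbar_G[OF that(1)] that(2) Dbar_G[OF that(3)] that(4)] unfolding EDom_eq by blast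
 have iw: "integrable (M2 Q) (%z. w (fst z) * ?F z)"
 proof (rule Bochner_Integration.integrable_bound[of _ "%z. Cw * ?F z"])
  show "integrable (M2 Q) (%z. Cw * ?F z)" by (rule integrable_mult_right[OF i])
  show "(%z. w (fst z) * ?F z) \<in> borel_measurable (M2 Q)" by (rule borel_measurable_times[OF D.meas_p[OF wm] borel_measurable_integrable[OF i]])
  show "AE z in M2 Q. norm (w (fst z) * ?F z) <= norm (Cw * ?F z)"
   using D.AE_p[OF C(3)] by eventually_elim (auto simp: abs_mult intro!: mult_right_mono)
 qed
 have "(\<integral>z. w (fst z) * ?F z \<partial>M2 Q) = (\<integral>g. w g * Gamma_sq Q u v g \<partial>Q)"
  unfolding integral_M2(1)[OF iw] Ga by simp
 thus "2 * (\<integral>g. w g * Gamma_sq Q u v g \<partial>Q)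
   = Ebar Q u (%g. v g * w g) + Ebar Q (%g. u g * w g) v - Ebar Q (%g. u g * v g) w"
  using D.square_field[OF G L]
   Ebar_cl_form[OF uvw(1) mult[OF uvw(2) C(2) uvw(3) C(3)]] Ebar_cl_form[OF mult[OF uvw(1) C(1) uvw(3) C(3)] uvw(2)]
   Ebar_cl_form[OF mult[OF uvw(1) C(1) uvw(2) C(2)] uvw(3)] by simp
qed

end

theorem theorem7p5:
  fixes \<beta> :: real and Q :: "(real \<Rightarrow> real) measure"
  assumes "\<beta> > 0" and "is_Q0 \<beta> Q"
  shows
    \<comment> \<open>(i)\<close>
    "closable Q (Zset 1) (Eform Q)
     \<and> dirichlet_form Q (EDom Q) (Ebar Q)
     \<and> regular_G0 Q (EDom Q) (Ebar Q)
     \<and> recurrent Q (EDom Q) (Ebar Q)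
     \<and> D_closable Q
     \<and> EDom Q = Dom_Dbar Q
     \<and> (\<forall>u\<in>Dom_Dbar Q. \<forall>v\<in>Dom_Dbar Q.
          Ebar Q u v = (\<integral>z. Dbar Q u z * Dbar Q v z \<partial>M2 Q))
    \<comment> \<open>(ii)\<close>
     \<and> core_G0 Q (EDom Q) (Ebar Q) Zinf0
    \<comment> \<open>(iii)\<close>
     \<and> friedrichs_admissible Q Zinf0 (L0 \<beta>)
     \<and> (\<forall>u f. gen_rel Q (EDom Q) (Ebar Q) u f \<longleftrightarrow> friedrichs_rel Q Zinf0 (L0 \<beta>) u f)
    \<comment> \<open>(iv)\<close>
     \<and> (\<forall>u\<in>EDom Q. \<forall>v\<in>EDom Q. \<forall>w\<in>EDom Q. Linf Q u \<and> Linf Q v \<and> Linf Q w \<longrightarrow>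
          integrable Q (Gamma_sq Q u v) \<and>
          2 * (\<integral>g. w g * Gamma_sq Q u v g \<partial>Q)
            = Ebar Q u (\<lambda>g. v g * w g) + Ebar Q (\<lambda>g. u g * w g) v - Ebar Q (\<lambda>g. u g * v g) w)"
proof -
 interpret entropic \<beta> Q using assms by unfold_locales
 have sub: "h \<in> EDom Q" "cont_G0 h" if "h \<in> Zinf0" for h using Zset_EDom Zset_cont Zinf0_subset that by blast+
 show ?thesis
 proof (intro conjI allI ballI impI)
  have "closable Q (Zset 1) (Eform Q) \<longleftrightarrow> closable Q (Zset 1) D.E"
   by (rule form_cong_closable) (rule Eform_eq D.A_diff; assumption)+
  thus "closable Q (Zset 1) (Eform Q)" using D.closable_form by blast
  show "regular_G0 Q (EDom Q) (Ebar Q)" unfolding regular_G0_def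
  proof (intro conjI allI ballI impI)
   show "\<exists>h\<in>EDom Q. cont_G0 h \<and> (\<forall>g\<in>G0. \<bar>f g - h g\<bar> < e)" if "cont_G0 f" "0 < e" for f e
    using Zinf0_uniformly_dense[OF that] sub by blast
   show "\<exists>h\<in>EDom Q. cont_G0 h \<and> e1 Q (Ebar Q) (%x. u x - h x) (%x. u x - h x) < e" if "u \<in> EDom Q" "0 < e" for u e
    using Zinf0_e1_dense[OF that] sub by blast
  qed
  show "D_closable Q" unfolding D_closable_def Dbar_rel_eq using D.G_zero by blast
  show "Ebar Q u v = (\<integral>z. Dbar Q u z * Dbar Q v z \<partial>M2 Q)" if "u \<in> Dom_Dbar Q" "v \<in> Dom_Dbar Q" for u v
   by (intro Ebar_eq Dbar_G) (use that EDom_Dom_Dbar in auto)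
  show "core_G0 Q (EDom Q) (Ebar Q) Zinf0" unfolding core_G0_def
   using sub Zinf0_e1_dense Zinf0_uniformly_dense by blast
  show "integrable Q (Gamma_sq Q u v)" if "u \<in> EDom Q" "v \<in> EDom Q" "w \<in> EDom Q" "Linf Q u \<and> Linf Q v \<and> Linf Q w" for u v w
   using square_field_Gamma(1)[OF that(1-3)] that(4) by blast
  show "2 * (\<integral>g. w g * Gamma_sq Q u v g \<partial>Q)
      = Ebar Q u (%g. v g * w g) + Ebar Q (%g. u g * w g) v - Ebar Q (%g. u g * v g) w"
   if "u \<in> EDom Q" "v \<in> EDom Q" "w \<in> EDom Q" "Linf Q u \<and> Linf Q v \<and> Linf Q w" for u v w
   using square_field_Gamma(2)[OF that(1-3)] that(4) by blast
 qed (rule dirichlet recurrent_Ebar EDom_Dom_Dbar friedrichs generator_eq)+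
qed

end
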